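(* Let $(\underline{X},\underline{D})$ be a smooth complete intersection pair of type $(d_1,\dots,d_c;k)$ in $\mathbb{P}^n_{\mathbb{C}}$ with $\sum_{i=1}^c d_i^2+k^2\le n+1$. Then, for every positive integer $m$ and any $m$-tuple of points on $\underline{X}\setminus\underline{D}$, there exists an $\mathbb{A}^1$-curve on $(\underline{X},\underline{D})$ passing through all of these points.
   Context: Smooth complete intersection pair of type $(d_1,\dots,d_c;k)$: $\underline{X}\subset\mathbb{P}^n$ ($n\ge2$) is a smooth complete intersection of type $(d_1,\dots,d_c)$ with all $d_i\ge2$ ($c=0$ meaning $\underline{X}=\mathbb{P}^n$), and $\underline{D}\subset\underline{X}$ is a smooth hypersurface section of degree $k$. $X$ is the log scheme associated to the pair; its open locus with trivial log structure is $\underline{X}\setminus\underline{D}$. Stable log maps are in the sense of Chen, Abramovich–Chen and Gross–Siebert. An $\mathbb{A}^1$-map is a genus zero stable log map with precisely one marked point with a non-trivial contact order. An $\mathbb{A}^1$-curve on $(\underline{X},\underline{D})$ is an $\mathbb{A}^1$-map to $X$ with irreducible source curve whose image meets $\underline{X}\setminus\underline{D}$. *)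

theory Defs
  imports "HOL-Analysis.Analysis" "HOL-Library.Poly_Mapping"
begin

section \<open>Projective varieties over the complex numbers\<close>

text \<open>
  Varieties are treated classically, through their closed points. All schemes that occur (a smooth
  complete intersection, a smooth divisor on it, the projective line) are reduced and of finite
  type over the complex numbers, so they are determined by their closed points together with the
  regular functions on open sets.
\<close>

text \<open>Polynomials in the variables \<open>X\<^sub>0, X\<^sub>1, \<dots>\<close>: exponent vectors mapped to coefficients.\<close>

type_synonym cpoly = "(nat \<Rightarrow>\<^sub>0 nat) \<Rightarrow>\<^sub>0 complex"

definition peval :: "cpoly \<Rightarrow> (nat \<Rightarrow> complex) \<Rightarrow> complex" where
  "peval F v = (\<Sum>e\<in>Poly_Mapping.keys F.
     Poly_Mapping.lookup F e * (\<Prod>i\<in>Poly_Mapping.keys e. v i ^ Poly_Mapping.lookup e i))"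

text \<open>Homogeneous of degree \<open>d\<close> in \<open>X\<^sub>0, \<dots>, X\<^sub>n\<close>; the zero polynomial is included.\<close>

definition homog :: "nat \<Rightarrow> nat \<Rightarrow> cpoly \<Rightarrow> bool" where
  "homog n d F \<longleftrightarrow> (\<forall>e\<in>Poly_Mapping.keys F. Poly_Mapping.keys e \<subseteq> {..n} \<and>
     (\<Sum>i\<in>Poly_Mapping.keys e. Poly_Mapping.lookup e i) = d)"

definition partial :: "nat \<Rightarrow> cpoly \<Rightarrow> (nat \<Rightarrow> complex) \<Rightarrow> complex" where
  "partial j F v = deriv (\<lambda>t. peval F (v(j := t))) (v j)"

text \<open>A point of projective space is the set of all its homogeneous coordinate vectors; vectors of
  length \<open>n + 1\<close> are functions vanishing beyond \<open>n\<close>.\<close>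

type_synonym ppoint = "(nat \<Rightarrow> complex) set"

definition proj :: "nat \<Rightarrow> ppoint set" where
  "proj n = {{\<lambda>i. a * v i | a. a \<noteq> 0} | v. (\<exists>i. v i \<noteq> 0) \<and> (\<forall>i>n. v i = 0)}"

definition zeros :: "nat \<Rightarrow> cpoly set \<Rightarrow> ppoint set" where
  "zeros n S = {p \<in> proj n. \<forall>F\<in>S. \<forall>v\<in>p. peval F v = 0}"

text \<open>The Zariski topology, generated by the principal open sets.\<close>

definition zariski :: "nat \<Rightarrow> ppoint topology" where
  "zariski n = topology_generated_by {proj n - zeros n {F} | F d. homog n d F}"

abbreviation zopen :: "nat \<Rightarrow> ppoint set \<Rightarrow> ppoint set \<Rightarrow> bool" where
  "zopen n X U \<equiv> openin (subtopology (zariski n) X) U"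

text \<open>The sections over \<open>U\<close> of the structure sheaf of \<open>X \<subseteq> \<P>\<^sup>n\<close>. Sections of sheaves are
  represented by extensional functions, so that distinct functions are distinct sections and
  \<open>restrict\<close> is the restriction map.\<close>

definition regular_fun :: "nat \<Rightarrow> ppoint set \<Rightarrow> ppoint set \<Rightarrow> (ppoint \<Rightarrow> complex) set" where
  "regular_fun n X U = {h \<in> extensional U. \<forall>p\<in>U. \<exists>W A B d. zopen n X W \<and> p \<in> W \<and> W \<subseteq> U \<and>
     homog n d A \<and> homog n d B \<and>
     (\<forall>q\<in>W. \<forall>v\<in>q. peval B v \<noteq> 0 \<and> h q = peval A v / peval B v)}"

definition variety_morphism ::
    "nat \<Rightarrow> ppoint set \<Rightarrow> nat \<Rightarrow> ppoint set \<Rightarrow> (ppoint \<Rightarrow> ppoint) \<Rightarrow> bool" where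
  "variety_morphism n X n' Y f \<longleftrightarrow>
     continuous_map (subtopology (zariski n) X) (subtopology (zariski n') Y) f \<and>
     (\<forall>V. zopen n' Y V \<longrightarrow> (\<forall>h\<in>regular_fun n' Y V.
        restrict (h \<circ> f) (X \<inter> f -` V) \<in> regular_fun n X (X \<inter> f -` V)))"


section \<open>Smooth complete intersection pairs\<close>

text \<open>\<open>Fs\<close> are equations of type \<open>ds\<close> with common zero locus \<open>X\<close>, and at every point of \<open>X\<close> the rows
  of their Jacobian matrix are linearly independent: the scheme defined by \<open>Fs\<close> is smooth of
  codimension \<open>length ds\<close>.\<close>

definition smooth_ci_equations :: "nat \<Rightarrow> nat list \<Rightarrow> cpoly list \<Rightarrow> ppoint set \<Rightarrow> bool" where
  "smooth_ci_equations n ds Fs X \<longleftrightarrow>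
     length Fs = length ds \<and> (\<forall>i<length ds. homog n (ds ! i) (Fs ! i)) \<and> X = zeros n (set Fs) \<and>
     (\<forall>p\<in>X. \<forall>v\<in>p. \<forall>a :: nat \<Rightarrow> complex.
        (\<forall>j\<le>n. (\<Sum>i<length ds. a i * partial j (Fs ! i) v) = 0) \<longrightarrow> (\<forall>i<length ds. a i = 0))"

text \<open>The divisor \<open>D\<close> is the section of \<open>X\<close> by a hypersurface \<open>G\<close> of degree \<open>k\<close>, and is smooth as
  such. The list \<open>ds\<close> may be empty, in which case \<open>X = \<P>\<^sup>n\<close>.\<close>

definition smooth_ci_pair ::
    "nat \<Rightarrow> nat list \<Rightarrow> nat \<Rightarrow> ppoint set \<Rightarrow> ppoint set \<Rightarrow> bool" where
  "smooth_ci_pair n ds k X D \<longleftrightarrow> 2 \<le> n \<and> (\<forall>d\<in>set ds. 2 \<le> d) \<and> 1 \<le> k \<and>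
     (\<exists>Fs G. smooth_ci_equations n ds Fs X \<and> smooth_ci_equations n (ds @ [k]) (Fs @ [G]) D)"


section \<open>Log structures\<close>

text \<open>The sections over \<open>U\<close> of the divisorial log structure of \<open>(X, D)\<close>: the regular functions that
  are invertible away from \<open>D\<close>. Its structure map to the regular functions is the inclusion.\<close>

definition div_log :: "nat \<Rightarrow> ppoint set \<Rightarrow> ppoint set \<Rightarrow> ppoint set \<Rightarrow> (ppoint \<Rightarrow> complex) set" where
  "div_log n X D U = {h \<in> regular_fun n X U. \<forall>p\<in>U - D. h p \<noteq> 0}"

definition add_submonoid :: "'a::comm_monoid_add set \<Rightarrow> bool" where
  "add_submonoid Q \<longleftrightarrow> 0 \<in> Q \<and> (\<forall>x\<in>Q. \<forall>y\<in>Q. x + y \<in> Q)"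

text \<open>Sharp fs monoids, as submonoids of a free abelian group of countable rank; up to isomorphism
  every sharp fs monoid is of this form, since its group is free of finite rank. In the saturation
  condition the sum is the \<open>m\<close>-fold multiple of \<open>x - y\<close>.\<close>

definition sharp_fs_monoid :: "(nat \<Rightarrow>\<^sub>0 int) set \<Rightarrow> bool" where
  "sharp_fs_monoid Q \<longleftrightarrow>
     (\<exists>G. finite G \<and> Q = add_submonoid hull G) \<and>
     (\<forall>x\<in>Q. \<forall>y\<in>Q. \<forall>m>0::nat. (\<Sum>i<m. x - y) \<in> Q \<longrightarrow> x - y \<in> Q) \<and>
     (\<forall>x\<in>Q. - x \<in> Q \<longrightarrow> x = 0)"

text \<open>
  The log structure of a log smooth curve with underlying curve the projective line and set of
  marked points \<open>P\<close>, over the log point with characteristic monoid \<open>Q\<close>. It is the amalgamated sum,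
  over the invertible functions, of the log structure pulled back from the base and of the
  divisorial log structure of \<open>P\<close>, that is, the product of the constant sheaf \<open>Q\<close> with the latter.
  (Nonempty open sets are connected, so that sections of the constant sheaf are constant.)
\<close>

type_synonym curve_section = "ppoint \<Rightarrow> (nat \<Rightarrow>\<^sub>0 int) \<times> complex"

definition curve_log ::
    "(nat \<Rightarrow>\<^sub>0 int) set \<Rightarrow> ppoint set \<Rightarrow> ppoint set \<Rightarrow> curve_section set" where
  "curve_log Q P U = {s \<in> extensional U.
     (\<exists>q\<in>Q. \<forall>p\<in>U. fst (s p) = q) \<and> restrict (snd \<circ> s) U \<in> div_log 1 (proj 1) P U}"

text \<open>The structure map of this log structure: nonzero elements of \<open>Q\<close> are sent to zero.\<close>

definition curve_alpha :: "ppoint set \<Rightarrow> curve_section \<Rightarrow> ppoint \<Rightarrow> complex" where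
  "curve_alpha U s = (\<lambda>p\<in>U. if fst (s p) = 0 then snd (s p) else 0)"


section \<open>Log maps and \<open>\<A>\<^sup>1\<close>-curves\<close>

text \<open>
  A log map from the log curve above to the log scheme of \<open>(X, D)\<close>: a morphism \<open>f\<close> of varieties
  together with a homomorphism \<open>fl\<close> from the log structure of \<open>(X, D)\<close> to the direct image of the
  log structure of the curve, compatible with the structure maps.
\<close>

definition log_morphism ::
    "nat \<Rightarrow> ppoint set \<Rightarrow> ppoint set \<Rightarrow> (nat \<Rightarrow>\<^sub>0 int) set \<Rightarrow> ppoint set \<Rightarrow>
     (ppoint \<Rightarrow> ppoint) \<Rightarrow> (ppoint set \<Rightarrow> (ppoint \<Rightarrow> complex) \<Rightarrow> curve_section) \<Rightarrow> bool" where
  "log_morphism n X D Q P f fl \<longleftrightarrow>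
     variety_morphism 1 (proj 1) n X f \<and>
     (\<forall>V. zopen n X V \<longrightarrow> (let U = proj 1 \<inter> f -` V in
        fl V (\<lambda>p\<in>V. 1) = (\<lambda>p\<in>U. (0, 1)) \<and>
        (\<forall>s\<in>div_log n X D V. \<forall>t\<in>div_log n X D V. fl V (\<lambda>p\<in>V. s p * t p) =
           (\<lambda>p\<in>U. (fst (fl V s p) + fst (fl V t p), snd (fl V s p) * snd (fl V t p)))) \<and>
        (\<forall>s\<in>div_log n X D V. fl V s \<in> curve_log Q P U \<and>
           curve_alpha U (fl V s) = restrict (s \<circ> f) U \<and>
           (\<forall>V'. zopen n X V' \<and> V' \<subseteq> V \<longrightarrow>
              fl V' (restrict s V') = restrict (fl V s) (proj 1 \<inter> f -` V')))))"

text \<open>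
  The contact order at a marked point \<open>p\<close> is the homomorphism from the characteristic monoid of
  \<open>(X, D)\<close> at \<open>f p\<close> to the characteristic monoid \<open>Q \<oplus> \<nat>\<close> of the curve at \<open>p\<close>, followed by the
  projection to \<open>\<nat>\<close>, which is the characteristic monoid of the divisorial log structure of the
  marked points. It is trivial iff every germ is sent to a unit, i.e. to a function not
  vanishing at \<open>p\<close>.
\<close>

definition trivial_contact ::
    "nat \<Rightarrow> ppoint set \<Rightarrow> ppoint set \<Rightarrow> (ppoint \<Rightarrow> ppoint) \<Rightarrow>
     (ppoint set \<Rightarrow> (ppoint \<Rightarrow> complex) \<Rightarrow> curve_section) \<Rightarrow> ppoint \<Rightarrow> bool" where
  "trivial_contact n X D f fl p \<longleftrightarrow>
     (\<forall>V s. zopen n X V \<and> f p \<in> V \<and> s \<in> div_log n X D V \<longrightarrow> snd (fl V s p) \<noteq> 0)"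

text \<open>
  Genus zero stable log maps to \<open>(X, D)\<close> over a log point, with irreducible source curve. The source
  is then the projective line, with distinct marked points \<open>ps\<close>; it is stable iff the underlying map
  is nonconstant or there are at least three marked points.
\<close>

definition irreducible_genus0_stable_log_map ::
    "nat \<Rightarrow> ppoint set \<Rightarrow> ppoint set \<Rightarrow> (nat \<Rightarrow>\<^sub>0 int) set \<Rightarrow> ppoint list \<Rightarrow>
     (ppoint \<Rightarrow> ppoint) \<Rightarrow> (ppoint set \<Rightarrow> (ppoint \<Rightarrow> complex) \<Rightarrow> curve_section) \<Rightarrow> bool" where
  "irreducible_genus0_stable_log_map n X D Q ps f fl \<longleftrightarrow>
     sharp_fs_monoid Q \<and> distinct ps \<and> set ps \<subseteq> proj 1 \<and> log_morphism n X D Q (set ps) f fl \<and>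
     (f constant_on proj 1 \<longrightarrow> 3 \<le> length ps)"

definition A1_curve ::
    "nat \<Rightarrow> ppoint set \<Rightarrow> ppoint set \<Rightarrow> (nat \<Rightarrow>\<^sub>0 int) set \<Rightarrow> ppoint list \<Rightarrow>
     (ppoint \<Rightarrow> ppoint) \<Rightarrow> (ppoint set \<Rightarrow> (ppoint \<Rightarrow> complex) \<Rightarrow> curve_section) \<Rightarrow> bool" where
  "A1_curve n X D Q ps f fl \<longleftrightarrow>
     irreducible_genus0_stable_log_map n X D Q ps f fl \<and>
     (\<exists>!p. p \<in> set ps \<and> \<not> trivial_contact n X D f fl p) \<and>
     f ` proj 1 \<inter> (X - D) \<noteq> {}"

end

theory Submission
  imports Defs "HOL-Computational_Algebra.Computational_Algebra"
begin

text \<open>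
  In terms of the cones over \<open>X\<close> and \<open>D\<close>, it suffices to find a nonconstant polynomial curve
  \<open>F\<^sub>1 = \<dots> = F\<^sub>c = 0\<close>, \<open>G = 1\<close> with prescribed values \<open>y\<^sub>t\<close> at finitely many parameters \<open>t\<close>: its
  homogenization meets \<open>D\<close> at infinity only. Write the equations as \<open>H\<^sub>i = \<kappa>\<^sub>i\<close> with forms \<open>H\<^sub>i\<close> of
  degree \<open>d\<^sub>i\<close> in \<open>N\<close> variables. The bound on the degrees gives \<open>\<Sum>(2 d\<^sub>i - 1) < N\<close>, which is the number
  of conditions on \<open>v\<close> for \<open>H(p + t v) = \<kappa>\<close> and \<open>H(q + t v) = 0\<close> to hold identically in \<open>t\<close>. So generic
  solutions \<open>p\<close> of \<open>H = \<kappa>\<close> and \<open>q\<close> of \<open>H = 0\<close> are joined by a chain of two lines, which are free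
  because derivations move \<open>p\<close>, \<open>q\<close> and \<open>v\<close>. The chain smooths to a conic
  \<open>H(q + \<lambda> a + \<lambda>\<^sup>2 p) = \<kappa> \<lambda>\<^bsup>2 d\<^esup>\<close> along which the linearized equations have solutions of low degree.

  Applied over Laurent series, with \<open>p\<close> a generic arc through \<open>y\<^sub>t\<close>, this provides the jets at \<open>t\<close> of
  a solution of \<open>H(f) = \<kappa> \<lambda>\<^bsup>2 d\<^esup>\<close> over \<open>\<complex>[T][[\<lambda>]]\<close>; at \<open>\<lambda> = 0\<close> it is started from the pullback of a
  conic in \<open>H = 0\<close> by a polynomial of high degree, which is positive enough to keep the degrees in \<open>T\<close>
  bounded in a Newton iteration. Embedding the countable ring generated by the coefficients of \<open>f\<close>
  into \<open>\<complex>\<close> turns \<open>\<lambda>\<close> into a number, and \<open>\<lambda>\<^bsup>-2\<^esup> f\<close> is the curve.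
\<close>

section \<open>Curves from polynomial parametrizations\<close>

text \<open>Neither dimension theory nor deformation theory of maps is set up; one device takes
  their place. A countable domain embeds into the complex numbers, which are uncountable and
  algebraically closed. So a solution over power or Laurent series becomes a numerical one, provided
  that everything needed of it, such as an inverse of a differential, is given by finitely many
  further ring elements. Derivations replace tangent vectors at generic points: in characteristic 0
  they extend to every further number, so whatever is built from a generic point moves with it.

  The obstacle is that lines and conics are available only through generic points, while the
  \<open>y_t\<close> are arbitrary. Over Laurent series the conic of a generic arc through
  \<open>y_t\<close> may have poles at \<open>t\<close>. Rescaling \<lambda> clears them, but makes
  the curve at \<lambda> = 0 and the linearized equations degenerate at \<open>t\<close> to a fixed
  order, which the gluing must absorb.

  The squares enter through 2 d - 1 \<le> d^2, which is strict for d \<ge> 2; a hyperplane in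
  projective space itself is left to Lagrange interpolation.\<close>

definition monomial_at :: "(nat \<Rightarrow>\<^sub>0 nat) \<Rightarrow> (nat \<Rightarrow> complex) \<Rightarrow> complex" where
  "monomial_at e v = (\<Prod>i\<in>Poly_Mapping.keys e. v i ^ Poly_Mapping.lookup e i)"

definition total_degree :: "(nat \<Rightarrow>\<^sub>0 nat) \<Rightarrow> nat" where
  "total_degree e = (\<Sum>i\<in>Poly_Mapping.keys e. Poly_Mapping.lookup e i)"

text \<open>Forms are kept as functions, with a polynomial only as a witness; products and
  composites are then verified on values instead of coefficients.\<close>

definition form :: "nat \<Rightarrow> nat \<Rightarrow> ((nat \<Rightarrow> complex) \<Rightarrow> complex) \<Rightarrow> bool" where
  "form n d \<phi> \<longleftrightarrow> (\<exists>F. homog n d F \<and> peval F = \<phi>)"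

lemma monomial_at_superset:
  assumes "finite S" "Poly_Mapping.keys e \<subseteq> S"
  shows "monomial_at e v = (\<Prod>i\<in>S. v i ^ Poly_Mapping.lookup e i)"
  unfolding monomial_at_def using assms
  by (intro prod.mono_neutral_left) (auto simp: in_keys_iff)

lemma total_degree_superset:
  assumes "finite S" "Poly_Mapping.keys e \<subseteq> S"
  shows "total_degree e = (\<Sum>i\<in>S. Poly_Mapping.lookup e i)"
  unfolding total_degree_def using assms
  by (intro sum.mono_neutral_left) (auto simp: in_keys_iff)

lemma keys_add_exponents:
  fixes e e' :: "nat \<Rightarrow>\<^sub>0 nat"
  shows "Poly_Mapping.keys (e + e') = Poly_Mapping.keys e \<union> Poly_Mapping.keys e'"
  by (auto simp: in_keys_iff lookup_add)

lemma monomial_at_add: "monomial_at (e + e') v = monomial_at e v * monomial_at e' v"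
  using monomial_at_superset[of "Poly_Mapping.keys e \<union> Poly_Mapping.keys e'"]
  by (simp add: keys_add_exponents lookup_add power_add prod.distrib)

lemma total_degree_add: "total_degree (e + e') = total_degree e + total_degree e'"
  using total_degree_superset[of "Poly_Mapping.keys e \<union> Poly_Mapping.keys e'"]
  by (simp add: keys_add_exponents lookup_add sum.distrib)

lemma monomial_at_scale: "monomial_at e (\<lambda>i. a * v i) = a ^ total_degree e * monomial_at e v"
  by (simp add: monomial_at_def total_degree_def power_mult_distrib prod.distrib power_sum)

lemma peval_monomials:
  "peval F v = (\<Sum>e\<in>Poly_Mapping.keys F. Poly_Mapping.lookup F e * monomial_at e v)"
  by (simp add: peval_def monomial_at_def)

lemma peval_superset:
  assumes "finite S" "Poly_Mapping.keys F \<subseteq> S"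
  shows "peval F v = (\<Sum>e\<in>S. Poly_Mapping.lookup F e * monomial_at e v)"
  unfolding peval_monomials using assms
  by (intro sum.mono_neutral_left) (auto simp: in_keys_iff)

lemma homog_iff:
  "homog n d F \<longleftrightarrow> (\<forall>e\<in>Poly_Mapping.keys F. Poly_Mapping.keys e \<subseteq> {..n} \<and> total_degree e = d)"
  by (simp add: homog_def total_degree_def)

lemma peval_scale:
  assumes "homog n d F"
  shows "peval F (\<lambda>i. a * v i) = a ^ d * peval F v"
  using assms unfolding peval_monomials homog_iff sum_distrib_left
  by (intro sum.cong) (auto simp: monomial_at_scale)

lemma peval_add: "peval (F + G) v = peval F v + peval G v"
proof -
  let ?S = "Poly_Mapping.keys F \<union> Poly_Mapping.keys G"
  have "peval (F + G) v = (\<Sum>e\<in>?S. Poly_Mapping.lookup (F + G) e * monomial_at e v)"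
    by (intro peval_superset keys_add) auto
  then show ?thesis
    using peval_superset[of ?S F v] peval_superset[of ?S G v]
    by (simp add: lookup_add distrib_right sum.distrib)
qed

lemma form_zero: "form n d (\<lambda>v. 0)"
  unfolding form_def by (intro exI[of _ 0]) (auto simp: homog_def peval_def)

lemma form_add: "form n d \<phi> \<Longrightarrow> form n d \<psi> \<Longrightarrow> form n d (\<lambda>v. \<phi> v + \<psi> v)"
proof -
  assume "form n d \<phi>" "form n d \<psi>"
  then obtain F G where "homog n d F" "peval F = \<phi>" "homog n d G" "peval G = \<psi>"
    by (auto simp: form_def)
  moreover have "homog n d (F + G)"
    using calculation keys_add[of F G] unfolding homog_iff by blast
  ultimately show ?thesis
    unfolding form_def by (intro exI[of _ "F + G"]) (auto simp: peval_add)
qed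

lemma form_sum: "(\<And>x. x \<in> S \<Longrightarrow> form n d (\<phi> x)) \<Longrightarrow> form n d (\<lambda>v. \<Sum>x\<in>S. \<phi> x v)"
  by (induction S rule: infinite_finite_induct) (simp_all add: form_zero form_add)

lemma form_monomial:
  assumes "Poly_Mapping.keys e \<subseteq> {..n}" "total_degree e = d"
  shows "form n d (\<lambda>v. c * monomial_at e v)"
  unfolding form_def
proof (intro exI conjI ext)
  show "homog n d (Poly_Mapping.single e c)"
    using assms by (auto simp: homog_iff split: if_splits)
  show "peval (Poly_Mapping.single e c) v = c * monomial_at e v" for v
    using peval_superset[of "{e}" "Poly_Mapping.single e c" v] by auto
qed

lemma form_mult:
  assumes "form n d \<phi>" "form n d' \<psi>"
  shows "form n (d + d') (\<lambda>v. \<phi> v * \<psi> v)"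
proof -
  obtain F G where *: "homog n d F" "\<phi> = peval F" "homog n d' G" "\<psi> = peval G"
    using assms by (auto simp: form_def)
  have "form n (d + d') (\<lambda>v. \<Sum>e\<in>Poly_Mapping.keys F. \<Sum>e'\<in>Poly_Mapping.keys G.
      (Poly_Mapping.lookup F e * Poly_Mapping.lookup G e') * monomial_at (e + e') v)"
    using * by (intro form_sum form_monomial)
      (auto simp: homog_iff keys_add_exponents total_degree_add)
  also have "(\<lambda>v. \<Sum>e\<in>Poly_Mapping.keys F. \<Sum>e'\<in>Poly_Mapping.keys G.
      (Poly_Mapping.lookup F e * Poly_Mapping.lookup G e') * monomial_at (e + e') v)
      = (\<lambda>v. \<phi> v * \<psi> v)"
    by (simp add: * peval_monomials sum_product monomial_at_add mult_ac)
  finally show ?thesis .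
qed

lemma form_const: "form n 0 (\<lambda>v. c)"
  using form_monomial[of 0 n 0 c] by (simp add: total_degree_def monomial_at_def)

lemma form_cmult: "form n d \<phi> \<Longrightarrow> form n d (\<lambda>v. c * \<phi> v)"
  using form_mult[OF form_const] by simp

lemma form_var: "i \<le> n \<Longrightarrow> form n 1 (\<lambda>v. v i)"
  using form_monomial[of "Poly_Mapping.single i 1" n 1 1]
  by (simp add: total_degree_def monomial_at_def)

lemma form_power: "form n d \<phi> \<Longrightarrow> form n (m * d) (\<lambda>v. \<phi> v ^ m)"
proof (induction m)
  case 0
  then show ?case using form_const[of n 1] by simp
next
  case (Suc m)
  then show ?case using form_mult[of n d \<phi> "m * d"] by simp
qed

lemma form_prod:
  assumes "\<And>i. i \<in> S \<Longrightarrow> form n (g i) (\<phi> i)"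
  shows "form n (\<Sum>i\<in>S. g i) (\<lambda>v. \<Prod>i\<in>S. \<phi> i v)"
  using assms
  by (induction S rule: infinite_finite_induct) (simp_all add: form_mult form_const)

lemma form_compose:
  assumes "homog n d F" "\<And>i. i \<le> n \<Longrightarrow> form l e (\<lambda>v. \<phi> v i)"
  shows "form l (d * e) (\<lambda>v. peval F (\<phi> v))"
  unfolding peval_monomials
proof (intro form_sum form_cmult)
  fix x assume x: "x \<in> Poly_Mapping.keys F"
  have "form l (\<Sum>i\<in>Poly_Mapping.keys x. Poly_Mapping.lookup x i * e)
      (\<lambda>v. \<Prod>i\<in>Poly_Mapping.keys x. \<phi> v i ^ Poly_Mapping.lookup x i)"
    using assms x by (intro form_prod form_power) (auto simp: homog_def)
  then show "form l (d * e) (\<lambda>v. monomial_at x (\<phi> v))"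
    using assms x by (simp add: monomial_at_def homog_def flip: sum_distrib_right)
qed

section \<open>Points of projective space, zero loci and the Zariski topology\<close>

definition point_of :: "(nat \<Rightarrow> complex) \<Rightarrow> ppoint" where
  "point_of v = {\<lambda>i. a * v i | a. a \<noteq> 0}"

definition vectors :: "nat \<Rightarrow> (nat \<Rightarrow> complex) set" where
  "vectors n = {v. (\<exists>i. v i \<noteq> 0) \<and> (\<forall>i>n. v i = 0)}"

lemma proj_eq: "proj n = point_of ` vectors n"
  by (auto simp: proj_def point_of_def vectors_def)

lemma mem_point_of: "v \<in> point_of v"
  by (auto simp: point_of_def intro!: exI[of _ 1])

lemma point_of_scale:
  assumes "a \<noteq> 0"
  shows "point_of (\<lambda>i. a * v i) = point_of v"
proof -
  have "\<exists>b. (\<lambda>i. c * v i) = (\<lambda>i. b * (a * v i)) \<and> b \<noteq> 0" if "c \<noteq> 0" for c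
    using that assms by (intro exI[of _ "c / a"]) auto
  moreover have "\<exists>c. (\<lambda>i. b * (a * v i)) = (\<lambda>i. c * v i) \<and> c \<noteq> 0" if "b \<noteq> 0" for b
    using that assms by (intro exI[of _ "b * a"]) (auto simp: mult.assoc)
  ultimately show ?thesis
    unfolding point_of_def by auto
qed

lemma proj_memD:
  assumes "p \<in> proj n" "v \<in> p"
  shows "v \<in> vectors n" "p = point_of v"
proof -
  obtain w where w: "w \<in> vectors n" "p = point_of w"
    using assms by (auto simp: proj_eq)
  with assms obtain a where a: "a \<noteq> 0" "v = (\<lambda>i. a * w i)"
    by (auto simp: point_of_def)
  show "v \<in> vectors n" using w a by (auto simp: vectors_def)
  show "p = point_of v" using w a point_of_scale by simp
qed

lemma proj_nonempty: "p \<in> proj n \<Longrightarrow> \<exists>v. v \<in> p"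
  using mem_point_of by (auto simp: proj_eq)

lemma zeros_iff:
  assumes "v \<in> vectors n" "\<And>F. F \<in> S \<Longrightarrow> \<exists>d. homog n d F"
  shows "point_of v \<in> zeros n S \<longleftrightarrow> (\<forall>F\<in>S. peval F v = 0)"
proof
  assume "point_of v \<in> zeros n S"
  then show "\<forall>F\<in>S. peval F v = 0"
    using mem_point_of by (simp add: zeros_def)
next
  assume *: "\<forall>F\<in>S. peval F v = 0"
  have "peval F w = 0" if F: "F \<in> S" and w: "w \<in> point_of v" for F w
  proof -
    obtain d where "homog n d F" using assms(2) F by blast
    moreover obtain a where "w = (\<lambda>i. a * v i)" using w unfolding point_of_def by blast
    ultimately show ?thesis using * F by (simp add: peval_scale)
  qed
  moreover have "point_of v \<in> proj n"
    using assms(1) unfolding proj_eq by blast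
  ultimately show "point_of v \<in> zeros n S"
    unfolding zeros_def by blast
qed

lemma topspace_zariski: "topspace (zariski n) = proj n"
proof
  show "topspace (zariski n) \<subseteq> proj n"
    unfolding zariski_def topology_generated_by_topspace by blast
  obtain F where F: "homog n 0 F" "peval F = (\<lambda>v. 1)"
    using form_const[of n 1] unfolding form_def by blast
  have "zeros n {F} = {}"
    using proj_nonempty[of _ n] by (auto simp: zeros_def F(2))
  then show "proj n \<subseteq> topspace (zariski n)"
    using F(1) unfolding zariski_def topology_generated_by_topspace by blast
qed

text \<open>All sets in the union coincide, because rescaling \<open>v\<close> rescales
  \<open>\<phi> v\<close> by an \<open>e\<close>-th power. This avoids choosing a
  representative.\<close>

definition form_map :: "((nat \<Rightarrow> complex) \<Rightarrow> nat \<Rightarrow> complex) \<Rightarrow> ppoint \<Rightarrow> ppoint" where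
  "form_map \<phi> p = (\<Union>v\<in>p. point_of (\<phi> v))"

locale form_morphism =
  fixes l n e :: nat and \<phi> :: "(nat \<Rightarrow> complex) \<Rightarrow> nat \<Rightarrow> complex"
  assumes forms: "i \<le> n \<Longrightarrow> form l e (\<lambda>v. \<phi> v i)"
    and no_base_points: "v \<in> vectors l \<Longrightarrow> \<phi> v \<in> vectors n"
    and beyond: "i > n \<Longrightarrow> \<phi> v i = 0"
begin

lemma phi_scale: "\<phi> (\<lambda>i. a * v i) = (\<lambda>i. a ^ e * \<phi> v i)"
proof
  fix i
  show "\<phi> (\<lambda>i. a * v i) i = a ^ e * \<phi> v i"
  proof (cases "i \<le> n")
    case True
    then obtain F where "homog l e F" "peval F = (\<lambda>v. \<phi> v i)"
      using forms by (auto simp: form_def)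
    then show ?thesis
      using peval_scale[of l e F a v] by (simp add: fun_eq_iff)
  qed (simp add: beyond)
qed

lemma form_map_point_of: "form_map \<phi> (point_of v) = point_of (\<phi> v)"
proof -
  have "point_of (\<phi> w) = point_of (\<phi> v)" if w: "w \<in> point_of v" for w
  proof -
    obtain a where "a \<noteq> 0" "w = (\<lambda>i. a * v i)" using w unfolding point_of_def by blast
    then show ?thesis by (simp add: phi_scale point_of_scale)
  qed
  then show ?thesis
    using mem_point_of[of v] unfolding form_map_def by blast
qed

lemma form_map_proj: "p \<in> proj l \<Longrightarrow> form_map \<phi> p \<in> proj n"
  using no_base_points by (auto simp: proj_eq form_map_point_of)

lemma phi_mem_form_map: "v \<in> p \<Longrightarrow> \<phi> v \<in> form_map \<phi> p"
  using mem_point_of by (auto simp: form_map_def)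

lemma pullback_form:
  assumes "homog n d F"
  obtains F' where "homog l (d * e) F'" "\<And>v. peval F' v = peval F (\<phi> v)"
proof -
  have "form l (d * e) (\<lambda>v. peval F (\<phi> v))"
    by (rule form_compose[OF assms]) (rule forms)
  then show ?thesis
    using that by (auto simp: form_def fun_eq_iff)
qed

lemma form_map_zeros:
  assumes "homog n d F" "homog l d' F'" "\<And>v. peval F' v = peval F (\<phi> v)" "p \<in> proj l"
  shows "form_map \<phi> p \<in> zeros n {F} \<longleftrightarrow> p \<in> zeros l {F'}"
proof -
  obtain v where v: "v \<in> vectors l" "p = point_of v"
    using assms(4) by (auto simp: proj_eq)
  show ?thesis
    using zeros_iff[OF no_base_points[OF v(1)], of "{F}"] zeros_iff[OF v(1), of "{F'}"] assms(1-3)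
    unfolding v(2) form_map_point_of by (metis singletonD singletonI)
qed

lemma openin_vimage_basis:
  assumes "homog n d F"
  shows "openin (zariski l) (proj l \<inter> form_map \<phi> -` (proj n - zeros n {F}))"
proof -
  obtain F' where F': "homog l (d * e) F'" "\<And>v. peval F' v = peval F (\<phi> v)"
    using pullback_form[OF assms] by blast
  have "proj l \<inter> form_map \<phi> -` (proj n - zeros n {F}) = proj l - zeros l {F'}"
    using form_map_zeros[OF assms F'] form_map_proj by auto
  also have "openin (zariski l) \<dots>"
    unfolding zariski_def using F' by (intro topology_generated_by_Basis) auto
  finally show ?thesis .
qed

lemma continuous_form_map: "continuous_map (zariski l) (zariski n) (form_map \<phi>)"
  unfolding zariski_def[of n]
proof (rule continuous_on_generated_topo)
  fix U assume "U \<in> {proj n - zeros n {F} | F d. homog n d F}"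
  then show "openin (zariski l) (form_map \<phi> -` U \<inter> topspace (zariski l))"
    using openin_vimage_basis by (auto simp: topspace_zariski Int_commute)
next
  show "form_map \<phi> ` topspace (zariski l) \<subseteq> \<Union>{proj n - zeros n {F} |F d. homog n d F}"
    using form_map_proj topspace_zariski[of n]
    unfolding zariski_def[of n] topology_generated_by_topspace topspace_zariski by blast
qed

text \<open>A local quotient \<open>A / B\<close> pulls back to the quotient of
  \<open>A \<circ> \<phi>\<close> by \<open>B \<circ> \<phi>\<close>; both have degree
  \<open>d * e\<close>, so it is again a local presentation of a regular function.\<close>

lemma variety_morphism_form_map:
  assumes X: "form_map \<phi> ` proj l \<subseteq> X"
  shows "variety_morphism l (proj l) n X (form_map \<phi>)"
  unfolding variety_morphism_def
proof (intro conjI allI impI ballI)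
  have top_l: "subtopology (zariski l) (proj l) = zariski l"
    using subtopology_topspace[of "zariski l"] by (simp add: topspace_zariski)
  show cont: "continuous_map (subtopology (zariski l) (proj l)) (subtopology (zariski n) X) (form_map \<phi>)"
    using continuous_form_map X by (auto simp: top_l continuous_map_in_subtopology topspace_zariski)
  have pull_open: "zopen l (proj l) (proj l \<inter> form_map \<phi> -` V)" if "zopen n X V" for V
    using openin_continuous_map_preimage[OF cont that]
    by (simp add: top_l topspace_zariski Int_def vimage_def)
  fix V h
  assume V: "zopen n X V" and h: "h \<in> regular_fun n X V"
  show "restrict (h \<circ> form_map \<phi>) (proj l \<inter> form_map \<phi> -` V)
      \<in> regular_fun l (proj l) (proj l \<inter> form_map \<phi> -` V)"
    unfolding regular_fun_def
  proof (intro CollectI conjI ballI)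
    fix p assume p: "p \<in> proj l \<inter> form_map \<phi> -` V"
    then have "form_map \<phi> p \<in> V" by simp
    then obtain W A B d where W: "zopen n X W" "form_map \<phi> p \<in> W" "W \<subseteq> V" "homog n d A" "homog n d B"
      "\<forall>q\<in>W. \<forall>v\<in>q. peval B v \<noteq> 0 \<and> h q = peval A v / peval B v"
      using h unfolding regular_fun_def by blast
    obtain A' where A': "homog l (d * e) A'" "\<And>v. peval A' v = peval A (\<phi> v)"
      using pullback_form[OF W(4)] by blast
    obtain B' where B': "homog l (d * e) B'" "\<And>v. peval B' v = peval B (\<phi> v)"
      using pullback_form[OF W(5)] by blast
    have "\<forall>q\<in>proj l \<inter> form_map \<phi> -` W. \<forall>v\<in>q. peval B' v \<noteq> 0 \<and>
        restrict (h \<circ> form_map \<phi>) (proj l \<inter> form_map \<phi> -` V) q = peval A' v / peval B' v"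
      using W phi_mem_form_map by (auto simp: A' B')
    then show "\<exists>W A B d. zopen l (proj l) W \<and> p \<in> W \<and> W \<subseteq> proj l \<inter> form_map \<phi> -` V \<and>
        homog l d A \<and> homog l d B \<and> (\<forall>q\<in>W. \<forall>v\<in>q. peval B v \<noteq> 0 \<and>
        restrict (h \<circ> form_map \<phi>) (proj l \<inter> form_map \<phi> -` V) q = peval A v / peval B v)"
      using pull_open[OF W(1)] W(2,3) p A'(1) B'(1) by blast
  qed simp
qed

end

section \<open>Log maps obtained by pulling back functions\<close>

lemma sharp_fs_monoid_trivial: "sharp_fs_monoid {0}"
proof -
  have "add_submonoid hull {} = {0 :: nat \<Rightarrow>\<^sub>0 int}"
    by (rule hull_unique) (auto simp: add_submonoid_def)
  then show ?thesis
    unfolding sharp_fs_monoid_def by (auto intro!: exI[of _ "{}"])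
qed

text \<open>Dividing \<open>G\<close> by the \<open>k\<close>-th power of a coordinate that is
  nonzero at \<open>p\<close> gives a local equation of \<open>D\<close>. Its pullback will witness
  the nontrivial contact order.\<close>

lemma local_equation_in_div_log:
  assumes "homog n k G" "X \<subseteq> proj n" "D = X \<inter> zeros n {G}" "p \<in> X"
  obtains V s where "zopen n X V" "p \<in> V" "s \<in> div_log n X D V" "p \<in> D \<Longrightarrow> s p = 0"
proof -
  obtain v where v: "v \<in> vectors n" "p = point_of v"
    using assms unfolding proj_eq by blast
  then obtain i where "v i \<noteq> 0"
    unfolding vectors_def by blast
  moreover from this have "i \<le> n"
    using v(1) unfolding vectors_def by (metis (mono_tags, lifting) mem_Collect_eq not_le)
  ultimately have i: "v i \<noteq> 0" "i \<le> n" by auto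
  obtain L where L: "homog n 1 L" "peval L = (\<lambda>v. v i)"
    using form_var[OF i(2)] unfolding form_def by blast
  obtain B where B: "homog n k B" "peval B = (\<lambda>v. v i ^ k)"
    using form_power[OF form_var[OF i(2)], of k] unfolding form_def by auto
  define V where "V = X \<inter> (proj n - zeros n {L})"
  define s where "s = (\<lambda>q\<in>V. THE c. \<forall>w\<in>q. c = peval G w / peval B w)"
  have "openin (zariski n) (proj n - zeros n {L})"
    unfolding zariski_def by (rule topology_generated_by_Basis) (use L(1) in blast)
  then have V_open: "zopen n X V"
    unfolding V_def openin_subtopology by blast
  have nz: "w i \<noteq> 0" if q: "q \<in> V" and w: "w \<in> q" for q w
  proof -
    have q': "q \<in> proj n" "q \<notin> zeros n {L}" using q by (auto simp: V_def)
    have "peval L w \<noteq> 0"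
      using zeros_iff[of w n "{L}"] proj_memD[OF q'(1) w] q'(2) L(1) by (metis singletonD)
    then show ?thesis by (simp add: L(2))
  qed
  have s_eq: "s q = peval G w / peval B w" if q: "q \<in> V" and w: "w \<in> q" for q w
  proof -
    have q': "q = point_of w" using proj_memD(2)[OF _ w] q unfolding V_def by blast
    have "peval G u / peval B u = peval G w / peval B w" if "u \<in> q" for u
    proof -
      obtain a where "a \<noteq> 0" "u = (\<lambda>i. a * w i)"
        using \<open>u \<in> q\<close> unfolding q' point_of_def by blast
      then show ?thesis
        using peval_scale[OF assms(1), of a w] peval_scale[OF B(1), of a w] by simp
    qed
    note eq = this
    have "(THE c. \<forall>w\<in>q. c = peval G w / peval B w) = peval G w / peval B w"
    proof (rule the_equality)
      show "\<forall>u\<in>q. peval G w / peval B w = peval G u / peval B u"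
        by (intro ballI eq[symmetric])
    qed (use w in blast)
    moreover have "s q = (THE c. \<forall>w\<in>q. c = peval G w / peval B w)"
      unfolding s_def by (simp only: restrict_apply q if_True)
    ultimately show ?thesis by (rule trans[rotated])
  qed
  have D_iff: "q \<in> D \<longleftrightarrow> peval G w = 0" if q: "q \<in> V" and w: "w \<in> q" for q w
  proof -
    have "q \<in> proj n" "q \<in> X" using q by (auto simp: V_def)
    then show ?thesis
      using zeros_iff[of w n "{G}"] proj_memD[OF _ w] assms(1) unfolding assms(3)
      by (metis IntD2 IntI singletonD singletonI)
  qed
  have "s \<in> div_log n X D V"
    unfolding div_log_def regular_fun_def
  proof (intro CollectI conjI ballI)
    show "s \<in> extensional V" by (simp add: s_def)
    fix q assume q: "q \<in> V"
    show "\<exists>W A B d. zopen n X W \<and> q \<in> W \<and> W \<subseteq> V \<and> homog n d A \<and> homog n d B \<and>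
       (\<forall>q\<in>W. \<forall>v\<in>q. peval B v \<noteq> 0 \<and> s q = peval A v / peval B v)"
    proof (intro exI conjI ballI)
      show "zopen n X V" "q \<in> V" "V \<subseteq> V" "homog n k G" "homog n k B"
        using V_open q assms(1) B(1) by auto
      fix q' w assume *: "q' \<in> V" "w \<in> q'"
      show "peval B w \<noteq> 0" using nz[OF *] by (simp add: B(2))
      show "s q' = peval G w / peval B w" by (rule s_eq[OF *])
    qed
  next
    fix q assume q: "q \<in> V - D"
    then obtain w where "w \<in> q" using proj_nonempty[of q n] unfolding V_def by blast
    then show "s q \<noteq> 0" using q s_eq[of q w] D_iff[of q w] nz[of q w] B(2) by simp
  qed
  moreover have "p \<in> V"
  proof -
    have "p \<notin> zeros n {L}"
      using zeros_iff[OF v(1), of "{L}"] L(1) i(1) unfolding v(2) by (metis L(2) singletonD singletonI)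
    then show ?thesis using assms(2,4) unfolding V_def by blast
  qed
  moreover have "s p = 0" if "p \<in> D"
    using s_eq[of p v] D_iff[of p v] \<open>p \<in> V\<close> that v(2) mem_point_of by simp
  ultimately show ?thesis using that V_open by blast
qed

text \<open>As the curve meets \<open>D\<close> only in \<open>pinf\<close>, a section of the log
  structure pulls back to a function that is invertible away from \<open>pinf\<close>. So pulling
  back functions is already a log map over the base monoid \<open>{0}\<close>.\<close>

lemma (in form_morphism) A1_curve_form_map:
  assumes l: "l = 1" and G: "homog n k G" and X: "X \<subseteq> proj n" and D: "D = X \<inter> zeros n {G}"
    and into: "form_map \<phi> ` proj 1 \<subseteq> X" and pinf: "pinf \<in> proj 1" and q0: "q0 \<in> proj 1" "q0 \<noteq> pinf"
    and contact: "\<And>p. p \<in> proj 1 \<Longrightarrow> form_map \<phi> p \<in> D \<longleftrightarrow> p = pinf"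
  shows "\<exists>fl. A1_curve n X D {0} [pinf] (form_map \<phi>) fl"
proof -
  define fl :: "ppoint set \<Rightarrow> (ppoint \<Rightarrow> complex) \<Rightarrow> curve_section" where
    "fl V s = (\<lambda>p\<in>proj 1 \<inter> form_map \<phi> -` V. (0, s (form_map \<phi> p)))" for V s
  have mor: "variety_morphism 1 (proj 1) n X (form_map \<phi>)"
    using variety_morphism_form_map into l by simp
  have in_curve_log: "fl V s \<in> curve_log {0} (set [pinf]) (proj 1 \<inter> form_map \<phi> -` V)"
    if V: "zopen n X V" and s: "s \<in> div_log n X D V" for V s
  proof -
    let ?U = "proj 1 \<inter> form_map \<phi> -` V"
    have "restrict (snd \<circ> fl V s) ?U = restrict (s \<circ> form_map \<phi>) ?U"
      by (auto simp: fl_def restrict_def fun_eq_iff)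
    moreover have "restrict (s \<circ> form_map \<phi>) ?U \<in> regular_fun 1 (proj 1) ?U"
      using mor V s unfolding variety_morphism_def div_log_def by blast
    moreover have "restrict (s \<circ> form_map \<phi>) ?U p \<noteq> 0" if "p \<in> ?U - {pinf}" for p
      using that s contact[of p] by (auto simp: div_log_def)
    ultimately have "restrict (snd \<circ> fl V s) ?U \<in> div_log 1 (proj 1) (set [pinf]) ?U"
      unfolding div_log_def by simp
    then show ?thesis
      unfolding curve_log_def by (simp add: fl_def)
  qed
  have "log_morphism n X D {0} (set [pinf]) (form_map \<phi>) fl"
    unfolding log_morphism_def Let_def
  proof (intro conjI allI impI ballI)
    show "variety_morphism 1 (proj 1) n X (form_map \<phi>)" by (fact mor)
    fix V assume V: "zopen n X V"
    show "fl V (\<lambda>p\<in>V. 1) = (\<lambda>p\<in>proj 1 \<inter> form_map \<phi> -` V. (0, 1))"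
      by (auto simp: fl_def fun_eq_iff)
    fix s assume s: "s \<in> div_log n X D V"
    show "fl V (\<lambda>p\<in>V. s p * t p) = (\<lambda>p\<in>proj 1 \<inter> form_map \<phi> -` V.
        (fst (fl V s p) + fst (fl V t p), snd (fl V s p) * snd (fl V t p)))" for t
      by (auto simp: fl_def fun_eq_iff)
    show "fl V s \<in> curve_log {0} (set [pinf]) (proj 1 \<inter> form_map \<phi> -` V)"
      using in_curve_log[OF V s] .
    show "curve_alpha (proj 1 \<inter> form_map \<phi> -` V) (fl V s) =
        restrict (s \<circ> form_map \<phi>) (proj 1 \<inter> form_map \<phi> -` V)"
      by (auto simp: curve_alpha_def fl_def fun_eq_iff)
    show "fl V' (restrict s V') = restrict (fl V s) (proj 1 \<inter> form_map \<phi> -` V')"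
      if "zopen n X V' \<and> V' \<subseteq> V" for V'
      using that by (auto simp: fl_def fun_eq_iff)
  qed
  moreover have "\<not> form_map \<phi> constant_on proj 1"
    using contact pinf q0 unfolding constant_on_def by metis
  ultimately have "irreducible_genus0_stable_log_map n X D {0} [pinf] (form_map \<phi>) fl"
    using sharp_fs_monoid_trivial pinf by (simp add: irreducible_genus0_stable_log_map_def)
  moreover have "\<not> trivial_contact n X D (form_map \<phi>) fl pinf"
  proof -
    have "form_map \<phi> pinf \<in> X" using into pinf by blast
    then obtain V s where *: "zopen n X V" "form_map \<phi> pinf \<in> V" "s \<in> div_log n X D V"
      "form_map \<phi> pinf \<in> D \<Longrightarrow> s (form_map \<phi> pinf) = 0"
      using local_equation_in_div_log[OF G X D] by metis
    then have "snd (fl V s pinf) = 0"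
      using pinf contact[OF pinf] by (simp add: fl_def)
    then show ?thesis
      using * unfolding trivial_contact_def by blast
  qed
  moreover have "form_map \<phi> q0 \<in> X - D"
    using into q0 contact by auto
  ultimately show ?thesis
    unfolding A1_curve_def using q0 by (intro exI[of _ fl]) auto
qed

section \<open>Homogenization of a polynomial curve\<close>

lemma continuous_peval:
  assumes "\<And>i. continuous_on UNIV (\<lambda>s. f s i)"
  shows "continuous_on UNIV (\<lambda>s::complex. peval F (f s))"
  unfolding peval_def using assms by (intro continuous_intros)

definition homogenize :: "nat \<Rightarrow> (nat \<Rightarrow> complex poly) \<Rightarrow> (nat \<Rightarrow> complex) \<Rightarrow> nat \<Rightarrow> complex" where
  "homogenize e c v i = (\<Sum>j\<le>e. poly.coeff (c i) j * (v 0 ^ j * v 1 ^ (e - j)))"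

lemma form_homogenize: "form 1 e (\<lambda>v. homogenize e c v i)"
proof -
  have "form 1 e (\<lambda>v. v 0 ^ j * v 1 ^ (e - j))" if "j \<le> e" for j
  proof -
    have "form 1 (j * 1 + (e - j) * 1) (\<lambda>v. v 0 ^ j * v 1 ^ (e - j))"
      by (rule form_mult[OF form_power[OF form_var] form_power[OF form_var]]) simp_all
    then show ?thesis using that by simp
  qed
  then show ?thesis
    unfolding homogenize_def by (intro form_sum form_cmult) auto
qed

lemma homogenize_affine:
  assumes "v 1 \<noteq> 0" "degree (c i) \<le> e"
  shows "homogenize e c v i = v 1 ^ e * poly (c i) (v 0 / v 1)"
proof -
  have "poly (c i) (v 0 / v 1) = (\<Sum>j\<le>e. poly.coeff (c i) j * (v 0 / v 1) ^ j)"
    unfolding poly_altdef using assms(2)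
    by (intro sum.mono_neutral_left) (auto simp: coeff_eq_0)
  then have "v 1 ^ e * poly (c i) (v 0 / v 1)
      = (\<Sum>j\<le>e. v 1 ^ e * (poly.coeff (c i) j * (v 0 / v 1) ^ j))"
    by (simp only: sum_distrib_left)
  also have "\<dots> = homogenize e c v i"
    unfolding homogenize_def using assms
    by (intro sum.cong) (auto simp: power_divide power_diff)
  finally show ?thesis ..
qed

text \<open>Where \<open>v 1\<close> is nonzero both sides are obtained from the affine curve by
  rescaling; the case \<open>v 1 = 0\<close> follows by continuity in \<open>v 1\<close>.\<close>

lemma peval_homogenize:
  assumes F: "homog n d F" and deg: "\<And>i. degree (c i) \<le> e"
    and val: "\<And>t. peval F (\<lambda>i. poly (c i) t) = b"
  shows "peval F (homogenize e c v) = b * (v 1 ^ e) ^ d"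
proof -
  have affine: "peval F (homogenize e c v) = b * (v 1 ^ e) ^ d" if "v 1 \<noteq> 0" for v
  proof -
    have "homogenize e c v = (\<lambda>i. v 1 ^ e * poly (c i) (v 0 / v 1))"
      using homogenize_affine[of v c _ e, OF that deg] by auto
    then show ?thesis
      by (simp add: peval_scale[OF F] val)
  qed
  define g where "g s = peval F (homogenize e c (v(1 := s))) - b * (s ^ e) ^ d" for s
  have "continuous_on UNIV g"
    unfolding g_def homogenize_def
    by (intro continuous_intros continuous_peval) auto
  then have "(g \<longlongrightarrow> g 0) (at 0)"
    by (simp add: continuous_on_def)
  moreover have "(g \<longlongrightarrow> 0) (at 0)"
    by (rule tendsto_eventually) (auto simp: eventually_at_filter g_def affine)
  ultimately have "g 0 = 0"
    using tendsto_unique[of "at (0::complex)" g "g 0" 0] by simp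
  then show ?thesis
    using affine[of v] by (cases "v 1 = 0") (auto simp: g_def fun_upd_idem)
qed

lemma A1_curve_of_polynomials:
  assumes Fs: "\<And>F. F \<in> set Fs \<Longrightarrow> \<exists>d. homog n d F" and G: "homog n k G" "0 < k"
    and X: "X = zeros n (set Fs)" and D: "D = zeros n (set (Fs @ [G]))"
    and beyond: "\<And>i. i > n \<Longrightarrow> c i = 0" and nonconst: "degree (c i0) > 0"
    and F0: "\<And>F t. F \<in> set Fs \<Longrightarrow> peval F (\<lambda>i. poly (c i) t) = 0"
    and G1: "\<And>t. peval G (\<lambda>i. poly (c i) t) = 1"
  shows "\<exists>Q ps f fl. A1_curve n X D Q ps f fl \<and> (\<forall>t. point_of (\<lambda>i. poly (c i) t) \<in> f ` proj 1)"
proof -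
  \<comment> \<open>A coordinate attaining the maximal degree is nonzero at infinity, so
    homogenizing all coordinates in this degree creates no base point there.\<close>
  define e where "e = Max (degree ` c ` {..n})"
  have i0: "i0 \<le> n" using nonconst beyond[of i0] by (cases "i0 \<le> n") auto
  have deg: "degree (c i) \<le> e" for i
    using beyond[of i] unfolding e_def by (cases "i \<le> n") auto
  have "e \<in> degree ` c ` {..n}"
    unfolding e_def by (rule Max_in) auto
  then obtain i1 where i1: "degree (c i1) = e" by auto
  have e: "0 < e" using deg[of i0] nonconst by simp
  have i1c: "c i1 \<noteq> 0" using i1 e by auto
  define \<phi> where "\<phi> = homogenize e c"
  \<comment> \<open>This vanishes exactly at infinity: elsewhere it excludes both base points and
    contact with \<open>D\<close>.\<close>
  have GF: "peval G (\<phi> v) = (v 1 ^ e) ^ k" for v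
    unfolding \<phi>_def using peval_homogenize[OF G(1) deg G1] by simp
  have FF: "peval F (\<phi> v) = 0" if F: "F \<in> set Fs" for F v
  proof -
    obtain d where "homog n d F" using Fs[OF F] by blast
    from peval_homogenize[OF this deg F0[OF F]] show ?thesis unfolding \<phi>_def by simp
  qed
  have phi_inf: "\<phi> v i1 = lead_coeff (c i1) * v 0 ^ e" if "v 1 = 0" for v
  proof -
    have "\<phi> v i1 = (\<Sum>j\<in>{e}. poly.coeff (c i1) j * (v 0 ^ j * v 1 ^ (e - j)))"
      unfolding \<phi>_def homogenize_def using that by (intro sum.mono_neutral_right) auto
    then show ?thesis by (simp add: i1)
  qed
  have G0: "peval G (\<lambda>i. 0) = 0"
    using peval_scale[OF G(1), of 0 "\<lambda>i. 0"] G(2) by (simp add: zero_power)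
  have beyond': "\<phi> v i = 0" if "i > n" for v i
    using beyond[OF that] by (simp add: \<phi>_def homogenize_def)
  interpret form_morphism 1 n e \<phi>
  proof
    show "form 1 e (\<lambda>v. \<phi> v i)" for i
      unfolding \<phi>_def by (rule form_homogenize)
    show "\<phi> v i = 0" if "i > n" for v i
      using beyond' that .
    fix v assume v: "v \<in> vectors 1"
    have "\<exists>i. \<phi> v i \<noteq> 0"
    proof (cases "v 1 = 0")
      case True
      then have "v 0 \<noteq> 0"
        using v by (auto simp: vectors_def) (metis One_nat_def less_Suc0 linorder_neqE_nat)
      then show ?thesis
        using phi_inf[of v, OF True] i1c by (intro exI[of _ i1]) auto
    next
      case False
      then have "\<phi> v \<noteq> (\<lambda>i. 0)" using GF[of v] G0 by auto
      then show ?thesis by auto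
    qed
    then show "\<phi> v \<in> vectors n"
      using beyond' by (simp add: vectors_def)
  qed
  have S: "\<exists>d. homog n d F" if "F \<in> set (Fs @ [G])" for F
    using that Fs G by auto
  have inX: "form_map \<phi> (point_of v) \<in> X" if v: "v \<in> vectors 1" for v
    unfolding X form_map_point_of
    using FF by (subst zeros_iff[OF no_base_points[OF v]]) (auto simp: Fs)
  have inD: "form_map \<phi> (point_of v) \<in> D \<longleftrightarrow> v 1 = 0" if v: "v \<in> vectors 1" for v
  proof -
    have "form_map \<phi> (point_of v) \<in> D \<longleftrightarrow> (\<forall>F\<in>set (Fs @ [G]). peval F (\<phi> v) = 0)"
      unfolding D form_map_point_of by (rule zeros_iff[OF no_base_points[OF v] S])
    then show ?thesis using FF GF e G(2) by auto
  qed
  have DX: "D = X \<inter> zeros n {G}"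
    unfolding D X by (auto simp: zeros_def)
  define at_inf :: "nat \<Rightarrow> complex" where "at_inf i = (if i = 0 then 1 else 0)" for i
  define aff :: "complex \<Rightarrow> nat \<Rightarrow> complex" where
    "aff t i = (if i = 0 then t else if i = 1 then 1 else 0)" for t i
  have vec: "at_inf \<in> vectors 1" "aff t \<in> vectors 1" for t
    by (auto simp: vectors_def at_inf_def aff_def)
  have at_inf_iff: "point_of v = point_of at_inf \<longleftrightarrow> v 1 = 0" if v: "v \<in> vectors 1" for v
  proof
    assume "point_of v = point_of at_inf"
    then have "v \<in> point_of at_inf" using mem_point_of by metis
    then show "v 1 = 0" by (auto simp: point_of_def at_inf_def)
  next
    assume v1: "v 1 = 0"
    have "v 0 \<noteq> 0"
      using v v1 by (auto simp: vectors_def) (metis One_nat_def less_Suc0 linorder_neqE_nat)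
    moreover have "v = (\<lambda>i. v 0 * at_inf i)"
    proof
      fix i :: nat
      consider "i = 0" | "i = 1" | "i > 1" by linarith
      then show "v i = v 0 * at_inf i"
        using v v1 by cases (auto simp: vectors_def at_inf_def)
    qed
    ultimately show "point_of v = point_of at_inf"
      using point_of_scale by metis
  qed
  have "\<exists>fl. A1_curve n X D {0} [point_of at_inf] (form_map \<phi>) fl"
  proof (rule A1_curve_form_map[OF refl G(1) _ DX])
    show "X \<subseteq> proj n" by (auto simp: X zeros_def)
    show "form_map \<phi> ` proj 1 \<subseteq> X" using inX by (auto simp: proj_eq)
    show "point_of at_inf \<in> proj 1" "point_of (aff 0) \<in> proj 1" using vec by (auto simp: proj_eq)
    show "point_of (aff 0) \<noteq> point_of at_inf"
      using at_inf_iff[OF vec(2)] by (simp add: aff_def)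
    show "form_map \<phi> p \<in> D \<longleftrightarrow> p = point_of at_inf" if "p \<in> proj 1" for p
      using that inD at_inf_iff by (auto simp: proj_eq)
  qed
  moreover have "point_of (\<lambda>i. poly (c i) t) \<in> form_map \<phi> ` proj 1" for t
  proof -
    have "\<phi> (aff t) = (\<lambda>i. poly (c i) t)"
      unfolding \<phi>_def using homogenize_affine[of "aff t" c _ e] deg by (auto simp: aff_def)
    then have "point_of (\<lambda>i. poly (c i) t) = form_map \<phi> (point_of (aff t))"
      by (simp add: form_map_point_of)
    then show ?thesis using vec by (auto simp: proj_eq)
  qed
  ultimately show ?thesis by blast
qed

section \<open>Polynomial expressions\<close>

text \<open>Expressions are evaluated along maps that are multiplicative and additive only on a subring of the
  complex numbers containing the constants, which rules out \<open>map_poly\<close> and the like.\<close>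

datatype pexp = PConst complex | PVar nat | PAdd pexp pexp | PMul pexp pexp

primrec pvars :: "pexp \<Rightarrow> nat set" where
  "pvars (PConst c) = {}"
| "pvars (PVar i) = {i}"
| "pvars (PAdd e f) = pvars e \<union> pvars f"
| "pvars (PMul e f) = pvars e \<union> pvars f"

primrec pconsts :: "pexp \<Rightarrow> complex set" where
  "pconsts (PConst c) = {c}"
| "pconsts (PVar i) = {}"
| "pconsts (PAdd e f) = pconsts e \<union> pconsts f"
| "pconsts (PMul e f) = pconsts e \<union> pconsts f"

primrec ev :: "(complex \<Rightarrow> 'a) \<Rightarrow> pexp \<Rightarrow> (nat \<Rightarrow> 'a) \<Rightarrow> 'a::comm_ring_1" where
  "ev h (PConst c) v = h c"
| "ev h (PVar i) v = v i"
| "ev h (PAdd e f) v = ev h e v + ev h f v"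
| "ev h (PMul e f) v = ev h e v * ev h f v"

primrec pd :: "nat \<Rightarrow> pexp \<Rightarrow> pexp" where
  "pd j (PConst c) = PConst 0"
| "pd j (PVar i) = PConst (if i = j then 1 else 0)"
| "pd j (PAdd e f) = PAdd (pd j e) (pd j f)"
| "pd j (PMul e f) = PAdd (PMul (pd j e) f) (PMul e (pd j f))"

definition ring_map :: "('a::comm_ring_1 \<Rightarrow> 'b::comm_ring_1) \<Rightarrow> bool" where
  "ring_map h \<longleftrightarrow> h 0 = 0 \<and> h 1 = 1 \<and> (\<forall>a b. h (a + b) = h a + h b) \<and> (\<forall>a b. h (a * b) = h a * h b)"

lemma ring_mapD:
  assumes "ring_map h"
  shows "h 0 = 0" "h 1 = 1" "h (a + b) = h a + h b" "h (a * b) = h a * h b"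
  using assms by (auto simp: ring_map_def)

lemma ring_map_uminus: "ring_map h \<Longrightarrow> h (- a) = - h a"
  using ring_mapD(1,3)[of h] by (metis add.right_inverse add_eq_0_iff)

lemma ring_map_diff: "ring_map h \<Longrightarrow> h (a - b) = h a - h b"
  using ring_mapD(3)[of h a "- b"] ring_map_uminus[of h b] by simp

lemma ring_map_sum: "ring_map h \<Longrightarrow> h (sum f S) = (\<Sum>x\<in>S. h (f x))"
  by (induction S rule: infinite_finite_induct) (simp_all add: ring_mapD)

lemma ring_map_power: "ring_map h \<Longrightarrow> h (a ^ n) = h a ^ n"
  by (induction n) (simp_all add: ring_mapD)

lemma ring_map_comp: "ring_map g \<Longrightarrow> ring_map h \<Longrightarrow> ring_map (\<lambda>x. g (h x))"
  by (simp add: ring_map_def)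

lemma ring_map_id [simp]: "ring_map (\<lambda>x. x)"
  by (simp add: ring_map_def)

lemma ring_map_pCons [simp]: "ring_map (\<lambda>c. [:c:])"
  by (simp add: ring_map_def one_pCons)

lemma ring_map_fps_const [simp]: "ring_map fps_const"
  by (simp add: ring_map_def)

lemma ring_map_fls_const [simp]: "ring_map fls_const"
  by (simp add: ring_map_def fls_plus_const)

lemma ring_map_fps_to_fls [simp]: "ring_map fps_to_fls"
  by (simp add: ring_map_def fls_times_fps_to_fls)

lemma ev_hom: "ring_map g \<Longrightarrow> g (ev h e v) = ev (\<lambda>c. g (h c)) e (\<lambda>i. g (v i))"
  by (induction e) (simp_all add: ring_mapD)

lemma ev_cong: "(\<And>i. i \<in> pvars e \<Longrightarrow> v i = w i) \<Longrightarrow> ev h e v = ev h e w"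
  by (induction e) auto

lemma pvars_pd: "pvars (pd j e) \<subseteq> pvars e"
  by (induction e) auto

lemma pconsts_pd: "pconsts (pd j e) \<subseteq> pconsts e \<union> {0, 1}"
  by (induction e) auto

text \<open>The differential of \<open>e\<close> at \<open>v\<close>, applied to a tangent vector
  \<open>x\<close> with \<open>N\<close> coordinates.\<close>

definition dev :: "nat \<Rightarrow> (complex \<Rightarrow> 'a) \<Rightarrow> pexp \<Rightarrow> (nat \<Rightarrow> 'a) \<Rightarrow> (nat \<Rightarrow> 'a) \<Rightarrow> 'a::comm_ring_1" where
  "dev N h e v x = (\<Sum>j<N. ev h (pd j e) v * x j)"

abbreviation evc :: "pexp \<Rightarrow> (nat \<Rightarrow> complex) \<Rightarrow> complex" where
  "evc \<equiv> ev (\<lambda>x. x)"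

abbreviation devc :: "nat \<Rightarrow> pexp \<Rightarrow> (nat \<Rightarrow> complex) \<Rightarrow> (nat \<Rightarrow> complex) \<Rightarrow> complex" where
  "devc N \<equiv> dev N (\<lambda>x. x)"

abbreviation evp :: "pexp \<Rightarrow> (nat \<Rightarrow> complex poly) \<Rightarrow> complex poly" where
  "evp \<equiv> ev (\<lambda>c. [:c:])"

abbreviation devp :: "nat \<Rightarrow> pexp \<Rightarrow> (nat \<Rightarrow> complex poly) \<Rightarrow> (nat \<Rightarrow> complex poly) \<Rightarrow> complex poly" where
  "devp N \<equiv> dev N (\<lambda>c. [:c:])"

abbreviation cvec :: "(nat \<Rightarrow> 'a::zero) \<Rightarrow> nat \<Rightarrow> 'a poly" where
  "cvec x \<equiv> \<lambda>j. [:x j:]"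

abbreviation line :: "(nat \<Rightarrow> 'a::zero) \<Rightarrow> (nat \<Rightarrow> 'a) \<Rightarrow> nat \<Rightarrow> 'a poly" where
  "line p v \<equiv> \<lambda>j. [:p j, v j:]"

abbreviation conic :: "(nat \<Rightarrow> 'a::zero) \<Rightarrow> (nat \<Rightarrow> 'a) \<Rightarrow> (nat \<Rightarrow> 'a) \<Rightarrow> nat \<Rightarrow> 'a poly" where
  "conic q a p \<equiv> \<lambda>j. [:q j, a j, p j:]"

abbreviation fvec :: "(nat \<Rightarrow> 'a::zero) \<Rightarrow> nat \<Rightarrow> 'a fps" where
  "fvec x \<equiv> \<lambda>j. fps_const (x j)"

abbreviation fps_cpoly :: "'a::zero \<Rightarrow> 'a fps poly" where
  "fps_cpoly \<equiv> \<lambda>c. [:fps_const c:]"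

abbreviation fls_cpoly :: "'a::zero \<Rightarrow> 'a fls poly" where
  "fls_cpoly \<equiv> \<lambda>c. [:fls_const c:]"

abbreviation cpoly2 :: "'a::zero \<Rightarrow> 'a poly poly" where
  "cpoly2 \<equiv> \<lambda>c. [:[:c:]:]"

lemma dev_add: "dev N h e v (\<lambda>j. x j + y j) = dev N h e v x + dev N h e v y"
  by (simp add: dev_def distrib_left sum.distrib)

lemma dev_diff: "dev N h e v (\<lambda>j. x j - y j) = dev N h e v x - dev N h e v y"
  by (simp add: dev_def right_diff_distrib sum_subtractf)

lemma dev_scale: "dev N h e v (\<lambda>j. a * x j) = a * dev N h e v x"
  by (simp add: dev_def sum_distrib_left mult_ac)

lemma dev_sum: "dev N h e v (\<lambda>j. \<Sum>s\<in>S. x s j) = (\<Sum>s\<in>S. dev N h e v (x s))"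
  unfolding dev_def sum_distrib_left by (rule sum.swap)

lemma dev_cong: "(\<And>j. j < N \<Longrightarrow> x j = y j) \<Longrightarrow> dev N h e v x = dev N h e v y"
  by (simp add: dev_def)

lemma dev_cong_point: "(\<And>i. i \<in> pvars e \<Longrightarrow> v i = w i) \<Longrightarrow> dev N h e v x = dev N h e w x"
  unfolding dev_def using pvars_pd by (intro sum.cong refl arg_cong2[where f="(*)"] ev_cong) blast

lemma dev_hom:
  "ring_map g \<Longrightarrow> g (dev N h e v x) = dev N (\<lambda>c. g (h c)) e (\<lambda>i. g (v i)) (\<lambda>i. g (x i))"
  by (simp add: dev_def ring_map_sum ring_mapD ev_hom)

lemma dev_simps:
  assumes "ring_map h"
  shows "dev N h (PConst c) v x = 0"
    "i < N \<Longrightarrow> dev N h (PVar i) v x = x i"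
    "dev N h (PAdd e f) v x = dev N h e v x + dev N h f v x"
    "dev N h (PMul e f) v x = dev N h e v x * ev h f v + ev h e v * dev N h f v x"
proof -
  have "dev N h (PVar i) v x = (\<Sum>j<N. if i = j then x j else 0)"
    unfolding dev_def using assms by (intro sum.cong) (auto simp: ring_mapD)
  then show "i < N \<Longrightarrow> dev N h (PVar i) v x = x i" by simp
qed (use assms in \<open>simp_all add: dev_def ring_mapD distrib_left distrib_right sum.distrib
    sum_distrib_left sum_distrib_right mult_ac\<close>)

lemma taylor:
  assumes h: "ring_map h" and "pvars e \<subseteq> {..<N}"
  shows "\<exists>z. ev h e (\<lambda>j. v j + w * x j) = ev h e v + w * dev N h e v x + w\<^sup>2 * z"
  using assms(2)
proof (induction e)
  case (PConst c)
  then show ?case by (auto simp: dev_simps[OF h] intro: exI[of _ 0])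
next
  case (PVar i)
  then show ?case by (auto simp: dev_simps[OF h] intro: exI[of _ 0])
next
  case (PAdd e f)
  then obtain a b where
    "ev h e (\<lambda>j. v j + w * x j) = ev h e v + w * dev N h e v x + w\<^sup>2 * a"
    "ev h f (\<lambda>j. v j + w * x j) = ev h f v + w * dev N h f v x + w\<^sup>2 * b"
    by auto
  then show ?case
    by (intro exI[of _ "a + b"]) (simp add: dev_simps[OF h] algebra_simps)
next
  case (PMul e f)
  then obtain a b where
    "ev h e (\<lambda>j. v j + w * x j) = ev h e v + w * dev N h e v x + w\<^sup>2 * a"
    "ev h f (\<lambda>j. v j + w * x j) = ev h f v + w * dev N h f v x + w\<^sup>2 * b"
    by auto
  then show ?case
    by (intro exI[of _ "dev N h e v x * dev N h f v x + a * ev h f v + ev h e v * b +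
        w * (dev N h e v x * b + a * dev N h f v x) + w\<^sup>2 * a * b"])
      (simp add: dev_simps[OF h] algebra_simps power2_eq_square)
qed

lemma ev_dvd_diff:
  assumes "\<And>j. j \<in> pvars e \<Longrightarrow> a dvd v j - w j"
  shows "a dvd ev h e v - ev h e w"
  using assms
proof (induction e)
  case (PAdd e f)
  then have "a dvd (ev h e v - ev h e w) + (ev h f v - ev h f w)" by (intro dvd_add) auto
  then show ?case by (simp add: algebra_simps)
next
  case (PMul e f)
  then have "a dvd (ev h e v - ev h e w) * ev h f v + ev h e w * (ev h f v - ev h f w)"
    by (intro dvd_add dvd_mult dvd_mult2) auto
  then show ?case by (simp add: algebra_simps)
qed auto

lemma dev_dvd_diff:
  assumes "\<And>j. j \<in> pvars e \<Longrightarrow> a dvd v j - w j"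
  shows "a dvd dev N h e v x - dev N h e w x"
proof -
  have "a dvd (ev h (pd j e) v - ev h (pd j e) w) * x j" for j
    using ev_dvd_diff[of "pd j e"] assms pvars_pd by (metis dvd_mult2 subsetD)
  then show ?thesis
    unfolding dev_def sum_subtractf[symmetric] left_diff_distrib[symmetric] by (intro dvd_sum) auto
qed

text \<open>Expressions that vanish for syntactic reasons are homogeneous of every degree; this makes
  homogeneity stable under formal differentiation.\<close>

inductive pzero :: "pexp \<Rightarrow> bool" where
  "pzero (PConst 0)"
| "pzero e \<Longrightarrow> pzero f \<Longrightarrow> pzero (PAdd e f)"
| "pzero e \<Longrightarrow> pzero (PMul e f)"
| "pzero f \<Longrightarrow> pzero (PMul e f)"

inductive phom :: "nat \<Rightarrow> pexp \<Rightarrow> bool" where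
  phom_zero: "pzero e \<Longrightarrow> phom d e"
| phom_const: "phom 0 (PConst c)"
| phom_var: "phom 1 (PVar i)"
| phom_add: "phom d e \<Longrightarrow> phom d f \<Longrightarrow> phom d (PAdd e f)"
| phom_mul: "phom d e \<Longrightarrow> phom d' f \<Longrightarrow> phom (d + d') (PMul e f)"

lemma pzero_ev: "pzero e \<Longrightarrow> ring_map h \<Longrightarrow> ev h e v = 0"
  by (induction rule: pzero.induct) (simp_all add: ring_mapD)

lemma pzero_pd: "pzero e \<Longrightarrow> pzero (pd j e)"
  by (induction rule: pzero.induct) (auto intro: pzero.intros)

lemma phom_0_pd: "phom d e \<Longrightarrow> d = 0 \<Longrightarrow> pzero (pd j e)"
  by (induction rule: phom.induct) (auto intro: pzero.intros simp: pzero_pd)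

lemma phom_pd: "phom d e \<Longrightarrow> phom (d - 1) (pd j e)"
proof (induction rule: phom.induct)
  case (phom_mul d e d' f)
  have "phom (d + d' - 1) (PMul (pd j e) f)"
  proof (cases "d = 0")
    case True
    then show ?thesis
      using phom_0_pd phom_mul by (intro phom_zero) (auto intro: pzero.intros)
  next
    case False
    then have "d + d' - 1 = d - 1 + d'" by simp
    then show ?thesis using phom_mul phom.phom_mul by metis
  qed
  moreover have "phom (d + d' - 1) (PMul e (pd j f))"
  proof (cases "d' = 0")
    case True
    then show ?thesis
      using phom_0_pd phom_mul by (intro phom_zero) (auto intro: pzero.intros)
  next
    case False
    then have "d + d' - 1 = d + (d' - 1)" by simp
    then show ?thesis using phom_mul phom.phom_mul by metis
  qed
  ultimately show ?case by (simp add: phom_add)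
qed (auto intro: phom.intros pzero.intros simp: pzero_pd)

lemma phom_ev:
  "phom d e \<Longrightarrow> ring_map h \<Longrightarrow> ev h e (\<lambda>i. a * v i) = a ^ d * ev h e v"
  by (induction rule: phom.induct) (simp_all add: pzero_ev algebra_simps power_add)

lemma phom_dev:
  assumes "phom d e" "ring_map h"
  shows "dev N h e (\<lambda>i. a * v i) x = a ^ (d - 1) * dev N h e v x"
  unfolding dev_def sum_distrib_left using phom_ev[OF phom_pd[OF assms(1)] assms(2)]
  by (simp add: mult_ac)

lemma phom_euler:
  assumes "phom d e" "ring_map h" "pvars e \<subseteq> {..<N}"
  shows "dev N h e v v = of_nat d * ev h e v"
  using assms(1,3)
proof (induction rule: phom.induct)
  case (phom_zero e d)
  then show ?case
    by (simp add: dev_def pzero_ev[OF _ assms(2)] pzero_pd)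
qed (auto simp: dev_simps[OF assms(2)] algebra_simps)

lemma ev_has_field_derivative:
  "((\<lambda>t. ev (\<lambda>c. c) e (v(j := t))) has_field_derivative ev (\<lambda>c. c) (pd j e) (v(j := t))) (at t)"
  by (induction e) (auto intro!: derivative_eq_intros)

lemma degree_ev_le:
  assumes "phom d e" and deg: "\<And>i. degree (v i) \<le> b" and h: "ring_map h"
    "\<And>c. degree (h c) = 0"
  shows "degree (ev h e v) \<le> d * b"
  using assms(1)
proof (induction rule: phom.induct)
  case (phom_zero e d)
  then show ?case by (simp add: pzero_ev[OF _ h(1)])
next
  case (phom_add d e f)
  then show ?case by (simp add: degree_add_le)
next
  case (phom_mul d e d' f)
  then show ?case
    using degree_mult_le[of "ev h e v" "ev h f v"] by (simp add: add_mult_distrib)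
qed (use deg h in auto)

section \<open>Linear equations\<close>

text \<open>Elimination by cross-multiplication, without division, because it is also applied over a
  polynomial ring.\<close>

lemma more_unknowns_than_equations:
  fixes a :: "nat \<Rightarrow> 'i \<Rightarrow> 'a::idom"
  assumes "finite J" "E < card J"
  shows "\<exists>x. (\<exists>j\<in>J. x j \<noteq> 0) \<and> (\<forall>i<E. (\<Sum>j\<in>J. a i j * x j) = 0)"
  using assms
proof (induction E arbitrary: J a)
  case 0
  then obtain j where "j \<in> J" by (metis card.empty ex_in_conv less_nat_zero_code)
  then show ?case by (intro exI[of _ "\<lambda>_. 1"]) auto
next
  case (Suc E)
  show ?case
  proof (cases "\<forall>j\<in>J. a E j = 0")
    case True
    obtain x where "\<exists>j\<in>J. x j \<noteq> 0" "\<forall>i<E. (\<Sum>j\<in>J. a i j * x j) = 0"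
      using Suc.IH[of J a] Suc.prems by auto
    with True show ?thesis
      by (intro exI[of _ x]) (auto simp: less_Suc_eq)
  next
    case False
    then obtain l where l: "l \<in> J" "a E l \<noteq> 0" by auto
    have "finite (J - {l})" "E < card (J - {l})"
      using Suc.prems l by auto
    from Suc.IH[OF this, of "\<lambda>i j. a E l * a i j - a i l * a E j"] obtain y where
      y: "\<exists>j\<in>J - {l}. y j \<noteq> 0" "\<And>i. i < E \<Longrightarrow> (\<Sum>j\<in>J - {l}. (a E l * a i j - a i l * a E j) * y j) = 0"
      by auto
    define S where "S i = (\<Sum>j\<in>J - {l}. a i j * y j)" for i
    define x where "x j = (if j = l then - S E else a E l * y j)" for j
    have eq: "(\<Sum>j\<in>J. a i j * x j) = a E l * S i - a i l * S E" for i
    proof -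
      have "(\<Sum>j\<in>J. a i j * x j) = a i l * x l + (\<Sum>j\<in>J - {l}. a i j * x j)"
        using Suc.prems l by (intro sum.remove) auto
      also have "(\<Sum>j\<in>J - {l}. a i j * x j) = (\<Sum>j\<in>J - {l}. a E l * (a i j * y j))"
        by (intro sum.cong) (auto simp: x_def)
      finally show ?thesis
        by (simp add: x_def S_def sum_distrib_left)
    qed
    have "a E l * S i - a i l * S E = 0" if "i < E" for i
      using y(2)[OF that] unfolding S_def sum_distrib_left sum_subtractf[symmetric]
      by (simp add: algebra_simps)
    moreover have "\<exists>j\<in>J. x j \<noteq> 0"
      using y(1) l by (auto simp: x_def)
    ultimately show ?thesis
      by (intro exI[of _ x]) (auto simp: eq less_Suc_eq)
  qed
qed

section \<open>Solving equations in formal power series\<close>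

lemma fps_X_power_dvd_iff: "fps_X ^ k dvd (f :: 'a::comm_ring_1 fps) \<longleftrightarrow> (\<forall>i<k. fps_nth f i = 0)"
proof
  assume "fps_X ^ k dvd f"
  then obtain g where "f = fps_X ^ k * g" by (auto elim: dvdE)
  then show "\<forall>i<k. fps_nth f i = 0" by (simp add: fps_X_power_mult_nth)
next
  assume "\<forall>i<k. fps_nth f i = 0"
  then have "f = fps_X ^ k * fps_shift k f"
    by (intro fps_ext) (simp add: fps_X_power_mult_nth)
  then show "fps_X ^ k dvd f" by (metis dvd_triv_left)
qed

lemma fps_X_dvd_iff: "fps_X dvd (f :: 'a::comm_ring_1 fps) \<longleftrightarrow> fps_nth f 0 = 0"
  using fps_X_power_dvd_iff[of 1 f] by simp

lemma fps_sequence_limit: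
  fixes F :: "nat \<Rightarrow> nat \<Rightarrow> 'a::comm_ring_1 fps"
  assumes "\<And>k j. fps_X ^ (k + 1) dvd F (Suc k) j - F k j"
  obtains f where "\<And>k j. fps_nth (f j) k = fps_nth (F k j) k" "\<And>k j. fps_X ^ (k + 1) dvd f j - F k j"
proof
  define f where "f j = Abs_fps (\<lambda>k. fps_nth (F k j) k)" for j
  have stable: "fps_nth (F (k + l) j) k = fps_nth (F k j) k" for k l j
  proof (induction l)
    case (Suc l)
    have "fps_nth (F (Suc (k + l)) j - F (k + l) j) k = 0"
      using assms[of "k + l" j] unfolding fps_X_power_dvd_iff by auto
    then show ?case using Suc by simp
  qed simp
  show "fps_nth (f j) k = fps_nth (F k j) k" for k j by (simp add: f_def)
  show "fps_X ^ (k + 1) dvd f j - F k j" for k j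
    unfolding fps_X_power_dvd_iff using stable[of _ "k - _" j]
    by (auto simp: f_def) (metis le_add_diff_inverse less_Suc_eq_le)
qed

text \<open>The two properties of a polynomial map with differential \<open>\<Psi>'\<close> on which
  Newton iteration rests. In contrast to values of a \<open>pexp\<close>, this class admits
  arbitrary ring elements as coefficients, and it is closed under sums and products.\<close>

definition tame :: "((nat \<Rightarrow> 'a) \<Rightarrow> 'a::comm_ring_1) \<Rightarrow> ((nat \<Rightarrow> 'a) \<Rightarrow> (nat \<Rightarrow> 'a) \<Rightarrow> 'a) \<Rightarrow> bool" where
  "tame \<Psi> \<Psi>' \<longleftrightarrow>
     (\<forall>v w x. \<exists>z. \<Psi> (\<lambda>j. v j + w * x j) = \<Psi> v + w * \<Psi>' v x + w\<^sup>2 * z) \<and>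
     (\<forall>a v v'. (\<forall>j. a dvd v j - v' j) \<longrightarrow> a dvd \<Psi> v - \<Psi> v' \<and> (\<forall>x. a dvd \<Psi>' v x - \<Psi>' v' x))"

lemma tame_ev: "ring_map h \<Longrightarrow> pvars e \<subseteq> {..<N} \<Longrightarrow> tame (ev h e) (dev N h e)"
  unfolding tame_def using taylor[of h e N] ev_dvd_diff dev_dvd_diff by blast

lemma tame_const: "tame (\<lambda>v. c) (\<lambda>v x. 0)"
  by (auto simp: tame_def intro: exI[of _ 0])

lemma tame_var: "tame (\<lambda>v. v j) (\<lambda>v x. x j)"
  by (auto simp: tame_def intro: exI[of _ 0])

lemma tame_add:
  fixes f g :: "(nat \<Rightarrow> 'a) \<Rightarrow> 'a::comm_ring_1"
  assumes "tame f f'" "tame g g'"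
  shows "tame (\<lambda>v. f v + g v) (\<lambda>v x. f' v x + g' v x)"
  unfolding tame_def
proof (intro conjI allI impI)
  fix v x :: "nat \<Rightarrow> 'a" and w
  obtain y z where "f (\<lambda>j. v j + w * x j) = f v + w * f' v x + w\<^sup>2 * y"
    "g (\<lambda>j. v j + w * x j) = g v + w * g' v x + w\<^sup>2 * z"
    using assms unfolding tame_def by meson
  then show "\<exists>z. f (\<lambda>j. v j + w * x j) + g (\<lambda>j. v j + w * x j) =
      f v + g v + w * (f' v x + g' v x) + w\<^sup>2 * z"
    by (intro exI[of _ "y + z"]) (simp add: algebra_simps)
next
  fix a and v v' :: "nat \<Rightarrow> 'a" assume *: "\<forall>j. a dvd v j - v' j"
  have "a dvd (f v - f v') + (g v - g v')"
    using assms * unfolding tame_def by (intro dvd_add) blast+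
  then show "a dvd f v + g v - (f v' + g v')" by (simp add: algebra_simps)
  fix x
  have "a dvd (f' v x - f' v' x) + (g' v x - g' v' x)"
    using assms * unfolding tame_def by (intro dvd_add) blast+
  then show "a dvd f' v x + g' v x - (f' v' x + g' v' x)" by (simp add: algebra_simps)
qed

lemma tame_mult:
  fixes f g :: "(nat \<Rightarrow> 'a) \<Rightarrow> 'a::comm_ring_1"
  assumes "tame f f'" "tame g g'"
  shows "tame (\<lambda>v. f v * g v) (\<lambda>v x. f' v x * g v + f v * g' v x)"
  unfolding tame_def
proof (intro conjI allI impI)
  fix v x :: "nat \<Rightarrow> 'a" and w
  obtain y z where "f (\<lambda>j. v j + w * x j) = f v + w * f' v x + w\<^sup>2 * y"
    "g (\<lambda>j. v j + w * x j) = g v + w * g' v x + w\<^sup>2 * z"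
    using assms unfolding tame_def by meson
  then show "\<exists>z. f (\<lambda>j. v j + w * x j) * g (\<lambda>j. v j + w * x j) =
      f v * g v + w * (f' v x * g v + f v * g' v x) + w\<^sup>2 * z"
    by (intro exI[of _ "f' v x * g' v x + y * g v + f v * z + w * (f' v x * z + y * g' v x) + w\<^sup>2 * y * z"])
      (simp add: algebra_simps power2_eq_square)
next
  fix a and v v' :: "nat \<Rightarrow> 'a" assume *: "\<forall>j. a dvd v j - v' j"
  have f: "a dvd f v - f v'" "a dvd f' v x - f' v' x" for x
    using assms(1) * unfolding tame_def by blast+
  have g: "a dvd g v - g v'" "a dvd g' v x - g' v' x" for x
    using assms(2) * unfolding tame_def by blast+
  have "a dvd (f v - f v') * g v + f v' * (g v - g v')"
    using f g by (intro dvd_add dvd_mult dvd_mult2)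
  then show "a dvd f v * g v - f v' * g v'" by (simp add: algebra_simps)
  fix x
  have "a dvd (f' v x - f' v' x) * g v + f' v' x * (g v - g v') + ((f v - f v') * g' v x + f v' * (g' v x - g' v' x))"
    using f g by (intro dvd_add dvd_mult dvd_mult2)
  then show "a dvd f' v x * g v + f v * g' v x - (f' v' x * g v' + f v' * g' v' x)"
    by (simp add: algebra_simps)
qed

lemma tame_sum:
  "(\<And>s. s \<in> S \<Longrightarrow> tame (f s) (f' s)) \<Longrightarrow> tame (\<lambda>v. \<Sum>s\<in>S. f s v) (\<lambda>v x. \<Sum>s\<in>S. f' s v x)"
  by (induction S rule: infinite_finite_induct) (simp_all add: tame_const tame_add)

text \<open>Newton iteration, one coefficient at a time. Surjectivity is needed only at
  \<open>x0\<close>: along the iteration \<open>\<Psi>'\<close> changes by multiples of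
  \<open>fps_X\<close>, which do not affect the coefficient being corrected.\<close>

lemma formal_solution:
  fixes \<Psi> :: "'i \<Rightarrow> (nat \<Rightarrow> complex fps) \<Rightarrow> complex fps"
  assumes tame: "\<And>i. i \<in> I \<Longrightarrow> tame (\<Psi> i) (\<Psi>' i)"
    and approx: "\<And>i. i \<in> I \<Longrightarrow> fps_nth (\<Psi> i (fvec x0)) 0 = 0"
    and onto: "\<And>\<rho>. \<exists>y. \<forall>i\<in>I. fps_nth (\<Psi>' i (fvec x0) (fvec y)) 0 = \<rho> i"
  shows "\<exists>x. (\<forall>j. fps_nth (x j) 0 = x0 j) \<and> (\<forall>i\<in>I. \<Psi> i x = 0)"
proof -
  define P where "P k f \<longleftrightarrow> (\<forall>i\<in>I. fps_X ^ (k + 1) dvd \<Psi> i f) \<and> (\<forall>j. fps_nth (f j) 0 = x0 j)"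
    for k :: nat and f
  define Q where "Q k f g \<longleftrightarrow> (\<forall>j. fps_X ^ (k + 1) dvd g j - (f j :: complex fps))" for k :: nat and f g :: "nat \<Rightarrow> complex fps"
  have "\<exists>f. \<forall>k. P k (f k) \<and> Q k (f k) (f (Suc k))"
  proof (rule dependent_nat_choice)
    show "\<exists>f. P 0 f"
      using approx by (intro exI[of _ "\<lambda>j. fps_const (x0 j)"]) (auto simp: P_def fps_X_dvd_iff)
    fix f k assume f: "P k f"
    let ?w = "fps_X ^ (k + 1) :: complex fps"
    obtain y where y: "\<And>i. i \<in> I \<Longrightarrow> fps_nth (\<Psi>' i (fvec x0) (fvec y)) 0
        = - fps_nth (\<Psi> i f) (k + 1)"
      using onto[of "\<lambda>i. - fps_nth (\<Psi> i f) (k + 1)"] by auto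
    define g where "g = (\<lambda>j. f j + ?w * fps_const (y j))"
    have "fps_X ^ (Suc k + 1) dvd \<Psi> i g" if i: "i \<in> I" for i
    proof -
      obtain z where z: "\<Psi> i g = \<Psi> i f + ?w * \<Psi>' i f (fvec y) + ?w\<^sup>2 * z"
        using tame[OF i] unfolding tame_def g_def by meson
      have "\<forall>j. fps_X dvd f j - fps_const (x0 j)"
        using f by (auto simp: P_def fps_X_dvd_iff)
      then have "fps_X dvd \<Psi>' i f (fvec y) - \<Psi>' i (fvec x0) (fvec y)"
        using tame[OF i] unfolding tame_def by meson
      then have "fps_nth (\<Psi>' i f (fvec y)) 0 = - fps_nth (\<Psi> i f) (k + 1)"
        unfolding fps_X_dvd_iff fps_sub_nth y[OF i] by (simp add: add_eq_0_iff2)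
      moreover have "fps_nth (\<Psi> i f) l = 0" if "l < k + 1" for l
        using f i that unfolding P_def fps_X_power_dvd_iff by blast
      moreover have "\<Psi> i g = \<Psi> i f + fps_X ^ (k + 1) * \<Psi>' i f (fvec y) + fps_X ^ (k + 1 + (k + 1)) * z"
        unfolding z by (simp only: power_add power2_eq_square)
      ultimately show ?thesis
        unfolding fps_X_power_dvd_iff
        by (auto simp: fps_X_power_mult_nth less_Suc_eq simp del: power_Suc)
    qed
    moreover have "fps_nth (g j) 0 = x0 j" for j
      using f by (simp add: g_def P_def)
    ultimately have "P (Suc k) g" unfolding P_def by blast
    moreover have "Q k f g" unfolding Q_def g_def by simp
    ultimately show "\<exists>g. P (Suc k) g \<and> Q k f g" by blast
  qed
  then obtain f where f: "\<And>k. P k (f k)" "\<And>k. Q k (f k) (f (Suc k))" by blast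
  obtain x where x: "\<And>k j. fps_nth (x j) k = fps_nth (f k j) k" and close: "\<And>k j. fps_X ^ (k + 1) dvd x j - f k j"
    using fps_sequence_limit[of f] f(2) unfolding Q_def by blast
  have "\<Psi> i x = 0" if i: "i \<in> I" for i
  proof -
    have "fps_nth (\<Psi> i x) k = 0" for k
    proof -
      have "fps_X ^ (k + 1) dvd \<Psi> i x - \<Psi> i (f k)"
        using tame[OF i] close unfolding tame_def by meson
      moreover have "fps_X ^ (k + 1) dvd \<Psi> i (f k)"
        using f(1) i unfolding P_def by blast
      ultimately have "fps_X ^ (k + 1) dvd \<Psi> i x"
        by (metis diff_add_cancel dvd_add)
      then show ?thesis unfolding fps_X_power_dvd_iff by auto
    qed
    then show ?thesis by (intro fps_ext) simp
  qed
  moreover have "fps_nth (x j) 0 = x0 j" for j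
    using f(1)[of 0] by (simp add: x P_def)
  ultimately show ?thesis by blast
qed

section \<open>Extending embeddings and derivations of subrings\<close>

definition subring :: "'a::comm_ring_1 set \<Rightarrow> bool" where
  "subring A \<longleftrightarrow> 0 \<in> A \<and> 1 \<in> A \<and> (\<forall>a\<in>A. \<forall>b\<in>A. a + b \<in> A \<and> a * b \<in> A \<and> - a \<in> A)"

lemma subringD:
  assumes "subring A"
  shows "0 \<in> A" "1 \<in> A" "a \<in> A \<Longrightarrow> b \<in> A \<Longrightarrow> a + b \<in> A" "a \<in> A \<Longrightarrow> b \<in> A \<Longrightarrow> a * b \<in> A"
    "a \<in> A \<Longrightarrow> - a \<in> A" "a \<in> A \<Longrightarrow> b \<in> A \<Longrightarrow> a - b \<in> A"
  using assms unfolding subring_def by (auto simp flip: add_uminus_conv_diff)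

lemma subring_sum: "subring A \<Longrightarrow> (\<And>s. s \<in> S \<Longrightarrow> f s \<in> A) \<Longrightarrow> sum f S \<in> A"
  by (induction S rule: infinite_finite_induct) (auto simp: subringD)

lemma subring_power: "subring A \<Longrightarrow> a \<in> A \<Longrightarrow> a ^ n \<in> A"
  by (induction n) (auto simp: subringD)

lemma subring_of_nat: "subring A \<Longrightarrow> of_nat n \<in> A"
  by (induction n) (auto simp: subringD)

lemma subring_ev: "subring A \<Longrightarrow> (\<And>c. c \<in> pconsts e \<Longrightarrow> h c \<in> A) \<Longrightarrow> (\<And>i. i \<in> pvars e \<Longrightarrow> v i \<in> A) \<Longrightarrow> ev h e v \<in> A"
  by (induction e) (auto simp: subringD)

definition over :: "'a::comm_ring_1 set \<Rightarrow> 'a poly set" where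
  "over A = {p. \<forall>i. poly.coeff p i \<in> A}"

lemma over_intros:
  assumes "subring A"
  shows "0 \<in> over A" "1 \<in> over A" "p \<in> over A \<Longrightarrow> q \<in> over A \<Longrightarrow> p + q \<in> over A"
    "p \<in> over A \<Longrightarrow> q \<in> over A \<Longrightarrow> p * q \<in> over A" "p \<in> over A \<Longrightarrow> - p \<in> over A"
    "p \<in> over A \<Longrightarrow> q \<in> over A \<Longrightarrow> p - q \<in> over A"
    "a \<in> A \<Longrightarrow> p \<in> over A \<Longrightarrow> pCons a p \<in> over A" "a \<in> A \<Longrightarrow> p \<in> over A \<Longrightarrow> smult a p \<in> over A"
    "a \<in> A \<Longrightarrow> monom a n \<in> over A"
  using assms by (auto simp: over_def subringD coeff_pCons coeff_mult subring_sum split: nat.splits)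

lemma subring_over: "subring A \<Longrightarrow> subring (over A)"
  by (simp add: subring_def[of "over A"] over_intros)

lemma countable_over:
  assumes "countable A"
  shows "countable (over A)"
proof -
  have "coeffs ` over A \<subseteq> lists A"
    by (auto simp: over_def coeffs_def)
  then have "countable (coeffs ` over A)"
    by (rule countable_subset) (rule countable_lists[OF assms])
  then show ?thesis
    by (rule countable_image_inj_on) (auto simp: inj_on_def coeffs_eq_iff)
qed

definition adjoin :: "'a::comm_ring_1 set \<Rightarrow> 'a \<Rightarrow> 'a set" where
  "adjoin A z = (\<lambda>p. poly p z) ` over A"

lemma subring_adjoin:
  assumes A: "subring A"
  shows "subring (adjoin A z)"
  unfolding subring_def[of "adjoin A z"] unfolding adjoin_def
proof (intro conjI ballI)
  show "0 \<in> (\<lambda>p. poly p z) ` over A" "1 \<in> (\<lambda>p. poly p z) ` over A"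
    using over_intros(1,2)[OF A] by (metis imageI poly_0, metis imageI poly_1)
  fix a b assume "a \<in> (\<lambda>p. poly p z) ` over A" "b \<in> (\<lambda>p. poly p z) ` over A"
  then obtain p q where "p \<in> over A" "q \<in> over A" "a = poly p z" "b = poly q z" by auto
  then show "a + b \<in> (\<lambda>p. poly p z) ` over A" "a * b \<in> (\<lambda>p. poly p z) ` over A" "- a \<in> (\<lambda>p. poly p z) ` over A"
    using over_intros[OF A] by (metis imageI poly_add, metis imageI poly_mult, metis imageI poly_minus)
qed

lemma adjoin_superset: "subring A \<Longrightarrow> a \<in> A \<Longrightarrow> a \<in> adjoin A z"
  unfolding adjoin_def by (rule image_eqI[of _ _ "[:a:]"]) (simp_all add: over_intros)

lemma adjoin_generator: "subring A \<Longrightarrow> z \<in> adjoin A z"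
  unfolding adjoin_def
  by (rule image_eqI[of _ _ "[:0, 1:]"]) (simp_all add: over_intros subringD)

lemma countable_adjoin: "countable A \<Longrightarrow> countable (adjoin A z)"
  by (simp add: adjoin_def countable_over)

definition adjoin_list :: "'a::comm_ring_1 set \<Rightarrow> 'a list \<Rightarrow> 'a set" where
  "adjoin_list = foldl adjoin"

lemma adjoin_list_simps [simp]:
  "adjoin_list A [] = A" "adjoin_list A (z # zs) = adjoin_list (adjoin A z) zs"
  by (simp_all add: adjoin_list_def)

lemma subring_adjoin_list: "subring A \<Longrightarrow> subring (adjoin_list A zs)"
  by (induction zs arbitrary: A) (auto simp: subring_adjoin)

lemma countable_adjoin_list: "countable A \<Longrightarrow> countable (adjoin_list A zs)"
  by (induction zs arbitrary: A) (auto simp: countable_adjoin)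

lemma adjoin_list_superset: "subring A \<Longrightarrow> a \<in> A \<Longrightarrow> a \<in> adjoin_list A zs"
  by (induction zs arbitrary: A) (auto simp: subring_adjoin adjoin_superset)

lemma adjoin_list_generators: "subring A \<Longrightarrow> z \<in> set zs \<Longrightarrow> z \<in> adjoin_list A zs"
  by (induction zs arbitrary: A) (auto simp: subring_adjoin adjoin_list_superset adjoin_generator)

text \<open>Division with remainder over a ring that is not a field; the factor \<open>c\<close> is
  a power of the leading coefficient of \<open>g\<close>.\<close>

lemma pseudo_division:
  fixes A :: "'a::idom set"
  assumes A: "subring A" and g: "g \<in> over A" "g \<noteq> 0" and f: "f \<in> over A"
  shows "\<exists>c q r. c \<in> A \<and> c \<noteq> 0 \<and> q \<in> over A \<and> r \<in> over A \<and> smult c f = q * g + r \<and>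
    (r = 0 \<or> degree r < degree g)"
  using f
proof (induction "degree f" arbitrary: f rule: less_induct)
  case less
  show ?case
  proof (cases "f = 0 \<or> degree f < degree g")
    case True
    then show ?thesis
      using less.prems over_intros(1)[OF A] subringD(2)[OF A]
      by (intro exI[of _ 1] exI[of _ 0] exI[of _ f]) auto
  next
    case False
    let ?k = "degree f - degree g"
    let ?m = "monom (lead_coeff f) ?k"
    define f' where "f' = smult (lead_coeff g) f - ?m * g"
    have lc: "lead_coeff f \<in> A" "lead_coeff g \<in> A" using g less.prems by (auto simp: over_def)
    then have f': "f' \<in> over A"
      unfolding f'_def using g less.prems by (intro over_intros A)
    have *: "c \<in> A \<Longrightarrow> c \<noteq> 0 \<Longrightarrow> q \<in> over A \<Longrightarrow> r \<in> over A \<Longrightarrow> smult c f' = q * g + r \<Longrightarrow>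
        r = 0 \<or> degree r < degree g \<Longrightarrow> ?thesis" for c q r
    proof (intro exI conjI)
      assume H: "c \<in> A" "c \<noteq> 0" "q \<in> over A" "r \<in> over A" "smult c f' = q * g + r"
      show "c * lead_coeff g \<in> A" "c * lead_coeff g \<noteq> 0" "q + smult c ?m \<in> over A" "r \<in> over A"
        using H lc g A by (auto intro!: subringD over_intros)
      show "smult (c * lead_coeff g) f = (q + smult c ?m) * g + r"
        using H(5) by (simp add: f'_def algebra_simps smult_diff_right)
    qed
    show ?thesis
    proof (cases "f' = 0")
      case True
      then show ?thesis
        using * [of 1 0 0] over_intros(1)[OF A] subringD(2)[OF A] by simp
    next
      case nz: False
      have "degree f' \<le> degree f"
        unfolding f'_def using False g(2)
        by (intro degree_diff_le) (auto intro: order.trans[OF degree_mult_le] simp: degree_monom_eq)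
      moreover have "poly.coeff f' (degree f) = 0"
        using False by (simp add: f'_def coeff_monom_mult)
      ultimately have "degree f' < degree f"
        using nz by (metis le_neq_implies_less leading_coeff_0_iff)
      from less.hyps[OF this f'] show ?thesis using * by metis
    qed
  qed
qed

section \<open>Embeddings of subrings\<close>

definition emb :: "'a::idom set \<Rightarrow> ('a \<Rightarrow> 'b::idom) \<Rightarrow> bool" where
  "emb A \<sigma> \<longleftrightarrow> subring A \<and> \<sigma> 0 = 0 \<and> \<sigma> 1 = 1 \<and>
     (\<forall>a\<in>A. \<forall>b\<in>A. \<sigma> (a + b) = \<sigma> a + \<sigma> b \<and> \<sigma> (a * b) = \<sigma> a * \<sigma> b) \<and> (\<forall>a\<in>A. \<sigma> a = 0 \<longrightarrow> a = 0)"

lemma embD: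
  assumes "emb A \<sigma>"
  shows "subring A" "\<sigma> 0 = 0" "\<sigma> 1 = 1" "a \<in> A \<Longrightarrow> b \<in> A \<Longrightarrow> \<sigma> (a + b) = \<sigma> a + \<sigma> b"
    "a \<in> A \<Longrightarrow> b \<in> A \<Longrightarrow> \<sigma> (a * b) = \<sigma> a * \<sigma> b" "a \<in> A \<Longrightarrow> \<sigma> a = 0 \<Longrightarrow> a = 0"
  using assms by (auto simp: emb_def)

lemma emb_uminus: "emb A \<sigma> \<Longrightarrow> a \<in> A \<Longrightarrow> \<sigma> (- a) = - \<sigma> a"
  using embD(1,2,4)[of A \<sigma>] subringD(5)[of A a] by (metis add.right_inverse add_eq_0_iff)

lemma emb_diff: "emb A \<sigma> \<Longrightarrow> a \<in> A \<Longrightarrow> b \<in> A \<Longrightarrow> \<sigma> (a - b) = \<sigma> a - \<sigma> b"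
  using embD(4)[of A \<sigma> a "- b"] emb_uminus[of A \<sigma> b] embD(1) subringD(5) by fastforce

lemma emb_sum:
  assumes \<sigma>: "emb A \<sigma>" and f: "\<And>s. s \<in> S \<Longrightarrow> f s \<in> A"
  shows "\<sigma> (sum f S) = (\<Sum>s\<in>S. \<sigma> (f s))"
  using f by (induction S rule: infinite_finite_induct)
    (auto simp: embD[OF \<sigma>] subring_sum[OF embD(1)[OF \<sigma>]])

lemma emb_inj:
  assumes "emb A \<sigma>" "a \<in> A" "b \<in> A" "\<sigma> a = \<sigma> b"
  shows "a = b"
proof -
  have "\<sigma> (a - b) = 0" using emb_diff[OF assms(1-3)] assms(4) by simp
  moreover have "a - b \<in> A" by (rule subringD(6)[OF embD(1)[OF assms(1)] assms(2,3)])
  ultimately show ?thesis using embD(6)[OF assms(1)] by fastforce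
qed

lemma emb_ev:
  assumes \<sigma>: "emb A \<sigma>" and "\<And>c. c \<in> pconsts e \<Longrightarrow> h c \<in> A" "\<And>c. c \<in> pconsts e \<Longrightarrow> \<sigma> (h c) = h' c"
    "\<And>i. i \<in> pvars e \<Longrightarrow> v i \<in> A"
  shows "\<sigma> (ev h e v) = ev h' e (\<lambda>i. \<sigma> (v i))"
  using assms(2-4) by (induction e) (auto simp: embD[OF \<sigma>] subring_ev[OF embD(1)[OF \<sigma>]])

lemma subring_image:
  assumes \<sigma>: "emb A \<sigma>"
  shows "subring (\<sigma> ` A)"
  unfolding subring_def[of "\<sigma> ` A"]
proof (intro conjI ballI)
  note A = embD(1)[OF \<sigma>]
  show "0 \<in> \<sigma> ` A" "1 \<in> \<sigma> ` A" using embD(2,3)[OF \<sigma>] subringD(1,2)[OF A] by (metis imageI)+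
  fix a b assume "a \<in> \<sigma> ` A" "b \<in> \<sigma> ` A"
  then obtain x y where "x \<in> A" "y \<in> A" "a = \<sigma> x" "b = \<sigma> y" by auto
  then show "a + b \<in> \<sigma> ` A" "a * b \<in> \<sigma> ` A" "- a \<in> \<sigma> ` A"
    using embD(4,5)[OF \<sigma>] emb_uminus[OF \<sigma>] subringD(3-5)[OF A] by (metis imageI)+
qed

lemma emb_inverse:
  assumes \<sigma>: "emb A \<sigma>"
  shows "emb (\<sigma> ` A) (the_inv_into A \<sigma>)" "a \<in> A \<Longrightarrow> the_inv_into A \<sigma> (\<sigma> a) = a"
proof -
  note A = embD(1)[OF \<sigma>]
  have inj: "inj_on \<sigma> A" using emb_inj[OF \<sigma>] by (auto simp: inj_on_def)
  then show inv: "the_inv_into A \<sigma> (\<sigma> a) = a" if "a \<in> A" for a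
    using that by (rule the_inv_into_f_f)
  have "the_inv_into A \<sigma> 0 = 0" "the_inv_into A \<sigma> 1 = 1"
    using inv[of 0] inv[of 1] embD(2,3)[OF \<sigma>] subringD(1,2)[OF A] by auto
  moreover have "the_inv_into A \<sigma> (\<sigma> x + \<sigma> y) = x + y" "the_inv_into A \<sigma> (\<sigma> x * \<sigma> y) = x * y"
    if "x \<in> A" "y \<in> A" for x y
    using that inv[of "x + y"] inv[of "x * y"] embD(4,5)[OF \<sigma>] subringD[OF A] by simp_all
  ultimately show "emb (\<sigma> ` A) (the_inv_into A \<sigma>)"
    using embD(2)[OF \<sigma>] by (auto simp: emb_def[of "\<sigma> ` A"] inv subring_image[OF \<sigma>])
qed

lemma map_poly_emb:
  assumes \<sigma>: "emb A \<sigma>"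
  shows "p \<in> over A \<Longrightarrow> q \<in> over A \<Longrightarrow> map_poly \<sigma> (p + q) = map_poly \<sigma> p + map_poly \<sigma> q"
    "p \<in> over A \<Longrightarrow> q \<in> over A \<Longrightarrow> map_poly \<sigma> (p * q) = map_poly \<sigma> p * map_poly \<sigma> q"
    "a \<in> A \<Longrightarrow> p \<in> over A \<Longrightarrow> map_poly \<sigma> (smult a p) = smult (\<sigma> a) (map_poly \<sigma> p)"
    "p \<in> over A \<Longrightarrow> map_poly \<sigma> p = 0 \<longleftrightarrow> p = 0"
    "p \<in> over A \<Longrightarrow> degree (map_poly \<sigma> p) = degree p"
proof -
  note A = embD(1)[OF \<sigma>] and c = coeff_map_poly[of \<sigma>, OF embD(2)[OF \<sigma>]]
  show "p \<in> over A \<Longrightarrow> q \<in> over A \<Longrightarrow> map_poly \<sigma> (p + q) = map_poly \<sigma> p + map_poly \<sigma> q"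
    by (intro poly_eqI) (auto simp: c over_def embD(4)[OF \<sigma>])
  show "p \<in> over A \<Longrightarrow> q \<in> over A \<Longrightarrow> map_poly \<sigma> (p * q) = map_poly \<sigma> p * map_poly \<sigma> q"
    by (intro poly_eqI) (auto simp: c over_def coeff_mult embD(5)[OF \<sigma>] emb_sum[OF \<sigma>] subringD(4)[OF A])
  show "a \<in> A \<Longrightarrow> p \<in> over A \<Longrightarrow> map_poly \<sigma> (smult a p) = smult (\<sigma> a) (map_poly \<sigma> p)"
    by (intro poly_eqI) (auto simp: c over_def embD(5)[OF \<sigma>])
  have z: "\<sigma> (poly.coeff p i) = 0 \<longleftrightarrow> poly.coeff p i = 0" if "p \<in> over A" for p i
    using that embD(2,6)[OF \<sigma>] by (auto simp: over_def)
  show "p \<in> over A \<Longrightarrow> map_poly \<sigma> p = 0 \<longleftrightarrow> p = 0"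
    using z by (auto simp: poly_eq_iff c)
  show "p \<in> over A \<Longrightarrow> degree (map_poly \<sigma> p) = degree p"
  proof (cases "p = 0")
    case False
    assume "p \<in> over A"
    then have "degree p \<le> degree (map_poly \<sigma> p)"
      using z False by (intro le_degree) (auto simp: c)
    moreover have "degree (map_poly \<sigma> p) \<le> degree p"
      by (intro degree_le) (auto simp: c coeff_eq_0 embD(2)[OF \<sigma>])
    ultimately show ?thesis by simp
  qed simp
qed

text \<open>Having the same relations makes the substitution of \<open>\<zeta>\<close> for
  \<open>z\<close> both well defined and injective.\<close>

definition matches :: "'a::idom set \<Rightarrow> ('a \<Rightarrow> 'b::idom) \<Rightarrow> 'a \<Rightarrow> 'b \<Rightarrow> bool" where
  "matches A \<sigma> z \<zeta> \<longleftrightarrow> (\<forall>p\<in>over A. poly p z = 0 \<longleftrightarrow> poly (map_poly \<sigma> p) \<zeta> = 0)"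

lemma emb_extend:
  assumes \<sigma>: "emb A \<sigma>" and m: "matches A \<sigma> z \<zeta>"
  shows "\<exists>\<sigma>'. emb (adjoin A z) \<sigma>' \<and> (\<forall>a\<in>A. \<sigma>' a = \<sigma> a) \<and> \<sigma>' z = \<zeta>"
proof -
  note A = embD(1)[OF \<sigma>]
  define \<sigma>' where "\<sigma>' x = poly (map_poly \<sigma> (SOME p. p \<in> over A \<and> poly p z = x)) \<zeta>" for x
  have eq: "\<sigma>' (poly p z) = poly (map_poly \<sigma> p) \<zeta>" if p: "p \<in> over A" for p
  proof -
    define q where "q = (SOME q. q \<in> over A \<and> poly q z = poly p z)"
    have q: "q \<in> over A \<and> poly q z = poly p z"
      unfolding q_def by (rule someI[of _ p]) (use p in auto)
    have m1: "- 1 \<in> A" using subringD[OF A] by blast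
    let ?d = "q + smult (- 1) p"
    have "?d \<in> over A" using p q A m1 by (intro over_intros) auto
    moreover have "poly ?d z = 0" using q by simp
    ultimately have "poly (map_poly \<sigma> ?d) \<zeta> = 0" using m by (simp only: matches_def)
    moreover have "map_poly \<sigma> ?d = map_poly \<sigma> q + smult (\<sigma> (- 1)) (map_poly \<sigma> p)"
      using p q A m1 by (simp add: map_poly_emb[OF \<sigma>] over_intros[OF A] del: smult_minus_left)
    moreover have "\<sigma> (- 1) = - 1"
      using emb_uminus[OF \<sigma>, of 1] embD(3)[OF \<sigma>] subringD(2)[OF A] by simp
    ultimately show ?thesis by (simp add: \<sigma>'_def q_def)
  qed
  have "emb (adjoin A z) \<sigma>'"
    unfolding emb_def
  proof (intro conjI ballI impI)
    show "subring (adjoin A z)" by (rule subring_adjoin[OF A])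
    show "\<sigma>' 0 = 0" using eq[OF over_intros(1)[OF A]] by simp
    show "\<sigma>' 1 = 1"
      using eq[OF over_intros(2)[OF A]] embD(2,3)[OF \<sigma>] by (simp add: map_poly_1)
    fix a assume "a \<in> adjoin A z"
    then obtain p where p: "p \<in> over A" "a = poly p z" by (auto simp: adjoin_def)
    show "a = 0" if "\<sigma>' a = 0" using that p m by (simp add: eq matches_def)
    fix b assume "b \<in> adjoin A z"
    then obtain q where q: "q \<in> over A" "b = poly q z" by (auto simp: adjoin_def)
    show "\<sigma>' (a + b) = \<sigma>' a + \<sigma>' b"
      using eq[of "p + q"] p q by (simp add: eq over_intros[OF A] map_poly_emb[OF \<sigma>])
    show "\<sigma>' (a * b) = \<sigma>' a * \<sigma>' b"
      using eq[of "p * q"] p q by (simp add: eq over_intros[OF A] map_poly_emb[OF \<sigma>])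
  qed
  moreover have "\<sigma>' a = \<sigma> a" if "a \<in> A" for a
    using eq[of "[:a:]"] that embD(2)[OF \<sigma>] over_intros[OF A] by (simp add: map_poly_pCons)
  moreover have "\<sigma>' z = \<zeta>"
    using eq[of "[:0, 1:]"] embD(2,3)[OF \<sigma>] over_intros[OF A] subringD[OF A] by (simp add: map_poly_pCons)
  ultimately show ?thesis by blast
qed

definition transc :: "'a::idom set \<Rightarrow> 'a \<Rightarrow> bool" where
  "transc A z \<longleftrightarrow> (\<forall>p\<in>over A. poly p z = 0 \<longrightarrow> p = 0)"

lemma map_poly_over_image:
  assumes \<sigma>: "emb A \<sigma>"
  shows "p \<in> over A \<Longrightarrow> map_poly \<sigma> p \<in> over (\<sigma> ` A)"
  by (auto simp: over_def coeff_map_poly[of \<sigma>, OF embD(2)[OF \<sigma>]])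

lemma matches_transc:
  "emb A \<sigma> \<Longrightarrow> transc A z \<Longrightarrow> transc (\<sigma> ` A) \<zeta> \<Longrightarrow> matches A \<sigma> z \<zeta>"
  unfolding matches_def transc_def using map_poly_emb(4) map_poly_over_image by (metis poly_0)

text \<open>A relation \<open>g\<close> of least degree at the root \<open>\<zeta>\<close> divides
  \<open>p\<close> up to a constant. If \<open>z\<close> were not a root of \<open>g\<close>, the
  cofactor would be a relation of \<open>z\<close> of smaller degree than \<open>p\<close>. So
  \<open>g\<close> vanishes at \<open>z\<close>, and the relations of \<open>z\<close> and of
  \<open>\<zeta>\<close> are the multiples of \<open>p\<close> and of \<open>g\<close>, up to
  constants, on both sides.\<close>

lemma matches_algebraic:
  assumes \<sigma>: "emb A \<sigma>" and p: "p \<in> over A" "p \<noteq> 0" "poly p z = 0"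
    and min: "\<And>g. g \<in> over A \<Longrightarrow> g \<noteq> 0 \<Longrightarrow> poly g z = 0 \<Longrightarrow> degree p \<le> degree g"
    and root: "poly (map_poly \<sigma> p) \<zeta> = 0"
  shows "matches A \<sigma> z \<zeta>"
proof -
  note A = embD(1)[OF \<sigma>]
  define R where "R g \<longleftrightarrow> g \<in> over A \<and> g \<noteq> 0 \<and> poly (map_poly \<sigma> g) \<zeta> = 0" for g
  have "R p" using p root by (simp add: R_def)
  define g where "g = arg_min degree R"
  have g: "R g" and gmin: "\<And>f. R f \<Longrightarrow> degree g \<le> degree f"
    using arg_min_nat_lemma[of R p degree] \<open>R p\<close> unfolding g_def by blast+
  have nz: "\<sigma> c \<noteq> 0" if "c \<in> A" "c \<noteq> 0" for c using that embD(6)[OF \<sigma>] by blast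
  have gdeg: "0 < degree g"
  proof (rule ccontr)
    assume "\<not> 0 < degree g"
    then obtain c where c: "g = [:c:]" by (metis degree_eq_zeroE gr0I)
    then have "c \<in> A" "c \<noteq> 0" using g by (auto simp: R_def over_def coeff_pCons split: nat.splits)
    then show False using g nz[of c] embD(2)[OF \<sigma>] unfolding c R_def by (simp add: map_poly_pCons)
  qed
  have divides: "\<exists>c q. c \<in> A \<and> c \<noteq> 0 \<and> q \<in> over A \<and> smult c f = q * g"
    if f: "f \<in> over A" "poly (map_poly \<sigma> f) \<zeta> = 0" for f
  proof -
    obtain c q r where *: "c \<in> A" "c \<noteq> 0" "q \<in> over A" "r \<in> over A" "smult c f = q * g + r"
      "r = 0 \<or> degree r < degree g"
      using pseudo_division[OF A, of g f] g f by (auto simp: R_def)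
    have "smult (\<sigma> c) (map_poly \<sigma> f) = map_poly \<sigma> q * map_poly \<sigma> g + map_poly \<sigma> r"
    proof -
      have "smult (\<sigma> c) (map_poly \<sigma> f) = map_poly \<sigma> (q * g + r)"
        unfolding *(5)[symmetric] using *(1) f(1) by (simp only: map_poly_emb(3)[OF \<sigma>])
      also have "\<dots> = map_poly \<sigma> q * map_poly \<sigma> g + map_poly \<sigma> r"
        using *(3,4) g by (simp add: map_poly_emb[OF \<sigma>] over_intros[OF A] R_def)
      finally show ?thesis .
    qed
    from arg_cong[OF this, of "\<lambda>p. poly p \<zeta>"] have "poly (map_poly \<sigma> r) \<zeta> = 0"
      using f(2) g by (simp add: R_def)
    then have "r = 0 \<or> degree g \<le> degree r" using gmin[of r] *(4) unfolding R_def by blast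
    then have "r = 0" using *(6) by auto
    then show ?thesis using * by auto
  qed
  have g0: "poly g z = 0"
  proof (rule ccontr)
    assume ne: "poly g z \<noteq> 0"
    obtain c q where *: "c \<in> A" "c \<noteq> 0" "q \<in> over A" "smult c p = q * g"
      using divides[OF p(1) root] by auto
    have "poly q z = 0"
      using arg_cong[OF *(4), of "\<lambda>p. poly p z"] p ne by simp
    moreover have "q \<noteq> 0" using * p by auto
    ultimately have "degree p \<le> degree q" using min * by blast
    moreover have "degree p = degree q + degree g"
    proof -
      have "degree p = degree (smult c p)" using *(2) by simp
      also have "\<dots> = degree q + degree g"
        unfolding *(4) using \<open>q \<noteq> 0\<close> g by (simp add: degree_mult_eq R_def)
      finally show ?thesis .
    qed
    ultimately show False using gdeg by simp
  qed
  show ?thesis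
    unfolding matches_def
  proof (intro ballI iffI)
    fix f assume f: "f \<in> over A"
    {
      assume "poly (map_poly \<sigma> f) \<zeta> = 0"
      then obtain c q where "c \<noteq> 0" "smult c f = q * g" using divides[OF f] by auto
      from arg_cong[OF this(2), of "\<lambda>p. poly p z"] this(1) show "poly f z = 0"
        using g0 by simp
    }
    assume f0: "poly f z = 0"
    obtain c q r where *: "c \<in> A" "c \<noteq> 0" "q \<in> over A" "r \<in> over A" "smult c f = q * p + r"
      "r = 0 \<or> degree r < degree p"
      using pseudo_division[OF A p(1,2) f] by auto
    have "poly r z = 0"
      using arg_cong[OF *(5), of "\<lambda>p. poly p z"] f0 p(3) by simp
    then have "r = 0" using min[of r] * by force
    then have "smult (\<sigma> c) (map_poly \<sigma> f) = map_poly \<sigma> q * map_poly \<sigma> p"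
    proof -
      assume "r = 0"
      have "smult (\<sigma> c) (map_poly \<sigma> f) = map_poly \<sigma> (q * p + r)"
        unfolding *(5)[symmetric] using *(1) f by (simp only: map_poly_emb(3)[OF \<sigma>])
      also have "\<dots> = map_poly \<sigma> q * map_poly \<sigma> p"
        using *(3) p(1) \<open>r = 0\<close> by (simp add: map_poly_emb[OF \<sigma>] over_intros[OF A])
      finally show ?thesis .
    qed
    from arg_cong[OF this, of "\<lambda>p. poly p \<zeta>"] have "\<sigma> c * poly (map_poly \<sigma> f) \<zeta> = 0"
      using root by simp
    then show "poly (map_poly \<sigma> f) \<zeta> = 0" using nz * by simp
  qed
qed

lemma minimal_relation:
  assumes "\<not> transc A z"
  obtains p where "p \<in> over A" "p \<noteq> 0" "poly p z = 0"
    "\<And>g. g \<in> over A \<Longrightarrow> g \<noteq> 0 \<Longrightarrow> poly g z = 0 \<Longrightarrow> degree p \<le> degree g"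
proof -
  define R where "R g \<longleftrightarrow> g \<in> over A \<and> g \<noteq> 0 \<and> poly g z = 0" for g
  obtain p0 where "R p0" using assms by (auto simp: transc_def R_def)
  have "R (arg_min degree R)" "\<And>f. R f \<Longrightarrow> degree (arg_min degree R) \<le> degree f"
    using arg_min_nat_lemma[of R p0 degree] \<open>R p0\<close> by blast+
  then show ?thesis using that unfolding R_def by blast
qed

lemma degree_pos_if_root:
  fixes p :: "'a::idom poly"
  assumes "poly p z = 0" "p \<noteq> 0"
  shows "0 < degree p"
proof (rule ccontr)
  assume "\<not> 0 < degree p"
  then obtain c where "p = [:c:]" by (metis degree_eq_zeroE gr0I)
  then show False using assms by simp
qed

lemma exists_transc:
  fixes A :: "'a::idom set"
  assumes "countable A" "uncountable S"
  shows "\<exists>z\<in>S. transc A z"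
proof (rule ccontr)
  assume "\<not> (\<exists>z\<in>S. transc A z)"
  then have "S \<subseteq> (\<Union>p\<in>over A - {0}. {z. poly p z = 0})"
    by (auto simp: transc_def)
  moreover have "countable (\<Union>p\<in>over A - {0}. {z. poly p z = 0})"
    using countable_over[OF assms(1)] by (intro countable_UN) (auto intro: countable_finite poly_roots_finite)
  ultimately show False using assms(2) countable_subset by blast
qed

text \<open>If \<open>z\<close> is transcendental, countability of \<open>A\<close> leaves a number
  transcendental over the image; otherwise the transformed minimal relation has a complex root. The
  source may be any domain, in particular Laurent series.\<close>

lemma emb_extend_complex:
  fixes \<sigma> :: "'a::idom \<Rightarrow> complex"
  assumes \<sigma>: "emb A \<sigma>" and "countable A"
  shows "\<exists>\<sigma>'. emb (adjoin A z) \<sigma>' \<and> (\<forall>a\<in>A. \<sigma>' a = \<sigma> a)"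
proof -
  have "\<exists>\<zeta>. matches A \<sigma> z \<zeta>"
  proof (cases "transc A z")
    case True
    have "countable (\<sigma> ` A)" using assms(2) by simp
    then show ?thesis
      using exists_transc[of "\<sigma> ` A" UNIV] matches_transc[OF \<sigma> True] uncountable_UNIV_complex by blast
  next
    case False
    obtain p where p: "p \<in> over A" "p \<noteq> 0" "poly p z = 0"
      "\<And>g. g \<in> over A \<Longrightarrow> g \<noteq> 0 \<Longrightarrow> poly g z = 0 \<Longrightarrow> degree p \<le> degree g"
      by (rule minimal_relation[OF False]) blast
    then have "0 < degree (map_poly \<sigma> p)"
      using degree_pos_if_root map_poly_emb(5)[OF \<sigma>] by metis
    then obtain \<zeta> where "poly (map_poly \<sigma> p) \<zeta> = 0"
      using alg_closed_imp_poly_has_root by blast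
    then show ?thesis using matches_algebraic[OF \<sigma> p] by blast
  qed
  then show ?thesis using emb_extend[OF \<sigma>] by blast
qed

lemma emb_extend_complex_list:
  fixes \<sigma> :: "'a::idom \<Rightarrow> complex"
  assumes "emb A \<sigma>" "countable A"
  shows "\<exists>\<sigma>'. emb (adjoin_list A zs) \<sigma>' \<and> (\<forall>a\<in>A. \<sigma>' a = \<sigma> a)"
  using assms
proof (induction zs arbitrary: A \<sigma>)
  case (Cons z zs)
  obtain \<sigma>1 where \<sigma>1: "emb (adjoin A z) \<sigma>1" "\<forall>a\<in>A. \<sigma>1 a = \<sigma> a"
    using emb_extend_complex[OF Cons.prems] by blast
  obtain \<sigma>2 where "emb (adjoin_list (adjoin A z) zs) \<sigma>2" "\<forall>a\<in>adjoin A z. \<sigma>2 a = \<sigma>1 a"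
    using Cons.IH[OF \<sigma>1(1) countable_adjoin[OF Cons.prems(2)]] by blast
  then show ?case using \<sigma>1 adjoin_superset[OF embD(1)[OF Cons.prems(1)]] by auto
qed auto

section \<open>Derivations of subrings\<close>

definition derivation :: "'a::field set \<Rightarrow> ('a \<Rightarrow> 'a) \<Rightarrow> bool" where
  "derivation A D \<longleftrightarrow> subring A \<and>
     (\<forall>a\<in>A. \<forall>b\<in>A. D (a + b) = D a + D b \<and> D (a * b) = D a * b + a * D b)"

lemma derivationD:
  assumes "derivation A D"
  shows "subring A" "a \<in> A \<Longrightarrow> b \<in> A \<Longrightarrow> D (a + b) = D a + D b"
    "a \<in> A \<Longrightarrow> b \<in> A \<Longrightarrow> D (a * b) = D a * b + a * D b" "D 0 = 0" "D 1 = 0"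
proof -
  show A: "subring A" and "a \<in> A \<Longrightarrow> b \<in> A \<Longrightarrow> D (a + b) = D a + D b"
    "a \<in> A \<Longrightarrow> b \<in> A \<Longrightarrow> D (a * b) = D a * b + a * D b"
    using assms by (auto simp: derivation_def)
  have "D (0 + 0) = D 0 + D 0" "D (1 * 1) = D 1 * 1 + 1 * D 1"
    using assms subringD(1,2)[OF A] unfolding derivation_def by blast+
  then show "D 0 = 0" "D 1 = 0"
    unfolding add_0_right mult_1_left mult_1_right by (metis add_cancel_right_right)+
qed

lemma derivation_zero: "subring A \<Longrightarrow> derivation A (\<lambda>a. 0)"
  by (simp add: derivation_def)

lemma derivation_subset: "derivation B D \<Longrightarrow> subring A \<Longrightarrow> A \<subseteq> B \<Longrightarrow> derivation A D"
  by (auto simp: derivation_def)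

lemma derivation_uminus: "derivation A D \<Longrightarrow> a \<in> A \<Longrightarrow> D (- a) = - D a"
  using derivationD(1,2,4)[of A D] subringD(5)[of A a] by (metis add.right_inverse add_eq_0_iff)

lemma derivation_sum:
  assumes D: "derivation A D" and f: "\<And>s. s \<in> S \<Longrightarrow> f s \<in> A"
  shows "D (sum f S) = (\<Sum>s\<in>S. D (f s))"
  using f by (induction S rule: infinite_finite_induct)
    (auto simp: derivationD[OF D] subring_sum[OF derivationD(1)[OF D]])

lemma derivation_ev:
  fixes h :: "complex \<Rightarrow> 'a::field"
  assumes D: "derivation A D" and h: "ring_map h"
    and "\<And>c. c \<in> pconsts e \<Longrightarrow> h c \<in> A" "\<And>c. c \<in> pconsts e \<Longrightarrow> D (h c) = 0"
    and "pvars e \<subseteq> {..<N}" "\<And>i. i < N \<Longrightarrow> v i \<in> A"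
  shows "D (ev h e v) = dev N h e v (\<lambda>i. D (v i))"
  using assms(3-5)
proof (induction e)
  case (PAdd e f)
  then show ?case
    using subring_ev[OF derivationD(1)[OF D], of e h v] subring_ev[OF derivationD(1)[OF D], of f h v] assms(6)
    by (simp add: dev_simps[OF h] derivationD[OF D] subset_iff)
next
  case (PMul e f)
  then show ?case
    using subring_ev[OF derivationD(1)[OF D], of e h v] subring_ev[OF derivationD(1)[OF D], of f h v] assms(6)
    by (simp add: dev_simps[OF h] derivationD[OF D] subset_iff)
qed (auto simp: dev_simps[OF h])

lemma map_poly_derivation:
  assumes D: "derivation A D"
  shows "p \<in> over A \<Longrightarrow> q \<in> over A \<Longrightarrow> map_poly D (p + q) = map_poly D p + map_poly D q"
    "p \<in> over A \<Longrightarrow> q \<in> over A \<Longrightarrow> map_poly D (p * q) = map_poly D p * q + p * map_poly D q"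
proof -
  note A = derivationD(1)[OF D] and c = coeff_map_poly[of D, OF derivationD(4)[OF D]]
  show "p \<in> over A \<Longrightarrow> q \<in> over A \<Longrightarrow> map_poly D (p + q) = map_poly D p + map_poly D q"
    by (intro poly_eqI) (auto simp: c over_def derivationD(2)[OF D])
  show "p \<in> over A \<Longrightarrow> q \<in> over A \<Longrightarrow> map_poly D (p * q) = map_poly D p * q + p * map_poly D q"
    by (intro poly_eqI)
      (auto simp: c over_def coeff_mult derivationD(3)[OF D] derivation_sum[OF D] subringD(4)[OF A] sum.distrib)
qed

text \<open>The value at \<open>poly p z\<close> forced on any derivation that extends
  \<open>D\<close> and sends \<open>z\<close> to \<open>w\<close>.\<close>

definition poly_derivation :: "('a::field \<Rightarrow> 'a) \<Rightarrow> 'a \<Rightarrow> 'a \<Rightarrow> 'a poly \<Rightarrow> 'a" where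
  "poly_derivation D z w p = poly (map_poly D p) z + poly (pderiv p) z * w"

lemma poly_derivation_add:
  "derivation A D \<Longrightarrow> p \<in> over A \<Longrightarrow> q \<in> over A \<Longrightarrow>
    poly_derivation D z w (p + q) = poly_derivation D z w p + poly_derivation D z w q"
  by (simp add: poly_derivation_def map_poly_derivation pderiv_add algebra_simps)

lemma poly_derivation_mult:
  "derivation A D \<Longrightarrow> p \<in> over A \<Longrightarrow> q \<in> over A \<Longrightarrow>
    poly_derivation D z w (p * q) = poly_derivation D z w p * poly q z + poly p z * poly_derivation D z w q"
  by (simp add: poly_derivation_def map_poly_derivation pderiv_mult algebra_simps)

lemma poly_derivation_pCons:
  "derivation A D \<Longrightarrow> poly_derivation D z w [:a:] = D a"
  by (simp add: poly_derivation_def derivationD(4) map_poly_pCons pderiv_pCons)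

lemma derivation_extend:
  assumes D: "derivation A D" and rel: "\<And>p. p \<in> over A \<Longrightarrow> poly p z = 0 \<Longrightarrow> poly_derivation D z w p = 0"
  shows "\<exists>D'. derivation (adjoin A z) D' \<and> (\<forall>a\<in>A. D' a = D a) \<and> D' z = w"
proof -
  note A = derivationD(1)[OF D]
  define D' where "D' x = poly_derivation D z w (SOME p. p \<in> over A \<and> poly p z = x)" for x
  have eq: "D' (poly p z) = poly_derivation D z w p" if p: "p \<in> over A" for p
  proof -
    define q where "q = (SOME q. q \<in> over A \<and> poly q z = poly p z)"
    have q: "q \<in> over A \<and> poly q z = poly p z"
      unfolding q_def by (rule someI[of _ p]) (use p in auto)
    have "q - p \<in> over A" "poly (q - p) z = 0"
      using p q by (auto intro: over_intros A)
    then have "poly_derivation D z w (q - p) = 0" by (rule rel)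
    then have "poly_derivation D z w q = poly_derivation D z w p"
      using poly_derivation_add[OF D \<open>q - p \<in> over A\<close> p, of z w] by simp
    then show ?thesis by (simp add: D'_def q_def)
  qed
  have "derivation (adjoin A z) D'"
    unfolding derivation_def
  proof (intro conjI ballI)
    show "subring (adjoin A z)" by (rule subring_adjoin[OF A])
    fix a b assume "a \<in> adjoin A z" "b \<in> adjoin A z"
    then obtain p q where p: "p \<in> over A" "a = poly p z" and q: "q \<in> over A" "b = poly q z"
      by (auto simp: adjoin_def)
    show "D' (a + b) = D' a + D' b"
      using eq[of "p + q"] p q by (simp add: eq over_intros[OF A] poly_derivation_add[OF D])
    show "D' (a * b) = D' a * b + a * D' b"
      using eq[of "p * q"] p q by (simp add: eq over_intros[OF A] poly_derivation_mult[OF D])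
  qed
  moreover have "D' a = D a" if "a \<in> A" for a
    using eq[of "[:a:]"] that over_intros[OF A] by (simp add: poly_derivation_pCons[OF D])
  moreover have "D' z = w"
    using eq[of "[:0, 1:]"] derivationD(4,5)[OF D] over_intros[OF A] subringD[OF A]
    by (simp add: poly_derivation_def map_poly_pCons pderiv_pCons)
  ultimately show ?thesis by blast
qed

lemma derivation_extend_transc:
  assumes "derivation A D" "transc A z"
  shows "\<exists>D'. derivation (adjoin A z) D' \<and> (\<forall>a\<in>A. D' a = D a) \<and> D' z = w"
  using assms by (intro derivation_extend) (auto simp: transc_def poly_derivation_def)

lemma over_pderiv: "subring A \<Longrightarrow> p \<in> over A \<Longrightarrow> pderiv p \<in> over A"
  unfolding over_def coeff_pderiv mem_Collect_eq by (metis subringD(4) subring_of_nat)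

text \<open>For algebraic \<open>z\<close> the derivative of a minimal relation \<open>p\<close>
  does not vanish at \<open>z\<close> in characteristic 0, so \<open>p\<close> determines
  \<open>w\<close>. Every other relation is a multiple of \<open>p\<close> up to a constant and
  imposes nothing new.\<close>

lemma derivation_extend_any:
  fixes A :: "'a::field_char_0 set"
  assumes D: "derivation A D"
  shows "\<exists>D'. derivation (adjoin A z) D' \<and> (\<forall>a\<in>A. D' a = D a)"
proof (cases "transc A z")
  case True
  then show ?thesis using derivation_extend_transc[OF D] by blast
next
  case False
  note A = derivationD(1)[OF D]
  obtain p where p: "p \<in> over A" "p \<noteq> 0" "poly p z = 0"
    "\<And>g. g \<in> over A \<Longrightarrow> g \<noteq> 0 \<Longrightarrow> poly g z = 0 \<Longrightarrow> degree p \<le> degree g"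
    by (rule minimal_relation[OF False]) blast
  have "poly (pderiv p) z \<noteq> 0"
  proof
    assume "poly (pderiv p) z = 0"
    moreover have "pderiv p \<noteq> 0"
      using degree_pos_if_root[OF p(3,2)] by (simp add: pderiv_eq_0_iff)
    ultimately have "degree p \<le> degree (pderiv p)"
      using p(1) over_pderiv[OF A] by (intro p(4)) auto
    then show False
      using degree_pos_if_root[OF p(3,2)] by (simp add: degree_pderiv)
  qed
  then obtain w where w: "poly_derivation D z w p = 0"
    unfolding poly_derivation_def
    by (metis (no_types, opaque_lifting) add.right_inverse nonzero_eq_divide_eq mult.commute)
  have "poly_derivation D z w f = 0" if f: "f \<in> over A" "poly f z = 0" for f
  proof -
    obtain c q r where *: "c \<in> A" "c \<noteq> 0" "q \<in> over A" "r \<in> over A" "smult c f = q * p + r"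
      "r = 0 \<or> degree r < degree p"
      using pseudo_division[OF A p(1,2) f(1)] by auto
    have "poly r z = 0"
      using arg_cong[OF *(5), of "\<lambda>p. poly p z"] f p(3) by simp
    then have "r = 0" using p(4)[of r] * by force
    then have "[:c:] * f = q * p" using *(5) by simp
    then have "poly_derivation D z w ([:c:] * f) = poly_derivation D z w (q * p)" by simp
    moreover have "poly_derivation D z w (q * p) = 0"
      using poly_derivation_mult[OF D *(3) p(1)] p(3) w by simp
    moreover have "poly_derivation D z w ([:c:] * f) = c * poly_derivation D z w f"
      using poly_derivation_mult[OF D _ f(1), of "[:c:]"] f *(1) over_intros[OF A] by simp
    ultimately show ?thesis using *(2) by simp
  qed
  then show ?thesis using derivation_extend[OF D, of z w] by blast
qed

lemma derivation_extend_list: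
  fixes A :: "'a::field_char_0 set"
  assumes "derivation A D"
  shows "\<exists>D'. derivation (adjoin_list A zs) D' \<and> (\<forall>a\<in>A. D' a = D a)"
  using assms
proof (induction zs arbitrary: A D)
  case (Cons z zs)
  obtain D1 where D1: "derivation (adjoin A z) D1" "\<forall>a\<in>A. D1 a = D a"
    using derivation_extend_any[OF Cons.prems] by blast
  obtain D2 where "derivation (adjoin_list (adjoin A z) zs) D2" "\<forall>a\<in>adjoin A z. D2 a = D1 a"
    using Cons.IH[OF D1(1)] by blast
  then show ?case using D1 adjoin_superset[OF derivationD(1)[OF Cons.prems]] by auto
qed auto

text \<open>Algebraic independence, in the successive form needed to prescribe a derivation on one
  element after the other.\<close>

primrec transc_list :: "'a::idom set \<Rightarrow> 'a list \<Rightarrow> bool" where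
  "transc_list A [] \<longleftrightarrow> True"
| "transc_list A (z # zs) \<longleftrightarrow> transc A z \<and> transc_list (adjoin A z) zs"

lemma derivation_extend_transc_list:
  fixes A :: "'a::field_char_0 set"
  assumes "derivation A D" "transc_list A zs" "length ws = length zs"
  shows "\<exists>D'. derivation (adjoin_list A zs) D' \<and> (\<forall>a\<in>A. D' a = D a) \<and> map D' zs = ws"
  using assms
proof (induction zs arbitrary: A D ws)
  case (Cons z zs)
  then obtain w ws' where ws: "ws = w # ws'" by (cases ws) auto
  obtain D1 where D1: "derivation (adjoin A z) D1" "\<forall>a\<in>A. D1 a = D a" "D1 z = w"
    using derivation_extend_transc[OF Cons.prems(1), of z w] Cons.prems(2) by auto
  obtain D2 where "derivation (adjoin_list (adjoin A z) zs) D2" "\<forall>a\<in>adjoin A z. D2 a = D1 a" "map D2 zs = ws'"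
    using Cons.IH[OF D1(1)] Cons.prems(2,3) ws by auto
  then show ?case
    using D1 ws adjoin_superset[OF derivationD(1)[OF Cons.prems(1)]] adjoin_generator[OF derivationD(1)[OF Cons.prems(1)]]
    by auto
qed auto

lemma subring_poly:
  assumes "subring B" "z \<in> B"
  shows "p \<in> over B \<Longrightarrow> poly p z \<in> B"
  unfolding poly_altdef over_def using assms
  by (intro subring_sum subringD(4) subring_power) auto

lemma emb_poly:
  assumes \<sigma>: "emb B \<sigma>" and z: "z \<in> B"
  shows "p \<in> over B \<Longrightarrow> \<sigma> (poly p z) = poly (map_poly \<sigma> p) (\<sigma> z)"
proof (induction p)
  case (pCons a p)
  then have ap: "a \<in> B" "p \<in> over B"
    by (auto simp: over_def coeff_pCons split: nat.splits)
  note B = embD(1)[OF \<sigma>]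
  have "poly p z \<in> B" by (rule subring_poly[OF B z ap(2)])
  then show ?case
    using pCons.IH ap z subringD(4)[OF B] by (simp add: map_poly_pCons embD[OF \<sigma>])
qed (simp add: embD(2)[OF \<sigma>])

lemma transc_emb:
  assumes \<sigma>: "emb B \<sigma>" and "A \<subseteq> B" "z \<in> B" "transc A z"
  shows "transc (\<sigma> ` A) (\<sigma> z)"
  unfolding transc_def
proof (intro ballI impI)
  fix q assume q: "q \<in> over (\<sigma> ` A)" "poly q (\<sigma> z) = 0"
  define \<tau> where "\<tau> = the_inv_into B \<sigma>"
  have \<tau>0: "\<tau> 0 = 0" and \<tau>: "\<And>a. a \<in> B \<Longrightarrow> \<tau> (\<sigma> a) = a"
    using emb_inverse[OF \<sigma>] embD(2)[OF emb_inverse(1)[OF \<sigma>]] by (auto simp: \<tau>_def)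
  define p where "p = map_poly \<tau> q"
  have cp: "\<exists>a\<in>A. poly.coeff q i = \<sigma> a \<and> poly.coeff p i = a" for i
  proof -
    obtain a where "a \<in> A" "poly.coeff q i = \<sigma> a" using q(1) unfolding over_def by blast
    moreover from this have "poly.coeff p i = a"
      using \<tau>[of a] assms(2) by (auto simp: p_def coeff_map_poly[of \<tau>, OF \<tau>0])
    ultimately show ?thesis by blast
  qed
  then have p: "p \<in> over A" unfolding over_def mem_Collect_eq by metis
  have qp: "q = map_poly \<sigma> p"
    unfolding poly_eq_iff coeff_map_poly[of \<sigma>, OF embD(2)[OF \<sigma>]] using cp by metis
  have B: "p \<in> over B" using p assms(2) by (auto simp: over_def)
  have "\<sigma> (poly p z) = 0" using emb_poly[OF \<sigma> assms(3) B] q(2) qp by simp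
  then have "poly p z = 0"
    using embD(6)[OF \<sigma>] subring_poly[OF embD(1)[OF \<sigma>] assms(3) B] by blast
  then have "p = 0" using assms(4) p unfolding transc_def by blast
  then show "q = 0" by (simp add: qp)
qed

section \<open>Roots of polynomials over Laurent series\<close>

lemma bezout_no_common_root:
  fixes g h :: "complex poly"
  assumes cop: "\<And>z. poly g z = 0 \<Longrightarrow> poly h z \<noteq> 0"
  shows "\<exists>r s. r * g + s * h = 1"
proof -
  define R where "R p \<longleftrightarrow> p \<noteq> 0 \<and> (\<exists>r s. p = r * g + s * h)" for p
  have "g \<noteq> 0 \<or> h \<noteq> 0" using cop[of 0] by auto
  moreover have "R g" if "g \<noteq> 0" unfolding R_def
    by (intro conjI that exI[of _ "1::complex poly"] exI[of _ "0::complex poly"]) simp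
  moreover have "R h" if "h \<noteq> 0" unfolding R_def
    by (intro conjI that exI[of _ "0::complex poly"] exI[of _ "1::complex poly"]) simp
  ultimately obtain p0 where "R p0" by blast
  then obtain p where p: "R p" "\<And>q. R q \<Longrightarrow> degree p \<le> degree q"
    using arg_min_nat_lemma[of R p0 degree] by blast
  obtain r s where rs: "p = r * g + s * h" and p0: "p \<noteq> 0" using p(1) by (auto simp: R_def)
  have dvd: "p dvd f" if f: "f = t * g + w * h" for f t w
  proof (rule ccontr)
    assume "\<not> p dvd f"
    then have m: "f mod p \<noteq> 0" by (simp add: dvd_eq_mod_eq_0)
    have "f mod p = f - f div p * p" by (simp add: minus_div_mult_eq_mod)
    also have "\<dots> = (t - f div p * r) * g + (w - f div p * s) * h"
      using f rs by (simp add: algebra_simps)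
    finally have "R (f mod p)" unfolding R_def using m by blast
    then show False using p(2)[of "f mod p"] degree_mod_less[OF p0, of f] m by linarith
  qed
  have g: "p dvd g" by (rule dvd[of _ 1 0]) simp
  have h: "p dvd h" by (rule dvd[of _ 0 1]) simp
  have "degree p = 0"
  proof (rule ccontr)
    assume "degree p \<noteq> 0"
    then obtain z where "poly p z = 0"
      using fundamental_theorem_of_algebra[of p] by (metis constant_degree)
    then show False using g h cop[of z] by (auto elim!: dvdE)
  qed
  then obtain c where c: "p = [:c:]" by (rule degree_eq_zeroE)
  then have "c \<noteq> 0" using p0 by auto
  have "smult (inverse c) r * g + smult (inverse c) s * h = smult (inverse c) p"
    by (simp add: rs smult_add_right)
  also have "\<dots> = 1" using \<open>c \<noteq> 0\<close> by (simp add: c one_pCons)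
  finally have "smult (inverse c) r * g + smult (inverse c) s * h = 1" .
  then show ?thesis by blast
qed

text \<open>Sending \<open>(u, v)\<close> to \<open>u * g + v * h\<close> is the differential of the
  product at the factors \<open>g\<close> and \<open>h\<close>; in these degrees it is the
  surjectivity needed to lift a factorization.\<close>

lemma coprime_solve:
  fixes g h :: "complex poly"
  assumes cop: "\<And>z. poly g z = 0 \<Longrightarrow> poly h z \<noteq> 0" and g: "g \<noteq> 0" and h: "h \<noteq> 0"
  assumes R: "\<And>i. i \<ge> degree g + degree h \<Longrightarrow> poly.coeff R i = 0"
  shows "\<exists>u v. u * g + v * h = R \<and> (\<forall>i\<ge>degree h. poly.coeff u i = 0) \<and> (\<forall>i\<ge>degree g. poly.coeff v i = 0)"
proof -
  obtain r s where rs: "r * g + s * h = 1"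
    using bezout_no_common_root[of g h] cop by blast
  define v where "v = (s * R) mod g"
  define u where "u = r * R + ((s * R) div g) * h"
  have "u * g + v * h = r * R * g + ((s * R) div g * g + (s * R) mod g) * h"
    by (simp only: u_def v_def distrib_left distrib_right mult_ac add_ac)
  also have "\<dots> = (r * g + s * h) * R"
    unfolding div_mult_mod_eq by (simp add: algebra_simps)
  finally have eq: "u * g + v * h = R" using rs by simp
  have v: "v = 0 \<or> degree v < degree g"
    unfolding v_def using degree_mod_less[OF g] by blast
  have "poly.coeff u i = 0" if i: "i \<ge> degree h" for i
  proof (rule ccontr)
    assume c: "poly.coeff u i \<noteq> 0"
    then have u: "u \<noteq> 0" and du: "degree u \<ge> i" by (auto intro: le_degree)
    then have "degree (u * g) = degree u + degree g" using g by (simp add: degree_mult_eq)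
    moreover have "u * g = R - v * h" using eq by (simp add: algebra_simps)
    moreover have "poly.coeff (R - v * h) (degree u + degree g) = 0"
    proof -
      have "poly.coeff (v * h) (degree u + degree g) = 0"
        using v du i h by (cases "v = 0") (auto intro!: coeff_eq_0 simp: degree_mult_eq)
      then show ?thesis using R du i by simp
    qed
    moreover have "u * g \<noteq> 0" using u g by simp
    ultimately show False by (metis leading_coeff_0_iff)
  qed
  moreover have "\<forall>i\<ge>degree g. poly.coeff v i = 0"
    using v by (auto intro: coeff_eq_0)
  ultimately show ?thesis using eq by blast
qed

text \<open>The unknowns are the non-leading coefficients of the two monic factors: the first
  \<open>a\<close> entries of \<open>x\<close> belong to \<open>G\<close>, the next \<open>b\<close>
  to \<open>H\<close>. The equations compare the coefficients of the product below degree
  \<open>a + b\<close>.\<close>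

lemma hensel_factorization:
  fixes P :: "complex fps poly" and g h :: "complex poly"
  assumes cop: "\<And>z. poly g z = 0 \<Longrightarrow> poly h z \<noteq> 0" and g: "lead_coeff g = 1" and h: "lead_coeff h = 1"
    and P: "lead_coeff P = 1" and red: "map_poly (\<lambda>f. fps_nth f 0) P = g * h"
    and dP: "degree P = degree g + degree h"
  shows "\<exists>G H. P = G * H \<and> degree G = degree g \<and> lead_coeff G = 1"
proof -
  define a b where "a = degree g" and "b = degree h"
  define cG where "cG l x = (if l < a then x l else if l = a then 1 else 0)" for l and x :: "nat \<Rightarrow> complex fps"
  define cH where "cH l x = (if l < b then x (a + l) else if l = b then 1 else 0)" for l and x :: "nat \<Rightarrow> complex fps"
  define cG' where "cG' l x y = (if l < a then y l else 0)" for l and x y :: "nat \<Rightarrow> complex fps"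
  define cH' where "cH' l x y = (if l < b then y (a + l) else 0)" for l and x y :: "nat \<Rightarrow> complex fps"
  define \<Psi> where "\<Psi> i x = (\<Sum>l\<le>i. cG l x * cH (i - l) x) + - poly.coeff P i" for i x
  define \<Psi>' where "\<Psi>' i x y = (\<Sum>l\<le>i. cG' l x y * cH (i - l) x + cG l x * cH' (i - l) x y) + 0" for i x y
  define x0 where "x0 j = (if j < a then poly.coeff g j else poly.coeff h (j - a))" for j
  have tG: "tame (cG l) (cG' l)" for l
    by (cases "l < a"; cases "l = a") (simp_all add: cG_def[abs_def] cG'_def[abs_def] tame_const tame_var)
  have tH: "tame (cH l) (cH' l)" for l
    by (cases "l < b"; cases "l = b") (simp_all add: cH_def[abs_def] cH'_def[abs_def] tame_const tame_var)
  have cg: "cG l (fvec x0) = fps_const (poly.coeff g l)" for l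
    using g by (auto simp: cG_def x0_def a_def coeff_eq_0)
  have ch: "cH l (fvec x0) = fps_const (poly.coeff h l)" for l
    using h by (auto simp: cH_def x0_def b_def coeff_eq_0)
  have cP: "fps_nth (poly.coeff P i) 0 = poly.coeff (g * h) i" for i
    using red by (metis coeff_map_poly fps_zero_nth)
  have "\<exists>x. (\<forall>j. fps_nth (x j) 0 = x0 j) \<and> (\<forall>i\<in>{..<a+b}. \<Psi> i x = 0)"
  proof (rule formal_solution[where \<Psi>' = \<Psi>'])
    show "tame (\<Psi> i) (\<Psi>' i)" for i
      unfolding \<Psi>_def[abs_def] \<Psi>'_def[abs_def]
      by (intro tame_add tame_sum tame_mult tame_const tG tH)
    show "fps_nth (\<Psi> i (fvec x0)) 0 = 0" for i
      by (simp add: \<Psi>_def cg ch cP coeff_mult fps_sum_nth)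
    fix \<rho> :: "nat \<Rightarrow> complex"
    define R where "R = (\<Sum>i<a+b. monom (\<rho> i) i)"
    have R: "poly.coeff R i = (if i < a + b then \<rho> i else 0)" for i
      by (auto simp: R_def coeff_sum)
    obtain u v where uv: "u * g + v * h = R" "\<And>i. i \<ge> b \<Longrightarrow> poly.coeff u i = 0" "\<And>i. i \<ge> a \<Longrightarrow> poly.coeff v i = 0"
    proof -
      have "g \<noteq> 0" "h \<noteq> 0" using g h by auto
      moreover have "poly.coeff R i = 0" if "i \<ge> degree g + degree h" for i
        using that R by (simp add: a_def b_def)
      ultimately show ?thesis using coprime_solve[of g h R] cop that unfolding a_def b_def by blast
    qed
    define y where "y j = (if j < a then poly.coeff v j else poly.coeff u (j - a))" for j
    have cg': "cG' l x (fvec y) = fps_const (poly.coeff v l)" for l x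
      using uv by (auto simp: cG'_def y_def)
    have ch': "cH' l x (fvec y) = fps_const (poly.coeff u l)" for l x
      using uv by (auto simp: cH'_def y_def)
    have "fps_nth (\<Psi>' i (fvec x0) (fvec y)) 0 = poly.coeff (v * h + g * u) i" for i
      by (simp add: \<Psi>'_def cg ch cg' ch' coeff_mult fps_sum_nth sum.distrib)
    then have "\<forall>i\<in>{..<a+b}. fps_nth (\<Psi>' i (fvec x0) (fvec y)) 0 = \<rho> i"
      using R
      by (metis (no_types) lessThan_iff uv(1) add.commute mult.commute)
    then show "\<exists>y. \<forall>i\<in>{..<a+b}. fps_nth (\<Psi>' i (fvec x0) (fvec y)) 0 = \<rho> i"
      by blast
  qed
  then obtain x where x: "\<And>i. i < a + b \<Longrightarrow> \<Psi> i x = 0" by auto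
  define G where "G = (\<Sum>l\<le>a. monom (cG l x) l)"
  define H where "H = (\<Sum>l\<le>b. monom (cH l x) l)"
  have G: "poly.coeff G l = cG l x" for l by (auto simp: G_def coeff_sum cG_def)
  have H: "poly.coeff H l = cH l x" for l by (auto simp: H_def coeff_sum cH_def)
  have dG: "degree G = a" by (rule antisym[OF degree_le le_degree]) (auto simp: G cG_def)
  have dH: "degree H = b" by (rule antisym[OF degree_le le_degree]) (auto simp: H cH_def)
  have lG: "lead_coeff G = 1" and lH: "lead_coeff H = 1" by (auto simp: dG dH G H cG_def cH_def)
  have "poly.coeff P i = poly.coeff (G * H) i" for i
  proof -
    consider "i < a + b" | "i = a + b" | "i > a + b" by linarith
    then show ?thesis
    proof cases
      case 1
      then show ?thesis using x[OF 1] by (simp add: \<Psi>_def coeff_mult G H add_eq_0_iff)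
    next
      case 2
      then show ?thesis using P dP lG lH coeff_mult_degree_sum[of G H] by (simp add: dG dH a_def b_def)
    next
      case 3
      then have "degree (G * H) < i" using degree_mult_le[of G H] by (simp add: dG dH)
      then show ?thesis using 3 dP by (simp add: coeff_eq_0 a_def b_def)
    qed
  qed
  then have "P = G * H" by (rule poly_eqI)
  then show ?thesis using dG lG a_def by blast
qed

section \<open>Puiseux' theorem by the Newton polygon\<close>

lemma coeff_pcompose_shift_top:
  "degree p \<le> n \<Longrightarrow> poly.coeff (pcompose p [:s, 1:]) n = poly.coeff (p :: 'a::field poly) n"
proof (induction p arbitrary: n)
  case (pCons a p)
  show ?case
  proof (cases n)
    case 0
    then have "degree (pCons a p) = 0" using pCons.prems by simp
    then have "p = 0" by (metis degree_pCons_eq nat.distinct(1))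
    then show ?thesis by (simp add: pcompose_pCons)
  next
    case (Suc k)
    then have d: "degree p \<le> k" using pCons.prems by (cases "p = 0") auto
    then have "degree p < Suc k" by simp
    then have "degree (pcompose p [:s, 1:]) < Suc k" by (simp add: degree_pcompose)
    then have "poly.coeff (pcompose p [:s, 1:]) (Suc k) = 0" by (rule coeff_eq_0)
    then show ?thesis using pCons.IH[OF d] by (simp add: Suc pcompose_pCons coeff_pCons)
  qed
qed simp

lemma coeff_pcompose_shift:
  "degree p \<le> Suc n \<Longrightarrow> poly.coeff (pcompose p [:s, 1:]) n =
     poly.coeff (p :: 'a::field poly) n + of_nat (Suc n) * s * poly.coeff p (Suc n)"
proof (induction p arbitrary: n)
  case (pCons a p)
  then have d: "degree p \<le> n" by (cases "p = 0") auto
  then have top: "poly.coeff (pcompose p [:s, 1:]) n = poly.coeff p n"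
    by (rule coeff_pcompose_shift_top)
  show ?case
  proof (cases n)
    case 0
    then show ?thesis using top by (simp add: pcompose_pCons)
  next
    case (Suc k)
    then show ?thesis using top pCons.IH[of k] d by (simp add: pcompose_pCons algebra_simps)
  qed
qed simp

lemma poly_map_poly_sum:
  fixes f :: "'a::zero \<Rightarrow> 'b::comm_semiring_1"
  assumes "f 0 = 0" "degree p \<le> n"
  shows "poly (map_poly f p) z = (\<Sum>i\<le>n. f (poly.coeff p i) * z ^ i)"
proof -
  have "poly (map_poly f p) z = (\<Sum>i\<le>degree (map_poly f p). poly.coeff (map_poly f p) i * z ^ i)"
    by (rule poly_altdef)
  also have "\<dots> = (\<Sum>i\<le>n. poly.coeff (map_poly f p) i * z ^ i)"
    using assms map_poly_degree_leq[of f p] by (intro sum.mono_neutral_left) (auto simp: coeff_eq_0)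
  finally show ?thesis using assms by (simp add: coeff_map_poly)
qed

lemma map_poly_ring_hom:
  assumes "ring_map f"
  shows "map_poly f (p + q) = map_poly f p + map_poly f q" "map_poly f (p * q) = map_poly f p * map_poly f q"
    "map_poly f (smult a p) = smult (f a) (map_poly f p)"
  by (intro poly_eqI; simp add: coeff_map_poly ring_mapD[OF assms] coeff_mult ring_map_sum[OF assms])+

lemma map_poly_pcompose_ring_hom:
  "ring_map f \<Longrightarrow> map_poly f (pcompose p q) = pcompose (map_poly f p) (map_poly f q)"
  by (induction p) (simp_all add: map_poly_pCons ring_mapD pcompose_pCons map_poly_ring_hom)

text \<open>Substitution of the \<open>e\<close>-th power for the variable. Adjoining an
  \<open>e\<close>-th root of the variable thus becomes an endomorphism of one field, and no larger
  field has to be constructed.\<close>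

definition ramify :: "nat \<Rightarrow> complex fls \<Rightarrow> complex fls" where
  "ramify e a = fls_compose_power a e"

lemma ring_map_ramify: "e > 0 \<Longrightarrow> ring_map (ramify e)"
  by (simp add: ring_map_def ramify_def)

lemma ramify_0 [simp]: "ramify e 0 = 0"
  by (simp add: ramify_def)

lemma ramify_nth: "e > 0 \<Longrightarrow> fls_nth (ramify e a) n = (if int e dvd n then fls_nth a (n div int e) else 0)"
  by (simp add: ramify_def fls_nth_compose_power)

lemma ramify_nth_mult: "e > 0 \<Longrightarrow> fls_nth (ramify e a) (int e * n) = fls_nth a n"
  by (simp add: ramify_nth)

lemma ramify_eq_0_iff: "e > 0 \<Longrightarrow> ramify e a = 0 \<longleftrightarrow> a = 0"
  by (metis fls_eqI fls_zero_nth ramify_0 ramify_nth_mult)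

lemma ramify_ramify: "e > 0 \<Longrightarrow> e' > 0 \<Longrightarrow> ramify e' (ramify e a) = ramify (e * e') a"
proof (rule fls_eqI)
  fix n assume e: "e > 0" "e' > 0"
  show "fls_nth (ramify e' (ramify e a)) n = fls_nth (ramify (e * e') a) n"
  proof (cases "int e' dvd n")
    case True
    then obtain k where "n = int e' * k" by (rule dvdE)
    then show ?thesis using e by (simp add: ramify_nth mult.commute[of e e'] flip: zdiv_zmult2_eq)
  next
    case False
    then show ?thesis using e by (auto simp: ramify_nth dest: dvd_mult_right)
  qed
qed

lemma ramify_subdegree: "e > 0 \<Longrightarrow> a \<noteq> 0 \<Longrightarrow> fls_nth (ramify e a) (int e * fls_subdegree a) \<noteq> 0"
  by (simp add: ramify_nth_mult)

text \<open>The full multiplicity of one root is split off. The cofactor has positive degree: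
  otherwise \<open>p\<close> would be a power of one linear factor, and the vanishing coefficient
  would force \<open>p\<close> to be a monomial, contrary to \<open>i0\<close>.\<close>

lemma puiseux_reduction:
  fixes p :: "complex poly"
  assumes n: "degree p = n" "n > 0" and monic: "lead_coeff p = 1" and "poly.coeff p (n - 1) = 0"
    and i0: "i0 < n" "poly.coeff p i0 \<noteq> 0"
  shows "\<exists>g h. p = g * h \<and> (\<forall>z. poly g z = 0 \<longrightarrow> poly h z \<noteq> 0) \<and> lead_coeff g = 1 \<and> lead_coeff h = 1 \<and>
    0 < degree g \<and> degree g < n"
proof -
  have p: "p \<noteq> 0" using monic by auto
  obtain \<alpha> where \<alpha>: "poly p \<alpha> = 0"
    using alg_closed_imp_poly_has_root[of p] n by auto
  define g where "g = [:- \<alpha>, 1:] ^ order \<alpha> p"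
  obtain h where h: "p = g * h" "\<not> [:- \<alpha>, 1:] dvd h"
    using order_decomp[OF p, of \<alpha>] by (auto simp: g_def)
  have g1: "lead_coeff g = 1" by (simp add: g_def lead_coeff_power)
  have h1: "lead_coeff h = 1" using monic g1 by (simp add: h(1) lead_coeff_mult)
  have dg: "degree g = order \<alpha> p" by (simp add: g_def degree_linear_power)
  have "order \<alpha> p > 0" using \<alpha> p order_root[of p \<alpha>] by simp
  have nz: "g \<noteq> 0" "h \<noteq> 0" using p h by auto
  have "degree h \<noteq> 0"
  proof
    assume "degree h = 0"
    then have "h = 1" using h1 by (metis degree_eq_zeroE lead_coeff_pCons(2) one_pCons pCons_0_0 zero_neq_one lead_coeff_pCons(1))
    then have pg: "p = [:- \<alpha>, 1:] ^ n" using h dg n by (simp add: g_def)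
    obtain k where k: "n = Suc k" using n by (cases n) auto
    have "poly.coeff p k = of_nat n * (- \<alpha>)"
      unfolding pg k by (subst coeff_linear_poly_power) auto
    then have "\<alpha> = 0" using assms(4) k by (simp del: of_nat_Suc)
    then have "p = monom 1 n" using pg by (simp add: monom_altdef)
    then show False using i0 by simp
  qed
  then have "degree g < n" using n nz by (simp add: h(1) degree_mult_eq)
  moreover have "poly h z \<noteq> 0" if "poly g z = 0" for z
  proof -
    have "z = \<alpha>" using that by (simp add: g_def)
    then show ?thesis using h(2) by (simp add: poly_eq_0_iff_dvd)
  qed
  moreover have "0 < degree g" using dg \<open>order \<alpha> p > 0\<close> by linarith
  ultimately show ?thesis using h(1) g1 h1 by blast
qed

text \<open>The slope of a side of the Newton polygon: \<open>w i / int (n - i)\<close> is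
  minimized, with the comparison cleared of denominators.\<close>

lemma exists_least_slope:
  fixes w :: "nat \<Rightarrow> int"
  assumes "finite I" "I \<noteq> {}" "\<And>i. i \<in> I \<Longrightarrow> i < n"
  shows "\<exists>i0\<in>I. \<forall>i\<in>I. w i0 * int (n - i) \<le> w i * int (n - i0)"
  using assms
proof (induction I rule: finite_ne_induct)
  case (insert j I)
  then obtain i0 where i0: "i0 \<in> I" "\<And>i. i \<in> I \<Longrightarrow> w i0 * int (n - i) \<le> w i * int (n - i0)"
    by auto
  show ?case
  proof (cases "w i0 * int (n - j) \<le> w j * int (n - i0)")
    case True
    then show ?thesis using i0 by (intro bexI[of _ i0]) auto
  next
    case False
    have "w j * int (n - i) \<le> w i * int (n - j)" if i: "i \<in> I" for i
    proof -
      have pos: "int (n - i0) > 0" "int (n - i) > 0" "int (n - j) > 0"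
        using insert.prems[of i0] insert.prems[of i] insert.prems[of j] i0 i by auto
      have "w j * int (n - i) * int (n - i0) = w j * int (n - i0) * int (n - i)" by simp
      also have "\<dots> \<le> w i0 * int (n - j) * int (n - i)"
        using False pos by (intro mult_right_mono) auto
      also have "\<dots> = w i0 * int (n - i) * int (n - j)" by simp
      also have "\<dots> \<le> w i * int (n - i0) * int (n - j)"
        using i0(2)[OF i] pos by (intro mult_right_mono) auto
      finally have "w j * int (n - i) * int (n - i0) \<le> (w i * int (n - j)) * int (n - i0)"
        by (simp add: mult_ac)
      then show ?thesis using pos by (simp add: mult_le_cancel_right)
    qed
    then show ?thesis by (intro bexI[of _ j]) auto
  qed
qed auto

definition has_ramified_root :: "complex fls poly \<Rightarrow> bool" where
  "has_ramified_root P \<longleftrightarrow> (\<exists>e>0. \<exists>z. poly (map_poly (ramify e) P) z = 0)"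

lemma has_ramified_root_shift:
  assumes "has_ramified_root (pcompose P [:s, 1:])"
  shows "has_ramified_root P"
proof -
  obtain e z where e: "e > 0" "poly (map_poly (ramify e) (pcompose P [:s, 1:])) z = 0"
    using assms unfolding has_ramified_root_def by blast
  note h = ring_map_ramify[OF e(1)]
  have "poly (map_poly (ramify e) P) (ramify e s + z) = 0"
    using e(2) by (simp add: map_poly_pcompose_ring_hom[OF h] poly_pcompose map_poly_pCons ring_mapD[OF h])
  then show ?thesis using e(1) unfolding has_ramified_root_def by blast
qed

text \<open>After ramification, rescaling the unknown by a power of the variable along the least
  slope makes all coefficients integral, keeps the leading one 1 and makes that of index
  \<open>i0\<close> a unit. Then \<open>puiseux_reduction\<close> splits the reduction, Hensel's
  lemma lifts the factorization, and a factor of smaller degree has a root by induction.\<close>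

lemma puiseux_step:
  fixes P :: "complex fls poly"
  assumes n: "degree P = n" and monic: "lead_coeff P = 1" and sub: "poly.coeff P (n - 1) = 0"
    and nz: "j < n" "poly.coeff P j \<noteq> 0"
    and IH: "\<And>Q. 0 < degree Q \<Longrightarrow> degree Q < n \<Longrightarrow> has_ramified_root Q"
  shows "has_ramified_root P"
proof -
  define a where "a = poly.coeff P"
  define w where "w i = fls_subdegree (a i)" for i
  obtain i0 where i0: "i0 < n" "a i0 \<noteq> 0" and
    slope: "\<And>i. i < n \<Longrightarrow> a i \<noteq> 0 \<Longrightarrow> w i0 * int (n - i) \<le> w i * int (n - i0)"
  proof -
    have "finite {i. i < n \<and> a i \<noteq> 0}" "{i. i < n \<and> a i \<noteq> 0} \<noteq> {}" using nz by (auto simp: a_def)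
    from exists_least_slope[OF this, of n w] show ?thesis using that by blast
  qed
  \<comment> \<open>Ramification of this order turns the slope \<open>w i0 / (n - i0)\<close> into
    the integer \<open>u\<close>.\<close>
  define e where "e = n - i0"
  have e: "e > 0" using i0 by (simp add: e_def)
  define u where "u = w i0"
  define B where "B i = fls_shift (u * int (n - i)) (ramify e (a i))" for i
  have Bnth: "fls_nth (B i) k = fls_nth (ramify e (a i)) (k + u * int (n - i))" for i k
    by (simp add: B_def)
  have Bn: "B n = 1" using monic n ring_mapD(2)[OF ring_map_ramify[OF e]] by (simp add: B_def a_def)
  have B0: "B i = 0" if "a i = 0" for i using that by (simp add: B_def)
  have Bsub: "fls_subdegree (B i) \<ge> 0" if "i \<le> n" for i
  proof (cases "a i = 0 \<or> i = n")
    case True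
    then show ?thesis using B0 Bn by auto
  next
    case False
    then have i: "i < n" "a i \<noteq> 0" using that by auto
    show ?thesis
    proof (rule fls_subdegree_ge0I)
      fix k :: int assume k: "k < 0"
      have "fls_nth (a i) ((k + u * int (n - i)) div int e) = 0" if d: "int e dvd k + u * int (n - i)"
      proof -
        obtain q where q: "k + u * int (n - i) = int e * q" using d by (rule dvdE)
        have "int e * q < u * int (n - i)" using q k by simp
        also have "\<dots> \<le> int e * w i" using slope[OF i] by (simp add: u_def e_def mult.commute)
        finally have "q < w i" using e by simp
        then show ?thesis using q e by (simp add: w_def)
      qed
      then show "fls_nth (B i) k = 0" by (simp add: Bnth ramify_nth e)
    qed
  qed
  have Bi0: "fls_nth (B i0) 0 \<noteq> 0"
    using ramify_subdegree[OF e i0(2)] by (simp add: Bnth u_def e_def w_def mult.commute)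
  define R where "R = (\<Sum>i\<le>n. monom (fls_regpart (B i)) i)"
  have R: "poly.coeff R i = (if i \<le> n then fls_regpart (B i) else 0)" for i
    by (auto simp: R_def coeff_sum)
  have dR: "degree R = n" by (rule antisym[OF degree_le le_degree]) (auto simp: R Bn)
  have lR: "lead_coeff R = 1" by (simp add: dR R Bn)
  define p where "p = map_poly (\<lambda>f. fps_nth f 0) R"
  have p: "poly.coeff p i = (if i \<le> n then fls_nth (B i) 0 else 0)" for i
    by (simp add: p_def coeff_map_poly R)
  have dp: "degree p = n" by (rule antisym[OF degree_le le_degree]) (auto simp: p Bn)
  have lp: "lead_coeff p = 1" by (simp add: dp p Bn)
  have "n > 0" using i0 by simp
  have "poly.coeff p (n - 1) = 0" using sub by (simp add: p B0 a_def)
  moreover have "poly.coeff p i0 \<noteq> 0" using i0 Bi0 by (simp add: p)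
  ultimately obtain g h where gh: "p = g * h" "\<And>z. poly g z = 0 \<Longrightarrow> poly h z \<noteq> 0" "lead_coeff g = 1"
      "lead_coeff h = 1" "0 < degree g" "degree g < n"
    using puiseux_reduction[OF dp \<open>n > 0\<close> lp _ i0(1)] by blast
  have "g \<noteq> 0" "h \<noteq> 0" using gh(3,4) by auto
  then have "degree R = degree g + degree h"
    using dR dp by (simp add: gh(1) degree_mult_eq)
  then obtain G K where GK: "R = G * K" "degree G = degree g" "lead_coeff G = 1"
    using hensel_factorization[of g h R] gh(2-4) lR gh(1) by (auto simp: p_def)
  define G' where "G' = map_poly fps_to_fls G"
  have "degree G' = degree g"
    unfolding G'_def using GK(2) by (subst degree_map_poly) auto
  then obtain e' z where e': "e' > 0" and z: "poly (map_poly (ramify e') G') z = 0"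
    using IH[of G'] gh unfolding has_ramified_root_def by metis
  note h = ring_map_ramify[OF e']
  have "map_poly fps_to_fls R = G' * map_poly fps_to_fls K"
    unfolding G'_def GK(1) by (rule map_poly_ring_hom(2)) simp
  then have "poly (map_poly (ramify e') (map_poly fps_to_fls R)) z = 0"
    using z by (simp add: map_poly_ring_hom(2)[OF h])
  moreover have "degree (map_poly fps_to_fls R) \<le> n" using dR map_poly_degree_leq[of fps_to_fls R] by simp
  ultimately have *: "(\<Sum>i\<le>n. ramify e' (B i) * z ^ i) = 0"
    using Bsub by (simp add: poly_map_poly_sum[of _ _ n] coeff_map_poly R)
  define X where "X = (fls_X_intpow (u * int e') :: complex fls)"
  have B': "ramify e' (B i) * X ^ (n - i) = ramify (e * e') (a i)" for i
  proof -
    have "B i * fls_X_intpow (u * int (n - i)) = ramify e (a i)"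
      by (simp add: B_def fls_X_intpow_times_conv_shift)
    then have "ramify e' (B i) * ramify e' (fls_X_intpow (u * int (n - i))) = ramify e' (ramify e (a i))"
      using ring_mapD(4)[OF h] by metis
    moreover have "ramify e' (fls_X_intpow (u * int (n - i))) = X ^ (n - i)"
      unfolding ramify_def X_def fls_X_intpow_power by (simp add: e' mult_ac)
    ultimately show ?thesis by (simp add: ramify_ramify e e')
  qed
  have "poly (map_poly (ramify (e * e')) P) (X * z) = (\<Sum>i\<le>n. ramify (e * e') (a i) * (X * z) ^ i)"
    using n by (subst poly_map_poly_sum[of _ _ n]) (auto simp: a_def)
  also have "\<dots> = (\<Sum>i\<le>n. X ^ n * (ramify e' (B i) * z ^ i))"
  proof (intro sum.cong refl)
    fix i assume "i \<in> {..n}"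
    then have "X ^ n = X ^ (n - i) * X ^ i" by (simp flip: power_add)
    then show "ramify (e * e') (a i) * (X * z) ^ i = X ^ n * (ramify e' (B i) * z ^ i)"
      unfolding B'[symmetric] by (simp only: power_mult_distrib mult_ac)
  qed
  also have "\<dots> = 0" using * by (simp flip: sum_distrib_left)
  finally have "poly (map_poly (ramify (e * e')) P) (X * z) = 0" .
  moreover have "0 < e * e'" using e e' by simp
  ultimately show ?thesis unfolding has_ramified_root_def by blast
qed

lemma puiseux:
  "0 < degree P \<Longrightarrow> has_ramified_root P"
proof (induction "degree P" arbitrary: P rule: less_induct)
  case less
  define n where "n = degree P"
  have P: "P \<noteq> 0" using less.prems by auto
  define Q where "Q = smult (inverse (lead_coeff P)) P"
  \<comment> \<open>The shift of the unknown by \<open>s\<close> removes the coefficient below the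
    leading one.\<close>
  define s where "s = - poly.coeff Q (n - 1) / of_nat n"
  define R where "R = pcompose Q [:s, 1:]"
  have dQ: "degree Q = n" using P by (simp add: Q_def n_def)
  have lQ: "lead_coeff Q = 1" using P by (simp add: Q_def)
  have dR: "degree R = n" using dQ by (simp add: R_def degree_pcompose)
  have lR: "lead_coeff R = 1" using lQ by (simp add: R_def lead_coeff_comp)
  obtain k where k: "n = Suc k" using less.prems by (cases n) (auto simp: n_def)
  have subR: "poly.coeff R (n - 1) = 0"
  proof -
    have nz: "(of_nat n :: complex fls) \<noteq> 0" by (simp add: k del: of_nat_Suc)
    have "degree Q \<le> Suc k" using dQ k by simp
    then have "poly.coeff R k = poly.coeff Q k + of_nat n * s * poly.coeff Q n"
      unfolding R_def k by (rule coeff_pcompose_shift)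
    then show ?thesis using nz lQ dQ by (simp add: k[symmetric] s_def) (simp add: k)
  qed
  have "has_ramified_root R"
  proof (cases "\<exists>j<n. poly.coeff R j \<noteq> 0")
    case True
    then show ?thesis
      using puiseux_step[OF dR lR subR] less.hyps unfolding n_def by blast
  next
    case False
    have "poly.coeff R 0 = 0" using False k by blast
    then have "poly.coeff (map_poly (ramify 1) R) 0 = 0" by (simp add: coeff_map_poly)
    then have "poly (map_poly (ramify 1) R) 0 = 0" by (simp add: poly_0_coeff_0)
    then show ?thesis unfolding has_ramified_root_def using zero_less_one by blast
  qed
  then have "has_ramified_root Q" unfolding R_def by (rule has_ramified_root_shift)
  then obtain e z where e: "e > 0" "poly (map_poly (ramify e) Q) z = 0" unfolding has_ramified_root_def by blast
  note h = ring_map_ramify[OF e(1)]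
  have "ramify e (inverse (lead_coeff P)) \<noteq> 0" using P ramify_eq_0_iff[OF e(1)] by simp
  then have "poly (map_poly (ramify e) P) z = 0"
    using e(2) by (simp add: Q_def map_poly_ring_hom(3)[OF h])
  then show ?case using e(1) unfolding has_ramified_root_def by blast
qed

section \<open>Embeddings into Laurent series up to ramification\<close>

lemma emb_ramify: "emb A \<sigma> \<Longrightarrow> e > 0 \<Longrightarrow> emb A (\<lambda>a. ramify e (\<sigma> a))"
  using ring_mapD[OF ring_map_ramify[of e]] by (auto simp: emb_def ramify_eq_0_iff)

text \<open>The transformed minimal relation may acquire a root only after ramification; so it is
  the composite of \<open>\<sigma>\<close> with some \<open>ramify e\<close> that is
  extended.\<close>

lemma emb_extend_fls:
  fixes \<sigma> :: "'a::idom \<Rightarrow> complex fls"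
  assumes \<sigma>: "emb A \<sigma>" and "countable A"
  shows "\<exists>e>0. \<exists>\<sigma>'. emb (adjoin A z) \<sigma>' \<and> (\<forall>a\<in>A. \<sigma>' a = ramify e (\<sigma> a))"
proof -
  have "\<exists>e>0. \<exists>\<zeta>. matches A (\<lambda>a. ramify e (\<sigma> a)) z \<zeta>"
  proof (cases "transc A z")
    case True
    have e: "(1::nat) > 0" by simp
    have "countable ((\<lambda>a. ramify 1 (\<sigma> a)) ` A)" using assms(2) by simp
    moreover have "uncountable (range (fls_const :: complex \<Rightarrow> _))"
    proof
      assume "countable (range (fls_const :: complex \<Rightarrow> _))"
      moreover have "inj (fls_const :: complex \<Rightarrow> _)" by (rule injI) (metis fls_const_nth)
      ultimately show False using countable_image_inj_on uncountable_UNIV_complex by blast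
    qed
    ultimately obtain \<zeta> where "transc ((\<lambda>a. ramify 1 (\<sigma> a)) ` A) \<zeta>"
      using exists_transc by blast
    then show ?thesis using matches_transc[OF emb_ramify[OF \<sigma> e] True] e by blast
  next
    case False
    obtain p where p: "p \<in> over A" "p \<noteq> 0" "poly p z = 0"
      "\<And>g. g \<in> over A \<Longrightarrow> g \<noteq> 0 \<Longrightarrow> poly g z = 0 \<Longrightarrow> degree p \<le> degree g"
      by (rule minimal_relation[OF False]) blast
    then have "0 < degree (map_poly \<sigma> p)"
      using degree_pos_if_root map_poly_emb(5)[OF \<sigma>] by metis
    then obtain e \<zeta> where e: "e > 0" and "poly (map_poly (ramify e) (map_poly \<sigma> p)) \<zeta> = 0"
      using puiseux unfolding has_ramified_root_def by blast
    moreover have "map_poly (ramify e) (map_poly \<sigma> p) = map_poly (\<lambda>a. ramify e (\<sigma> a)) p"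
      by (intro poly_eqI) (simp add: coeff_map_poly embD(2)[OF \<sigma>])
    ultimately have "poly (map_poly (\<lambda>a. ramify e (\<sigma> a)) p) \<zeta> = 0" by metis
    then show ?thesis using matches_algebraic[OF emb_ramify[OF \<sigma> e] p] e by blast
  qed
  then show ?thesis using emb_extend[OF emb_ramify[OF \<sigma>]] by blast
qed

lemma emb_extend_fls_list:
  fixes \<sigma> :: "'a::idom \<Rightarrow> complex fls"
  assumes "emb A \<sigma>" "countable A"
  shows "\<exists>e>0. \<exists>\<sigma>'. emb (adjoin_list A zs) \<sigma>' \<and> (\<forall>a\<in>A. \<sigma>' a = ramify e (\<sigma> a))"
  using assms
proof (induction zs arbitrary: A \<sigma>)
  case Nil
  then show ?case using emb_ramify[OF Nil(1), of 1] by (intro exI[of _ 1]) auto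
next
  case (Cons z zs)
  obtain e \<sigma>1 where e: "e > 0" and \<sigma>1: "emb (adjoin A z) \<sigma>1" "\<And>a. a\<in>A \<Longrightarrow> \<sigma>1 a = ramify e (\<sigma> a)"
    using emb_extend_fls[OF Cons.prems] by blast
  obtain e' \<sigma>2 where e': "e' > 0" and \<sigma>2: "emb (adjoin_list (adjoin A z) zs) \<sigma>2"
      "\<And>a. a\<in>adjoin A z \<Longrightarrow> \<sigma>2 a = ramify e' (\<sigma>1 a)"
    using Cons.IH[OF \<sigma>1(1) countable_adjoin[OF Cons.prems(2)]] by blast
  have "\<forall>a\<in>A. \<sigma>2 a = ramify (e * e') (\<sigma> a)"
  proof
    fix a assume a: "a \<in> A"
    show "\<sigma>2 a = ramify (e * e') (\<sigma> a)"
      unfolding \<sigma>2(2)[OF adjoin_superset[OF embD(1)[OF Cons.prems(1)] a]] \<sigma>1(2)[OF a]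
      by (rule ramify_ramify[OF e e'])
  qed
  moreover have "0 < e * e'" using e e' by simp
  ultimately show ?case using \<sigma>2(1) unfolding adjoin_list_simps by blast
qed

section \<open>Forms in more variables than equations\<close>

lemma adjoin_list_append: "adjoin_list A (xs @ ys) = adjoin_list (adjoin_list A xs) ys"
  by (simp add: adjoin_list_def)

lemma adjoin_least: "subring B \<Longrightarrow> A \<subseteq> B \<Longrightarrow> z \<in> B \<Longrightarrow> adjoin A z \<subseteq> B"
  unfolding adjoin_def using subring_poly by (force simp: over_def)

lemma adjoin_list_least: "subring B \<Longrightarrow> A \<subseteq> B \<Longrightarrow> set zs \<subseteq> B \<Longrightarrow> adjoin_list A zs \<subseteq> B"
  by (induction zs arbitrary: A) (simp_all add: adjoin_least)

lemma exists_transc_list: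
  fixes A :: "complex set"
  assumes "countable A"
  shows "\<exists>zs. length zs = n \<and> transc_list A zs"
  using assms
proof (induction n arbitrary: A)
  case (Suc n)
  obtain z where z: "transc A z" using exists_transc[OF Suc.prems uncountable_UNIV_complex] by blast
  obtain zs where "length zs = n" "transc_list (adjoin A z) zs"
    using Suc.IH[OF countable_adjoin[OF Suc.prems]] by blast
  then show ?case using z by (intro exI[of _ "z # zs"]) simp
qed simp

lemma subring_of_int: "subring (range of_int)"
  unfolding subring_def by (auto intro: range_eqI[of _ _ 0] range_eqI[of _ _ 1] simp flip: of_int_add of_int_mult of_int_minus)

lemma exists_countable_subring:
  assumes "finite (S :: complex set)"
  shows "\<exists>k. subring k \<and> countable k \<and> S \<subseteq> k"
proof -
  obtain zs where zs: "set zs = S" using finite_list[OF assms] by blast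
  define k where "k = adjoin_list (range of_int :: complex set) zs"
  have "subring k" unfolding k_def by (rule subring_adjoin_list[OF subring_of_int])
  moreover have "countable k" unfolding k_def by (rule countable_adjoin_list) simp
  moreover have "S \<subseteq> k" unfolding k_def zs[symmetric] using adjoin_list_generators[OF subring_of_int] by blast
  ultimately show ?thesis by blast
qed

lemma finite_pconsts: "finite (pconsts e)"
  by (induction e) auto

lemma derivation_poly:
  assumes D: "derivation B D" and k: "A \<subseteq> B" "\<And>a. a \<in> A \<Longrightarrow> D a = 0" and z: "z \<in> B"
  shows "p \<in> over A \<Longrightarrow> D (poly p z) = poly (pderiv p) z * D z"
proof (induction p)
  case (pCons a p)
  note B = derivationD(1)[OF D]
  have ap: "a \<in> A" "p \<in> over A"
    using pCons.prems by (auto simp: over_def coeff_pCons split: nat.splits)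
  have "p \<in> over B" using ap(2) k(1) by (auto simp: over_def)
  then have "poly p z \<in> B" by (rule subring_poly[OF B z])
  moreover have "a \<in> B" using ap k by blast
  ultimately have "D (poly (pCons a p) z) = D a + (D z * poly p z + z * D (poly p z))"
    using z by (simp add: derivationD[OF D] subringD(4)[OF B])
  then show ?case using pCons.IH[OF ap(2)] k(2)[OF ap(1)] by (simp add: pderiv_pCons algebra_simps)
qed (simp add: derivationD[OF D])

text \<open>Applying \<open>D\<close> to a minimal relation of \<open>z\<close> would make the
  derivative of that relation vanish at \<open>z\<close>, which is a relation of smaller
  degree.\<close>

lemma transc_if_derivation:
  fixes B :: "'a::field_char_0 set"
  assumes D: "derivation B D" and k: "subring A" "A \<subseteq> B" "\<And>a. a \<in> A \<Longrightarrow> D a = 0" and z: "z \<in> B" "D z \<noteq> 0"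
  shows "transc A z"
proof (rule ccontr)
  assume "\<not> transc A z"
  then obtain p where p: "p \<in> over A" "p \<noteq> 0" "poly p z = 0"
    "\<And>g. g \<in> over A \<Longrightarrow> g \<noteq> 0 \<Longrightarrow> poly g z = 0 \<Longrightarrow> degree p \<le> degree g"
    by (rule minimal_relation) blast
  have "poly (pderiv p) z * D z = 0"
    using derivation_poly[OF D k(2,3) z(1) p(1)] p(3) derivationD(4)[OF D] by simp
  then have "poly (pderiv p) z = 0" using z(2) by simp
  moreover have "degree p > 0" by (rule degree_pos_if_root[OF p(3,2)])
  ultimately show False
    using p(4)[OF over_pderiv[OF k(1) p(1)]] by (simp add: pderiv_eq_0_iff degree_pderiv)
qed

text \<open>The powers of the inverse variable have distinct exponents, so the coefficients of a
  relation can be read off.\<close>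

lemma transc_fls_X_inv:
  "transc (fls_const ` A) (fls_X_inv :: 'a::field fls)"
  unfolding transc_def
proof (intro ballI impI)
  fix p :: "'a fls poly" assume p: "p \<in> over (fls_const ` A)" "poly p fls_X_inv = 0"
  then have "\<forall>i. \<exists>a. poly.coeff p i = fls_const a" by (auto simp: over_def)
  then obtain c where c: "\<And>i. poly.coeff p i = fls_const (c i)" by metis
  have "c j = 0" if "j \<le> degree p" for j
  proof -
    have "0 = fls_nth (poly p fls_X_inv) (- int j)" using p by simp
    also have "\<dots> = (\<Sum>i\<le>degree p. if i = j then c i else 0)"
      unfolding poly_altdef c fls_nth_sum
      by (intro sum.cong refl) (auto simp: fls_X_inv_power_times_conv_shift(2))
    finally show ?thesis using that by simp
  qed
  then show "p = 0" using c by (metis fls_const_0 leading_coeff_0_iff order_refl)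
qed

lemma emb_fls_const: "subring A \<Longrightarrow> emb A fls_const"
  by (simp add: emb_def fls_plus_const)

text \<open>The form at the coefficients of index \<open>w\<close> is the coefficient of index
  \<open>d * w\<close> of the value at \<open>\<xi>\<close>. That index is negative, while the value
  is a constant.\<close>

lemma ev_leading_coefficients:
  fixes \<xi> :: "nat \<Rightarrow> complex fls"
  assumes e: "phom d e" "d > 0" "pvars e \<subseteq> {..<M}" and w: "w < 0" "\<And>i. i < M \<Longrightarrow> \<xi> i = 0 \<or> w \<le> fls_subdegree (\<xi> i)"
    and c: "ev fls_const e \<xi> = fls_const c"
  shows "ev (\<lambda>x. x) e (\<lambda>i. fls_nth (\<xi> i) w) = 0"
proof -
  define \<eta> where "\<eta> i = fls_regpart (fls_shift w (\<xi> i))" for i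
  have \<eta>: "fps_to_fls (\<eta> i) = fls_shift w (\<xi> i)" if "i < M" for i
    using w(2)[OF that] by (cases "\<xi> i = 0") (auto simp: \<eta>_def)
  have hom: "ring_map (\<lambda>f. fps_nth f 0 :: complex)" by (simp add: ring_map_def)
  have "fps_to_fls (ev fps_const e \<eta>) = ev fls_const e (\<lambda>i. fps_to_fls (\<eta> i))"
    by (subst ev_hom[OF ring_map_fps_to_fls]) simp
  also have "\<dots> = ev fls_const e (\<lambda>i. fls_X_intpow (- w) * \<xi> i)"
  proof (rule ev_cong)
    fix i assume "i \<in> pvars e"
    then have "i < M" using e(3) by auto
    then show "fps_to_fls (\<eta> i) = fls_X_intpow (- w) * \<xi> i"
      unfolding fls_X_intpow_times_conv_shift using \<eta> by simp
  qed
  also have "\<dots> = fls_X_intpow (- w) ^ d * fls_const c"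
    using phom_ev[OF e(1) ring_map_fls_const] c by metis
  also have "\<dots> = fls_shift (int d * w) (fls_const c)"
    unfolding fls_X_intpow_power fls_X_intpow_times_conv_shift by simp
  finally have "fls_nth (fps_to_fls (ev fps_const e \<eta>)) 0 = fls_nth (fls_shift (int d * w) (fls_const c)) 0"
    by simp
  moreover have "int d * w \<noteq> 0" using e(2) w(1) by simp
  ultimately have "fps_nth (ev fps_const e \<eta>) 0 = 0" by simp
  moreover have "fps_nth (ev fps_const e \<eta>) 0 = ev (\<lambda>x. x) e (\<lambda>i. fps_nth (\<eta> i) 0)"
    by (subst ev_hom[OF hom]) simp
  ultimately show ?thesis by (simp add: \<eta>_def)
qed

text \<open>At a point \<open>x\<close> with independent coordinates the Jacobian has a kernel
  vector \<open>c\<close>, and a derivation with \<open>D (x i) = c i\<close> kills all values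
  \<open>f j\<close>. So some \<open>x i0\<close> is transcendental over the ring \<open>B\<close>
  of these values: the fibre of the forms through \<open>x\<close> contains a curve on which this
  coordinate tends to infinity. Sending \<open>x i0\<close> to a pole keeps the values constant, and
  the leading coefficients of the coordinates form a nontrivial common zero.\<close>

theorem forms_common_zero:
  assumes \<phi>: "\<And>j. j < E \<Longrightarrow> phom (d j) (\<phi> j)" "\<And>j. j < E \<Longrightarrow> d j > 0" "\<And>j. j < E \<Longrightarrow> pvars (\<phi> j) \<subseteq> {..<M}"
    and "E < M"
  shows "\<exists>v. (\<exists>i<M. v i \<noteq> 0) \<and> (\<forall>j<E. ev (\<lambda>x. x) (\<phi> j) v = 0)"
proof -
  have "finite (\<Union>j<E. pconsts (\<phi> j))" by (simp add: finite_pconsts)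
  then obtain k where k: "subring k" "countable k" "(\<Union>j<E. pconsts (\<phi> j)) \<subseteq> k"
    using exists_countable_subring by blast
  obtain xs where xs: "length xs = M" "transc_list k xs"
    using exists_transc_list[OF k(2)] by blast
  define x where "x i = xs ! i" for i
  define A where "A = adjoin_list k xs"
  have A: "subring A" unfolding A_def by (rule subring_adjoin_list[OF k(1)])
  have kA: "a \<in> A" if "a \<in> k" for a unfolding A_def by (rule adjoin_list_superset[OF k(1) that])
  have xA: "x i \<in> A" if "i < M" for i
    unfolding A_def x_def using that xs by (intro adjoin_list_generators[OF k(1)]) simp
  obtain c where c: "\<exists>i<M. c i \<noteq> 0" "\<And>j. j < E \<Longrightarrow> dev M (\<lambda>x. x) (\<phi> j) x c = 0"
    using more_unknowns_than_equations[of "{..<M}" E "\<lambda>j i. ev (\<lambda>x. x) (pd i (\<phi> j)) x"] \<open>E < M\<close>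
    by (auto simp: dev_def)
  obtain D where D: "derivation A D" "\<And>a. a \<in> k \<Longrightarrow> D a = 0" "map D xs = map c [0..<M]"
    using derivation_extend_transc_list[OF derivation_zero[OF k(1)] xs(2), of "map c [0..<M]"] xs(1)
    unfolding A_def by auto
  have Dx: "D (x i) = c i" if "i < M" for i
    using arg_cong[OF D(3), of "\<lambda>l. l ! i"] that xs by (simp add: x_def)
  define f where "f j = ev (\<lambda>x. x) (\<phi> j) x" for j
  define B where "B = adjoin_list k (map f [0..<E])"
  have B: "subring B" unfolding B_def by (rule subring_adjoin_list[OF k(1)])
  have Z: "subring {a \<in> A. D a = 0}"
    unfolding subring_def using subringD[OF A] derivationD[OF D(1)] derivation_uminus[OF D(1)] by auto
  have fA: "f j \<in> A" "D (f j) = 0" if j: "j < E" for j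
  proof -
    have con: "a \<in> A" "D a = 0" if "a \<in> pconsts (\<phi> j)" for a using that j k(3) kA D(2) by blast+
    show "f j \<in> A" unfolding f_def using con \<phi>(3)[OF j] xA by (intro subring_ev[OF A]) auto
    have "D (f j) = dev M (\<lambda>x. x) (\<phi> j) x (\<lambda>i. D (x i))"
      unfolding f_def using con \<phi>(3)[OF j] xA by (intro derivation_ev[OF D(1)]) auto
    also have "\<dots> = dev M (\<lambda>x. x) (\<phi> j) x c" by (rule dev_cong) (rule Dx)
    finally show "D (f j) = 0" using c(2)[OF j] by simp
  qed
  have "B \<subseteq> {a \<in> A. D a = 0}"
    unfolding B_def by (rule adjoin_list_least[OF Z]) (auto simp: kA D(2) fA)
  then have BA: "B \<subseteq> A" "\<And>a. a \<in> B \<Longrightarrow> D a = 0" by auto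
  obtain i0 where i0: "i0 < M" "c i0 \<noteq> 0" using c(1) by blast
  have tr: "transc B (x i0)"
    using transc_if_derivation[OF D(1) B BA xA[OF i0(1)]] Dx[OF i0(1)] i0(2) by simp
  note \<sigma>0 = emb_fls_const[OF B]
  obtain \<sigma>1 where \<sigma>1: "emb (adjoin B (x i0)) \<sigma>1" "\<And>a. a \<in> B \<Longrightarrow> \<sigma>1 a = fls_const a" "\<sigma>1 (x i0) = fls_X_inv"
    using emb_extend[OF \<sigma>0 matches_transc[OF \<sigma>0 tr transc_fls_X_inv]] by blast
  have "countable (adjoin B (x i0))"
    unfolding B_def by (intro countable_adjoin countable_adjoin_list k(2))
  then obtain e \<sigma> where e: "e > 0" and \<sigma>: "emb (adjoin_list (adjoin B (x i0)) xs) \<sigma>"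
      "\<And>a. a \<in> adjoin B (x i0) \<Longrightarrow> \<sigma> a = ramify e (\<sigma>1 a)"
    using emb_extend_fls_list[OF \<sigma>1(1)] by blast
  define C where "C = adjoin_list (adjoin B (x i0)) xs"
  note B' = subring_adjoin[OF B, of "x i0"]
  have BB': "a \<in> adjoin B (x i0)" if "a \<in> B" for a by (rule adjoin_superset[OF B that])
  have kB: "a \<in> B" if "a \<in> k" for a unfolding B_def by (rule adjoin_list_superset[OF k(1) that])
  have \<sigma>B: "\<sigma> a = fls_const a" if "a \<in> B" for a
    unfolding \<sigma>(2)[OF BB'[OF that]] \<sigma>1(2)[OF that] using e by (simp add: ramify_def)
  have BC: "a \<in> C" if "a \<in> B" for a unfolding C_def by (rule adjoin_list_superset[OF B' BB'[OF that]])
  have xC: "x i \<in> C" if "i < M" for i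
  proof -
    have "x i \<in> set xs" using that xs by (simp add: x_def)
    then show ?thesis unfolding C_def by (rule adjoin_list_generators[OF B'])
  qed
  define \<xi> where "\<xi> i = \<sigma> (x i)" for i
  have \<xi>i0: "\<xi> i0 = fls_X_intpow (- int e)"
    unfolding \<xi>_def \<sigma>(2)[OF adjoin_generator[OF B]] \<sigma>1(3) using e by (simp add: ramify_def)
  have ev\<xi>: "ev fls_const (\<phi> j) \<xi> = fls_const (f j)" if j: "j < E" for j
  proof -
    have con: "a \<in> B" if "a \<in> pconsts (\<phi> j)" for a using that j k(3) kB by blast
    have fB: "f j \<in> B" unfolding B_def using j by (intro adjoin_list_generators[OF k(1)]) simp
    have "\<sigma> (f j) = ev fls_const (\<phi> j) (\<lambda>i. \<sigma> (x i))"
      unfolding f_def using con \<phi>(3)[OF j] \<sigma>B BC xC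
      by (intro emb_ev[OF \<sigma>(1)[folded C_def]]) auto
    then show ?thesis using \<sigma>B[OF fB] by (simp add: \<xi>_def[abs_def])
  qed
  define w where "w = Min (fls_subdegree ` \<xi> ` {i. i < M \<and> \<xi> i \<noteq> 0})"
  have \<xi>i0_nz: "\<xi> i0 \<noteq> 0" unfolding \<xi>i0 by (rule fls_X_intpow_nonzero)
  have ne: "fls_subdegree ` \<xi> ` {i. i < M \<and> \<xi> i \<noteq> 0} \<noteq> {}" using i0(1) \<xi>i0_nz by blast
  have w_le: "\<xi> i = 0 \<or> w \<le> fls_subdegree (\<xi> i)" if "i < M" for i
    unfolding w_def using that by (auto intro: Min_le)
  have "w \<le> - int e" using w_le[OF i0(1)] \<xi>i0_nz \<xi>i0 by simp
  then have "w < 0" using e by simp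
  have "w \<in> fls_subdegree ` \<xi> ` {i. i < M \<and> \<xi> i \<noteq> 0}" unfolding w_def by (rule Min_in[OF _ ne]) simp
  then obtain i where "i < M" "\<xi> i \<noteq> 0" "w = fls_subdegree (\<xi> i)" by blast
  then have "\<exists>i<M. fls_nth (\<xi> i) w \<noteq> 0" using nth_fls_subdegree_nonzero by blast
  moreover have "ev (\<lambda>x. x) (\<phi> j) (\<lambda>i. fls_nth (\<xi> i) w) = 0" if j: "j < E" for j
    by (rule ev_leading_coefficients[OF \<phi>(1-3)[OF j] \<open>w < 0\<close> w_le ev\<xi>[OF j]])
  ultimately show ?thesis by (intro exI[of _ "\<lambda>i. fls_nth (\<xi> i) w"]) simp
qed

section \<open>Generic points\<close>

lemma tame_ev_compose:
  assumes h: "ring_map h" and "pvars e \<subseteq> {..<N}" and f: "\<And>j. j < N \<Longrightarrow> tame (f j) (f' j)"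
  shows "tame (\<lambda>v. ev h e (\<lambda>j. f j v)) (\<lambda>v x. dev N h e (\<lambda>j. f j v) (\<lambda>j. f' j v x))"
  using assms(2) by (induction e) (auto simp: dev_simps[OF h] intro: tame_const tame_add tame_mult f)

lemma emb_subset: "emb B \<sigma> \<Longrightarrow> subring A \<Longrightarrow> A \<subseteq> B \<Longrightarrow> emb A \<sigma>"
  by (auto simp: emb_def)

lemma emb_dev:
  assumes \<sigma>: "emb A \<sigma>" and h: "ring_map h" "ring_map h'"
    and "\<And>c. c \<in> pconsts e \<Longrightarrow> h c \<in> A" "\<And>c. c \<in> pconsts e \<Longrightarrow> \<sigma> (h c) = h' c"
    "pvars e \<subseteq> {..<N}" "\<And>j. j < N \<Longrightarrow> v j \<in> A" "\<And>j. j < N \<Longrightarrow> x j \<in> A"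
  shows "\<sigma> (dev N h e v x) = dev N h' e (\<lambda>j. \<sigma> (v j)) (\<lambda>j. \<sigma> (x j))"
proof -
  note A = embD(1)[OF \<sigma>]
  have c: "h c \<in> A" "\<sigma> (h c) = h' c" if "c \<in> pconsts (pd j e)" for c j
    using that pconsts_pd[of j e] assms(4,5) ring_mapD(1,2)[OF h(1)] ring_mapD(1,2)[OF h(2)]
      subringD(1,2)[OF A] embD(2,3)[OF \<sigma>] by auto
  have v: "v i \<in> A" if "i \<in> pvars (pd j e)" for i j
    using that pvars_pd[of j e] assms(6,7) by auto
  have "ev h (pd j e) v \<in> A" for j by (intro subring_ev[OF A] c v)
  then have "\<sigma> (dev N h e v x) = (\<Sum>j<N. \<sigma> (ev h (pd j e) v) * \<sigma> (x j))"
    unfolding dev_def using assms(8) by (subst emb_sum[OF \<sigma>]) (auto simp: embD[OF \<sigma>] subringD(4)[OF A])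
  also have "\<dots> = dev N h' e (\<lambda>j. \<sigma> (v j)) (\<lambda>j. \<sigma> (x j))"
    unfolding dev_def by (intro sum.cong refl arg_cong2[where f="(*)"] emb_ev[OF \<sigma>] c v)
  finally show ?thesis .
qed

lemma emb_image_adjoin:
  assumes \<sigma>: "emb B \<sigma>" and A: "subring A" "A \<subseteq> B" and z: "z \<in> B"
  shows "\<sigma> ` adjoin A z = adjoin (\<sigma> ` A) (\<sigma> z)"
proof
  note e = emb_subset[OF \<sigma> A]
  have eq: "\<sigma> (poly p z) = poly (map_poly \<sigma> p) (\<sigma> z)" if "p \<in> over A" for p
    using that A(2) by (intro emb_poly[OF \<sigma> z]) (auto simp: over_def)
  show "\<sigma> ` adjoin A z \<subseteq> adjoin (\<sigma> ` A) (\<sigma> z)"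
    unfolding adjoin_def using eq map_poly_over_image[OF e] by auto
  have "adjoin A z \<subseteq> B" by (rule adjoin_least[OF embD(1)[OF \<sigma>] A(2) z])
  then have "subring (\<sigma> ` adjoin A z)" by (intro subring_image emb_subset[OF \<sigma>] subring_adjoin A)
  then show "adjoin (\<sigma> ` A) (\<sigma> z) \<subseteq> \<sigma> ` adjoin A z"
    using adjoin_superset[OF A(1)] adjoin_generator[OF A(1)] by (intro adjoin_least) auto
qed

lemma transc_list_emb:
  assumes \<sigma>: "emb B \<sigma>"
  shows "subring A \<Longrightarrow> A \<subseteq> B \<Longrightarrow> set zs \<subseteq> B \<Longrightarrow> transc_list A zs \<Longrightarrow> transc_list (\<sigma> ` A) (map \<sigma> zs)"
proof (induction zs arbitrary: A)
  case (Cons z zs)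
  have z: "z \<in> B" using Cons.prems by simp
  have "transc (\<sigma> ` A) (\<sigma> z)" using Cons.prems z by (intro transc_emb[OF \<sigma>]) auto
  moreover have "transc_list (\<sigma> ` adjoin A z) (map \<sigma> zs)"
    using Cons.prems z by (intro Cons.IH subring_adjoin adjoin_least embD(1)[OF \<sigma>]) auto
  ultimately show ?case using emb_image_adjoin[OF \<sigma> Cons.prems(1,2) z] by simp
qed simp

lemma exists_transc_list_in:
  fixes A :: "'a::idom set"
  assumes "countable A" "\<And>j::nat. uncountable (S j)"
  shows "\<exists>zs. length zs = n \<and> transc_list A zs \<and> (\<forall>j<n. zs ! j \<in> S j)"
  using assms
proof (induction n arbitrary: A S)
  case (Suc n)
  obtain z where z: "z \<in> S 0" "transc A z" using exists_transc[OF Suc.prems(1) Suc.prems(2)] by blast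
  obtain zs where "length zs = n" "transc_list (adjoin A z) zs" "\<forall>j<n. zs ! j \<in> S (Suc j)"
    using Suc.IH[OF countable_adjoin[OF Suc.prems(1)], of "\<lambda>j. S (Suc j)"] Suc.prems(2) by blast
  then show ?case using z by (intro exI[of _ "z # zs"]) (auto simp: nth_Cons split: nat.split)
qed simp

lemma ring_map_fps_nth_0: "ring_map (\<lambda>f. fps_nth f 0)"
  by (simp add: ring_map_def)

text \<open>The inverse is produced as a family of series, so that it can be adjoined to a ring and
  invertibility survives an embedding of that ring.\<close>

lemma left_inverse_fps:
  fixes m :: "nat \<Rightarrow> nat \<Rightarrow> complex fps"
  assumes "\<And>i l. i < r \<Longrightarrow> l < r \<Longrightarrow> fps_nth (m i l) 0 = (if i = l then 1 else 0)"
  shows "\<exists>u. \<forall>s<r. \<forall>l<r. (\<Sum>i<r. u s i * m i l) = (if s = l then 1 else 0)"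
proof -
  have "\<exists>u. \<forall>l<r. (\<Sum>i<r. u i * m i l) = (if s = l then 1 else 0)" if s: "s < r" for s
  proof -
    define \<Psi> where "\<Psi> l u = (\<Sum>i<r. u i * m i l) + - (if s = l then 1 else 0)" for l u
    define \<Psi>' where "\<Psi>' l u x = (\<Sum>i<r. x i * m i l + u i * 0) + 0" for l and u x :: "nat \<Rightarrow> complex fps"
    have "\<exists>u. (\<forall>j. fps_nth (u j) 0 = (if j = s then 1 else 0)) \<and> (\<forall>l\<in>{..<r}. \<Psi> l u = 0)"
    proof (rule formal_solution[where \<Psi>' = \<Psi>'])
      show "tame (\<Psi> l) (\<Psi>' l)" for l unfolding \<Psi>_def[abs_def] \<Psi>'_def[abs_def]
        by (intro tame_add tame_sum tame_mult tame_var tame_const)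
      have sub: "(\<Sum>i<r. f i * fps_nth (m i l) 0) = f l" if "l < r" for f :: "nat \<Rightarrow> complex" and l
      proof -
        have "(\<Sum>i<r. f i * fps_nth (m i l) 0) = (\<Sum>i<r. if i = l then f i else 0)"
          using that assms by (intro sum.cong) auto
        then show ?thesis using that by simp
      qed
      show "fps_nth (\<Psi> l (\<lambda>j. fps_const (if j = s then 1 else 0))) 0 = 0" if "l \<in> {..<r}" for l
        using that sub[of l "\<lambda>j. if j = s then 1 else 0"] by (simp add: \<Psi>_def fps_sum_nth)
      show "\<exists>y. \<forall>l\<in>{..<r}. fps_nth (\<Psi>' l (\<lambda>j. fps_const (if j = s then 1 else 0)) (fvec y)) 0 = \<rho> l" for \<rho>
        using sub by (intro exI[of _ \<rho>]) (simp add: \<Psi>'_def fps_sum_nth)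
    qed
    then obtain u where "\<forall>l<r. \<Psi> l u = 0" by auto
    then show ?thesis by (intro exI[of _ u]) (simp add: \<Psi>_def eq_neg_iff_add_eq_0[symmetric])
  qed
  then have "\<forall>s. \<exists>u. s < r \<longrightarrow> (\<forall>l<r. (\<Sum>i<r. u i * m i l) = (if s = l then 1 else 0))" by blast
  then show ?thesis by (rule choice[THEN exE]) blast
qed

text \<open>The factor \<open>s\<close> covers at once the affine variety
  \<open>H = \<kappa>\<close> and the cone \<open>H = 0\<close>; \<open>regular\<close> says that
  both are smooth away from the origin. In \<open>few_equations\<close>, \<open>2 * d i - 1\<close>
  counts the conditions that the \<open>i\<close>-th equation imposes on a chain of two
  lines.\<close>

locale smooth_system =
  fixes N r :: nat and H :: "nat \<Rightarrow> pexp" and d :: "nat \<Rightarrow> nat" and \<kappa> :: "nat \<Rightarrow> complex"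
  assumes form: "i < r \<Longrightarrow> phom (d i) (H i)" and vars: "i < r \<Longrightarrow> pvars (H i) \<subseteq> {..<N}"
    and degree_pos: "i < r \<Longrightarrow> 0 < d i"
    and regular: "\<And>v s \<rho>. \<exists>j<N. v j \<noteq> 0 \<Longrightarrow> \<forall>i<r. evc (H i) v = s * \<kappa> i \<Longrightarrow>
      \<exists>x. \<forall>i<r. devc N (H i) v x = \<rho> i"
    and few_equations: "(\<Sum>i<r. 2 * d i - 1) < N"
    and nonlinear: "\<exists>i<r. 2 \<le> d i"
    and \<kappa>_nonzero: "\<exists>i<r. \<kappa> i \<noteq> 0"
begin

text \<open>This is what is needed of a generic point over \<open>k\<close>: every tangent vector there is the value of a
  derivation that is trivial on \<open>k\<close>, so that anything algebraic over \<open>k(g)\<close> can be moved along it.\<close>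

definition generic :: "complex set \<Rightarrow> (nat \<Rightarrow> complex) \<Rightarrow> bool" where
  "generic k g \<longleftrightarrow> (\<forall>\<xi>. (\<forall>i<r. devc N (H i) g \<xi> = 0) \<longrightarrow>
     (\<exists>D. derivation (adjoin_list k (map g [0..<N])) D \<and> (\<forall>a\<in>k. D a = 0) \<and> (\<forall>j<N. D (g j) = \<xi> j)))"

text \<open>Near \<open>y\<close> the level set is a graph: an arc with arbitrary coordinates is
  corrected along directions \<open>Y l\<close> dual to the differentials. Arcs \<open>z j\<close>
  that are algebraically independent over the constants give a point over Laurent series. Embedding
  the countable ring generated by it into the complex numbers yields \<open>g\<close>, and
  \<open>\<tau>\<close> is the inverse of this embedding, so that \<open>g\<close> specializes to
  \<open>y\<close>.\<close>

theorem generic_point: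
  assumes k: "subring k" "countable k" "\<And>i. i < r \<Longrightarrow> pconsts (H i) \<subseteq> k" "\<And>i. i < r \<Longrightarrow> s * \<kappa> i \<in> k"
    and y: "\<exists>j<N. y j \<noteq> 0" "\<forall>i<r. evc (H i) y = s * \<kappa> i"
  shows "\<exists>g \<tau> \<gamma>. (\<forall>i<r. evc (H i) g = s * \<kappa> i) \<and> generic k g \<and> emb (adjoin_list k (map g [0..<N])) \<tau> \<and>
    (\<forall>a\<in>k. \<tau> a = fls_const a) \<and> (\<forall>j<N. \<tau> (g j) = fps_to_fls (\<gamma> j) \<and> fps_nth (\<gamma> j) 0 = y j)"
proof -
  have "\<forall>l. \<exists>x. \<forall>i<r. devc N (H i) y x = (if i = l then 1 else 0)"
    using regular[OF y] by (intro allI)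
  then obtain Y where Y: "\<And>l i. i < r \<Longrightarrow> devc N (H i) y (Y l) = (if i = l then 1 else 0)" by metis
  define k1 where "k1 = adjoin_list k (map y [0..<N] @ concat (map (\<lambda>l. map (Y l) [0..<N]) [0..<r]))"
  have k1: "subring k1" "countable k1"
    unfolding k1_def by (rule subring_adjoin_list[OF k(1)], rule countable_adjoin_list[OF k(2)])
  have kk1: "a \<in> k1" if "a \<in> k" for a unfolding k1_def by (rule adjoin_list_superset[OF k(1) that])
  have Yk1: "Y l j \<in> k1" if "l < r" "j < N" for j l
    unfolding k1_def using that by (intro adjoin_list_generators[OF k(1)]) fastforce
  have yk1: "y j \<in> k1" if "j < N" for j
    unfolding k1_def using that by (intro adjoin_list_generators[OF k(1)]) simp
  define K where "K = fls_const ` k1"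
  have K: "subring K" "countable K" unfolding K_def using k1 by (auto intro: subring_image[OF emb_fls_const])
  \<comment> \<open>Arcs with constant term \<open>y j\<close>; there are uncountably many, so
    independent ones can be chosen among them.\<close>
  define S where "S j = range (\<lambda>c. fps_to_fls (fps_const (y j) + fps_const c * fps_X))" for j
  have unc: "uncountable (S j)" for j
  proof
    assume "countable (S j)"
    moreover have "inj (\<lambda>c. fps_to_fls (fps_const (y j) + fps_const c * fps_X))"
    proof (rule injI)
      fix a b assume "fps_to_fls (fps_const (y j) + fps_const a * fps_X) = fps_to_fls (fps_const (y j) + fps_const b * fps_X)"
      then have "fps_const (y j) + fps_const a * fps_X = fps_const (y j) + fps_const b * fps_X"
        by (simp only: fps_to_fls_eq_iff)
      then have "fps_nth (fps_const (y j) + fps_const a * fps_X) 1 = fps_nth (fps_const (y j) + fps_const b * fps_X) 1"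
        by simp
      then show "a = b" by simp
    qed
    ultimately show False unfolding S_def using countable_image_inj_on uncountable_UNIV_complex by blast
  qed
  obtain zs where zs: "length zs = N" "transc_list K zs" "\<forall>j<N. zs ! j \<in> S j"
    using exists_transc_list_in[of K S N, OF K(2) unc] by (elim exE conjE)
  have "\<forall>j\<in>{..<N}. \<exists>c. zs ! j = fps_to_fls (fps_const (y j) + fps_const c * fps_X)"
    using zs(3) unfolding S_def by blast
  then obtain c where c: "\<And>j. j < N \<Longrightarrow> zs ! j = fps_to_fls (fps_const (y j) + fps_const (c j) * fps_X)"
    unfolding bchoice_iff by blast
  define z where "z j = fps_const (y j) + fps_const (c j) * fps_X" for j
  have z: "zs ! j = fps_to_fls (z j)" if "j < N" for j using c[OF that] by (simp add: z_def)
  have z0: "fps_nth (z j) 0 = y j" for j by (simp add: z_def)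
  define \<Psi> where "\<Psi> i w = ev fps_const (H i) (\<lambda>j. z j + (\<Sum>l<r. w l * fps_const (Y l j))) + - fps_const (s * \<kappa> i)" for i w
  define \<Psi>' where "\<Psi>' i w x = dev N fps_const (H i) (\<lambda>j. z j + (\<Sum>l<r. w l * fps_const (Y l j)))
     (\<lambda>j. 0 + (\<Sum>l<r. x l * fps_const (Y l j) + w l * 0)) + 0" for i and w x :: "nat \<Rightarrow> complex fps"
  have "\<exists>w. (\<forall>j. fps_nth (w j) 0 = 0) \<and> (\<forall>i\<in>{..<r}. \<Psi> i w = 0)"
  proof (rule formal_solution[where \<Psi>' = \<Psi>'])
    fix i assume i: "i \<in> {..<r}"
    then show "tame (\<Psi> i) (\<Psi>' i)" unfolding \<Psi>_def[abs_def] \<Psi>'_def[abs_def]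
      by (intro tame_add[where g = "\<lambda>w. - fps_const (s * \<kappa> i)"] tame_ev_compose tame_add tame_sum tame_mult tame_var tame_const vars) auto
    show "fps_nth (\<Psi> i (\<lambda>j. fps_const 0)) 0 = 0"
      using i y(2) by (simp add: \<Psi>_def ev_hom[OF ring_map_fps_nth_0] z0)
  next
    fix \<rho> :: "nat \<Rightarrow> complex"
    have "fps_nth (\<Psi>' i (\<lambda>j. fps_const 0) (fvec \<rho>)) 0 = \<rho> i" if i: "i < r" for i
    proof -
      have "fps_nth (\<Psi>' i (\<lambda>j. fps_const 0) (fvec \<rho>)) 0 =
          devc N (H i) y (\<lambda>j. \<Sum>l<r. \<rho> l * Y l j)"
        by (simp add: \<Psi>'_def dev_hom[OF ring_map_fps_nth_0] z0 fps_sum_nth)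
      also have "\<dots> = (\<Sum>l<r. if i = l then \<rho> l else 0)"
        unfolding dev_sum dev_scale using Y[OF i] by (intro sum.cong) auto
      finally show ?thesis using i by simp
    qed
    then show "\<exists>x. \<forall>i\<in>{..<r}. fps_nth (\<Psi>' i (\<lambda>j. fps_const 0) (fvec x)) 0 = \<rho> i"
      by (intro exI[of _ \<rho>]) simp
  qed
  then obtain w where w: "\<And>j. fps_nth (w j) 0 = 0" "\<And>i. i < r \<Longrightarrow> \<Psi> i w = 0" by auto
  define \<gamma> where "\<gamma> j = z j + (\<Sum>l<r. w l * fps_const (Y l j))" for j
  have \<gamma>0: "fps_nth (\<gamma> j) 0 = y j" for j by (simp add: \<gamma>_def z0 w fps_sum_nth)
  have H\<gamma>: "ev fps_const (H i) \<gamma> = fps_const (s * \<kappa> i)" if "i < r" for i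
    using w(2)[OF that] unfolding \<Psi>_def \<gamma>_def[abs_def]
    by (simp only: add_uminus_conv_diff right_minus_eq)
  define m where "m i l = dev N fps_const (H i) \<gamma> (\<lambda>j. fps_const (Y l j))" for i l
  have "fps_nth (m i l) 0 = (if i = l then 1 else 0)" if "i < r" for i l
    using Y[OF that] by (simp add: m_def dev_hom[OF ring_map_fps_nth_0] \<gamma>0)
  \<comment> \<open>The inverse of the matrix of differentials along the corrected arc joins the
    ring, to be used after the passage to numbers.\<close>
  then obtain U where U: "\<And>a l. a < r \<Longrightarrow> l < r \<Longrightarrow> (\<Sum>i<r. U a i * m i l) = (if a = l then 1 else 0)"
    using left_inverse_fps[of r m] by blast
  define Ls where "Ls = zs @ map (\<lambda>l. fps_to_fls (w l)) [0..<r] @ concat (map (\<lambda>a. map (\<lambda>i. fps_to_fls (U a i)) [0..<r]) [0..<r])"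
  define R where "R = adjoin_list K Ls"
  have R: "subring R" unfolding R_def by (rule subring_adjoin_list[OF K(1)])
  have KR: "K \<subseteq> R" unfolding R_def using adjoin_list_superset[OF K(1)] by blast
  have LsR: "set Ls \<subseteq> R" unfolding R_def using adjoin_list_generators[OF K(1)] by blast
  have zsR: "set zs \<subseteq> R" using LsR by (simp add: Ls_def)
  have wR: "fps_to_fls (w l) \<in> R" if "l < r" for l using LsR that by (auto simp: Ls_def)
  have UR: "fps_to_fls (U a i) \<in> R" if "a < r" "i < r" for a i
  proof -
    have "fps_to_fls (U a i) \<in> set Ls" unfolding Ls_def using that by fastforce
    then show ?thesis using LsR by blast
  qed
  have zR: "fps_to_fls (z j) \<in> R" if "j < N" for j using zsR zs(1) z[OF that] that by (metis nth_mem subsetD)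
  have cR: "fls_const a \<in> R" if "a \<in> k1" for a using KR that by (auto simp: K_def)
  have "emb K (\<lambda>a. fls_nth a 0)"
    using K(1) by (auto simp: emb_def K_def)
  then obtain \<sigma> where \<sigma>: "emb R \<sigma>" "\<And>a. a \<in> K \<Longrightarrow> \<sigma> a = fls_nth a 0"
    using emb_extend_complex_list[OF _ K(2)] unfolding R_def by blast
  have \<sigma>c: "\<sigma> (fls_const a) = a" if "a \<in> k1" for a using \<sigma>(2) that by (simp add: K_def)
  define zc wc g where "zc j = \<sigma> (fps_to_fls (z j))" and "wc l = \<sigma> (fps_to_fls (w l))" and
    "g j = \<sigma> (fps_to_fls (\<gamma> j))" for j l
  have \<gamma>eq: "fps_to_fls (\<gamma> j) = fps_to_fls (z j) + (\<Sum>l<r. fps_to_fls (w l) * fls_const (Y l j))" for j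
    unfolding \<gamma>_def by (simp add: ring_map_sum[OF ring_map_fps_to_fls] fls_times_fps_to_fls)
  have \<gamma>R: "fps_to_fls (\<gamma> j) \<in> R" if "j < N" for j
    unfolding \<gamma>eq using zR wR cR Yk1 that by (intro subringD(3,4)[OF R] subring_sum[OF R]) auto
  have g: "g j = zc j + (\<Sum>l<r. wc l * Y l j)" if "j < N" for j
  proof -
    have "(\<Sum>l<r. fps_to_fls (w l) * fls_const (Y l j)) \<in> R"
      using wR cR Yk1 that by (intro subringD(4)[OF R] subring_sum[OF R]) auto
    then have "g j = zc j + \<sigma> (\<Sum>l<r. fps_to_fls (w l) * fls_const (Y l j))"
      unfolding g_def \<gamma>eq zc_def using zR[OF that] by (intro embD(4)[OF \<sigma>(1)]) auto
    also have "\<sigma> (\<Sum>l<r. fps_to_fls (w l) * fls_const (Y l j)) = (\<Sum>l<r. \<sigma> (fps_to_fls (w l) * fls_const (Y l j)))"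
      using wR cR Yk1 that by (intro emb_sum[OF \<sigma>(1)] subringD(4)[OF R]) auto
    also have "\<dots> = (\<Sum>l<r. wc l * Y l j)"
      unfolding wc_def using wR cR Yk1 \<sigma>c that by (intro sum.cong refl) (simp add: embD[OF \<sigma>(1)])
    finally show ?thesis .
  qed
  have con: "a \<in> k1" if "a \<in> pconsts (H i)" "i < r" for a i using that k(3) kk1 by blast
  have Hg: "evc (H i) g = s * \<kappa> i" if i: "i < r" for i
  proof -
    have "\<sigma> (ev fls_const (H i) (\<lambda>j. fps_to_fls (\<gamma> j))) = ev (\<lambda>x. x) (H i) (\<lambda>j. \<sigma> (fps_to_fls (\<gamma> j)))"
      using con i cR \<sigma>c \<gamma>R vars[OF i] by (intro emb_ev[OF \<sigma>(1)]) auto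
    moreover have "ev fls_const (H i) (\<lambda>j. fps_to_fls (\<gamma> j)) = fls_const (s * \<kappa> i)"
      using arg_cong[OF H\<gamma>[OF i], of fps_to_fls] by (simp add: ev_hom[OF ring_map_fps_to_fls])
    ultimately show ?thesis using \<sigma>c[OF kk1[OF k(4)[OF i]]] by (simp add: g_def[abs_def])
  qed
  define Uc where "Uc a i = \<sigma> (fps_to_fls (U a i))" for a i
  have inv: "(\<Sum>i<r. Uc a i * devc N (H i) g (Y l)) = (if a = l then 1 else 0)" if al: "a < r" "l < r" for a l
  proof -
    define mm where "mm i = dev N fls_const (H i) (\<lambda>j. fps_to_fls (\<gamma> j)) (\<lambda>j. fls_const (Y l j))" for i
    have mm: "fps_to_fls (m i l) = mm i" for i
      by (simp add: m_def mm_def dev_hom[OF ring_map_fps_to_fls])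
    have mmR: "mm i \<in> R" if i: "i < r" for i
    proof -
      have "ev fls_const (pd j (H i)) (\<lambda>j. fps_to_fls (\<gamma> j)) \<in> R" for j
        using pconsts_pd[of j "H i"] pvars_pd[of j "H i"] con i cR \<gamma>R vars[OF i] subringD(1,2)[OF k1(1)]
        by (intro subring_ev[OF R]) (auto simp del: fls_const_0 fls_const_1)
      then show ?thesis unfolding mm_def dev_def using cR Yk1 al by (intro subring_sum[OF R] subringD(4)[OF R]) auto
    qed
    have "\<sigma> (mm i) = devc N (H i) (\<lambda>j. \<sigma> (fps_to_fls (\<gamma> j))) (\<lambda>j. \<sigma> (fls_const (Y l j)))" if i: "i < r" for i
      unfolding mm_def using con i cR \<gamma>R vars[OF i] \<sigma>c Yk1 al by (intro emb_dev[OF \<sigma>(1)]) auto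
    also have "\<dots> i = devc N (H i) g (Y l)" for i
      unfolding g_def[abs_def, symmetric] using \<sigma>c Yk1 al by (intro dev_cong) auto
    finally have \<sigma>mm: "\<sigma> (mm i) = devc N (H i) g (Y l)" if "i < r" for i using that .
    have "(\<Sum>i<r. Uc a i * devc N (H i) g (Y l)) = (\<Sum>i<r. \<sigma> (fps_to_fls (U a i) * mm i))"
      using \<sigma>mm UR mmR al by (intro sum.cong refl) (simp add: Uc_def embD[OF \<sigma>(1)])
    also have "\<dots> = \<sigma> (\<Sum>i<r. fps_to_fls (U a i) * mm i)"
      using UR mmR al by (intro emb_sum[OF \<sigma>(1), symmetric] subringD(4)[OF R]) auto
    also have "(\<Sum>i<r. fps_to_fls (U a i) * mm i) = fps_to_fls (\<Sum>i<r. U a i * m i l)"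
      by (simp add: ring_map_sum[OF ring_map_fps_to_fls] fls_times_fps_to_fls mm)
    also have "\<sigma> \<dots> = (if a = l then 1 else 0)"
      using U[OF al] embD(2,3)[OF \<sigma>(1)] by simp
    finally show ?thesis .
  qed
  \<comment> \<open>Independence of the \<open>zc j\<close> permits a derivation with
    \<open>D (zc j) = \<xi> j\<close>. As \<open>\<xi>\<close> is tangent, differentiating the
    equations at \<open>g\<close> leaves a homogeneous system for the \<open>D (wc l)\<close>, which
    vanish by invertibility; hence \<open>D (g j) = \<xi> j\<close>.\<close>
  have "generic k g" unfolding generic_def
  proof (intro allI impI)
    fix \<xi> :: "nat \<Rightarrow> complex" assume \<xi>: "\<forall>i<r. devc N (H i) g \<xi> = 0"
    have zs_eq: "zs = map (\<lambda>j. fps_to_fls (z j)) [0..<N]"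
      using zs(1) z by (intro nth_equalityI) auto
    have \<sigma>K: "\<sigma> ` K = k1" unfolding K_def image_image using \<sigma>c by simp
    have "transc_list (\<sigma> ` K) (map \<sigma> zs)"
      by (rule transc_list_emb[OF \<sigma>(1) K(1) KR zsR zs(2)])
    then have "transc_list k1 (map zc [0..<N])" unfolding \<sigma>K zs_eq by (simp add: zc_def[abs_def] comp_def)
    then obtain D0 where D0: "derivation (adjoin_list k1 (map zc [0..<N])) D0" "\<And>a. a \<in> k1 \<Longrightarrow> D0 a = 0"
        "map D0 (map zc [0..<N]) = map \<xi> [0..<N]"
      using derivation_extend_transc_list[OF derivation_zero[OF k1(1)], of "map zc [0..<N]" "map \<xi> [0..<N]"] by auto
    define A0 where "A0 = adjoin_list k1 (map zc [0..<N])"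
    define A1 where "A1 = adjoin_list A0 (map wc [0..<r])"
    obtain D where D: "derivation A1 D" "\<And>a. a \<in> A0 \<Longrightarrow> D a = D0 a"
      using derivation_extend_list[OF D0(1)] unfolding A0_def A1_def by blast
    have A0: "subring A0" unfolding A0_def by (rule subring_adjoin_list[OF k1(1)])
    note A1 = derivationD(1)[OF D(1)]
    have kA0: "a \<in> A0" if "a \<in> k1" for a unfolding A0_def by (rule adjoin_list_superset[OF k1(1) that])
    have zA0: "zc j \<in> A0" if "j < N" for j unfolding A0_def using that by (intro adjoin_list_generators[OF k1(1)]) simp
    have A01: "a \<in> A1" if "a \<in> A0" for a unfolding A1_def by (rule adjoin_list_superset[OF A0 that])
    have wA1: "wc l \<in> A1" if "l < r" for l unfolding A1_def using that by (intro adjoin_list_generators[OF A0]) simp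
    have Dk: "D a = 0" if "a \<in> k1" for a using D(2)[OF kA0[OF that]] D0(2)[OF that] by simp
    have Dz: "D (zc j) = \<xi> j" if "j < N" for j
      using D(2)[OF zA0[OF that]] arg_cong[OF D0(3), of "\<lambda>l. l ! j"] that by simp
    have YA1: "Y l j \<in> A1" if "l < r" "j < N" for l j using A01 kA0 Yk1 that by blast
    have gA1: "g j \<in> A1" if "j < N" for j
      using A01[OF zA0[OF that]] wA1 YA1 that g[OF that] by (auto intro!: subringD(3,4)[OF A1] subring_sum[OF A1])
    have Dg: "D (g j) = \<xi> j + (\<Sum>l<r. D (wc l) * Y l j)" if j: "j < N" for j
    proof -
      have "D (g j) = D (zc j) + D (\<Sum>l<r. wc l * Y l j)"
        unfolding g[OF j] using A01[OF zA0[OF j]] wA1 YA1 j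
        by (intro derivationD(2)[OF D(1)] subring_sum[OF A1] subringD(4)[OF A1]) auto
      also have "D (\<Sum>l<r. wc l * Y l j) = (\<Sum>l<r. D (wc l * Y l j))"
        using wA1 YA1 j by (intro derivation_sum[OF D(1)] subringD(4)[OF A1]) auto
      also have "\<dots> = (\<Sum>l<r. D (wc l) * Y l j)"
        using wA1 YA1 Yk1 Dk j by (intro sum.cong refl) (simp add: derivationD(3)[OF D(1)])
      finally show ?thesis by (simp add: Dz[OF j])
    qed
    have dH: "(\<Sum>l<r. D (wc l) * devc N (H i) g (Y l)) = 0" if i: "i < r" for i
    proof -
      have "D (evc (H i) g) = devc N (H i) g (\<lambda>j. D (g j))"
        using con i A01 kA0 Dk vars[OF i] gA1 by (intro derivation_ev[OF D(1)]) auto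
      also have "\<dots> = devc N (H i) g (\<lambda>j. \<xi> j + (\<Sum>l<r. D (wc l) * Y l j))"
        by (rule dev_cong) (rule Dg)
      also have "\<dots> = (\<Sum>l<r. D (wc l) * devc N (H i) g (Y l))"
        using \<xi> i by (simp add: dev_add dev_sum dev_scale)
      finally show ?thesis using Hg[OF i] Dk[OF kk1[OF k(4)[OF i]]] by simp
    qed
    have Dw: "D (wc a) = 0" if a: "a < r" for a
    proof -
      have "0 = (\<Sum>i<r. Uc a i * (\<Sum>l<r. D (wc l) * devc N (H i) g (Y l)))" using dH by simp
      also have "\<dots> = (\<Sum>l<r. D (wc l) * (\<Sum>i<r. Uc a i * devc N (H i) g (Y l)))"
        unfolding sum_distrib_left by (subst sum.swap) (simp add: mult_ac)
      also have "\<dots> = (\<Sum>l<r. if a = l then D (wc l) else 0)" using inv a by (intro sum.cong) auto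
      finally show ?thesis using a by simp
    qed
    have "D (g j) = \<xi> j" if "j < N" for j using Dg[OF that] Dw by simp
    moreover have "derivation (adjoin_list k (map g [0..<N])) D"
      using kk1 kA0 A01 gA1
      by (intro derivation_subset[OF D(1)] subring_adjoin_list[OF k(1)] adjoin_list_least[OF A1]) auto
    ultimately show "\<exists>D. derivation (adjoin_list k (map g [0..<N])) D \<and> (\<forall>a\<in>k. D a = 0) \<and> (\<forall>j<N. D (g j) = \<xi> j)"
      using Dk kk1 by blast
  qed
  moreover
  define \<tau> where "\<tau> = the_inv_into R \<sigma>"
  have \<tau>: "emb (\<sigma> ` R) \<tau>" "\<And>a. a \<in> R \<Longrightarrow> \<tau> (\<sigma> a) = a"
    unfolding \<tau>_def using emb_inverse[OF \<sigma>(1)] by blast+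
  have \<tau>k: "\<tau> a = fls_const a" if "a \<in> k" for a
    using \<tau>(2)[OF cR[OF kk1[OF that]]] \<sigma>c[OF kk1[OF that]] by simp
  moreover have "emb (adjoin_list k (map g [0..<N])) \<tau>"
  proof (intro emb_subset[OF \<tau>(1)] subring_adjoin_list[OF k(1)] adjoin_list_least[OF subring_image[OF \<sigma>(1)]])
    show "k \<subseteq> \<sigma> ` R" using cR[OF kk1] \<sigma>c[OF kk1] by (metis image_eqI subsetI)
    show "set (map g [0..<N]) \<subseteq> \<sigma> ` R" using \<gamma>R by (auto simp: g_def)
  qed
  moreover have "\<tau> (g j) = fps_to_fls (\<gamma> j)" if "j < N" for j unfolding g_def by (rule \<tau>(2)[OF \<gamma>R[OF that]])
  ultimately show ?thesis using Hg \<gamma>0 by blast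
qed

end

section \<open>Free lines\<close>

lemma root_factor:
  assumes "poly p t = 0"
  obtains q where "p = [:- t, 1:] * (q :: 'a::comm_ring_1 poly)"
  using assms unfolding poly_eq_0_iff_dvd by (rule dvdE)

text \<open>A homomorphism of vector bundles on the projective line that is surjective at every point,
  including infinity.\<close>

locale poly_matrix =
  fixes N r :: nat and m :: "nat \<Rightarrow> nat \<Rightarrow> complex poly" and \<delta> :: "nat \<Rightarrow> nat"
  assumes deg: "i < r \<Longrightarrow> j < N \<Longrightarrow> degree (m i j) \<le> \<delta> i"
    and onto: "\<And>t \<rho>. \<exists>x. \<forall>i<r. (\<Sum>j<N. poly (m i j) t * x j) = \<rho> i"
    and onto_infinity: "\<And>\<rho>. \<exists>x. \<forall>i<r. (\<Sum>j<N. poly.coeff (m i j) (\<delta> i) * x j) = \<rho> i"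
begin

definition app :: "nat \<Rightarrow> (nat \<Rightarrow> complex poly) \<Rightarrow> complex poly" where
  "app i x = (\<Sum>j<N. m i j * x j)"

lemma app_add: "app i (\<lambda>j. x j + y j) = app i x + app i y"
  by (simp add: app_def distrib_left sum.distrib)

lemma app_diff: "app i (\<lambda>j. x j - y j) = app i x - app i y"
  by (simp add: app_def right_diff_distrib sum_subtractf)

lemma app_mult: "app i (\<lambda>j. f * x j) = f * app i x"
  by (simp add: app_def sum_distrib_left mult_ac)

lemma app_sum: "app i (\<lambda>j. \<Sum>l\<in>L. x l j) = (\<Sum>l\<in>L. app i (x l))"
  unfolding app_def sum_distrib_left by (rule sum.swap)

lemma poly_app: "poly (app i x) t = (\<Sum>j<N. poly (m i j) t * poly (x j) t)"
  by (simp add: app_def poly_sum)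

lemma degree_app:
  assumes "i < r" "\<And>j. j < N \<Longrightarrow> degree (x j) \<le> e"
  shows "degree (app i x) \<le> \<delta> i + e"
  unfolding app_def
proof (rule degree_sum_le)
  fix j assume "j \<in> {..<N}"
  then show "degree (m i j * x j) \<le> \<delta> i + e"
    using deg[OF assms(1), of j] assms(2)[of j] degree_mult_le[of "m i j" "x j"] by simp
qed simp

lemma coeff_app_top:
  assumes i: "i < r" and "\<And>j. j < N \<Longrightarrow> degree (x j) \<le> e"
  shows "poly.coeff (app i x) (\<delta> i + e) = (\<Sum>j<N. poly.coeff (m i j) (\<delta> i) * poly.coeff (x j) e)"
  unfolding app_def coeff_sum
proof (rule sum.cong[OF refl])
  fix j assume "j \<in> {..<N}"
  then have dm: "degree (m i j) \<le> \<delta> i" and dx: "degree (x j) \<le> e" using deg i assms(2) by auto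
  have "poly.coeff (m i j) a * poly.coeff (x j) (\<delta> i + e - a) =
      (if a = \<delta> i then poly.coeff (m i j) (\<delta> i) * poly.coeff (x j) e else 0)" if "a \<le> \<delta> i + e" for a
    using that dm dx by (cases a "\<delta> i" rule: linorder_cases) (auto simp: coeff_eq_0)
  then show "poly.coeff (m i j * x j) (\<delta> i + e) = poly.coeff (m i j) (\<delta> i) * poly.coeff (x j) e"
    by (simp add: coeff_mult)
qed

text \<open>Surjectivity at infinity removes the top coefficient by an element of the image; in
  \<open>peel_root\<close> surjectivity at \<open>t\<close> does the same with the value at
  \<open>t\<close>.\<close>

lemma peel_infinity:
  assumes R: "\<And>i. i < r \<Longrightarrow> degree (R i) \<le> \<delta> i + Suc e"
  shows "\<exists>y R'. (\<forall>j<N. degree (y j) \<le> Suc e) \<and> (\<forall>i<r. degree (R' i) \<le> \<delta> i + e \<and> R i = app i y + R' i)"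
proof -
  obtain x where x: "\<And>i. i < r \<Longrightarrow> (\<Sum>j<N. poly.coeff (m i j) (\<delta> i) * x j) = poly.coeff (R i) (\<delta> i + Suc e)"
    using onto_infinity[of "\<lambda>i. poly.coeff (R i) (\<delta> i + Suc e)"] by blast
  define y where "y j = monom (x j) (Suc e)" for j
  have dy: "degree (y j) \<le> Suc e" for j by (simp add: y_def degree_monom_le)
  have "degree (R i - app i y) \<le> \<delta> i + e" if i: "i < r" for i
  proof (rule degree_le, intro allI impI)
    fix a assume a: "a > \<delta> i + e"
    show "poly.coeff (R i - app i y) a = 0"
    proof (cases "a = \<delta> i + Suc e")
      case True
      show ?thesis unfolding True coeff_diff coeff_app_top[OF i dy] using x[OF i] by (simp add: y_def)
    next
      case False
      then have "a > \<delta> i + Suc e" using a by simp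
      then show ?thesis using R[OF i] degree_app[OF i, of y "Suc e"] dy by (simp add: coeff_eq_0)
    qed
  qed
  then show ?thesis using dy by - (rule exI[of _ y], rule exI[of _ "\<lambda>i. R i - app i y"], simp)
qed

lemma peel_root:
  assumes R: "\<And>i. i < r \<Longrightarrow> degree (R i) \<le> \<delta> i + Suc e"
  shows "\<exists>y R'. (\<forall>j<N. degree (y j) \<le> Suc e) \<and> (\<forall>i<r. degree (R' i) \<le> \<delta> i + e \<and> R i = app i y + [:- t, 1:] * R' i)"
proof -
  obtain x where x: "\<And>i. i < r \<Longrightarrow> (\<Sum>j<N. poly (m i j) t * x j) = poly (R i) t"
    using onto[of t "\<lambda>i. poly (R i) t"] by blast
  define y where "y j = [:x j:]" for j
  have dy: "degree (y j) \<le> Suc e" for j by (simp add: y_def)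
  have "\<forall>i\<in>{..<r}. \<exists>S. degree S \<le> \<delta> i + e \<and> R i = app i y + [:- t, 1:] * S"
  proof
    fix i assume "i \<in> {..<r}"
    then have i: "i < r" by simp
    have "poly (R i - app i y) t = 0" using x[OF i] by (simp add: poly_app y_def)
    then obtain S where S: "R i - app i y = [:- t, 1:] * S" by (rule root_factor)
    have d: "degree (R i - app i y) \<le> \<delta> i + Suc e"
      using R[OF i] degree_app[OF i, of y "Suc e"] dy by (intro degree_diff_le) auto
    have "degree S \<le> \<delta> i + e"
    proof (cases "S = 0")
      case False
      then have "degree ([:- t, 1:] * S) = Suc (degree S)" by (subst degree_mult_eq) auto
      then show ?thesis using d S by simp
    qed simp
    then show "\<exists>S. degree S \<le> \<delta> i + e \<and> R i = app i y + [:- t, 1:] * S" using S by (auto simp: algebra_simps)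
  qed
  then obtain R' where "\<forall>i\<in>{..<r}. degree (R' i) \<le> \<delta> i + e \<and> R i = app i y + [:- t, 1:] * R' i"
    unfolding bchoice_iff by blast
  then show ?thesis using dy by - (rule exI[of _ y], rule exI[of _ R'], simp)
qed

lemma peel_infinity_many:
  assumes "\<And>i. i < r \<Longrightarrow> degree (R i) \<le> \<delta> i + e + l"
  shows "\<exists>y R'. (\<forall>j<N. degree (y j) \<le> e + l) \<and> (\<forall>i<r. degree (R' i) \<le> \<delta> i + e \<and> R i = app i y + R' i)"
  using assms
proof (induction l arbitrary: R)
  case 0
  then show ?case by - (rule exI[of _ "\<lambda>_. 0"], rule exI[of _ R], (simp add: app_def))
next
  case (Suc l)
  obtain y R1 where y: "\<forall>j<N. degree (y j) \<le> Suc (e + l)"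
      "\<forall>i<r. degree (R1 i) \<le> \<delta> i + (e + l) \<and> R i = app i y + R1 i"
    using peel_infinity[of R "e + l"] Suc.prems by (metis add.assoc add_Suc_right)
  obtain z R2 where z: "\<forall>j<N. degree (z j) \<le> e + l"
      "\<forall>i<r. degree (R2 i) \<le> \<delta> i + e \<and> R1 i = app i z + R2 i"
    using Suc.IH[of R1] y(2) by (metis add.assoc)
  show ?case
  proof (rule exI[of _ "\<lambda>j. y j + z j"], rule exI[of _ R2], intro conjI allI impI)
    show "degree (y j + z j) \<le> e + Suc l" if "j < N" for j
      using y(1) z(1) that by (intro degree_add_le) (auto simp: le_Suc_eq)
    show "R i = app i (\<lambda>j. y j + z j) + R2 i" if "i < r" for i
      using y(2) z(2) that by (simp add: app_add)
  qed (use z in auto)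
qed

lemma peel_poly:
  assumes "f \<noteq> 0" "\<And>i. i < r \<Longrightarrow> degree (R i) \<le> \<delta> i + e + degree f"
  shows "\<exists>y R'. (\<forall>j<N. degree (y j) \<le> e + degree f) \<and> (\<forall>i<r. degree (R' i) \<le> \<delta> i + e \<and> R i = app i y + f * R' i)"
  using assms
proof (induction "degree f" arbitrary: f R)
  case 0
  then obtain c where c: "f = [:c:]" by (metis degree_eq_zeroE)
  then show ?case using 0
    by - (rule exI[of _ "\<lambda>_. 0"], rule exI[of _ "\<lambda>i. smult (inverse c) (R i)"], (simp add: app_def))
next
  case (Suc l)
  obtain t where "poly f t = 0" using alg_closed_imp_poly_has_root[of f] Suc.hyps(2) by auto
  then obtain g where g: "f = [:- t, 1:] * g" by (rule root_factor)
  then have "g \<noteq> 0" using Suc.prems by auto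
  have "degree f = Suc (degree g)" unfolding g using \<open>g \<noteq> 0\<close> by (subst degree_mult_eq) auto
  then have dg: "degree g = l" using Suc.hyps(2) by simp
  obtain y R1 where y: "\<forall>j<N. degree (y j) \<le> Suc (e + l)"
      "\<forall>i<r. degree (R1 i) \<le> \<delta> i + (e + l) \<and> R i = app i y + [:- t, 1:] * R1 i"
    using peel_root[of R "e + l" t] Suc.prems(2) Suc.hyps(2) by (metis add.assoc add_Suc_right)
  obtain z R2 where z: "\<forall>j<N. degree (z j) \<le> e + l"
      "\<forall>i<r. degree (R2 i) \<le> \<delta> i + e \<and> R1 i = app i z + g * R2 i"
    using Suc.hyps(1)[of g R1] y(2) dg \<open>g \<noteq> 0\<close> by (metis add.assoc)
  show ?case
  proof (rule exI[of _ "\<lambda>j. y j + [:- t, 1:] * z j"], rule exI[of _ R2], intro conjI allI impI)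
    show "degree (y j + [:- t, 1:] * z j) \<le> e + degree f" if "j < N" for j
    proof (rule degree_add_le)
      show "degree (y j) \<le> e + degree f" using y(1) that Suc.hyps(2) by auto
      have "degree ([:- t, 1:] * z j) \<le> degree [:- t, 1:] + degree (z j)" by (rule degree_mult_le)
      then show "degree ([:- t, 1:] * z j) \<le> e + degree f" using z(1) that Suc.hyps(2) by fastforce
    qed
    show "R i = app i (\<lambda>j. y j + [:- t, 1:] * z j) + f * R2 i" if "i < r" for i
      using y(2) z(2) that unfolding app_add app_mult g by (simp only: distrib_left mult.assoc add.assoc)
  qed (use z in auto)
qed

text \<open>The images of the vectors \<open>c a\<close> form a matrix \<open>v\<close> that is the
  identity at 0. Together with the unit vector of index \<open>l\<close> there are
  \<open>r + 1\<close> columns, hence a linear relation. Its last coefficient is nonzero, since a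
  nontrivial relation among the first \<open>r\<close> columns would be divisible by the variable
  again and again.\<close>

lemma torsion_cokernel: "\<exists>f x. f \<noteq> 0 \<and> (\<forall>i<r. app i x = (if i = l then f else 0))"
proof -
  have "\<exists>c. \<forall>a. \<forall>i<r. (\<Sum>j<N. poly (m i j) 0 * c a j) = (if i = a then 1 else 0)"
    using onto[of 0] by (intro choice allI)
  then obtain c where c: "\<And>a i. i < r \<Longrightarrow> (\<Sum>j<N. poly (m i j) 0 * c a j) = (if i = a then 1 else 0)"
    by blast
  define v where "v i a = (if a < r then app i (\<lambda>j. [:c a j:]) else if i = l then 1 else 0)" for i a
  obtain x where x: "\<exists>a\<in>{..r}. x a \<noteq> 0" "\<And>i. i < r \<Longrightarrow> (\<Sum>a\<le>r. v i a * x a) = 0"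
    using more_unknowns_than_equations[of "{..r}" r v] by auto
  have split: "(\<Sum>a<r. v i a * x a) + v i r * x r = 0" if "i < r" for i
    using x(2)[OF that] by (simp add: lessThan_Suc_atMost[symmetric])
  have "x r \<noteq> 0"
  proof
    assume xr: "x r = 0"
    define R where "R y \<longleftrightarrow> (\<exists>a<r. y a \<noteq> 0) \<and> (\<forall>i<r. (\<Sum>a<r. v i a * y a) = 0)" for y :: "nat \<Rightarrow> complex poly"
    define s where "s y = (\<Sum>a<r. degree (y a))" for y :: "nat \<Rightarrow> complex poly"
    have "R x" using x xr split unfolding R_def by (auto simp: le_less)
    then obtain y where y: "R y" "\<And>z. R z \<Longrightarrow> s y \<le> s z"
      using arg_min_nat_lemma[of R x s] by blast
    have v0: "poly (v i a) 0 = (if i = a then 1 else 0)" if "i < r" "a < r" for i a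
      using c[OF that(1), of a] that by (simp add: v_def poly_app)
    have "poly (y i) 0 = 0" if i: "i < r" for i
    proof -
      have "0 = poly (\<Sum>a<r. v i a * y a) 0" using y(1) i by (simp add: R_def)
      also have "\<dots> = (\<Sum>a<r. if i = a then poly (y a) 0 else 0)"
        unfolding poly_sum using v0[OF i] by (intro sum.cong) auto
      finally show ?thesis using i by simp
    qed
    then have "\<forall>a\<in>{..<r}. \<exists>z. y a = [:0, 1:] * z" by (metis lessThan_iff minus_zero root_factor)
    then obtain z where z: "\<And>a. a < r \<Longrightarrow> y a = [:0, 1:] * z a" unfolding bchoice_iff by auto
    obtain b where b: "b < r" "y b \<noteq> 0" using y(1) by (auto simp: R_def)
    have "(\<Sum>a<r. v i a * z a) = 0" if "i < r" for i
    proof -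
      have "[:0, 1:] * (\<Sum>a<r. v i a * z a) = (\<Sum>a<r. v i a * y a)"
        unfolding sum_distrib_left using z by (intro sum.cong) (auto simp: mult_ac)
      then show ?thesis using y(1) that by (simp add: R_def)
    qed
    moreover have "z b \<noteq> 0" using b z by auto
    ultimately have "R z" unfolding R_def using b(1) by blast
    moreover have "s z < s y" unfolding s_def
    proof (rule sum_strict_mono_ex1)
      have dz: "degree (y a) = (if z a = 0 then 0 else Suc (degree (z a)))" if "a < r" for a
        using z[OF that] by (simp add: degree_mult_eq)
      show "\<forall>a\<in>{..<r}. degree (z a) \<le> degree (y a)" using dz by auto
      show "\<exists>a\<in>{..<r}. degree (z a) < degree (y a)" using dz b(1) \<open>z b \<noteq> 0\<close> by auto
    qed simp
    ultimately show False using y(2)[of z] by simp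
  qed
  moreover have "app i (\<lambda>j. \<Sum>a<r. - x a * [:c a j:]) = (if i = l then x r else 0)" if i: "i < r" for i
  proof -
    have "app i (\<lambda>j. \<Sum>a<r. - x a * [:c a j:]) = - (\<Sum>a<r. v i a * x a)"
      unfolding app_sum app_mult by (simp add: v_def sum_negf mult.commute)
    also have "\<dots> = v i r * x r" using split[OF i] by (simp add: add_eq_0_iff)
    finally show ?thesis by (simp add: v_def)
  qed
  ultimately show ?thesis by blast
qed

text \<open>This plays the role of the vanishing of cohomology after a large twist. Modulo the
  image, \<open>R\<close> is reduced first at infinity and then at the roots of \<open>f\<close>;
  what remains is a multiple of \<open>f\<close> and has a preimage by
  \<open>torsion_cokernel\<close>, whose degree \<open>e\<close> accommodates.\<close>

lemma onto_large_degree: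
  "\<exists>e. \<forall>R. (\<forall>i<r. degree (R i) \<le> \<delta> i + e) \<longrightarrow> (\<exists>x. (\<forall>j<N. degree (x j) \<le> e) \<and> (\<forall>i<r. app i x = R i))"
proof -
  have "\<forall>l. \<exists>f x. f \<noteq> 0 \<and> (\<forall>i<r. app i x = (if i = l then f else 0))" using torsion_cokernel by blast
  then obtain F X where FX: "\<And>l. F l \<noteq> 0" "\<And>l i. i < r \<Longrightarrow> app i (X l) = (if i = l then F l else 0)" by metis
  define f where "f = (\<Prod>l<r. F l)"
  have f: "f \<noteq> 0" using FX(1) by (simp add: f_def)
  define Y where "Y l j = (\<Prod>a\<in>{..<r} - {l}. F a) * X l j" for l j
  have Y: "app i (Y l) = (if i = l then f else 0)" if "i < r" "l < r" for i l
    using FX(2)[OF that(1), of l] that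
    unfolding Y_def app_mult f_def by (auto simp: prod.remove[of "{..<r}" l] mult.commute)
  define B where "B = (\<Sum>l<r. \<Sum>j<N. degree (Y l j))"
  have B: "degree (Y l j) \<le> B" if "l < r" "j < N" for l j
  proof -
    have "degree (Y l j) \<le> (\<Sum>j<N. degree (Y l j))" using that by (intro member_le_sum) auto
    also have "\<dots> \<le> B" unfolding B_def using that by (intro member_le_sum[of l]) auto
    finally show ?thesis .
  qed
  define \<Delta> where "\<Delta> = (\<Sum>l<r. \<delta> l)"
  have \<Delta>: "\<delta> l \<le> \<Delta>" if "l < r" for l unfolding \<Delta>_def using that by (intro member_le_sum) auto
  define e where "e = \<Delta> + B + degree f"
  have "\<exists>x. (\<forall>j<N. degree (x j) \<le> e) \<and> (\<forall>i<r. app i x = R i)" if R: "\<forall>i<r. degree (R i) \<le> \<delta> i + e" for R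
  proof -
    obtain y R1 where y: "\<forall>j<N. degree (y j) \<le> degree f + (\<Delta> + B)"
        "\<forall>i<r. degree (R1 i) \<le> \<delta> i + degree f \<and> R i = app i y + R1 i"
      using peel_infinity_many[of R "degree f" "\<Delta> + B"] R by (auto simp: e_def add_ac)
    obtain z R2 where z: "\<forall>j<N. degree (z j) \<le> 0 + degree f"
        "\<forall>i<r. degree (R2 i) \<le> \<delta> i + 0 \<and> R1 i = app i z + f * R2 i"
      using peel_poly[OF f, of R1 0] y(2) by auto
    define x where "x j = y j + z j + (\<Sum>l<r. R2 l * Y l j)" for j
    show ?thesis
    proof (rule exI[of _ x], intro conjI allI impI)
      fix j assume j: "j < N"
      have "degree (R2 l * Y l j) \<le> e" if "l < r" for l
      proof -
        have "degree (R2 l * Y l j) \<le> degree (R2 l) + degree (Y l j)" by (rule degree_mult_le)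
        also have "\<dots> \<le> \<Delta> + B" using z(2) \<Delta>[OF that] B[OF that j] that by (intro add_mono) force+
        finally show ?thesis by (simp add: e_def)
      qed
      then have "degree (\<Sum>l<r. R2 l * Y l j) \<le> e" by (intro degree_sum_le) auto
      moreover have "degree (y j) \<le> e" "degree (z j) \<le> e" using y(1) z(1) j by (auto simp: e_def add_ac trans_le_add1)
      ultimately show "degree (x j) \<le> e" unfolding x_def by (intro degree_add_le)
    next
      fix i assume i: "i < r"
      have "app i (\<lambda>j. \<Sum>l<r. R2 l * Y l j) = (\<Sum>l<r. if i = l then R2 l * f else 0)"
        unfolding app_sum app_mult using Y[OF i] by (intro sum.cong) auto
      then have "app i (\<lambda>j. \<Sum>l<r. R2 l * Y l j) = f * R2 i" using i by simp
      then show "app i x = R i"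
        unfolding x_def app_add using y(2) z(2) i by (simp add: add.assoc)
    qed
  qed
  then show ?thesis by blast
qed

text \<open>If the kernel at \<open>0\<close> consists of values of linear sections of the kernel bundle, then that
  bundle is globally generated at \<open>0\<close> after a twist, and surjectivity descends to constant
  vectors.\<close>

theorem onto_constants:
  assumes ker: "\<And>\<xi>. \<forall>i<r. (\<Sum>j<N. poly (m i j) 0 * \<xi> j) = 0 \<Longrightarrow> \<exists>\<eta>. \<forall>i<r. app i (line \<xi> \<eta>) = 0"
    and R: "\<And>i. i < r \<Longrightarrow> degree (R i) \<le> \<delta> i"
  shows "\<exists>x. \<forall>i<r. app i (cvec x) = R i"
proof -
  define S where "S e \<longleftrightarrow> (\<forall>R :: nat \<Rightarrow> complex poly. (\<forall>i<r. degree (R i) \<le> \<delta> i + e) \<longrightarrow>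
    (\<exists>x. (\<forall>j<N. degree (x j) \<le> e) \<and> (\<forall>i<r. app i x = R i)))" for e
  \<comment> \<open>With \<open>R\<close> multiplied by the variable, a preimage of degree
    \<open>Suc e\<close> takes at 0 a value in the kernel. Subtracting the linear section through
    this value makes the preimage divisible by the variable.\<close>
  have step: "S e" if S: "S (Suc e)" for e
    unfolding S_def
  proof (intro allI impI)
    fix R :: "nat \<Rightarrow> complex poly" assume R: "\<forall>i<r. degree (R i) \<le> \<delta> i + e"
    have "\<forall>i<r. degree ([:0, 1:] * R i) \<le> \<delta> i + Suc e"
      using R by (auto simp: degree_pCons_eq_if)
    then obtain x where x: "\<forall>j<N. degree (x j) \<le> Suc e" "\<forall>i<r. app i x = [:0, 1:] * R i"
      using S unfolding S_def by (elim allE[of _ "\<lambda>i. [:0, 1:] * R i"]) blast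
    have "\<forall>i<r. (\<Sum>j<N. poly (m i j) 0 * poly (x j) 0) = 0"
      using x(2) by (simp flip: poly_app)
    from ker[OF this] obtain \<eta> where \<eta>: "\<forall>i<r. app i (\<lambda>j. [:poly (x j) 0, \<eta> j:]) = 0" ..
    have "\<exists>q. x j - [:poly (x j) 0, \<eta> j:] = [:0, 1:] * q" for j
      by (rule root_factor[of "x j - [:poly (x j) 0, \<eta> j:]" 0]) auto
    then obtain z where z: "\<And>j. x j - [:poly (x j) 0, \<eta> j:] = [:0, 1:] * z j" by metis
    show "\<exists>x. (\<forall>j<N. degree (x j) \<le> e) \<and> (\<forall>i<r. app i x = R i)"
    proof (rule exI[of _ z], intro conjI allI impI)
      fix j assume j: "j < N"
      have "degree ([:0, 1:] * z j) \<le> Suc e"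
        unfolding z[symmetric] using x(1) j by (intro degree_diff_le) auto
      then show "degree (z j) \<le> e" by (cases "z j = 0") (auto simp: degree_pCons_eq_if)
    next
      fix i assume i: "i < r"
      have "[:0, 1:] * app i z = app i (\<lambda>j. x j - [:poly (x j) 0, \<eta> j:])" unfolding z app_mult ..
      also have "\<dots> = [:0, 1:] * R i" using x(2) \<eta> i by (simp add: app_diff)
      finally show "app i z = R i" by simp
    qed
  qed
  obtain e where "S e" using onto_large_degree unfolding S_def by blast
  then have "S 0" by (induction e) (auto intro: step)
  then obtain x where x: "\<forall>j<N. degree (x j) \<le> 0" "\<forall>i<r. app i x = R i"
    using R unfolding S_def by (metis add.right_neutral)
  have "app i (\<lambda>j. [:poly.coeff (x j) 0:]) = app i x" for i
    unfolding app_def using x(1) by (intro sum.cong refl) (auto simp: degree_0_id)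
  then show ?thesis using x(2) by (intro exI[of _ "\<lambda>j. poly.coeff (x j) 0"]) simp
qed

end

section \<open>Expanding a form along two directions\<close>

fun plist_sum :: "pexp list \<Rightarrow> pexp" where
  "plist_sum [] = PConst 0"
| "plist_sum (e # es) = PAdd e (plist_sum es)"

text \<open>The coefficient of \<open>A\<^sup>a B\<^sup>c\<close> in the expansion of \<open>e\<close> at \<open>A p + x + B q\<close>, as an
  expression in \<open>x\<close>.\<close>

primrec hco :: "(nat \<Rightarrow> complex) \<Rightarrow> (nat \<Rightarrow> complex) \<Rightarrow> pexp \<Rightarrow> nat \<Rightarrow> nat \<Rightarrow> pexp" where
  "hco p q (PConst z) = (\<lambda>a c. PConst (if a = 0 \<and> c = 0 then z else 0))"
| "hco p q (PVar i) = (\<lambda>a c. if a = 0 \<and> c = 0 then PVar i else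
     PConst (if a = 1 \<and> c = 0 then p i else if a = 0 \<and> c = 1 then q i else 0))"
| "hco p q (PAdd e f) = (\<lambda>a c. PAdd (hco p q e a c) (hco p q f a c))"
| "hco p q (PMul e f) = (\<lambda>a c. plist_sum (concat (map (\<lambda>c'. map (\<lambda>a'.
     PMul (hco p q e a' c') (hco p q f (a - a') (c - c'))) [0..<Suc a]) [0..<Suc c])))"

lemma ev_plist_sum: "ring_map h \<Longrightarrow> ev h (plist_sum es) v = (\<Sum>e\<leftarrow>es. ev h e v)"
  by (induction es) (simp_all add: ring_mapD)

lemma pd_plist_sum: "ring_map h \<Longrightarrow> ev h (pd j (plist_sum es)) v = (\<Sum>e\<leftarrow>es. ev h (pd j e) v)"
  by (induction es) (simp_all add: ring_mapD)

lemma sum_list_map_concat: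
  "(\<Sum>e\<leftarrow>concat xss. f e) = (\<Sum>xs\<leftarrow>xss. \<Sum>e\<leftarrow>xs. (f e :: 'a::comm_monoid_add))"
  by (induction xss) simp_all

lemma sum_list_concat_upt:
  "(\<Sum>e\<leftarrow>concat (map (\<lambda>c'. map (\<lambda>a'. g a' c') [0..<Suc a]) [0..<Suc c]). f e) = (\<Sum>c'\<le>c. \<Sum>a'\<le>a. f (g a' c'))"
  for f :: "_ \<Rightarrow> 'a::comm_monoid_add"
  by (simp add: sum_list_map_concat comp_def interv_sum_list_conv_sum_set_nat atLeast0LessThan
      lessThan_Suc_atMost del: upt_Suc)

lemma ev_hco_PMul:
  assumes "ring_map h"
  shows "ev h (hco p q (PMul e f) a c) v =
    (\<Sum>c'\<le>c. \<Sum>a'\<le>a. ev h (hco p q e a' c') v * ev h (hco p q f (a - a') (c - c')) v)"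
  by (simp add: ev_plist_sum[OF assms] sum_list_concat_upt del: upt_Suc)

lemma ev_pd_hco_PMul:
  assumes "ring_map h"
  shows "ev h (pd j (hco p q (PMul e f) a c)) v =
    (\<Sum>c'\<le>c. \<Sum>a'\<le>a. ev h (pd j (hco p q e a' c')) v * ev h (hco p q f (a - a') (c - c')) v +
      ev h (hco p q e a' c') v * ev h (pd j (hco p q f (a - a') (c - c'))) v)"
  by (simp add: pd_plist_sum[OF assms] sum_list_concat_upt del: upt_Suc)

lemma ev_hco_pd:
  assumes h: "ring_map h"
  shows "ev h (hco p q (pd j e) a c) v = ev h (pd j (hco p q e a c)) v"
proof (induction e arbitrary: a c)
  case (PMul e f)
  then show ?case
    by (simp add: ev_hco_PMul[OF h] ev_pd_hco_PMul[OF h] sum.distrib del: hco.simps(4) add: hco.simps(3))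
qed (auto simp: ring_mapD[OF h])

lemma coeff_hco:
  fixes h :: "complex \<Rightarrow> 'a::comm_ring_1"
  assumes h: "ring_map h"
  shows "poly.coeff (poly.coeff (ev (\<lambda>x. [:[:h x:]:]) e (\<lambda>j. [:[:v j, h (p j):], [:h (q j):]:])) c) a =
    ev h (hco p q e a c) v"
proof (induction e arbitrary: a c)
  case (PMul e f)
  then show ?case by (simp add: ev_hco_PMul[OF h] coeff_mult coeff_sum del: hco.simps(4))
qed (auto simp: coeff_pCons ring_mapD[OF h] split: nat.split)

lemma pvars_plist_sum: "pvars (plist_sum es) = (\<Union>e\<in>set es. pvars e)"
  by (induction es) auto

lemma pconsts_plist_sum: "pconsts (plist_sum es) \<subseteq> {0} \<union> (\<Union>e\<in>set es. pconsts e)"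
  by (induction es) auto

lemma set_concat_upt:
  "set (concat (map (\<lambda>c'. map (\<lambda>a'. g a' c') [0..<Suc a]) [0..<Suc c])) = (\<Union>c'\<le>c. \<Union>a'\<le>a. {g a' c'})"
  by (auto simp: atLeast0LessThan lessThan_Suc_atMost simp del: upt_Suc)

lemma pvars_hco: "pvars (hco p q e a c) \<subseteq> pvars e"
proof (induction e arbitrary: a c)
  case (PMul e f)
  then show ?case unfolding hco.simps pvars_plist_sum set_concat_upt by fastforce
next
  case (PAdd e f)
  then show ?case by (simp add: le_supI1 le_supI2)
qed auto

lemma pconsts_hco:
  assumes "pvars e \<subseteq> V"
  shows "pconsts (hco p q e a c) \<subseteq> {0} \<union> p ` V \<union> q ` V \<union> pconsts e"
  using assms
proof (induction e arbitrary: a c)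
  case (PMul e f)
  have "pconsts (hco p q (PMul e f) a c) \<subseteq> {0} \<union> (\<Union>c'\<le>c. \<Union>a'\<le>a. pconsts (hco p q e a' c') \<union> pconsts (hco p q f (a - a') (c - c')))"
    unfolding hco.simps by (rule order_trans[OF pconsts_plist_sum]) (simp only: set_concat_upt, auto)
  moreover have "pconsts (hco p q e a c) \<subseteq> {0} \<union> p ` V \<union> q ` V \<union> pconsts (PMul e f)"
    "pconsts (hco p q f a c) \<subseteq> {0} \<union> p ` V \<union> q ` V \<union> pconsts (PMul e f)" for a c
    using PMul.IH(1)[of a c] PMul.IH(2)[of a c] PMul.prems by auto
  ultimately show ?case by (elim order_trans) (intro Un_least UN_least, auto)
next
  case (PAdd e f)
  have "pconsts (hco p q e a c) \<subseteq> {0} \<union> p ` V \<union> q ` V \<union> pconsts e"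
    "pconsts (hco p q f a c) \<subseteq> {0} \<union> p ` V \<union> q ` V \<union> pconsts f"
    using PAdd.prems by (intro PAdd.IH; simp)+
  then show ?case by auto
qed auto

lemma pzero_plist_sum: "(\<And>e. e \<in> set es \<Longrightarrow> pzero e) \<Longrightarrow> pzero (plist_sum es)"
  by (induction es) (auto intro: pzero.intros)

lemma phom_plist_sum: "(\<And>e. e \<in> set es \<Longrightarrow> phom n e) \<Longrightarrow> phom n (plist_sum es)"
  by (induction es) (auto intro: phom.intros pzero.intros)

lemma pzero_hco: "pzero e \<Longrightarrow> pzero (hco p q e a c)"
proof (induction arbitrary: a c rule: pzero.induct)
  case (3 e f)
  then show ?case unfolding hco.simps by (intro pzero_plist_sum) (unfold set_concat_upt, auto intro: pzero.intros)
next
  case (4 f e)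
  then show ?case unfolding hco.simps by (intro pzero_plist_sum) (unfold set_concat_upt, auto intro: pzero.intros)
qed (auto intro: pzero.intros)

lemma phom_hco_aux:
  "phom d e \<Longrightarrow> (a + c \<le> d \<longrightarrow> phom (d - (a + c)) (hco p q e a c)) \<and> (d < a + c \<longrightarrow> pzero (hco p q e a c))"
proof (induction arbitrary: a c rule: phom.induct)
  case (phom_zero e d)
  then show ?case using pzero_hco phom.phom_zero by blast
next
  case (phom_mul d e d' f)
  have "phom (d + d' - (a + c)) (PMul (hco p q e a' c') (hco p q f (a - a') (c - c')))"
    if "a' \<le> a" "c' \<le> c" "a + c \<le> d + d'" for a' c'
  proof (cases "a' + c' \<le> d \<and> a - a' + (c - c') \<le> d'")
    case True
    then have "d + d' - (a + c) = (d - (a' + c')) + (d' - (a - a' + (c - c')))" using that by linarith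
    then show ?thesis using True phom_mul.IH phom.phom_mul by metis
  next
    case False
    then have "pzero (hco p q e a' c') \<or> pzero (hco p q f (a - a') (c - c'))"
      using phom_mul.IH not_le by blast
    then show ?thesis by (auto intro!: phom.phom_zero intro: pzero.intros)
  qed
  moreover have "pzero (PMul (hco p q e a' c') (hco p q f (a - a') (c - c')))"
    if "a' \<le> a" "c' \<le> c" "d + d' < a + c" for a' c'
  proof -
    have "d < a' + c' \<or> d' < a - a' + (c - c')" using that by linarith
    then have "pzero (hco p q e a' c') \<or> pzero (hco p q f (a - a') (c - c'))"
      using phom_mul.IH by blast
    then show ?thesis by (auto intro: pzero.intros)
  qed
  ultimately show ?case unfolding hco.simps
    by (intro conjI impI phom_plist_sum pzero_plist_sum) (unfold set_concat_upt, auto)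
next
  case (phom_const z)
  then show ?case by (auto intro: phom.intros pzero.intros)
next
  case (phom_var i)
  then show ?case by (auto intro: phom.intros(2) phom.intros(3)[unfolded One_nat_def] pzero.intros)
next
  case (phom_add d e f)
  then show ?case by (auto intro: phom.intros(4) pzero.intros)
qed

lemmas phom_hco = phom_hco_aux[THEN conjunct1, rule_format]
  and pzero_hco_large = phom_hco_aux[THEN conjunct2, rule_format]

definition tri :: "nat \<Rightarrow> (nat \<times> nat) set" where
  "tri d = {(a, c). a + c \<le> d}"

lemma finite_tri: "finite (tri d)"
  by (rule finite_subset[of _ "{..d} \<times> {..d}"]) (auto simp: tri_def)

lemma poly_sum_atMost: "degree p \<le> n \<Longrightarrow> poly p (x :: 'a::comm_semiring_1) = (\<Sum>i\<le>n. poly.coeff p i * x ^ i)"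
  using poly_map_poly_sum[of "\<lambda>x. x" p n x] by simp

text \<open>The weight \<open>C\<close> makes the two lines, where \<open>A\<close> or
  \<open>B\<close> is 0, and the conic specializations of one expansion, so that all their equations
  are expressed by the same coefficients \<open>hco\<close>.\<close>

lemma ev_expand:
  fixes h :: "complex \<Rightarrow> 'a::comm_ring_1"
  assumes e: "phom d e" and h: "ring_map h"
  shows "ev h e (\<lambda>j. A * h (p j) + C * v j + B * h (q j)) =
    (\<Sum>(a, c)\<in>tri d. A ^ a * B ^ c * C ^ (d - (a + c)) * ev h (hco p q e a c) v)"
proof -
  define F where "F = ev (\<lambda>x. [:[:h x:]:]) e (\<lambda>j. [:[:C * v j, h (p j):], [:h (q j):]:])"
  define n where "n = max d (degree F)"
  define l where "l = d + (\<Sum>c\<le>n. degree (poly.coeff F c))"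
  have cF: "poly.coeff (poly.coeff F c) a = ev h (hco p q e a c) (\<lambda>j. C * v j)" for a c
    unfolding F_def by (rule coeff_hco[OF h])
  have hom: "ring_map (\<lambda>P. poly (poly P [:B:]) A)" by (simp add: ring_map_def)
  have "ev h e (\<lambda>j. A * h (p j) + C * v j + B * h (q j)) = poly (poly F [:B:]) A"
    unfolding F_def by (subst ev_hom[OF hom]) (simp add: algebra_simps)
  also have "poly F [:B:] = (\<Sum>c\<le>n. poly.coeff F c * [:B:] ^ c)"
    by (rule poly_sum_atMost) (simp add: n_def)
  also have "poly \<dots> A = (\<Sum>c\<le>n. poly (poly.coeff F c) A * B ^ c)"
    by (simp add: poly_sum poly_power)
  also have "\<dots> = (\<Sum>c\<le>n. \<Sum>a\<le>l. ev h (hco p q e a c) (\<lambda>j. C * v j) * A ^ a * B ^ c)"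
  proof (rule sum.cong[OF refl])
    fix c assume "c \<in> {..n}"
    then have "degree (poly.coeff F c) \<le> l" unfolding l_def by (intro trans_le_add2 member_le_sum) auto
    then have "poly (poly.coeff F c) A = (\<Sum>a\<le>l. poly.coeff (poly.coeff F c) a * A ^ a)"
      by (rule poly_sum_atMost)
    then show "poly (poly.coeff F c) A * B ^ c = (\<Sum>a\<le>l. ev h (hco p q e a c) (\<lambda>j. C * v j) * A ^ a * B ^ c)"
      by (simp add: cF sum_distrib_right)
  qed
  also have "\<dots> = (\<Sum>a\<le>l. \<Sum>c\<le>n. ev h (hco p q e a c) (\<lambda>j. C * v j) * A ^ a * B ^ c)" by (rule sum.swap)
  also have "\<dots> = (\<Sum>(a, c)\<in>{..l} \<times> {..n}. ev h (hco p q e a c) (\<lambda>j. C * v j) * A ^ a * B ^ c)"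
    by (simp add: sum.cartesian_product)
  also have "\<dots> = (\<Sum>(a, c)\<in>tri d. ev h (hco p q e a c) (\<lambda>j. C * v j) * A ^ a * B ^ c)"
  proof (rule sum.mono_neutral_right)
    show "tri d \<subseteq> {..l} \<times> {..n}" by (auto simp: tri_def l_def n_def)
    show "\<forall>x\<in>{..l} \<times> {..n} - tri d. (case x of (a, c) \<Rightarrow> ev h (hco p q e a c) (\<lambda>j. C * v j) * A ^ a * B ^ c) = 0"
    proof
      fix x assume x: "x \<in> {..l} \<times> {..n} - tri d"
      obtain a c where ac: "x = (a, c)" by (cases x)
      then have "d < a + c" using x by (auto simp: tri_def)
      then show "(case x of (a, c) \<Rightarrow> ev h (hco p q e a c) (\<lambda>j. C * v j) * A ^ a * B ^ c) = 0"
        using pzero_ev[OF pzero_hco_large[OF e] h, of a c p q] by (simp add: ac)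
    qed
  qed simp
  also have "\<dots> = (\<Sum>(a, c)\<in>tri d. A ^ a * B ^ c * C ^ (d - (a + c)) * ev h (hco p q e a c) v)"
    using phom_ev[OF phom_hco[OF e] h, of _ _ _ _ C v] by (intro sum.cong) (auto simp: tri_def mult_ac)
  finally show ?thesis .
qed

lemma dev_expand:
  fixes h :: "complex \<Rightarrow> 'a::comm_ring_1"
  assumes e: "phom d e" and h: "ring_map h"
  shows "dev N h e (\<lambda>j. A * h (p j) + C * v j + B * h (q j)) y =
    (\<Sum>(a, c)\<in>tri (d - 1). A ^ a * B ^ c * C ^ (d - 1 - (a + c)) * dev N h (hco p q e a c) v y)"
proof -
  have "dev N h e (\<lambda>j. A * h (p j) + C * v j + B * h (q j)) y =
     (\<Sum>j<N. \<Sum>(a, c)\<in>tri (d - 1). A ^ a * B ^ c * C ^ (d - 1 - (a + c)) * (ev h (pd j (hco p q e a c)) v * y j))"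
    unfolding dev_def ev_expand[OF phom_pd[OF e] h] ev_hco_pd[OF h] sum_distrib_right
    by (intro sum.cong refl) (auto simp: mult_ac)
  also have "\<dots> = (\<Sum>(a, c)\<in>tri (d - 1). A ^ a * B ^ c * C ^ (d - 1 - (a + c)) * dev N h (hco p q e a c) v y)"
    unfolding dev_def sum_distrib_left by (subst sum.swap) (auto intro!: sum.cong)
  finally show ?thesis .
qed

section \<open>Chains of two lines\<close>

lemma poly_zero_if_nat_zeros:
  assumes "\<And>n. poly P (of_nat n) = (0 :: 'a::{idom,ring_char_0})"
  shows "P = 0"
proof (rule ccontr)
  assume "P \<noteq> 0"
  then have "finite {x. poly P x = 0}" by (rule poly_roots_finite)
  moreover have "range of_nat \<subseteq> {x. poly P x = 0}" using assms by auto
  ultimately have "finite (range (of_nat :: nat \<Rightarrow> 'a))" by (rule rev_finite_subset)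
  then show False using finite_imageD[of of_nat UNIV] inj_of_nat infinite_UNIV_nat by blast
qed

lemma ring_map_poly: "ring_map (\<lambda>p. poly p t)"
  by (simp add: ring_map_def)

lemma derivation_of_nat: "derivation A D \<Longrightarrow> D (of_nat n) = 0"
proof (induction n)
  case (Suc n)
  have A: "subring A" by (rule derivationD(1)[OF Suc.prems])
  show ?case using derivationD(2)[OF Suc.prems subringD(2)[OF A] subring_of_nat[OF A]] Suc derivationD(5)[OF Suc.prems]
    by simp
qed (simp add: derivationD)

text \<open>Natural numbers lie in every subring and are killed by every derivation. At these
  parameters the assertion is \<open>D\<close> applied to a numerical identity, and they suffice to
  test a polynomial.\<close>

lemma line_derivation:
  fixes A :: "complex set"
  assumes D: "derivation A D" and con: "\<And>c. c \<in> pconsts e \<Longrightarrow> c \<in> A" "\<And>c. c \<in> pconsts e \<Longrightarrow> D c = 0"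
    and "pvars e \<subseteq> {..<N}" and pq: "\<And>j. j < N \<Longrightarrow> p j \<in> A" "\<And>j. j < N \<Longrightarrow> q j \<in> A"
    and line: "evp e (line p q) = [:z:]" "D z = 0"
  shows "devp N e (line p q) (\<lambda>j. [:D (p j), D (q j):]) = 0"
proof (rule poly_zero_if_nat_zeros)
  fix n
  let ?t = "of_nat n :: complex"
  note A = derivationD(1)[OF D]
  have t: "?t \<in> A" by (rule subring_of_nat[OF A])
  have mem: "p j + ?t * q j \<in> A" if "j < N" for j
    using pq[OF that] t by (intro subringD(3,4)[OF A])
  have Dj: "D (p j + ?t * q j) = D (p j) + ?t * D (q j)" if "j < N" for j
    using pq[OF that] t derivationD(2,3)[OF D] subringD(4)[OF A] derivation_of_nat[OF D] by simp
  have "evc e (\<lambda>j. p j + ?t * q j) = z"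
    using arg_cong[OF line(1), of "\<lambda>f. poly f ?t"] by (simp add: ev_hom[OF ring_map_poly])
  then have "0 = D (evc e (\<lambda>j. p j + ?t * q j))" using line(2) by simp
  also have "\<dots> = devc N e (\<lambda>j. p j + ?t * q j) (\<lambda>j. D (p j + ?t * q j))"
    using con assms(4) mem by (intro derivation_ev[OF D]) auto
  also have "\<dots> = devc N e (\<lambda>j. p j + ?t * q j) (\<lambda>j. D (p j) + ?t * D (q j))"
    by (rule dev_cong) (rule Dj)
  also have "\<dots> = poly (devp N e (line p q) (\<lambda>j. [:D (p j), D (q j):])) ?t"
    by (simp add: dev_hom[OF ring_map_poly])
  finally show "poly (devp N e (line p q) (\<lambda>j. [:D (p j), D (q j):])) ?t = 0" ..
qed

lemma coeff_mult_top:
  assumes "degree p \<le> a" "degree q \<le> b"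
  shows "poly.coeff (p * q) (a + b) = poly.coeff p a * (poly.coeff q b :: 'a::comm_ring_1)"
proof -
  have "poly.coeff p i * poly.coeff q (a + b - i) = (if i = a then poly.coeff p a * poly.coeff q b else 0)"
    if "i \<le> a + b" for i
    using that assms by (cases i a rule: linorder_cases) (auto simp: coeff_eq_0)
  then show ?thesis by (simp add: coeff_mult)
qed

lemma degree_ev_line: "phom n e \<Longrightarrow> degree (evp e (line p q)) \<le> n"
  using degree_ev_le[of n e "\<lambda>j. [:p j, q j:]" 1 "\<lambda>c. [:c:]"] by simp

lemma coeff_top_line:
  "phom n e \<Longrightarrow> poly.coeff (evp e (line p q)) n = evc e q"
proof (induction rule: phom.induct)
  case (phom_mul d e d' f)
  then show ?case using coeff_mult_top[OF degree_ev_line degree_ev_line] by simp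
qed (simp_all add: pzero_ev)

context smooth_system
begin

text \<open>The differentials along the line form a \<open>poly_matrix\<close>: every point of the
  line lies on the level set, and its point at infinity is the direction \<open>q\<close>, which
  lies on the cone. Then \<open>deform\<close> is the hypothesis of \<open>onto_constants\<close> on
  the kernel at \<open>p\<close>.\<close>

lemma line_onto:
  assumes line: "\<And>i. i < r \<Longrightarrow> evp (H i) (line p q) = [:s * \<kappa> i:]"
    and nz: "\<And>t. \<exists>j<N. p j + t * q j \<noteq> 0" and q: "\<exists>j<N. q j \<noteq> 0"
    and deform: "\<And>\<xi>. \<forall>i<r. devc N (H i) p \<xi> = 0 \<Longrightarrow>
      \<exists>\<eta>. \<forall>i<r. devp N (H i) (line p q) (line \<xi> \<eta>) = 0"
    and R: "\<And>i. i < r \<Longrightarrow> degree (R i) \<le> d i - 1"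
  shows "\<exists>x. \<forall>i<r. devp N (H i) (line p q) (cvec x) = R i"
proof -
  define m where "m i j = evp (pd j (H i)) (line p q)" for i j
  have m: "poly (m i j) t = evc (pd j (H i)) (\<lambda>j. p j + t * q j)" for i j t
    by (simp add: m_def ev_hom[OF ring_map_poly])
  have c: "poly.coeff (m i j) (d i - 1) = evc (pd j (H i)) q" if "i < r" for i j
    unfolding m_def by (rule coeff_top_line[OF phom_pd[OF form[OF that]]])
  interpret poly_matrix N r m "\<lambda>i. d i - 1"
  proof
    show "degree (m i j) \<le> d i - 1" if "i < r" for i j
      unfolding m_def by (rule degree_ev_line[OF phom_pd[OF form[OF that]]])
    fix t \<rho>
    have "\<forall>i<r. evc (H i) (\<lambda>j. p j + t * q j) = s * \<kappa> i"
    proof (intro allI impI)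
      fix i assume "i < r"
      from arg_cong[OF line[OF this], of "\<lambda>f. poly f t"]
      show "evc (H i) (\<lambda>j. p j + t * q j) = s * \<kappa> i" by (simp add: ev_hom[OF ring_map_poly])
    qed
    from regular[OF nz this] show "\<exists>x. \<forall>i<r. (\<Sum>j<N. poly (m i j) t * x j) = \<rho> i"
      by (simp add: m dev_def)
    have "\<forall>i<r. evc (H i) q = 0 * \<kappa> i"
    proof (intro allI impI)
      fix i assume i: "i < r"
      show "evc (H i) q = 0 * \<kappa> i"
        using coeff_top_line[OF form[OF i], of p q] degree_pos[OF i] by (simp add: line[OF i] coeff_pCons split: nat.splits)
    qed
    from regular[OF q this] obtain x where "\<forall>i<r. devc N (H i) q x = \<rho> i" ..
    then show "\<exists>x. \<forall>i<r. (\<Sum>j<N. poly.coeff (m i j) (d i - 1) * x j) = \<rho> i"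
      by (intro exI[of _ x]) (simp add: c dev_def del: One_nat_def)
  qed
  have app: "app i x = devp N (H i) (line p q) x" for i x
    by (simp add: app_def dev_def m_def)
  show ?thesis unfolding app[symmetric]
  proof (rule onto_constants[OF _ R])
    fix \<xi> :: "nat \<Rightarrow> complex" assume "\<forall>i<r. (\<Sum>j<N. poly (m i j) 0 * \<xi> j) = 0"
    then have "\<forall>i<r. devc N (H i) p \<xi> = 0" by (simp add: m dev_def)
    from deform[OF this] show "\<exists>\<eta>. \<forall>i<r. app i (line \<xi> \<eta>) = 0" unfolding app .
  qed
qed

lemma generic_derivation:
  assumes "generic k g" "subring k" "\<forall>i<r. devc N (H i) g \<xi> = 0"
  obtains D where "derivation (adjoin_list k (map g [0..<N] @ zs)) D" "\<And>a. a \<in> k \<Longrightarrow> D a = 0" "\<And>j. j < N \<Longrightarrow> D (g j) = \<xi> j"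
proof -
  obtain D where D: "derivation (adjoin_list k (map g [0..<N])) D" "\<forall>a\<in>k. D a = 0" "\<forall>j<N. D (g j) = \<xi> j"
    using assms(1,3) unfolding generic_def by blast
  obtain D' where D': "derivation (adjoin_list k (map g [0..<N] @ zs)) D'" "\<forall>a\<in>adjoin_list k (map g [0..<N]). D' a = D a"
    using derivation_extend_list[OF D(1), of zs] unfolding adjoin_list_append by blast
  have "D' a = 0" if "a \<in> k" for a using D'(2) D(2) adjoin_list_superset[OF assms(2) that] that by simp
  moreover have "D' (g j) = \<xi> j" if "j < N" for j
  proof -
    have "g j \<in> adjoin_list k (map g [0..<N])" using that by (intro adjoin_list_generators[OF assms(2)]) simp
    then show ?thesis using D'(2) D(3) that by simp
  qed
  ultimately show ?thesis using that D'(1) by blast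
qed

end

text \<open>\<open>q\<close> is the end of the chain on the cone, \<open>p\<close> the end on level
  \<open>s\<close>. Since \<open>p\<close> is generic even after \<open>q\<close> has been adjoined
  to \<open>k\<close>, it can be moved while \<open>q\<close> stays fixed.\<close>

locale two_points = smooth_system +
  fixes k :: "complex set" and s :: complex and p q :: "nat \<Rightarrow> complex"
  assumes k: "subring k" "i < r \<Longrightarrow> pconsts (H i) \<subseteq> k" "i < r \<Longrightarrow> s * \<kappa> i \<in> k"
    and q: "\<exists>j<N. q j \<noteq> 0" "i < r \<Longrightarrow> evc (H i) q = 0" "generic k q"
    and p: "i < r \<Longrightarrow> evc (H i) p = s * \<kappa> i" "generic (adjoin_list k (map q [0..<N])) p"
      "\<And>c. \<exists>j<N. p j \<noteq> c * q j"
begin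

abbreviation hc :: "nat \<Rightarrow> nat \<Rightarrow> nat \<Rightarrow> pexp" where
  "hc i \<equiv> hco p q (H i)"

definition k1 :: "complex set" where
  "k1 = adjoin_list k (map q [0..<N])"

lemma k1: "subring k1" "a \<in> k \<Longrightarrow> a \<in> k1" "j < N \<Longrightarrow> q j \<in> k1"
  unfolding k1_def by (rule subring_adjoin_list[OF k(1)], rule adjoin_list_superset[OF k(1)], assumption,
    rule adjoin_list_generators[OF k(1)], simp)

lemma con: "i < r \<Longrightarrow> c \<in> pconsts (H i) \<Longrightarrow> c \<in> k"
  using k(2) by blast

text \<open>The vector \<open>v\<close> is arbitrary, because in characteristic 0 the derivation
  extends to it. Nothing is prescribed for \<open>D (v j)\<close>; what matters is that equations
  between \<open>p\<close>, \<open>q\<close> and \<open>v\<close> can be differentiated.\<close>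

lemma derivation_p:
  assumes "\<forall>i<r. devc N (H i) p \<xi> = 0"
  obtains A D where "derivation A D" "\<And>a. a \<in> k1 \<Longrightarrow> a \<in> A" "\<And>a. a \<in> k1 \<Longrightarrow> D a = 0"
    "\<And>j. j < N \<Longrightarrow> p j \<in> A" "\<And>j. j < N \<Longrightarrow> v j \<in> A" "\<And>j. j < N \<Longrightarrow> D (p j) = \<xi> j"
proof -
  obtain D where D: "derivation (adjoin_list k1 (map p [0..<N] @ map v [0..<N])) D" "\<And>a. a \<in> k1 \<Longrightarrow> D a = 0"
      "\<And>j. j < N \<Longrightarrow> D (p j) = \<xi> j"
    using generic_derivation[OF p(2)[folded k1_def] k1(1) assms, of "map v [0..<N]"] by blast
  show ?thesis
    by (rule that[OF D(1)]) (auto intro: adjoin_list_superset[OF k1(1)] adjoin_list_generators[OF k1(1)] D(2,3))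
qed

lemma derivation_q:
  assumes "\<forall>i<r. devc N (H i) q \<xi> = 0"
  obtains A D where "derivation A D" "\<And>a. a \<in> k \<Longrightarrow> a \<in> A" "\<And>a. a \<in> k \<Longrightarrow> D a = 0"
    "\<And>j. j < N \<Longrightarrow> q j \<in> A" "\<And>j. j < N \<Longrightarrow> v j \<in> A" "\<And>j. j < N \<Longrightarrow> D (q j) = \<xi> j"
proof -
  obtain D where D: "derivation (adjoin_list k (map q [0..<N] @ map v [0..<N])) D" "\<And>a. a \<in> k \<Longrightarrow> D a = 0"
      "\<And>j. j < N \<Longrightarrow> D (q j) = \<xi> j"
    using generic_derivation[OF q(3) k(1) assms, of "map v [0..<N]"] by blast
  show ?thesis
    by (rule that[OF D(1)]) (auto intro: adjoin_list_superset[OF k(1)] adjoin_list_generators[OF k(1)] D(2,3))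
qed

text \<open>Otherwise moving \<open>p\<close> with \<open>q\<close> fixed shows that tangent vectors
  at \<open>p\<close> are tangent all along the line. But by surjectivity some constant vector has
  as differential the parameter itself in one equation of degree at least 2, and 0 in the others: it
  is tangent at \<open>p\<close> but not along the line.\<close>

lemma no_line: "\<exists>i<r. evp (H i) (line p q) \<noteq> [:s * \<kappa> i:]"
proof (rule ccontr)
  assume "\<not> ?thesis"
  then have line: "evp (H i) (line p q) = [:s * \<kappa> i:]" if "i < r" for i using that by blast
  have const: "devp N (H i) (line p q) (\<lambda>j. [:\<xi> j, 0:]) = 0"
    if \<xi>: "\<forall>i<r. devc N (H i) p \<xi> = 0" and i: "i < r" for \<xi> i
  proof -
    obtain A D where D: "derivation A D" "\<And>a. a \<in> k1 \<Longrightarrow> a \<in> A" "\<And>a. a \<in> k1 \<Longrightarrow> D a = 0"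
      "\<And>j. j < N \<Longrightarrow> p j \<in> A" "\<And>j. j < N \<Longrightarrow> p j \<in> A" "\<And>j. j < N \<Longrightarrow> D (p j) = \<xi> j"
      using derivation_p[OF \<xi>, of p] by blast
    have "devp N (H i) (line p q) (\<lambda>j. [:D (p j), D (q j):]) = 0"
      using con[OF i] k1(2,3) k(3)[OF i] D(2-4) vars[OF i] by (intro line_derivation[OF D(1) _ _ _ _ _ line[OF i]]) auto
    moreover have "devp N (H i) (line p q) (\<lambda>j. [:D (p j), D (q j):]) =
        devp N (H i) (line p q) (\<lambda>j. [:\<xi> j, 0:])"
      using D(3,6) k1(3) by (intro dev_cong) auto
    ultimately show ?thesis by simp
  qed
  obtain i0 where i0: "i0 < r" "2 \<le> d i0" using nonlinear by blast
  have "\<exists>x. \<forall>i<r. devp N (H i) (line p q) (cvec x) = (if i = i0 then [:0, 1:] else 0)"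
  proof (rule line_onto[OF line _ q(1)])
    show "\<exists>j<N. p j + t * q j \<noteq> 0" for t using p(3)[of "- t"] by (simp add: add_eq_0_iff2)
    show "\<exists>\<eta>. \<forall>i<r. devp N (H i) (line p q) (line \<xi> \<eta>) = 0"
      if "\<forall>i<r. devc N (H i) p \<xi> = 0" for \<xi>
      using const[OF that] by (intro exI[of _ "\<lambda>_. 0"]) simp
    show "degree (if i = i0 then [:0, 1::complex:] else 0) \<le> d i - 1" for i using i0 by auto
  qed
  then obtain x where x: "\<And>i. i < r \<Longrightarrow> devp N (H i) (line p q) (cvec x) = (if i = i0 then [:0, 1:] else 0)"
    by blast
  have "devc N (H i) p x = 0" if i: "i < r" for i
    using arg_cong[OF x[OF i], of "\<lambda>f. poly f 0"] by (auto simp: dev_hom[OF ring_map_poly] split: if_splits)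
  then have "devp N (H i0) (line p q) (\<lambda>j. [:x j, 0:]) = 0" using const i0 by blast
  then show False using x[OF i0(1)] by simp
qed

text \<open>Truncated subtraction encodes both lines in one index: for \<open>l \<le> d i\<close>
  the condition is the coefficient of degree \<open>l\<close> in \<open>v\<close> on the line from
  \<open>p\<close>, for \<open>l \<ge> d i\<close> the one of degree \<open>2 * d i - l\<close> on
  the line to \<open>q\<close>. They share the condition \<open>l = d i\<close>, that
  \<open>v\<close> lies on the cone, and the indices 0 and \<open>2 * d i\<close> are settled by the
  choice of \<open>p\<close> and \<open>q\<close>. Thus there are \<open>2 * d i - 1\<close>
  conditions, all of positive degree.\<close>

lemma exists_chain:
  "\<exists>v. (\<exists>j<N. v j \<noteq> 0) \<and> (\<forall>i<r. \<forall>l\<in>{1..<2 * d i}. evc (hc i (d i - l) (l - d i)) v = 0)"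
proof -
  define L where "L = concat (map (\<lambda>i. map (\<lambda>l. (d i - (d i - l + (l - d i)), hc i (d i - l) (l - d i))) [1..<2 * d i]) [0..<r])"
  have L: "x \<in> set L \<longleftrightarrow> (\<exists>i<r. \<exists>l\<in>{1..<2 * d i}. x = (d i - (d i - l + (l - d i)), hc i (d i - l) (l - d i)))" for x
    by (auto simp: L_def)
  have len: "length L = (\<Sum>i<r. 2 * d i - 1)"
    by (simp add: L_def length_concat comp_def interv_sum_list_conv_sum_set_nat atLeast0LessThan)
  have "\<exists>v. (\<exists>i<N. v i \<noteq> 0) \<and> (\<forall>j<length L. evc (snd (L ! j)) v = 0)"
  proof (rule forms_common_zero[where d = "\<lambda>j. fst (L ! j)"])
    fix j assume "j < length L"
    then have "L ! j \<in> set L" by simp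
    then obtain i l where il: "i < r" "l \<in> {1..<2 * d i}"
        "L ! j = (d i - (d i - l + (l - d i)), hc i (d i - l) (l - d i))"
      unfolding L by blast
    have le: "d i - l + (l - d i) < d i" using il(2) by auto
    show "phom (fst (L ! j)) (snd (L ! j))" "0 < fst (L ! j)" "pvars (snd (L ! j)) \<subseteq> {..<N}"
      using phom_hco[OF form[OF il(1)] less_imp_le[OF le]] le order_trans[OF pvars_hco vars[OF il(1)]] il(3) by auto
  qed (use few_equations len in simp)
  then obtain v where v: "\<exists>i<N. v i \<noteq> 0" "\<And>j. j < length L \<Longrightarrow> evc (snd (L ! j)) v = 0" by blast
  have "evc (snd x) v = 0" if "x \<in> set L" for x using that v(2) by (metis in_set_conv_nth)
  then have "evc (hc i (d i - l) (l - d i)) v = 0" if "i < r" "l \<in> {1..<2 * d i}" for i l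
    using that L by (metis snd_conv)
  then show ?thesis using v(1) by blast
qed

end

locale chain = two_points +
  fixes v :: "nat \<Rightarrow> complex"
  assumes v: "\<exists>j<N. v j \<noteq> 0"
    and chain: "i < r \<Longrightarrow> l \<in> {1..<2 * d i} \<Longrightarrow> evc (hc i (d i - l) (l - d i)) v = 0"
begin

lemma pc_hom: "evp e (cvec x) = [:evc e x:]"
  using ev_hom[OF ring_map_pCons, of "\<lambda>x. x" e x] by simp

lemma pc_dev_hom: "devp N e (cvec x) (cvec y) = [:devc N e x y:]"
  using dev_hom[OF ring_map_pCons, of N "\<lambda>x. x" e x y] by simp

lemma line_p:
  assumes i: "i < r"
  shows "evp (H i) (line p v) = [:s * \<kappa> i:]"
proof -
  let ?f = "\<lambda>(a, c). 1 ^ a * 0 ^ c * [:0, 1:] ^ (d i - (a + c)) * evp (hc i a c) (cvec v)"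
  let ?P = "evp (H i) (line p v)"
  have "?P = evp (H i) (\<lambda>j. 1 * [:p j:] + [:0, 1:] * [:v j:] + 0 * [:q j:])" by simp
  also have "\<dots> = sum ?f (tri (d i))" by (rule ev_expand[OF form[OF i]]) simp
  also have "\<dots> = sum ?f {(d i, 0)}"
  proof (rule sum.mono_neutral_right[OF finite_tri])
    show "{(d i, 0)} \<subseteq> tri (d i)" by (simp add: tri_def)
    show "\<forall>x\<in>tri (d i) - {(d i, 0)}. ?f x = 0"
    proof
      fix x assume x: "x \<in> tri (d i) - {(d i, 0)}"
      obtain a c where ac: "x = (a, c)" by (cases x)
      show "?f x = 0"
      proof (cases "c = 0")
        case True
        then have "a < d i" using x ac by (auto simp: tri_def)
        then have "evc (hc i a 0) v = 0" using chain[OF i, of "d i - a"] by (simp add: Suc_leI)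
        then show ?thesis using ac True by (simp add: pc_hom)
      qed (simp add: ac power_0_left)
    qed
  qed
  also have "\<dots> = [:evc (hc i (d i) 0) v:]" by (simp add: pc_hom)
  finally have *: "?P = [:evc (hc i (d i) 0) v:]" .
  have "poly ?P 0 = evc (H i) p" by (simp add: ev_hom[OF ring_map_poly])
  then show ?thesis using p(1)[OF i] unfolding * by simp
qed

lemma line_q:
  assumes i: "i < r"
  shows "evp (H i) (line v q) = 0"
proof -
  let ?f = "\<lambda>(a, c). 0 ^ a * [:0, 1:] ^ c * 1 ^ (d i - (a + c)) * evp (hc i a c) (cvec v)"
  let ?P = "evp (H i) (line v q)"
  have "?P = evp (H i) (\<lambda>j. 0 * [:p j:] + 1 * [:v j:] + [:0, 1:] * [:q j:])" by simp
  also have "\<dots> = sum ?f (tri (d i))" by (rule ev_expand[OF form[OF i]]) simp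
  also have "\<dots> = sum ?f {(0, d i)}"
  proof (rule sum.mono_neutral_right[OF finite_tri])
    show "{(0, d i)} \<subseteq> tri (d i)" by (simp add: tri_def)
    show "\<forall>x\<in>tri (d i) - {(0, d i)}. ?f x = 0"
    proof
      fix x assume x: "x \<in> tri (d i) - {(0, d i)}"
      obtain a c where ac: "x = (a, c)" by (cases x)
      show "?f x = 0"
      proof (cases "a = 0")
        case True
        then have "c < d i" using x ac by (auto simp: tri_def)
        then have "evc (hc i 0 c) v = 0" using chain[OF i, of "d i + c"] by auto
        then show ?thesis using ac True by (simp add: pc_hom)
      qed (simp add: ac power_0_left)
    qed
  qed
  also have "\<dots> = monom (evc (hc i 0 (d i)) v) (d i)" by (simp add: pc_hom monom_altdef)
  finally have *: "?P = monom (evc (hc i 0 (d i)) v) (d i)" .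
  have "poly.coeff ?P (d i) = 0" using coeff_top_line[OF form[OF i], of v q] q(2)[OF i] by simp
  then show ?thesis unfolding * by simp
qed

lemma line_q': "i < r \<Longrightarrow> evp (H i) (line q v) = 0"
proof (rule poly_zero_if_nat_zeros)
  fix n assume i: "i < r"
  show "poly (evp (H i) (line q v)) (of_nat n) = 0"
  proof (cases "n = 0")
    case True
    then show ?thesis using q(2)[OF i] by (simp add: ev_hom[OF ring_map_poly])
  next
    case False
    have "evc (H i) (\<lambda>j. q j + of_nat n * v j) = evc (H i) (\<lambda>j. of_nat n * (v j + inverse (of_nat n) * q j))"
      using False by (intro ev_cong) (simp add: field_simps)
    also have "\<dots> = of_nat n ^ d i * evc (H i) (\<lambda>j. v j + inverse (of_nat n) * q j)"
      by (rule phom_ev[OF form[OF i]]) simp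
    also have "evc (H i) (\<lambda>j. v j + inverse (of_nat n) * q j) = 0"
      using arg_cong[OF line_q[OF i], of "\<lambda>f. poly f (inverse (of_nat n))"] by (simp add: ev_hom[OF ring_map_poly])
    finally show ?thesis by (simp add: ev_hom[OF ring_map_poly])
  qed
qed

text \<open>If \<open>p\<close> were proportional to \<open>v\<close>, the line through it in
  direction \<open>q\<close> would lie in the cone, against \<open>no_line\<close>; and
  \<open>p\<close> is not 0.\<close>

lemma not_multiple_p: "\<exists>j<N. p j + t * v j \<noteq> 0"
proof (rule ccontr)
  assume "\<not> ?thesis"
  then have pv: "p j = - t * v j" if "j < N" for j using that by (auto simp: add_eq_0_iff2)
  have z: "evc (H i) (\<lambda>j. p j + w * q j) = 0" if i: "i < r" for i w
  proof (cases "t = 0")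
    case True
    then have "\<forall>j<N. p j = 0 * q j" using pv by simp
    then show ?thesis using p(3) by blast
  next
    case False
    have "evc (H i) (\<lambda>j. p j + w * q j) = evc (H i) (\<lambda>j. - t * (v j + - w / t * q j))"
      using pv vars[OF i] False by (intro ev_cong) (auto simp: field_simps)
    also have "\<dots> = (- t) ^ d i * evc (H i) (\<lambda>j. v j + - w / t * q j)"
      by (rule phom_ev[OF form[OF i]]) simp
    also have "evc (H i) (\<lambda>j. v j + - w / t * q j) = 0"
      using arg_cong[OF line_q[OF i], of "\<lambda>f. poly f (- w / t)"] by (simp add: ev_hom[OF ring_map_poly])
    finally show ?thesis by simp
  qed
  have "evp (H i) (line p q) = [:s * \<kappa> i:]" if i: "i < r" for i
  proof -
    have "evp (H i) (line p q) = 0"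
      using z[OF i] by (intro poly_zero_if_nat_zeros) (simp add: ev_hom[OF ring_map_poly])
    then show ?thesis using z[OF i, of 0] p(1)[OF i] by simp
  qed
  then show False using no_line by blast
qed

lemma not_multiple_q: "\<exists>j<N. q j + t * v j \<noteq> 0"
proof (rule ccontr)
  assume "\<not> ?thesis"
  then have qv: "q j = - t * v j" if "j < N" for j using that by (auto simp: add_eq_0_iff2)
  have "evp (H i) (line p q) = [:s * \<kappa> i:]" if i: "i < r" for i
  proof -
    have "evp (H i) (line p q) - [:s * \<kappa> i:] = 0"
    proof (rule poly_zero_if_nat_zeros)
      fix n
      have "evc (H i) (\<lambda>j. p j + of_nat n * q j) = evc (H i) (\<lambda>j. p j + of_nat n * - t * v j)"
        using qv vars[OF i] by (intro ev_cong) auto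
      also have "\<dots> = s * \<kappa> i"
        using arg_cong[OF line_p[OF i], of "\<lambda>f. poly f (of_nat n * - t)"] by (simp add: ev_hom[OF ring_map_poly])
      finally show "poly (evp (H i) (line p q) - [:s * \<kappa> i:]) (of_nat n) = 0"
        by (simp add: ev_hom[OF ring_map_poly])
    qed
    then show ?thesis by simp
  qed
  then show False using no_line by blast
qed

text \<open>A tangent vector at \<open>p\<close> is the value of a derivation that fixes
  \<open>q\<close>; differentiating the equation of the line shows that \<open>D (v j)\<close>
  completes it to a linear section of the kernel.\<close>

lemma onto_p:
  assumes "\<And>i. i < r \<Longrightarrow> degree (R i) \<le> d i - 1"
  shows "\<exists>x. \<forall>i<r. devp N (H i) (line p v) (cvec x) = R i"
proof (rule line_onto[OF line_p not_multiple_p v _ assms])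
  fix \<xi> assume \<xi>: "\<forall>i<r. devc N (H i) p \<xi> = 0"
  obtain A D where D: "derivation A D" "\<And>a. a \<in> k1 \<Longrightarrow> a \<in> A" "\<And>a. a \<in> k1 \<Longrightarrow> D a = 0"
    "\<And>j. j < N \<Longrightarrow> p j \<in> A" "\<And>j. j < N \<Longrightarrow> v j \<in> A" "\<And>j. j < N \<Longrightarrow> D (p j) = \<xi> j"
    using derivation_p[OF \<xi>, of v] by blast
  have "devp N (H i) (line p v) (\<lambda>j. [:\<xi> j, D (v j):]) = 0" if i: "i < r" for i
  proof -
    have "devp N (H i) (line p v) (\<lambda>j. [:D (p j), D (v j):]) = 0"
      using con[OF i] k1(2,3) k(3)[OF i] D(2-5) vars[OF i] by (intro line_derivation[OF D(1) _ _ _ _ _ line_p[OF i]]) auto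
    moreover have "devp N (H i) (line p v) (\<lambda>j. [:D (p j), D (v j):]) =
        devp N (H i) (line p v) (\<lambda>j. [:\<xi> j, D (v j):])"
      using D(6) by (intro dev_cong) auto
    ultimately show ?thesis by simp
  qed
  then show "\<exists>\<eta>. \<forall>i<r. devp N (H i) (line p v) (line \<xi> \<eta>) = 0"
    by (intro exI[of _ "\<lambda>j. D (v j)"]) blast
qed

lemma onto_q:
  assumes "\<And>i. i < r \<Longrightarrow> degree (R i) \<le> d i - 1"
  shows "\<exists>x. \<forall>i<r. devp N (H i) (line q v) (cvec x) = R i"
proof (rule line_onto[of q v 0, OF _ not_multiple_q v _ assms])
  show "evp (H i) (line q v) = [:0 * \<kappa> i:]" if "i < r" for i using line_q'[OF that] by simp
  fix \<xi> assume \<xi>: "\<forall>i<r. devc N (H i) q \<xi> = 0"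
  obtain A D where D: "derivation A D" "\<And>a. a \<in> k \<Longrightarrow> a \<in> A" "\<And>a. a \<in> k \<Longrightarrow> D a = 0"
    "\<And>j. j < N \<Longrightarrow> q j \<in> A" "\<And>j. j < N \<Longrightarrow> v j \<in> A" "\<And>j. j < N \<Longrightarrow> D (q j) = \<xi> j"
    using derivation_q[OF \<xi>, of v] by blast
  have "devp N (H i) (line q v) (\<lambda>j. [:\<xi> j, D (v j):]) = 0" if i: "i < r" for i
  proof -
    have "evp (H i) (line q v) = [:0:]" using line_q'[OF i] by simp
    then have "devp N (H i) (line q v) (\<lambda>j. [:D (q j), D (v j):]) = 0"
      using con[OF i] D(2-5) vars[OF i] derivationD(4)[OF D(1)] by (intro line_derivation[OF D(1)]) auto
    moreover have "devp N (H i) (line q v) (\<lambda>j. [:D (q j), D (v j):]) =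
        devp N (H i) (line q v) (\<lambda>j. [:\<xi> j, D (v j):])"
      using D(6) by (intro dev_cong) auto
    ultimately show ?thesis by simp
  qed
  then show "\<exists>\<eta>. \<forall>i<r. devp N (H i) (line q v) (line \<xi> \<eta>) = 0"
    by (intro exI[of _ "\<lambda>j. D (v j)"]) blast
qed

lemma coeff_dev_p:
  assumes i: "i < r" and n: "n \<le> d i - 1"
  shows "poly.coeff (devp N (H i) (line p v) (cvec x)) n =
    devc N (hc i (d i - 1 - n) 0) v x"
proof -
  let ?f = "\<lambda>(a, c). 1 ^ a * 0 ^ c * [:0, 1:] ^ (d i - 1 - (a + c)) * devp N (hc i a c) (cvec v) (cvec x)"
  have "devp N (H i) (line p v) (cvec x) =
      devp N (H i) (\<lambda>j. 1 * [:p j:] + [:0, 1:] * [:v j:] + 0 * [:q j:]) (cvec x)" by simp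
  also have "\<dots> = sum ?f (tri (d i - 1))" by (rule dev_expand[OF form[OF i]]) simp
  finally have "poly.coeff (devp N (H i) (line p v) (cvec x)) n = poly.coeff (sum ?f (tri (d i - 1))) n" by (rule arg_cong)
  also have "\<dots> = (\<Sum>z\<in>tri (d i - 1). if z = (d i - 1 - n, 0) then
      devc N (hc i (d i - 1 - n) 0) v x else 0)"
    unfolding coeff_sum
  proof (rule sum.cong[OF refl])
    fix z assume z: "z \<in> tri (d i - 1)"
    obtain a c where ac: "z = (a, c)" by (cases z)
    show "poly.coeff (?f z) n = (if z = (d i - 1 - n, 0) then
        devc N (hc i (d i - 1 - n) 0) v x else 0)"
    proof (cases "c = 0")
      case True
      have f: "?f z = monom (devc N (hc i a 0) v x) (d i - 1 - a)"
        by (simp add: ac True pc_dev_hom monom_altdef)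
      have "a \<le> d i - 1" using z ac True by (simp add: tri_def)
      then have iff: "d i - 1 - a = n \<longleftrightarrow> a = d i - 1 - n" using n by (metis diff_diff_cancel)
      show ?thesis unfolding f coeff_monom iff unfolding ac True by (cases "a = d i - 1 - n") simp_all
    qed (simp add: ac power_0_left)
  qed
  also have "\<dots> = devc N (hc i (d i - 1 - n) 0) v x"
    unfolding sum.delta[OF finite_tri] by (simp add: tri_def)
  finally show ?thesis .
qed

lemma coeff_dev_q:
  assumes i: "i < r" and n: "n \<le> d i - 1"
  shows "poly.coeff (devp N (H i) (line q v) (cvec x)) n =
    devc N (hc i 0 (d i - 1 - n)) v x"
proof -
  let ?f = "\<lambda>(a, c). 0 ^ a * 1 ^ c * [:0, 1:] ^ (d i - 1 - (a + c)) * devp N (hc i a c) (cvec v) (cvec x)"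
  have "devp N (H i) (line q v) (cvec x) =
      devp N (H i) (\<lambda>j. 0 * [:p j:] + [:0, 1:] * [:v j:] + 1 * [:q j:]) (cvec x)" by simp
  also have "\<dots> = sum ?f (tri (d i - 1))" by (rule dev_expand[OF form[OF i]]) simp
  finally have "poly.coeff (devp N (H i) (line q v) (cvec x)) n = poly.coeff (sum ?f (tri (d i - 1))) n" by (rule arg_cong)
  also have "\<dots> = (\<Sum>z\<in>tri (d i - 1). if z = (0, d i - 1 - n) then
      devc N (hc i 0 (d i - 1 - n)) v x else 0)"
    unfolding coeff_sum
  proof (rule sum.cong[OF refl])
    fix z assume z: "z \<in> tri (d i - 1)"
    obtain a c where ac: "z = (a, c)" by (cases z)
    show "poly.coeff (?f z) n = (if z = (0, d i - 1 - n) then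
        devc N (hc i 0 (d i - 1 - n)) v x else 0)"
    proof (cases "a = 0")
      case True
      have f: "?f z = monom (devc N (hc i 0 c) v x) (d i - 1 - c)"
        by (simp add: ac True pc_dev_hom monom_altdef)
      have "c \<le> d i - 1" using z ac True by (simp add: tri_def)
      then have iff: "d i - 1 - c = n \<longleftrightarrow> c = d i - 1 - n" using n by (metis diff_diff_cancel)
      show ?thesis unfolding f coeff_monom iff unfolding ac True by (cases "c = d i - 1 - n") simp_all
    qed (simp add: ac power_0_left)
  qed
  also have "\<dots> = devc N (hc i 0 (d i - 1 - n)) v x"
    unfolding sum.delta[OF finite_tri] by (simp add: tri_def)
  finally show ?thesis .
qed

lemma dev_line_q_zero:
  assumes i: "i < r" and z: "devp N (H i) (line v q) (cvec x) = 0" and c: "c \<le> d i - 1"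
  shows "devc N (hc i 0 c) v x = 0"
proof -
  let ?f = "\<lambda>(a, c). 0 ^ a * [:0, 1:] ^ c * 1 ^ (d i - 1 - (a + c)) * devp N (hc i a c) (cvec v) (cvec x)"
  have "0 = devp N (H i) (\<lambda>j. 0 * [:p j:] + 1 * [:v j:] + [:0, 1:] * [:q j:]) (cvec x)" using z by simp
  also have "\<dots> = sum ?f (tri (d i - 1))" by (rule dev_expand[OF form[OF i]]) simp
  finally have "0 = poly.coeff (sum ?f (tri (d i - 1))) c" by simp
  also have "\<dots> = (\<Sum>z\<in>tri (d i - 1). if z = (0, c) then devc N (hc i 0 c) v x else 0)"
    unfolding coeff_sum
  proof (rule sum.cong[OF refl])
    fix z assume z: "z \<in> tri (d i - 1)"
    obtain a b where ab: "z = (a, b)" by (cases z)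
    show "poly.coeff (?f z) c = (if z = (0, c) then devc N (hc i 0 c) v x else 0)"
    proof (cases "a = 0")
      case True
      have "?f z = monom (devc N (hc i 0 b) v x) b"
        by (simp add: ab True pc_dev_hom monom_altdef)
      then show ?thesis using ab True by auto
    qed (simp add: ab power_0_left)
  qed
  also have "\<dots> = devc N (hc i 0 c) v x"
    unfolding sum.delta[OF finite_tri] using c by (simp add: tri_def)
  finally show ?thesis ..
qed

text \<open>Moving \<open>p\<close> in a suitable direction \<open>\<xi>\<close> while \<open>q\<close> is fixed, \<open>v\<close> moves in a direction which is
  tangent to the second line and has a prescribed effect on the first one.\<close>

lemma chain_transversal:
  "\<exists>x. \<forall>i<r. \<forall>l\<in>{1..<2 * d i}. devc N (hc i (d i - l) (l - d i)) v x = \<rho> i l"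
proof -
  define R1 where "R1 i = (\<Sum>n<d i. monom (\<rho> i (Suc n)) n)" for i
  have R1: "poly.coeff (R1 i) n = (if n < d i then \<rho> i (Suc n) else 0)" for i n by (auto simp: R1_def coeff_sum)
  have "degree (R1 i) \<le> d i - 1" for i by (rule degree_le) (auto simp: R1)
  then obtain x1 where x1: "\<And>i. i < r \<Longrightarrow> devp N (H i) (line p v) (cvec x1) = R1 i"
    using onto_p by blast
  \<comment> \<open>What \<open>x1\<close> leaves to be done on the second line. Index 0 does not
    enter \<open>R2\<close>: it is the common condition at \<open>v\<close>, already settled by
    \<open>x1\<close>.\<close>
  define b where "b i c = \<rho> i (d i + c) - devc N (hc i 0 c) v x1" for i c
  define R2 where "R2 i = (\<Sum>n<d i - 1. monom (b i (d i - 1 - n)) n)" for i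
  have R2: "poly.coeff (R2 i) n = (if n < d i - 1 then b i (d i - 1 - n) else 0)" for i n by (auto simp: R2_def coeff_sum)
  have "degree (R2 i) \<le> d i - 1" for i by (rule degree_le) (auto simp: R2)
  then obtain x2 where x2: "\<And>i. i < r \<Longrightarrow> devp N (H i) (line q v) (cvec x2) = R2 i"
    using onto_q by blast
  have x2c: "devc N (hc i 0 c) v x2 = (if c = 0 then 0 else b i c)" if i: "i < r" and c: "c \<le> d i - 1" for i c
  proof -
    have eqs: "d i - 1 - (d i - 1 - c) = c" "d i - 1 - c < d i - 1 \<longleftrightarrow> c \<noteq> 0" using c degree_pos[OF i] by auto
    have "d i - 1 - c \<le> d i - 1" by simp
    from coeff_dev_q[OF i this, of x2] show ?thesis unfolding x2[OF i] R2 eqs by (simp split: if_splits)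
  qed
  \<comment> \<open>The unwanted effect of \<open>x2\<close> on the first line. As \<open>x2\<close>
    is tangent to the cone at \<open>v\<close>, its coefficient of degree \<open>d i - 1\<close>
    vanishes, so that multiplication by the parameter stays within this degree.\<close>
  define P where "P i = devp N (H i) (line p v) (cvec x2)" for i
  have dP: "degree ([:0, -1:] * P i) \<le> d i - 1" if i: "i < r" for i
  proof (rule degree_le, intro allI impI)
    fix n assume n: "n > d i - 1"
    have "degree (P i) \<le> d i - 1"
      unfolding P_def dev_def
    proof (rule degree_sum_le)
      fix j
      have "degree (evp (pd j (H i)) (line p v) * [:x2 j:]) \<le>
          degree (evp (pd j (H i)) (line p v)) + degree [:x2 j:]" by (rule degree_mult_le)
      then show "degree (evp (pd j (H i)) (line p v) * [:x2 j:]) \<le> d i - 1"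
        using degree_ev_line[OF phom_pd[OF form[OF i]], of j p v] by simp
    qed simp
    moreover have "poly.coeff (P i) (d i - 1) = 0"
      using coeff_dev_p[OF i, of "d i - 1" x2] x2c[OF i, of 0] by (simp add: P_def)
    ultimately have "poly.coeff (P i) (n - 1) = 0"
      using n degree_pos[OF i] by (cases "n - 1 = d i - 1") (auto intro: coeff_eq_0)
    then show "poly.coeff ([:0, -1:] * P i) n = 0" using n by (cases n) auto
  qed
  \<comment> \<open>When \<open>p\<close> moves in this direction, the first line stays on its level
    only if the motion \<open>\<eta>\<close> of \<open>v\<close> has the effect \<open>P i\<close>,
    which cancels that of \<open>x2\<close>.\<close>
  then obtain \<xi> where \<xi>: "\<And>i. i < r \<Longrightarrow> devp N (H i) (line p v) (cvec \<xi>) = [:0, -1:] * P i"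
    using onto_p[of "\<lambda>i. [:0, -1:] * P i"] by blast
  have "\<forall>i<r. devc N (H i) p \<xi> = 0"
  proof (intro allI impI)
    fix i assume "i < r"
    from arg_cong[OF \<xi>[OF this], of "\<lambda>f. poly f 0"] show "devc N (H i) p \<xi> = 0"
      by (simp add: dev_hom[OF ring_map_poly])
  qed
  then obtain A D where D: "derivation A D" "\<And>a. a \<in> k1 \<Longrightarrow> a \<in> A" "\<And>a. a \<in> k1 \<Longrightarrow> D a = 0"
    "\<And>j. j < N \<Longrightarrow> p j \<in> A" "\<And>j. j < N \<Longrightarrow> v j \<in> A" "\<And>j. j < N \<Longrightarrow> D (p j) = \<xi> j"
    using derivation_p[of \<xi> v] by blast
  define \<eta> where "\<eta> j = D (v j)" for j
  have \<eta>p: "devp N (H i) (line p v) (cvec \<eta>) = P i" if i: "i < r" for i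
  proof -
    have "0 = devp N (H i) (line p v) (\<lambda>j. [:D (p j), D (v j):])"
      using con[OF i] k1(2,3) k(3)[OF i] D(2-5) vars[OF i] by (intro line_derivation[OF D(1) _ _ _ _ _ line_p[OF i], symmetric]) auto
    also have "\<dots> = devp N (H i) (line p v) (\<lambda>j. [:\<xi> j:] + [:0, 1:] * [:\<eta> j:])"
      using D(6) by (intro dev_cong) (auto simp: \<eta>_def)
    also have "\<dots> = [:0, -1:] * P i + [:0, 1:] * devp N (H i) (line p v) (cvec \<eta>)"
      unfolding dev_add dev_scale \<xi>[OF i] ..
    finally have "[:0, 1:] * (devp N (H i) (line p v) (cvec \<eta>) - P i) = 0"
      by (simp add: algebra_simps)
    then show ?thesis by (subst (asm) mult_eq_0_iff) simp
  qed
  have \<eta>q: "devc N (hc i 0 c) v \<eta> = 0" if i: "i < r" and c: "c \<le> d i - 1" for i c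
  proof (rule dev_line_q_zero[OF i _ c])
    have "evp (H i) (line v q) = [:0:]" using line_q[OF i] by simp
    then have "0 = devp N (H i) (line v q) (\<lambda>j. [:D (v j), D (q j):])"
      using con[OF i] k1(2,3) k(3)[OF i] D(2-5) vars[OF i] derivationD(4)[OF D(1)]
      by (intro line_derivation[OF D(1), symmetric]) auto
    also have "\<dots> = devp N (H i) (line v q) (cvec \<eta>)"
      using D(3) k1(3) by (intro dev_cong) (auto simp: \<eta>_def)
    finally show "devp N (H i) (line v q) (cvec \<eta>) = 0" ..
  qed
  define x where "x j = x1 j + (x2 j - \<eta> j)" for j
  have "devc N (hc i (d i - l) (l - d i)) v x = \<rho> i l" if i: "i < r" and l: "l \<in> {1..<2 * d i}" for i l
  proof (cases "l \<le> d i")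
    case True
    have pcx: "[:x j:] = [:x1 j:] + ([:x2 j:] - [:\<eta> j:])" for j by (simp add: x_def)
    have "devp N (H i) (line p v) (cvec x) = R1 i"
      unfolding pcx dev_add dev_diff x1[OF i] \<eta>p[OF i] P_def[symmetric] by simp
    then have "poly.coeff (R1 i) (l - 1) = devc N (hc i (d i - 1 - (l - 1)) 0) v x"
      using coeff_dev_p[OF i, of "l - 1" x] True by simp
    moreover have "d i - 1 - (l - 1) = d i - l" "l - d i = 0" "l - 1 < d i" "Suc (l - 1) = l" using l True by auto
    ultimately show ?thesis by (simp add: R1)
  next
    case False
    define c where "c = l - d i"
    have c: "l = d i + c" "c \<noteq> 0" "c \<le> d i - 1" "d i - l = 0" using False l by (auto simp: c_def)
    have "devc N (hc i 0 c) v x = \<rho> i l"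
      unfolding x_def dev_add dev_diff x2c[OF i c(3)] \<eta>q[OF i c(3)] using c by (simp add: b_def)
    then show ?thesis unfolding c(4) c_def[symmetric] .
  qed
  then show ?thesis by blast
qed

end

section \<open>Smoothing a chain to a conic\<close>

lemma tame_dev: "tame (\<lambda>y. dev N h e u y) (\<lambda>y z. dev N h e u z)"
  unfolding tame_def
proof (intro conjI allI impI)
  fix v x :: "nat \<Rightarrow> 'a" and w :: 'a
  show "\<exists>z. dev N h e u (\<lambda>j. v j + w * x j) = dev N h e u v + w * dev N h e u x + w\<^sup>2 * z"
    by (intro exI[of _ 0]) (simp add: dev_add dev_scale)
next
  fix a and v v' :: "nat \<Rightarrow> 'a" assume "\<forall>j. a dvd v j - v' j"
  then have "a dvd dev N h e u (\<lambda>j. v j - v' j)" unfolding dev_def by (intro dvd_sum dvd_mult) blast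
  then show "a dvd dev N h e u v - dev N h e u v'" by (simp add: dev_diff)
qed simp

lemma emb_power: "emb A \<sigma> \<Longrightarrow> a \<in> A \<Longrightarrow> \<sigma> (a ^ n) = \<sigma> a ^ n"
  by (induction n) (simp_all add: embD subring_power[OF embD(1)])

text \<open>The pairs \<open>(a, c)\<close> whose term in the expansion along the conic, where
  \<open>A = \<lambda>^2\<close>, \<open>B = 1\<close> and \<open>C = \<lambda>\<close>, has degree
  \<open>2 * d - l\<close> in \<lambda>.\<close>

definition band :: "nat \<Rightarrow> nat \<Rightarrow> (nat \<times> nat) set" where
  "band d l = {(a, c). a + c \<le> d \<and> d + c = l + a}"

lemma band_subset: "band d l \<subseteq> tri d"
  by (auto simp: band_def tri_def)

lemma finite_band: "finite (band d l)"
  using finite_subset[OF band_subset finite_tri] .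

lemma fps_nth_0_band:
  assumes "l < 2 * d"
  shows "fps_nth (\<Sum>(a, c)\<in>band d l. fps_X ^ (c - (l - d)) * F a c) 0 = fps_nth (F (d - l) (l - d) :: complex fps) 0"
proof -
  have mem: "(d - l, l - d) \<in> band d l" using assms by (auto simp: band_def)
  have "fps_nth (\<Sum>(a, c)\<in>band d l. fps_X ^ (c - (l - d)) * F a c) 0 =
      (\<Sum>z\<in>band d l. if z = (d - l, l - d) then fps_nth (F (d - l) (l - d)) 0 else 0)"
    unfolding fps_sum_nth
  proof (rule sum.cong[OF refl])
    fix z assume z: "z \<in> band d l"
    obtain a c where ac: "z = (a, c)" by (cases z)
    have e: "d + c = l + a" using z ac by (simp add: band_def)
    show "fps_nth (case z of (a, c) \<Rightarrow> fps_X ^ (c - (l - d)) * F a c) 0 =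
        (if z = (d - l, l - d) then fps_nth (F (d - l) (l - d)) 0 else 0)"
    proof (cases "z = (d - l, l - d)")
      case True
      then show ?thesis by simp
    next
      case False
      have "c - (l - d) \<noteq> 0"
      proof
        assume "c - (l - d) = 0"
        then have "c = l - d" "a = d - l" using e by arith+
        then show False using False ac by simp
      qed
      then show ?thesis using False ac by (simp add: fps_X_power_mult_nth)
    qed
  qed
  also have "\<dots> = fps_nth (F (d - l) (l - d)) 0"
    unfolding sum.delta[OF finite_band] using mem by simp
  finally show ?thesis .
qed

context chain
begin

text \<open>Up to a power of \<open>\<delta>\<close>, this is the coefficient of degree
  \<open>2 * d i - l\<close> in \<lambda> of \<open>H i\<close> along
  \<open>q + \<lambda> x / \<delta> + \<lambda>^2 p\<close>, where
  \<open>\<delta>^2 = fps_X\<close>. On the band the exponent of \<open>fps_X\<close> equals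
  \<open>min a c\<close>, so that at 0 only the chain condition of index \<open>l\<close>
  survives.\<close>

definition smoothing :: "nat \<Rightarrow> nat \<Rightarrow> (nat \<Rightarrow> complex fps) \<Rightarrow> complex fps" where
  "smoothing i l x = (\<Sum>(a, c)\<in>band (d i) l. fps_X ^ (c - (l - d i)) * ev fps_const (hc i a c) x)"

definition dsmoothing :: "nat \<Rightarrow> nat \<Rightarrow> (nat \<Rightarrow> complex fps) \<Rightarrow> (nat \<Rightarrow> complex fps) \<Rightarrow> complex fps" where
  "dsmoothing i l x y = (\<Sum>(a, c)\<in>band (d i) l. fps_X ^ (c - (l - d i)) * dev N fps_const (hc i a c) x y)"

text \<open>At \<open>fps_X = 0\<close> the system describes the chain, and
  \<open>chain_transversal\<close> is the surjectivity of its linearization; so the chain deforms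
  formally.\<close>

lemma formal_conic:
  "\<exists>x. (\<forall>j. fps_nth (x j) 0 = v j) \<and> (\<forall>i<r. \<forall>l\<in>{1..<2 * d i}. smoothing i l x = 0)"
proof -
  define I where "I = {(i, l). i < r \<and> l \<in> {1..<2 * d i}}"
  define \<Psi>' where "\<Psi>' = (\<lambda>(i, l) x y. \<Sum>z\<in>band (d i) l. 0 * ev fps_const (hc i (fst z) (snd z)) x +
     fps_X ^ (snd z - (l - d i)) * dev N fps_const (hc i (fst z) (snd z)) x y)"
  have \<Psi>': "\<Psi>' (i, l) = dsmoothing i l" for i l
    by (intro ext) (simp add: \<Psi>'_def dsmoothing_def case_prod_unfold)
  have "\<exists>x. (\<forall>j. fps_nth (x j) 0 = v j) \<and> (\<forall>z\<in>I. (\<lambda>(i, l). smoothing i l) z x = 0)"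
  proof (rule formal_solution[where \<Psi>' = \<Psi>'])
    fix z assume "z \<in> I"
    then obtain i l where z: "z = (i, l)" "i < r" "l \<in> {1..<2 * d i}" by (auto simp: I_def)
    have vars': "pvars (hc i a c) \<subseteq> {..<N}" for a c by (rule order_trans[OF pvars_hco vars[OF z(2)]])
    have "tame (\<lambda>x. \<Sum>z\<in>band (d i) l. fps_X ^ (snd z - (l - d i)) * ev fps_const (hc i (fst z) (snd z)) x) (\<Psi>' (i, l))"
      unfolding \<Psi>'_def split_conv
      by (intro tame_sum tame_mult[OF tame_const] tame_ev vars') simp
    then show "tame ((\<lambda>(i, l). smoothing i l) z) (\<Psi>' z)"
      by (simp add: z smoothing_def[abs_def] case_prod_unfold)
    have "fps_nth (smoothing i l (fvec v)) 0 = evc (hc i (d i - l) (l - d i)) v"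
      unfolding smoothing_def using z(3) by (subst fps_nth_0_band) (auto simp: ev_hom[OF ring_map_fps_nth_0])
    then show "fps_nth ((\<lambda>(i, l). smoothing i l) z (fvec v)) 0 = 0"
      using chain[OF z(2,3)] by (simp add: z)
  next
    fix \<rho> :: "nat \<times> nat \<Rightarrow> complex"
    obtain y where y: "\<And>i l. i < r \<Longrightarrow> l \<in> {1..<2 * d i} \<Longrightarrow> devc N (hc i (d i - l) (l - d i)) v y = \<rho> (i, l)"
      using chain_transversal[of "\<lambda>i l. \<rho> (i, l)"] by blast
    have "fps_nth (\<Psi>' z (fvec v) (fvec y)) 0 = \<rho> z" if zI: "z \<in> I" for z
    proof -
      obtain i l where z: "z = (i, l)" "i < r" "l \<in> {1..<2 * d i}" using zI by (auto simp: I_def)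
      show ?thesis unfolding z(1) \<Psi>' dsmoothing_def using z(3) y[OF z(2,3)]
        by (subst fps_nth_0_band) (auto simp: dev_hom[OF ring_map_fps_nth_0])
    qed
    then show "\<exists>y. \<forall>z\<in>I. fps_nth (\<Psi>' z (fvec v) (fvec y)) 0 = \<rho> z" by blast
  qed
  then show ?thesis by (auto simp: I_def)
qed

text \<open>Preimages of the unit vectors are needed as power series: surjectivity then concerns
  finitely many ring elements and survives the replacement of the variable by a number.\<close>

lemma formal_conic_onto:
  assumes x: "\<And>j. fps_nth (x j) 0 = v j"
  shows "\<exists>y. \<forall>i<r. \<forall>l\<in>{1..<2 * d i}. dsmoothing i l x y = (if i = i0 \<and> l = l0 then 1 else 0)"
proof -
  define I where "I = {(i, l). i < r \<and> l \<in> {1..<2 * d i}}"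
  define w where "w = (\<lambda>(i, l). - (if i = i0 \<and> l = l0 then 1 else 0) :: complex fps)"
  define \<Psi> where "\<Psi> = (\<lambda>(i, l) y. (\<Sum>z\<in>band (d i) l. 
     fps_X ^ (snd z - (l - d i)) * dev N fps_const (hc i (fst z) (snd z)) x y) + w (i, l))"
  define \<Psi>' where "\<Psi>' = (\<lambda>(i, l) y y'. (\<Sum>z\<in>band (d i) l. 0 * dev N fps_const (hc i (fst z) (snd z)) x y +
     fps_X ^ (snd z - (l - d i)) * dev N fps_const (hc i (fst z) (snd z)) x y') + 0)"
  have \<Psi>: "\<Psi> (i, l) y = dsmoothing i l x y + w (i, l)" and \<Psi>': "\<Psi>' (i, l) y y' = dsmoothing i l x y'" for i l y y'
    by (simp_all add: \<Psi>_def \<Psi>'_def dsmoothing_def case_prod_unfold)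
  have nth: "fps_nth (dsmoothing i l x (fvec y)) 0 = devc N (hc i (d i - l) (l - d i)) v y"
    if "l \<in> {1..<2 * d i}" for i l y
    unfolding dsmoothing_def using that by (subst fps_nth_0_band) (auto simp: dev_hom[OF ring_map_fps_nth_0] x)
  obtain y0 where y0: "\<And>i l. i < r \<Longrightarrow> l \<in> {1..<2 * d i} \<Longrightarrow> devc N (hc i (d i - l) (l - d i)) v y0 = - fps_nth (w (i, l)) 0"
    using chain_transversal[of "\<lambda>i l. - fps_nth (w (i, l)) 0"] by blast
  have "\<exists>y. (\<forall>j. fps_nth (y j) 0 = y0 j) \<and> (\<forall>z\<in>I. \<Psi> z y = 0)"
  proof (rule formal_solution[where \<Psi>' = \<Psi>'])
    fix z assume "z \<in> I"
    then obtain i l where z: "z = (i, l)" "i < r" "l \<in> {1..<2 * d i}" by (auto simp: I_def)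
    show "tame (\<Psi> z) (\<Psi>' z)"
      unfolding z(1) \<Psi>_def \<Psi>'_def split_conv
      by (intro tame_add tame_sum tame_mult[OF tame_const] tame_dev tame_const)
    show "fps_nth (\<Psi> z (fvec y0)) 0 = 0"
      by (simp add: z(1) \<Psi> nth[OF z(3)] y0[OF z(2,3)])
  next
    fix \<rho> :: "nat \<times> nat \<Rightarrow> complex"
    obtain y where y: "\<And>i l. i < r \<Longrightarrow> l \<in> {1..<2 * d i} \<Longrightarrow> devc N (hc i (d i - l) (l - d i)) v y = \<rho> (i, l)"
      using chain_transversal[of "\<lambda>i l. \<rho> (i, l)"] by blast
    have "fps_nth (\<Psi>' z (fvec y0) (fvec y)) 0 = \<rho> z" if "z \<in> I" for z
      using that y nth by (auto simp: I_def \<Psi>')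
    then show "\<exists>y. \<forall>z\<in>I. fps_nth (\<Psi>' z (fvec y0) (fvec y)) 0 = \<rho> z" by blast
  qed
  then obtain y where y: "\<And>z. z \<in> I \<Longrightarrow> \<Psi> z y = 0" by blast
  have "dsmoothing i l x y = (if i = i0 \<and> l = l0 then 1 else 0)" if "i < r" "l \<in> {1..<2 * d i}" for i l
    using y[of "(i, l)"] that by (auto simp: I_def \<Psi> w_def)
  then show ?thesis by blast
qed

lemma numerical_conic:
  "\<exists>\<epsilon> x. \<epsilon> \<noteq> 0 \<and>
    (\<forall>i<r. \<forall>l\<in>{1..<2 * d i}. (\<Sum>(a, c)\<in>band (d i) l. \<epsilon> ^ (c - (l - d i)) * evc (hc i a c) x) = 0) \<and>
    (\<forall>\<rho>. \<exists>y. \<forall>i<r. \<forall>l\<in>{1..<2 * d i}.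
       (\<Sum>(a, c)\<in>band (d i) l. \<epsilon> ^ (c - (l - d i)) * devc N (hc i a c) x y) = \<rho> i l)"
proof -
  obtain x where x: "\<And>j. fps_nth (x j) 0 = v j" "\<And>i l. i < r \<Longrightarrow> l \<in> {1..<2 * d i} \<Longrightarrow> smoothing i l x = 0"
    using formal_conic by blast
  have "\<forall>i0 l0. \<exists>y. \<forall>i<r. \<forall>l\<in>{1..<2 * d i}. dsmoothing i l x y = (if i = i0 \<and> l = l0 then 1 else 0)"
    using formal_conic_onto[of x, OF x(1)] by (intro allI)
  then obtain y where y: "\<And>i0 l0 i l. i < r \<Longrightarrow> l \<in> {1..<2 * d i} \<Longrightarrow>
      dsmoothing i l x (y i0 l0) = (if i = i0 \<and> l = l0 then 1 else 0)"
    unfolding choice_iff by blast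
  have "finite (p ` {..<N} \<union> q ` {..<N} \<union> (\<Union>i<r. pconsts (H i)))" by (simp add: finite_pconsts)
  from exists_countable_subring[OF this] obtain K0
    where K0: "subring K0" "countable K0" "p ` {..<N} \<union> q ` {..<N} \<union> (\<Union>i<r. pconsts (H i)) \<subseteq> K0" by blast
  have con0: "z \<in> K0" if "z \<in> pconsts (hc i a c)" "i < r" for z i a c
    using that pconsts_hco[OF vars[OF that(2)], of p q a c] K0(3) subringD(1)[OF K0(1)] by blast
  have var0: "pvars (hc i a c) \<subseteq> {..<N}" if "i < r" for i a c
    by (rule order_trans[OF pvars_hco vars[OF that]])
  have var1: "j < N" if "j \<in> pvars (hc i a c)" "i < r" for i j a c
    using var0[OF that(2), of a c] that(1) by blast
  have var2: "j < N" if "j \<in> pvars (pd l (hc i a c))" "i < r" for i j l a c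
    using pvars_pd[of l "hco p q (H i) a c"] that by (intro var1[OF _ that(2)]) blast
  have con1: "z \<in> K0" if z: "z \<in> pconsts (pd l (hc i a c))" and i: "i < r" for i z l a c
  proof -
    have "z \<in> pconsts (hc i a c) \<or> z = 0 \<or> z = 1" using pconsts_pd[of l "hco p q (H i) a c"] z by blast
    then show ?thesis using con0[OF _ i] subringD(1,2)[OF K0(1)] by blast
  qed
  define K where "K = fls_const ` K0"
  have K: "subring K" "countable K" unfolding K_def using K0 by (auto intro: subring_image[OF emb_fls_const])
  define m where "m = (\<Sum>i<r. 2 * d i)"
  have lm: "l < m" if "i < r" "l \<in> {1..<2 * d i}" for i l
  proof -
    have "2 * d i \<le> m" unfolding m_def using that(1) by (intro member_le_sum) auto
    then show ?thesis using that(2) by simp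
  qed
  define Ls where "Ls = [fls_X] @ map (\<lambda>j. fps_to_fls (x j)) [0..<N] @
    concat (map (\<lambda>i. concat (map (\<lambda>l. map (\<lambda>j. fps_to_fls (y i l j)) [0..<N]) [0..<m])) [0..<r])"
  define R where "R = adjoin_list K Ls"
  have R: "subring R" unfolding R_def by (rule subring_adjoin_list[OF K(1)])
  have gen: "z \<in> R" if "z \<in> set Ls" for z unfolding R_def by (rule adjoin_list_generators[OF K(1) that])
  have XR: "fls_X \<in> R" by (rule gen) (simp add: Ls_def)
  have xR: "fps_to_fls (x j) \<in> R" if "j < N" for j by (rule gen) (simp add: Ls_def that)
  have yR: "fps_to_fls (y i l j) \<in> R" if "i < r" "l < m" "j < N" for i l j
  proof (rule gen)
    have "fps_to_fls (y i l j) \<in> set (concat (map (\<lambda>i. concat (map (\<lambda>l. map (\<lambda>j. fps_to_fls (y i l j)) [0..<N]) [0..<m])) [0..<r]))"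
      unfolding set_concat set_map image_image using that
      by (intro UN_I[of i] UN_I[of l "set [0..<m]"] imageI) simp_all
    then show "fps_to_fls (y i l j) \<in> set Ls" by (simp add: Ls_def)
  qed
  have cR: "fls_const a \<in> R" if "a \<in> K0" for a
    unfolding R_def by (rule adjoin_list_superset[OF K(1)]) (simp add: K_def that)
  have "emb K (\<lambda>a. fls_nth a 0)" using K(1) by (auto simp: emb_def K_def)
  then obtain \<sigma> where \<sigma>: "emb R \<sigma>" "\<And>a. a \<in> K \<Longrightarrow> \<sigma> a = fls_nth a 0"
    using emb_extend_complex_list[OF _ K(2)] unfolding R_def by blast
  have \<sigma>c: "\<sigma> (fls_const a) = a" if "a \<in> K0" for a using \<sigma>(2) that by (simp add: K_def)
  \<comment> \<open>Injectivity of \<open>\<sigma>\<close> makes the image of \<open>fls_X\<close> a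
    nonzero number; no convergence is involved.\<close>
  define \<epsilon> X Y where "\<epsilon> = \<sigma> fls_X" and "X j = \<sigma> (fps_to_fls (x j))" and "Y i l j = \<sigma> (fps_to_fls (y i l j))" for i l j
  have "\<epsilon> \<noteq> 0" using embD(6)[OF \<sigma>(1) XR] by (auto simp: \<epsilon>_def)
  have transfer: "\<sigma> (fps_to_fls (\<Sum>(a, c)\<in>band (d i) l. fps_X ^ (c - (l - d i)) * F a c)) =
      (\<Sum>(a, c)\<in>band (d i) l. \<epsilon> ^ (c - (l - d i)) * \<sigma> (fps_to_fls (F a c)))"
    if "\<And>a c. fps_to_fls (F a c) \<in> R" for F i l
  proof -
    have "fps_to_fls (\<Sum>(a, c)\<in>band (d i) l. fps_X ^ (c - (l - d i)) * F a c) =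
        (\<Sum>(a, c)\<in>band (d i) l. fls_X ^ (c - (l - d i)) * fps_to_fls (F a c))"
      by (simp add: ring_map_sum[OF ring_map_fps_to_fls] case_prod_unfold fls_times_fps_to_fls fps_to_fls_power)
    also have "\<sigma> \<dots> = (\<Sum>z\<in>band (d i) l. \<sigma> (fls_X ^ (snd z - (l - d i)) * fps_to_fls (F (fst z) (snd z))))"
      unfolding case_prod_unfold using that
      by (intro emb_sum[OF \<sigma>(1)] subringD(4)[OF R] subring_power[OF R] XR)
    also have "\<dots> = (\<Sum>z\<in>band (d i) l. \<epsilon> ^ (snd z - (l - d i)) * \<sigma> (fps_to_fls (F (fst z) (snd z))))"
      using that by (simp add: embD(5)[OF \<sigma>(1)] emb_power[OF \<sigma>(1)] XR subring_power[OF R] \<epsilon>_def)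
    finally show ?thesis by (simp add: case_prod_unfold)
  qed
  have evR: "fps_to_fls (ev fps_const (hc i a c) x) \<in> R"
    "\<sigma> (fps_to_fls (ev fps_const (hc i a c) x)) = evc (hc i a c) X" if i: "i < r" for i a c
  proof -
    have *: "fps_to_fls (ev fps_const (hc i a c) x) = ev fls_const (hc i a c) (\<lambda>j. fps_to_fls (x j))"
      by (simp add: ev_hom[OF ring_map_fps_to_fls])
    show "fps_to_fls (ev fps_const (hc i a c) x) \<in> R"
      unfolding * by (intro subring_ev[OF R] cR con0[OF _ i] xR var1[OF _ i])
    show "\<sigma> (fps_to_fls (ev fps_const (hc i a c) x)) = evc (hc i a c) X"
      unfolding * X_def[abs_def] by (intro emb_ev[OF \<sigma>(1)] cR \<sigma>c con0[OF _ i] xR var1[OF _ i])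
  qed
  have devR: "fps_to_fls (dev N fps_const (hc i a c) x (y i0 l0)) \<in> R"
    "\<sigma> (fps_to_fls (dev N fps_const (hc i a c) x (y i0 l0))) = devc N (hc i a c) X (Y i0 l0)"
    if i: "i < r" and il: "i0 < r" "l0 < m" for i a c i0 l0
  proof -
    have *: "fps_to_fls (dev N fps_const (hc i a c) x (y i0 l0)) =
        dev N fls_const (hc i a c) (\<lambda>j. fps_to_fls (x j)) (\<lambda>j. fps_to_fls (y i0 l0 j))"
      by (simp add: dev_hom[OF ring_map_fps_to_fls])
    have "ev fls_const (pd j (hc i a c)) (\<lambda>j. fps_to_fls (x j)) \<in> R" for j
      by (intro subring_ev[OF R] cR con1[OF _ i] xR var2[OF _ i])
    then show "fps_to_fls (dev N fps_const (hc i a c) x (y i0 l0)) \<in> R"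
      unfolding * unfolding dev_def using yR il by (intro subring_sum[OF R] subringD(4)[OF R]) auto
    show "\<sigma> (fps_to_fls (dev N fps_const (hc i a c) x (y i0 l0))) = devc N (hc i a c) X (Y i0 l0)"
      unfolding * X_def[abs_def] Y_def[abs_def]
      by (intro emb_dev[OF \<sigma>(1)] cR \<sigma>c con0[OF _ i] xR yR il var0[OF i] ring_map_fls_const ring_map_id)
  qed
  have eqX: "(\<Sum>(a, c)\<in>band (d i) l. \<epsilon> ^ (c - (l - d i)) * evc (hc i a c) X) = 0" if "i < r" "l \<in> {1..<2 * d i}" for i l
  proof -
    have "\<sigma> (fps_to_fls (smoothing i l x)) = (\<Sum>(a, c)\<in>band (d i) l. \<epsilon> ^ (c - (l - d i)) * evc (hc i a c) X)"
      unfolding smoothing_def using evR[OF that(1)] by (subst transfer) auto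
    then show ?thesis using x(2)[OF that] embD(2)[OF \<sigma>(1)] by simp
  qed
  have eqY: "(\<Sum>(a, c)\<in>band (d i) l. \<epsilon> ^ (c - (l - d i)) * devc N (hc i a c) X (Y i0 l0)) =
      (if i = i0 \<and> l = l0 then 1 else 0)" if "i < r" "l \<in> {1..<2 * d i}" "i0 < r" "l0 < m" for i l i0 l0
  proof -
    have "\<sigma> (fps_to_fls (dsmoothing i l x (y i0 l0))) =
        (\<Sum>(a, c)\<in>band (d i) l. \<epsilon> ^ (c - (l - d i)) * devc N (hc i a c) X (Y i0 l0))"
      unfolding dsmoothing_def using devR[OF that(1,3,4)] by (subst transfer) auto
    then show ?thesis using y[OF that(1,2), of i0 l0] embD(2,3)[OF \<sigma>(1)] by (cases "i = i0 \<and> l = l0") auto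
  qed
  have "\<exists>y. \<forall>i<r. \<forall>l\<in>{1..<2 * d i}.
       (\<Sum>(a, c)\<in>band (d i) l. \<epsilon> ^ (c - (l - d i)) * devc N (hc i a c) X y) = \<rho> i l" for \<rho>
  proof (intro exI[of _ "\<lambda>j. \<Sum>i0<r. \<Sum>l0<m. \<rho> i0 l0 * Y i0 l0 j"] allI impI ballI)
    fix i l assume il: "i < r" "l \<in> {1..<2 * d i}"
    have "(\<Sum>(a, c)\<in>band (d i) l. \<epsilon> ^ (c - (l - d i)) * devc N (hc i a c) X (\<lambda>j. \<Sum>i0<r. \<Sum>l0<m. \<rho> i0 l0 * Y i0 l0 j)) =
      (\<Sum>z\<in>band (d i) l. \<Sum>i0<r. \<Sum>l0<m. \<rho> i0 l0 * (\<epsilon> ^ (snd z - (l - d i)) * devc N (hc i (fst z) (snd z)) X (Y i0 l0)))"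
      by (simp add: case_prod_unfold dev_sum dev_scale sum_distrib_left mult_ac)
    also have "\<dots> = (\<Sum>i0<r. \<Sum>l0<m. \<Sum>z\<in>band (d i) l. \<rho> i0 l0 * (\<epsilon> ^ (snd z - (l - d i)) * devc N (hc i (fst z) (snd z)) X (Y i0 l0)))"
      by (subst sum.swap, intro sum.cong refl, rule sum.swap)
    also have "\<dots> = (\<Sum>i0<r. \<Sum>l0<m. \<rho> i0 l0 * (if i = i0 \<and> l = l0 then 1 else 0))"
      using eqY[OF il] by (intro sum.cong refl) (simp add: case_prod_unfold flip: sum_distrib_left)
    also have "\<dots> = (\<Sum>i0<r. if i0 = i then \<rho> i l else 0)"
    proof (rule sum.cong[OF refl])
      fix i0
      have "(\<Sum>l0<m. \<rho> i0 l0 * (if i = i0 \<and> l = l0 then 1 else 0)) = (\<Sum>l0<m. if l0 = l then (if i0 = i then \<rho> i l else 0) else 0)"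
        by (intro sum.cong refl) auto
      then show "(\<Sum>l0<m. \<rho> i0 l0 * (if i = i0 \<and> l = l0 then 1 else 0)) = (if i0 = i then \<rho> i l else 0)"
        using lm[OF il] by simp
    qed
    also have "\<dots> = \<rho> i l" using il by simp
    finally show "(\<Sum>(a, c)\<in>band (d i) l. \<epsilon> ^ (c - (l - d i)) * devc N (hc i a c) X (\<lambda>j. \<Sum>i0<r. \<Sum>l0<m. \<rho> i0 l0 * Y i0 l0 j)) = \<rho> i l" .
  qed
  then show ?thesis using \<open>\<epsilon> \<noteq> 0\<close> eqX by blast
qed

end

lemma phom_0_dev: "phom 0 e \<Longrightarrow> ring_map h \<Longrightarrow> dev N h e v x = 0"
  using phom_0_pd[of 0 e] by (simp add: dev_def pzero_ev)

context chain
begin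

lemma hco_extreme:
  assumes i: "i < r"
  shows "evc (hc i (d i) 0) x = s * \<kappa> i" "evc (hc i 0 (d i)) x = 0"
proof -
  have "evc (H i) (\<lambda>j. 1 * p j + 0 * x j + 0 * q j) =
      (\<Sum>(a, c)\<in>tri (d i). 1 ^ a * 0 ^ c * 0 ^ (d i - (a + c)) * evc (hc i a c) x)"
    by (rule ev_expand[OF form[OF i] ring_map_id])
  also have "\<dots> = (\<Sum>z\<in>tri (d i). if z = (d i, 0) then evc (hc i (d i) 0) x else 0)"
    by (rule sum.cong[OF refl]) (auto simp: tri_def power_0_left split: if_splits)
  also have "\<dots> = evc (hc i (d i) 0) x"
    unfolding sum.delta[OF finite_tri] by (simp add: tri_def)
  finally show "evc (hc i (d i) 0) x = s * \<kappa> i" using p(1)[OF i] by simp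
  have "evc (H i) (\<lambda>j. 0 * p j + 0 * x j + 1 * q j) =
      (\<Sum>(a, c)\<in>tri (d i). 0 ^ a * 1 ^ c * 0 ^ (d i - (a + c)) * evc (hc i a c) x)"
    by (rule ev_expand[OF form[OF i] ring_map_id])
  also have "\<dots> = (\<Sum>z\<in>tri (d i). if z = (0, d i) then evc (hc i 0 (d i)) x else 0)"
    by (rule sum.cong[OF refl]) (auto simp: tri_def power_0_left split: if_splits)
  also have "\<dots> = evc (hc i 0 (d i)) x"
    unfolding sum.delta[OF finite_tri] by (simp add: tri_def)
  finally show "evc (hc i 0 (d i)) x = 0" using q(2)[OF i] by simp
qed

lemma sum_band:
  "(\<Sum>(a, c)\<in>tri e. if e + a - c = n then F a c else 0) = (\<Sum>(a, c)\<in>band e (2 * e - n). F a c)"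
  if "n \<le> 2 * e" for F :: "nat \<Rightarrow> nat \<Rightarrow> complex"
proof -
  have "(\<Sum>(a, c)\<in>tri e. if e + a - c = n then F a c else 0) = (\<Sum>z\<in>tri e. if z \<in> band e (2 * e - n) then F (fst z) (snd z) else 0)"
    using that by (intro sum.cong refl) (auto simp: tri_def band_def split: if_splits)
  also have "\<dots> = (\<Sum>z\<in>band e (2 * e - n). F (fst z) (snd z))"
    using band_subset[of e "2 * e - n"] by (simp add: sum.If_cases[OF finite_tri] Int_absorb1)
  finally show ?thesis by (simp add: case_prod_unfold)
qed

text \<open>The scaling \<open>a = X / \<delta>\<close> with \<open>\<delta>^2 = \<epsilon>\<close>
  turns the smoothed equations into the coefficients of the conic. Those strictly between the
  extreme degrees vanish by the choice of \<open>X\<close>; \<open>hco_extreme\<close> supplies the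
  ones of degree 0 and \<open>2 * d i\<close>.\<close>

lemma conic_aux:
  "\<exists>a. (\<forall>i<r. evp (H i) (conic q a p) = monom (s * \<kappa> i) (2 * d i)) \<and>
    (\<forall>R. (\<forall>i<r. degree (R i) \<le> 2 * d i - 2) \<longrightarrow>
      (\<exists>x. \<forall>i<r. devp N (H i) (conic q a p) (cvec x) = R i))"
proof -
  obtain \<epsilon> X where \<epsilon>: "\<epsilon> \<noteq> 0"
    and X: "\<And>i l. i < r \<Longrightarrow> l \<in> {1..<2 * d i} \<Longrightarrow> (\<Sum>(a, c)\<in>band (d i) l. \<epsilon> ^ (c - (l - d i)) * evc (hc i a c) X) = 0"
    and Y: "\<And>\<rho>. \<exists>y. \<forall>i<r. \<forall>l\<in>{1..<2 * d i}.
       (\<Sum>(a, c)\<in>band (d i) l. \<epsilon> ^ (c - (l - d i)) * devc N (hc i a c) X y) = \<rho> i l"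
    using numerical_conic by blast
  define \<delta> where "\<delta> = csqrt \<epsilon>"
  have \<delta>2: "\<delta> ^ 2 = \<epsilon>" by (simp add: \<delta>_def)
  have \<delta>: "\<delta> \<noteq> 0" using \<epsilon> \<delta>2 by auto
  define a where "a j = inverse \<delta> * X j" for j
  have \<delta>pow: "inverse \<delta> ^ n * \<delta> ^ l = \<epsilon> ^ c" if "l = n + 2 * c" for n l c
    using \<delta> by (simp add: that power_add power_mult \<delta>2 power_inverse)
  have expand: "(conic q a p) = (\<lambda>j. monom 1 2 * [:p j:] + monom 1 1 * [:a j:] + 1 * [:q j:])"
    by (simp add: fun_eq_iff monom_altdef power2_eq_square)
  have coeff_ev: "poly.coeff (evp (H i) (conic q a p)) n =
      (if n \<le> 2 * d i then \<Sum>(b, c)\<in>band (d i) (2 * d i - n). evc (hc i b c) a else 0)" if i: "i < r" for i n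
  proof -
    have "evp (H i) (conic q a p) =
        (\<Sum>(b, c)\<in>tri (d i). monom 1 2 ^ b * 1 ^ c * monom 1 1 ^ (d i - (b + c)) * evp (hc i b c) (cvec a))"
      unfolding expand by (rule ev_expand[OF form[OF i]]) simp
    also have "\<dots> = (\<Sum>(b, c)\<in>tri (d i). monom (evc (hc i b c) a) (d i + b - c))"
    proof (intro sum.cong refl, clarify)
      fix b c assume "(b, c) \<in> tri (d i)"
      then have e: "b * 2 + (d i - (b + c)) = d i + b - c" by (auto simp: tri_def)
      have "monom 1 2 ^ b * 1 ^ c * monom 1 1 ^ (d i - (b + c)) * evp (hc i b c) (cvec a) =
          monom 1 (b * 2 + (d i - (b + c))) * [:evc (hc i b c) a:]"
        by (simp add: pc_hom monom_power mult_monom mult.commute)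
      then show "monom 1 2 ^ b * 1 ^ c * monom 1 1 ^ (d i - (b + c)) * evp (hc i b c) (cvec a) =
          monom (evc (hc i b c) a) (d i + b - c)"
        unfolding e by (simp add: smult_monom)
    qed
    finally have "poly.coeff (evp (H i) (conic q a p)) n =
        (\<Sum>(b, c)\<in>tri (d i). if d i + b - c = n then evc (hc i b c) a else 0)"
      by (simp add: coeff_sum case_prod_unfold)
    moreover have "(\<Sum>(b, c)\<in>tri (d i). if d i + b - c = n then evc (hc i b c) a else 0) = 0" if "\<not> n \<le> 2 * d i"
      using that by (intro sum.neutral) (auto simp: tri_def)
    ultimately show ?thesis using sum_band[of n "d i"] by simp
  qed
  have scale: "evc (hc i b c) a * \<delta> ^ l = \<epsilon> ^ c * evc (hc i b c) X"
    if i: "i < r" and bc: "(b, c) \<in> band (d i) l" for i b c l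
  proof -
    have "evc (hc i b c) a = inverse \<delta> ^ (d i - (b + c)) * evc (hc i b c) X"
      unfolding a_def[abs_def] using bc by (intro phom_ev phom_hco[OF form[OF i]]) (auto simp: band_def)
    moreover have "inverse \<delta> ^ (d i - (b + c)) * \<delta> ^ l = \<epsilon> ^ c"
      using bc by (intro \<delta>pow) (auto simp: band_def)
    ultimately show ?thesis by (metis mult.assoc mult.commute)
  qed
  have split_pow: "\<epsilon> ^ c = \<epsilon> ^ (l - d i) * \<epsilon> ^ (c - (l - d i))" if "(b, c) \<in> band (d i) l" for b c l i
    using that by (subst power_add[symmetric]) (auto simp: band_def)
  have conic: "evp (H i) (conic q a p) = monom (s * \<kappa> i) (2 * d i)" if i: "i < r" for i
  proof (rule poly_eqI)
    fix n
    define l where "l = 2 * d i - n"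
    consider "n > 2 * d i" | "n = 2 * d i" | "n = 0" | "0 < n" "n < 2 * d i" by linarith
    then show "poly.coeff (evp (H i) (conic q a p)) n = poly.coeff (monom (s * \<kappa> i) (2 * d i)) n"
    proof cases
      case 1
      then show ?thesis by (simp add: coeff_ev[OF i])
    next
      case 2
      have "band (d i) 0 = {(d i, 0)}" by (auto simp: band_def)
      then show ?thesis using 2 by (simp add: coeff_ev[OF i] hco_extreme[OF i])
    next
      case 3
      have "band (d i) (2 * d i) = {(0, d i)}" by (auto simp: band_def)
      then show ?thesis using 3 degree_pos[OF i] by (simp add: coeff_ev[OF i] hco_extreme[OF i])
    next
      case 4
      then have l: "l \<in> {1..<2 * d i}" by (auto simp: l_def)
      have "(\<Sum>(b, c)\<in>band (d i) l. evc (hc i b c) a) * \<delta> ^ l =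
          (\<Sum>(b, c)\<in>band (d i) l. \<epsilon> ^ (l - d i) * (\<epsilon> ^ (c - (l - d i)) * evc (hc i b c) X))"
        unfolding sum_distrib_right
      proof (intro sum.cong refl, clarify)
        fix b c assume bc: "(b, c) \<in> band (d i) l"
        show "evc (hc i b c) a * \<delta> ^ l = \<epsilon> ^ (l - d i) * (\<epsilon> ^ (c - (l - d i)) * evc (hc i b c) X)"
          unfolding scale[OF i bc] split_pow[OF bc] by (rule mult.assoc)
      qed
      also have "\<dots> = \<epsilon> ^ (l - d i) * (\<Sum>(b, c)\<in>band (d i) l. \<epsilon> ^ (c - (l - d i)) * evc (hc i b c) X)"
        by (simp add: sum_distrib_left case_prod_unfold)
      also have "\<dots> = 0" by (simp add: X[OF i l])
      finally show ?thesis using 4 \<delta> by (simp add: coeff_ev[OF i] l_def)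
    qed
  qed
  have coeff_dev: "poly.coeff (devp N (H i) (conic q a p) (cvec y)) n =
      (if n \<le> 2 * d i - 2 then \<Sum>(b, c)\<in>band (d i) (2 * d i - 1 - n). devc N (hc i b c) a y else 0)"
    if i: "i < r" for i n y
  proof -
    have "devp N (H i) (conic q a p) (cvec y) =
        (\<Sum>(b, c)\<in>tri (d i - 1). monom 1 2 ^ b * 1 ^ c * monom 1 1 ^ (d i - 1 - (b + c)) * devp N (hc i b c) (cvec a) (cvec y))"
      unfolding expand by (rule dev_expand[OF form[OF i]]) simp
    also have "\<dots> = (\<Sum>(b, c)\<in>tri (d i - 1). monom (devc N (hc i b c) a y) (d i - 1 + b - c))"
    proof (intro sum.cong refl, clarify)
      fix b c assume "(b, c) \<in> tri (d i - 1)"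
      then have e: "b * 2 + (d i - 1 - (b + c)) = d i - 1 + b - c" by (auto simp: tri_def)
      have "monom 1 2 ^ b * 1 ^ c * monom 1 1 ^ (d i - 1 - (b + c)) * devp N (hc i b c) (cvec a) (cvec y) =
          monom 1 (b * 2 + (d i - 1 - (b + c))) * [:devc N (hc i b c) a y:]"
        by (simp add: pc_dev_hom monom_power mult_monom mult.commute)
      then show "monom 1 2 ^ b * 1 ^ c * monom 1 1 ^ (d i - 1 - (b + c)) * devp N (hc i b c) (cvec a) (cvec y) =
          monom (devc N (hc i b c) a y) (d i - 1 + b - c)"
        unfolding e by (simp add: smult_monom)
    qed
    finally have "poly.coeff (devp N (H i) (conic q a p) (cvec y)) n =
        (\<Sum>(b, c)\<in>tri (d i - 1). if d i - 1 + b - c = n then devc N (hc i b c) a y else 0)"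
      by (simp add: coeff_sum case_prod_unfold)
    moreover have "(\<Sum>(b, c)\<in>tri (d i - 1). if d i - 1 + b - c = n then devc N (hc i b c) a y else 0) = 0"
      if "\<not> n \<le> 2 * d i - 2"
      using that by (intro sum.neutral) (auto simp: tri_def)
    moreover have "(\<Sum>(b, c)\<in>tri (d i - 1). if d i - 1 + b - c = n then devc N (hc i b c) a y else 0) =
        (\<Sum>(b, c)\<in>band (d i) (2 * d i - 1 - n). devc N (hc i b c) a y)" if n: "n \<le> 2 * d i - 2"
    proof -
      have "2 * (d i - 1) = 2 * d i - 2" by simp
      then have "(\<Sum>(b, c)\<in>tri (d i - 1). if d i - 1 + b - c = n then devc N (hc i b c) a y else 0) =
          (\<Sum>(b, c)\<in>band (d i - 1) (2 * d i - 2 - n). devc N (hc i b c) a y)"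
        using sum_band[of n "d i - 1"] n by simp
      \<comment> \<open>The larger band only adds pairs with \<open>b + c = d i\<close>, for which
        \<open>hc i b c\<close> is constant and has differential 0.\<close>
      also have "\<dots> = (\<Sum>(b, c)\<in>band (d i) (2 * d i - 1 - n). devc N (hc i b c) a y)"
      proof (rule sum.mono_neutral_left[OF finite_band])
        show "band (d i - 1) (2 * d i - 2 - n) \<subseteq> band (d i) (2 * d i - 1 - n)"
          using n degree_pos[OF i] by (auto simp: band_def)
        show "\<forall>z\<in>band (d i) (2 * d i - 1 - n) - band (d i - 1) (2 * d i - 2 - n).
          (case z of (b, c) \<Rightarrow> devc N (hc i b c) a y) = 0"
        proof
          fix z assume z: "z \<in> band (d i) (2 * d i - 1 - n) - band (d i - 1) (2 * d i - 2 - n)"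
          obtain b c where bc: "z = (b, c)" by (cases z)
          have "b + c = d i" using z n degree_pos[OF i] unfolding bc by (auto simp: band_def)
          then have "phom 0 (hc i b c)" using phom_hco[OF form[OF i], of b c p q] by simp
          then show "(case z of (b, c) \<Rightarrow> devc N (hc i b c) a y) = 0" by (simp add: bc phom_0_dev)
        qed
      qed
      finally show ?thesis .
    qed
    ultimately show ?thesis by simp
  qed
  have dscale: "devc N (hc i b c) a y * \<delta> ^ (l - 1) = \<epsilon> ^ c * devc N (hc i b c) X y"
    if i: "i < r" and bc: "(b, c) \<in> band (d i) l" for i b c l y
  proof (cases "b + c = d i")
    case True
    then have "phom 0 (hc i b c)" using phom_hco[OF form[OF i], of b c p q] by simp
    then show ?thesis by (simp add: phom_0_dev)
  next
    case False
    then have lt: "b + c < d i" using bc by (auto simp: band_def)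
    have "devc N (hc i b c) a y = inverse \<delta> ^ (d i - (b + c) - 1) * devc N (hc i b c) X y"
      unfolding a_def[abs_def] using lt by (intro phom_dev phom_hco[OF form[OF i]]) auto
    then have "devc N (hc i b c) a y * \<delta> ^ (l - 1) =
        (inverse \<delta> ^ (d i - (b + c) - 1) * \<delta> ^ (l - 1)) * devc N (hc i b c) X y"
      by (simp only: mult_ac)
    moreover have "inverse \<delta> ^ (d i - (b + c) - 1) * \<delta> ^ (l - 1) = \<epsilon> ^ c"
    proof (rule \<delta>pow)
      have "d i + c = l + b" using bc by (simp add: band_def)
      then show "l - 1 = d i - (b + c) - 1 + 2 * c" using lt by linarith
    qed
    ultimately show ?thesis by (simp only:)
  qed
  have "\<exists>x. \<forall>i<r. devp N (H i) (conic q a p) (cvec x) = R i"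
    if R: "\<forall>i<r. degree (R i) \<le> 2 * d i - 2" for R
  proof -
    define \<rho> where "\<rho> i l = poly.coeff (R i) (2 * d i - 1 - l) * \<delta> ^ (l - 1) / \<epsilon> ^ (l - d i)" for i l
    obtain y where y: "\<And>i l. i < r \<Longrightarrow> l \<in> {1..<2 * d i} \<Longrightarrow>
       (\<Sum>(a, c)\<in>band (d i) l. \<epsilon> ^ (c - (l - d i)) * devc N (hc i a c) X y) = \<rho> i l"
      using Y[of \<rho>] by blast
    have "devp N (H i) (conic q a p) (cvec y) = R i" if i: "i < r" for i
    proof (rule poly_eqI)
      fix n
      show "poly.coeff (devp N (H i) (conic q a p) (cvec y)) n = poly.coeff (R i) n"
      proof (cases "n \<le> 2 * d i - 2")
        case False
        then have "degree (R i) < n" using R i by (meson le_less_trans not_le)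
        then show ?thesis using False by (simp add: coeff_dev[OF i] coeff_eq_0)
      next
        case True
        define l where "l = 2 * d i - 1 - n"
        have l: "l \<in> {1..<2 * d i}" "2 * d i - 1 - l = n" using True degree_pos[OF i] by (auto simp: l_def)
        have "(\<Sum>(b, c)\<in>band (d i) l. devc N (hc i b c) a y) * \<delta> ^ (l - 1) =
            (\<Sum>(b, c)\<in>band (d i) l. \<epsilon> ^ (l - d i) * (\<epsilon> ^ (c - (l - d i)) * devc N (hc i b c) X y))"
          unfolding sum_distrib_right
        proof (intro sum.cong refl, clarify)
          fix b c assume bc: "(b, c) \<in> band (d i) l"
          show "devc N (hc i b c) a y * \<delta> ^ (l - 1) =
              \<epsilon> ^ (l - d i) * (\<epsilon> ^ (c - (l - d i)) * devc N (hc i b c) X y)"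
            unfolding dscale[OF i bc] split_pow[OF bc] by (rule mult.assoc)
        qed
        also have "\<dots> = \<epsilon> ^ (l - d i) * (\<Sum>(b, c)\<in>band (d i) l. \<epsilon> ^ (c - (l - d i)) * devc N (hc i b c) X y)"
          by (simp add: sum_distrib_left case_prod_unfold)
        also have "\<dots> = poly.coeff (R i) n * \<delta> ^ (l - 1)" using \<epsilon> y[OF i l(1)] l(2) by (simp add: \<rho>_def)
        finally show ?thesis using True \<delta> by (simp add: coeff_dev[OF i] l_def)
      qed
    qed
    then show ?thesis by blast
  qed
  then show ?thesis using conic by blast
qed

end

context two_points
begin

theorem conic:
  "\<exists>a. (\<forall>i<r. evp (H i) (conic q a p) = monom (s * \<kappa> i) (2 * d i)) \<and>
    (\<forall>R. (\<forall>i<r. degree (R i) \<le> 2 * d i - 2) \<longrightarrow>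
      (\<exists>x. \<forall>i<r. devp N (H i) (conic q a p) (cvec x) = R i))"
proof -
  obtain v where "\<exists>j<N. v j \<noteq> 0" "\<forall>i<r. \<forall>l\<in>{1..<2 * d i}. evc (hc i (d i - l) (l - d i)) v = 0"
    using exists_chain by blast
  then interpret chain N r H d \<kappa> k s p q v by unfold_locales auto
  show ?thesis by (rule conic_aux)
qed

end

context smooth_system
begin

text \<open>Since \<open>r + 1 < N\<close>, there is a nonzero tangent vector at \<open>p\<close>
  whose coordinate \<open>j0\<close> is 0, where \<open>q j0\<close> is not. If
  \<open>p = c q\<close>, a derivation realizing this vector, extended to \<open>c\<close>, gives it
  as \<open>D c\<close> times \<open>q\<close>; coordinate \<open>j0\<close> forces
  \<open>D c = 0\<close>.\<close>

lemma generic_not_multiple: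
  assumes k: "subring k" "\<And>j. j < N \<Longrightarrow> q j \<in> k" and q: "\<exists>j<N. q j \<noteq> 0" and p: "generic k p"
  shows "\<exists>j<N. p j \<noteq> c * q j"
proof (rule ccontr)
  assume "\<not> ?thesis"
  then have pq: "\<And>j. j < N \<Longrightarrow> p j = c * q j" by blast
  obtain j0 where j0: "j0 < N" "q j0 \<noteq> 0" using q by blast
  \<comment> \<open>A form of degree at least 2 contributes at least 3 to the sum in
    \<open>few_equations\<close>, every other one at least 1.\<close>
  have "r + 1 < N"
  proof -
    obtain i0 where i0: "i0 < r" "2 \<le> d i0" using nonlinear by blast
    have "(\<Sum>i<r. if i = i0 then 3 else 1) \<le> (\<Sum>i<r. 2 * d i - 1)"
      using i0(2) degree_pos by (intro sum_mono) (auto, fastforce)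
    moreover have "(\<Sum>i<r. if i = i0 then 3 else 1) = (\<Sum>i<r. (if i = i0 then 2 else 0) + (1::nat))"
      by (intro sum.cong) auto
    moreover have "(\<Sum>i<r. (if i = i0 then 2 else 0) + (1::nat)) = 2 + r"
      by (subst sum.distrib) (use i0(1) in simp)
    ultimately show ?thesis using few_equations by linarith
  qed
  define b where "b i j = (if i < r then evc (pd j (H i)) p else if j = j0 then 1 else 0)" for i j
  obtain \<xi> where \<xi>: "\<exists>j\<in>{..<N}. \<xi> j \<noteq> 0" "\<And>i. i < r + 1 \<Longrightarrow> (\<Sum>j<N. b i j * \<xi> j) = 0"
    using more_unknowns_than_equations[of "{..<N}" "r + 1" b] \<open>r + 1 < N\<close> by auto
  have "\<forall>i<r. devc N (H i) p \<xi> = 0"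
  proof (intro allI impI)
    fix i assume "i < r"
    then show "devc N (H i) p \<xi> = 0" using \<xi>(2)[of i] by (simp add: b_def dev_def)
  qed
  then obtain D where D: "derivation (adjoin_list k (map p [0..<N] @ [c])) D" "\<And>a. a \<in> k \<Longrightarrow> D a = 0"
      "\<And>j. j < N \<Longrightarrow> D (p j) = \<xi> j"
    using generic_derivation[OF p k(1), of \<xi> "[c]"] by blast
  have c: "c \<in> adjoin_list k (map p [0..<N] @ [c])" by (rule adjoin_list_generators[OF k(1)]) simp
  have Dj: "\<xi> j = D c * q j" if j: "j < N" for j
    using D(3)[OF j] derivationD(3)[OF D(1) c adjoin_list_superset[OF k(1) k(2)[OF j]]] D(2)[OF k(2)[OF j]] pq[OF j]
    by simp
  have "0 = (\<Sum>j<N. if j = j0 then \<xi> j else 0)"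
    using \<xi>(2)[of r] by (simp add: b_def if_distrib[of "\<lambda>x. x * _"] cong: if_cong)
  then have "\<xi> j0 = 0" using j0(1) by simp
  then have "D c = 0" using Dj[OF j0(1)] j0(2) by simp
  then show False using Dj \<xi>(1) by auto
qed

end

section \<open>Conics along arcs\<close>

lemma emb_map_poly: "emb A \<sigma> \<Longrightarrow> emb (over A) (map_poly \<sigma>)"
  using map_poly_emb[of A \<sigma>] subring_over[OF embD(1), of A \<sigma>] embD(2,3)[of A \<sigma>]
  by (auto simp: emb_def[of "over A"] one_pCons map_poly_pCons)

lemma over_pCons: "a \<in> A \<Longrightarrow> p \<in> over A \<Longrightarrow> pCons a p \<in> over A"
  by (auto simp: over_def coeff_pCons split: nat.split)

lemma over_0: "0 \<in> A \<Longrightarrow> 0 \<in> over A"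
  by (simp add: over_def)

lemma ring_map_const_poly: "ring_map h \<Longrightarrow> ring_map (\<lambda>c. [:h c:])"
  by (simp add: ring_map_def one_pCons)

lemma ring_map_map_poly: "ring_map h \<Longrightarrow> ring_map (map_poly h)"
  unfolding ring_map_def[of "map_poly h"]
  by (simp add: map_poly_ring_hom one_pCons map_poly_pCons ring_mapD)

lemma ring_map_pcompose: "ring_map (\<lambda>p. pcompose p q)"
  by (simp add: ring_map_def pcompose_add pcompose_mult pcompose_1)

lemma fps_multiple_of_fls:
  fixes f :: "complex fls" and \<pi> :: "complex fps"
  assumes "fps_nth \<pi> 0 = 0" "\<pi> \<noteq> 0"
  shows "\<exists>n0. \<forall>n\<ge>n0. \<exists>g. fps_to_fls \<pi> ^ n * f = fps_to_fls g"
proof (cases "f = 0")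
  case True
  then show ?thesis by (metis fps_zero_to_fls mult_zero_right)
next
  case False
  have \<pi>: "fps_to_fls \<pi> \<noteq> 0" using assms(2) by simp
  have ord: "fls_subdegree (fps_to_fls \<pi>) \<ge> 1"
    using assms by (simp add: fls_subdegree_fls_to_fps Suc_le_eq subdegree_pos_iff)
  have "\<exists>g. fps_to_fls \<pi> ^ n * f = fps_to_fls g" if n: "n \<ge> nat (- fls_subdegree f)" for n
  proof -
    have "fls_subdegree (fps_to_fls \<pi> ^ n * f) = int n * fls_subdegree (fps_to_fls \<pi>) + fls_subdegree f"
      using \<pi> False by (simp add: fls_subdegree_mult fls_subdegree_pow)
    moreover have "int n * 1 \<le> int n * fls_subdegree (fps_to_fls \<pi>)" using ord by (intro mult_left_mono) auto
    ultimately have "0 \<le> fls_subdegree (fps_to_fls \<pi> ^ n * f)" using n by linarith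
    then show ?thesis by (metis fls_regpart_to_fls_trivial)
  qed
  then show ?thesis by blast
qed

lemma common_bound:
  fixes P :: "'i \<Rightarrow> nat \<Rightarrow> bool"
  assumes "finite I" "\<And>i. i \<in> I \<Longrightarrow> \<exists>n0. \<forall>n\<ge>n0. P i n"
  shows "\<exists>n0. \<forall>n\<ge>n0. \<forall>i\<in>I. P i n"
proof -
  have "\<forall>\<^sub>F n in sequentially. \<forall>i\<in>I. P i n"
    using assms by (intro eventually_ball_finite) (auto simp: eventually_sequentially)
  then show ?thesis by (simp add: eventually_sequentially)
qed

context smooth_system
begin

lemma H_zero: "i < r \<Longrightarrow> evc (H i) (\<lambda>j. 0) = 0"
  using phom_ev[OF form ring_map_id, of i 0 "\<lambda>j. 0"] degree_pos[of i] by (auto simp: power_0_left)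

lemma level_1_nonzero:
  assumes "\<And>i. i < r \<Longrightarrow> evc (H i) y = \<kappa> i"
  shows "\<exists>j<N. y j \<noteq> 0"
proof (rule ccontr)
  assume "\<not> ?thesis"
  then have y: "y j = 0" if "j < N" for j using that by blast
  obtain i where i: "i < r" "\<kappa> i \<noteq> 0" using \<kappa>_nonzero by blast
  have "evc (H i) y = evc (H i) (\<lambda>j. 0)" using vars[OF i(1)] y by (intro ev_cong) auto
  then show False using assms[OF i(1)] H_zero[OF i(1)] i by simp
qed

text \<open>The conic joins \<open>q\<close> to a generic point \<open>g\<close> that specializes to
  \<open>y\<close> along an arc. It involves only finitely many further numbers, so the embedding of
  \<open>g\<close> into Laurent series extends to them after ramification. The middle coefficient
  and the preimages may acquire poles in this way.\<close>

theorem conic_along_arc: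
  assumes k: "subring k" "countable k" "\<And>i. i < r \<Longrightarrow> pconsts (H i) \<subseteq> k" "\<And>i. i < r \<Longrightarrow> \<kappa> i \<in> k"
    and q: "\<exists>j<N. q j \<noteq> 0" "\<And>i. i < r \<Longrightarrow> evc (H i) q = 0" "generic k q"
    and y: "\<And>i. i < r \<Longrightarrow> evc (H i) y = \<kappa> i"
  shows "\<exists>\<gamma> a X. (\<forall>j<N. fps_nth (\<gamma> j) 0 = y j) \<and>
    (\<forall>i<r. ev fls_cpoly (H i) (\<lambda>j. [:fls_const (q j), a j, fps_to_fls (\<gamma> j):]) =
       monom (fls_const (\<kappa> i)) (2 * d i)) \<and>
    (\<forall>l<r. \<forall>i<r. dev N fls_cpoly (H i) (\<lambda>j. [:fls_const (q j), a j, fps_to_fls (\<gamma> j):])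
       (cvec (X l)) = (if i = l then 1 else 0))"
proof -
  define K where "K = adjoin_list k (map q [0..<N])"
  have K: "subring K" "countable K"
    unfolding K_def by (rule subring_adjoin_list[OF k(1)], rule countable_adjoin_list[OF k(2)])
  have kK: "c \<in> K" if "c \<in> k" for c unfolding K_def by (rule adjoin_list_superset[OF k(1) that])
  have qK: "q j \<in> K" if "j < N" for j unfolding K_def using that by (intro adjoin_list_generators[OF k(1)]) simp
  have \<kappa>K: "\<kappa> i \<in> K" if "i < r" for i by (rule kK[OF k(4)[OF that]])
  have conK: "c \<in> K" if "c \<in> pconsts (H i)" "i < r" for c i using that k(3) kK by blast
  have "\<exists>g \<tau> \<gamma>. (\<forall>i<r. evc (H i) g = 1 * \<kappa> i) \<and> generic K g \<and> emb (adjoin_list K (map g [0..<N])) \<tau> \<and>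
      (\<forall>a\<in>K. \<tau> a = fls_const a) \<and> (\<forall>j<N. \<tau> (g j) = fps_to_fls (\<gamma> j) \<and> fps_nth (\<gamma> j) 0 = y j)"
    using conK kK[OF k(4)] level_1_nonzero[OF y] y by (intro generic_point K) auto
  then obtain g \<tau> \<gamma>0 where g: "\<And>i. i < r \<Longrightarrow> evc (H i) g = 1 * \<kappa> i" "generic K g"
    and \<tau>: "emb (adjoin_list K (map g [0..<N])) \<tau>" "\<And>a. a \<in> K \<Longrightarrow> \<tau> a = fls_const a"
      "\<And>j. j < N \<Longrightarrow> \<tau> (g j) = fps_to_fls (\<gamma>0 j)" "\<And>j. j < N \<Longrightarrow> fps_nth (\<gamma>0 j) 0 = y j" by blast
  interpret two_points N r H d \<kappa> k 1 g q
    using k q g generic_not_multiple[OF K(1) qK q(1) g(2)] by unfold_locales (auto simp: K_def)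
  obtain a where a: "\<And>i. i < r \<Longrightarrow> evp (H i) (conic q a g) = monom (1 * \<kappa> i) (2 * d i)"
    and onto: "\<And>R. \<forall>i<r. degree (R i) \<le> 2 * d i - 2 \<Longrightarrow>
      \<exists>x. \<forall>i<r. devp N (H i) (conic q a g) (cvec x) = R i"
    using conic by blast
  have "\<forall>l. \<exists>x. \<forall>i<r. devp N (H i) (conic q a g) (cvec x) = (if i = l then 1 else 0)"
    using onto[of "\<lambda>i. if i = _ then 1 else 0"] by simp
  then obtain X where X: "\<And>l i. i < r \<Longrightarrow> devp N (H i) (conic q a g) (cvec (X l)) = (if i = l then 1 else 0)"
    unfolding choice_iff by blast
  define A where "A = adjoin_list K (map g [0..<N])"
  have A: "subring A" "countable A"
    unfolding A_def by (rule subring_adjoin_list[OF K(1)], rule countable_adjoin_list[OF K(2)])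
  have KA: "c \<in> A" if "c \<in> K" for c unfolding A_def by (rule adjoin_list_superset[OF K(1) that])
  have gA: "g j \<in> A" if "j < N" for j unfolding A_def using that by (intro adjoin_list_generators[OF K(1)]) simp
  define zs where "zs = map a [0..<N] @ concat (map (\<lambda>l. map (X l) [0..<N]) [0..<r])"
  obtain e \<sigma> where e: "e > 0" and \<sigma>: "emb (adjoin_list A zs) \<sigma>" "\<And>c. c \<in> A \<Longrightarrow> \<sigma> c = ramify e (\<tau> c)"
    using emb_extend_fls_list[OF \<tau>(1)[folded A_def] A(2), of zs] by blast
  define B where "B = adjoin_list A zs"
  have AB: "c \<in> B" if "c \<in> A" for c unfolding B_def by (rule adjoin_list_superset[OF A(1) that])
  have aB: "a j \<in> B" if "j < N" for j
    unfolding B_def zs_def using that by (intro adjoin_list_generators[OF A(1)]) simp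
  have XB: "X l j \<in> B" if "l < r" "j < N" for l j
    unfolding B_def zs_def using that by (intro adjoin_list_generators[OF A(1)]) fastforce
  have \<sigma>K: "\<sigma> c = fls_const c" if "c \<in> K" for c
    using \<sigma>(2)[OF KA[OF that]] \<tau>(2)[OF that] e by (simp add: ramify_def)
  \<comment> \<open>Ramification only reparametrizes the arc, which still starts at
    \<open>y\<close>.\<close>
  define \<gamma> where "\<gamma> j = fps_compose (\<gamma>0 j) (fps_X ^ e)" for j
  have \<gamma>: "\<sigma> (g j) = fps_to_fls (\<gamma> j)" if "j < N" for j
    using \<sigma>(2)[OF gA[OF that]] \<tau>(3)[OF that] e by (simp add: ramify_def fls_compose_power_fps_to_fls \<gamma>_def)
  have \<gamma>0: "fps_nth (\<gamma> j) 0 = y j" if "j < N" for j using \<tau>(4)[OF that] by (simp add: \<gamma>_def)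
  have \<sigma>': "emb (over B) (map_poly \<sigma>)" using emb_map_poly[OF \<sigma>(1)] unfolding B_def .
  have B: "subring B" using embD(1)[OF \<sigma>(1)] unfolding B_def .
  have \<sigma>0: "\<sigma> 0 = 0" and \<sigma>1: "\<sigma> 1 = 1" using embD(2,3)[OF \<sigma>(1)] .
  have pcB: "[:c:] \<in> over B" if "c \<in> B" for c using that subringD(1)[OF B] by (intro over_pCons over_0)
  have vB: "[:q j, a j, g j:] \<in> over B" if "j < N" for j
    using that subringD(1)[OF B] qK KA AB gA aB by (intro over_pCons over_0) auto
  have v: "map_poly \<sigma> [:q j, a j, g j:] = [:fls_const (q j), \<sigma> (a j), fps_to_fls (\<gamma> j):]" if "j < N" for j
    using \<gamma>[OF that] \<sigma>K[OF qK[OF that]] \<sigma>0 by (simp add: map_poly_pCons)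
  have pc: "map_poly \<sigma> [:c:] = [:\<sigma> c:]" for c using \<sigma>0 by (simp add: map_poly_pCons)
  have mp1: "map_poly \<sigma> 1 = 1" using \<sigma>0 \<sigma>1 by (simp add: one_pCons map_poly_pCons)
  have conic': "ev fls_cpoly (H i) (\<lambda>j. [:fls_const (q j), \<sigma> (a j), fps_to_fls (\<gamma> j):]) =
      monom (fls_const (\<kappa> i)) (2 * d i)" if i: "i < r" for i
  proof -
    have "map_poly \<sigma> (evp (H i) (conic q a g)) =
        ev fls_cpoly (H i) (\<lambda>j. map_poly \<sigma> [:q j, a j, g j:])"
      using conK[OF _ i] KA AB vars[OF i] vB \<sigma>K by (intro emb_ev[OF \<sigma>'] pcB) (auto simp: pc)
    also have "\<dots> = ev fls_cpoly (H i) (\<lambda>j. [:fls_const (q j), \<sigma> (a j), fps_to_fls (\<gamma> j):])"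
      using v vars[OF i] by (intro ev_cong) auto
    finally show ?thesis unfolding a[OF i] using \<sigma>K[OF \<kappa>K[OF i]] \<sigma>0 by (simp add: map_poly_monom)
  qed
  have "dev N fls_cpoly (H i) (\<lambda>j. [:fls_const (q j), \<sigma> (a j), fps_to_fls (\<gamma> j):]) (\<lambda>j. [:\<sigma> (X l j):]) =
      (if i = l then 1 else 0)" if i: "i < r" and l: "l < r" for i l
  proof -
    have "map_poly \<sigma> (devp N (H i) (conic q a g) (cvec (X l))) =
        dev N fls_cpoly (H i) (\<lambda>j. map_poly \<sigma> [:q j, a j, g j:]) (\<lambda>j. map_poly \<sigma> [:X l j:])"
      using conK[OF _ i] KA AB vars[OF i] vB \<sigma>K XB[OF l]
      by (intro emb_dev[OF \<sigma>'] pcB ring_map_const_poly) (auto simp: pc)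
    also have "\<dots> = dev N fls_cpoly (H i) (\<lambda>j. [:fls_const (q j), \<sigma> (a j), fps_to_fls (\<gamma> j):]) (\<lambda>j. [:\<sigma> (X l j):])"
      unfolding pc using v vars[OF i] by (intro dev_cong_point) auto
    finally show ?thesis unfolding X[OF i] using mp1 by (simp split: if_splits)
  qed
  then show ?thesis
    by (intro exI[of _ \<gamma>] exI[of _ "\<lambda>j. \<sigma> (a j)"] exI[of _ "\<lambda>l j. \<sigma> (X l j)"] conjI allI impI \<gamma>0 conic')
qed

end

lemma map_poly_fps_to_fls_inject: "map_poly fps_to_fls p = map_poly fps_to_fls q \<Longrightarrow> p = q"
  by (metis coeff_map_poly fps_to_fls_eq_iff fps_zero_to_fls poly_eqI)

lemma pcompose_monom_linear:
  "pcompose (monom a n) [:0, w:] = monom (a * w ^ n) n" for w :: "'a::comm_ring_1"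
proof -
  have w: "[:0, w:] = monom w (Suc 0)" by (simp add: monom_Suc monom_0)
  show ?thesis unfolding w by (rule poly_eqI) (simp add: mult.commute)
qed

context smooth_system
begin

abbreviation arc_conic :: "(nat \<Rightarrow> complex) \<Rightarrow> complex fps \<Rightarrow> nat \<Rightarrow> (nat \<Rightarrow> complex fps) \<Rightarrow> (nat \<Rightarrow> complex fps) \<Rightarrow> bool" where
  "arc_conic q \<pi> M b \<gamma> \<equiv>
    (\<forall>i<r. ev fps_cpoly (H i) (\<lambda>j. [:\<pi> ^ (2 * M) * fps_const (q j), \<pi> * b j, \<gamma> j:]) =
       monom (fps_const (\<kappa> i)) (2 * d i)) \<and>
    (\<exists>c0. \<forall>c\<ge>c0. \<forall>R. \<exists>x. \<forall>i<r. dev N fps_cpoly (H i)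
       (\<lambda>j. [:\<pi> ^ (2 * M) * fps_const (q j), \<pi> * b j, \<gamma> j:]) (cvec x) = [:\<pi> ^ c * R i:])"

text \<open>Replacing \<lambda> by \<open>\<lambda> / s\<close> and multiplying the curve by
  \<open>s^2\<close>, where \<open>s = \<pi>^M\<close>, preserves the right-hand side, multiplies
  the middle coefficient by \<open>s\<close> and the first one by \<open>s^2\<close>. The price is
  that the linearized equations are solvable only up to a power of \<open>\<pi>\<close>.\<close>

lemma clear_denominators:
  fixes \<pi> :: "complex fps" and a :: "nat \<Rightarrow> complex fls"
  assumes \<pi>: "fps_nth \<pi> 0 = 0" "\<pi> \<noteq> 0"
    and conic: "\<And>i. i < r \<Longrightarrow> ev fls_cpoly (H i) (\<lambda>j. [:fls_const (q j), a j, fps_to_fls (\<gamma> j):]) =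
       monom (fls_const (\<kappa> i)) (2 * d i)"
    and X: "\<And>l i. l < r \<Longrightarrow> i < r \<Longrightarrow> dev N fls_cpoly (H i) (\<lambda>j. [:fls_const (q j), a j, fps_to_fls (\<gamma> j):])
       (cvec (X l)) = (if i = l then 1 else 0)"
  shows "\<exists>M0. \<forall>M\<ge>M0. \<exists>b. arc_conic q \<pi> M b \<gamma>"
proof -
  define \<Lambda> where "\<Lambda> = fps_to_fls \<pi>"
  have \<Lambda>: "\<Lambda> \<noteq> 0" using \<pi>(2) by (simp add: \<Lambda>_def)
  have "\<exists>n0. \<forall>n\<ge>n0. \<forall>j\<in>{..<N}. \<exists>g. \<Lambda> ^ n * a j = fps_to_fls g"
    unfolding \<Lambda>_def by (rule common_bound) (simp_all add: fps_multiple_of_fls[OF \<pi>])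
  then obtain n0 where "\<forall>n\<ge>n0. \<forall>j\<in>{..<N}. \<exists>g. \<Lambda> ^ n * a j = fps_to_fls g" ..
  then have n0: "\<exists>g. \<Lambda> ^ n * a j = fps_to_fls g" if "n \<ge> n0" "j < N" for n j using that by blast
  \<comment> \<open>One factor \<open>\<pi>\<close> is kept in reserve, so that the middle
    coefficient vanishes at the centre of the arc.\<close>
  have "\<exists>b. arc_conic q \<pi> M b \<gamma>" if M: "M \<ge> Suc n0" for M
  proof -
    have "\<forall>j\<in>{..<N}. \<exists>g. \<Lambda> ^ (M - 1) * a j = fps_to_fls g" using n0[of "M - 1"] M by simp
    then obtain b where b: "\<And>j. j < N \<Longrightarrow> \<Lambda> ^ (M - 1) * a j = fps_to_fls (b j)" unfolding bchoice_iff by auto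
    define s where "s = \<Lambda> ^ M"
    have s: "s \<noteq> 0" using \<Lambda> by (simp add: s_def)
    have sa: "s * a j = fps_to_fls (\<pi> * b j)" if "j < N" for j
    proof -
      have "s = \<Lambda> * \<Lambda> ^ (M - 1)" using M by (simp add: s_def power_eq_if)
      then show ?thesis using b[OF that] by (simp add: fls_times_fps_to_fls \<Lambda>_def mult.assoc)
    qed
    define C where "C j = [:fls_const (q j), a j, fps_to_fls (\<gamma> j):]" for j
    define C' where "C' j = pcompose (C j) [:0, inverse s:]" for j
    define F where "F j = [:s\<^sup>2 * fls_const (q j), s * a j, fps_to_fls (\<gamma> j):]" for j
    have F: "F = (\<lambda>j. [:s\<^sup>2:] * C' j)"
      using s by (simp add: fun_eq_iff F_def C'_def C_def pcompose_pCons power2_eq_square field_simps)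
    define f where "f j = [:\<pi> ^ (2 * M) * fps_const (q j), \<pi> * b j, \<gamma> j:]" for j
    have f: "map_poly fps_to_fls (f j) = F j" if "j < N" for j
    proof -
      have "fps_to_fls (\<pi> ^ (2 * M) * fps_const (q j)) = s\<^sup>2 * fls_const (q j)"
        by (simp add: s_def \<Lambda>_def fls_times_fps_to_fls fps_to_fls_power mult.commute[of 2 M] flip: power_mult)
      then show ?thesis using sa[OF that] by (simp add: f_def F_def map_poly_pCons)
    qed
    have HF: "ev fls_cpoly (H i) F = monom (fls_const (\<kappa> i)) (2 * d i)" if i: "i < r" for i
    proof -
      have "ev fls_cpoly (H i) C' = pcompose (ev fls_cpoly (H i) C) [:0, inverse s:]"
        unfolding C'_def[abs_def] by (subst ev_hom[OF ring_map_pcompose]) (simp add: pcompose_const)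
      also have "\<dots> = smult (inverse s ^ (2 * d i)) (monom (fls_const (\<kappa> i)) (2 * d i))"
        unfolding C_def[abs_def] conic[OF i]
        unfolding pcompose_monom_linear by (simp add: smult_monom mult.commute)
      finally have C': "ev fls_cpoly (H i) C' = smult (inverse s ^ (2 * d i)) (monom (fls_const (\<kappa> i)) (2 * d i))" .
      have "ev fls_cpoly (H i) F = [:s\<^sup>2:] ^ d i * ev fls_cpoly (H i) C'"
        unfolding F by (rule phom_ev[OF form[OF i]]) (intro ring_map_const_poly ring_map_fls_const)
      also have "\<dots> = monom (fls_const (\<kappa> i)) (2 * d i)"
        using s unfolding C' by (simp add: poly_const_pow power_inverse flip: power_mult)
      finally show ?thesis .
    qed
    have dF: "dev N fls_cpoly (H i) F (cvec (X l)) = [:if i = l then (s\<^sup>2) ^ (d i - 1) else 0:]"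
      if i: "i < r" and l: "l < r" for i l
    proof -
      have "dev N fls_cpoly (H i) C' (cvec (X l)) =
          pcompose (dev N fls_cpoly (H i) C (cvec (X l))) [:0, inverse s:]"
        unfolding C'_def[abs_def] by (subst dev_hom[OF ring_map_pcompose]) (simp add: pcompose_const)
      also have "\<dots> = (if i = l then 1 else 0)"
        unfolding C_def[abs_def] X[OF l i] by (simp add: pcompose_1)
      finally have C': "dev N fls_cpoly (H i) C' (cvec (X l)) = (if i = l then 1 else 0)" .
      have "dev N fls_cpoly (H i) F (cvec (X l)) =
          [:s\<^sup>2:] ^ (d i - 1) * dev N fls_cpoly (H i) C' (cvec (X l))"
        unfolding F by (rule phom_dev[OF form[OF i]]) (intro ring_map_const_poly ring_map_fls_const)
      then show ?thesis unfolding C' by (simp add: poly_const_pow)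
    qed
    note hom = ring_map_map_poly[OF ring_map_fps_to_fls]
    have mpc: "map_poly fps_to_fls [:x:] = [:fps_to_fls x:]" for x by (simp add: map_poly_pCons)
    have Hf: "ev fps_cpoly (H i) f = monom (fps_const (\<kappa> i)) (2 * d i)" if i: "i < r" for i
    proof (rule map_poly_fps_to_fls_inject)
      have "map_poly fps_to_fls (ev fps_cpoly (H i) f) = ev fls_cpoly (H i) (\<lambda>j. map_poly fps_to_fls (f j))"
        by (simp add: ev_hom[OF hom] mpc)
      also have "\<dots> = ev fls_cpoly (H i) F" using f vars[OF i] by (intro ev_cong) auto
      finally show "map_poly fps_to_fls (ev fps_cpoly (H i) f) = map_poly fps_to_fls (monom (fps_const (\<kappa> i)) (2 * d i))"
        using HF[OF i] by (simp add: map_poly_monom)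
    qed
    have "\<exists>c0. \<forall>c\<ge>c0. \<forall>z\<in>{..<r} \<times> {..<N}. \<exists>g. \<Lambda> ^ c * (inverse (s\<^sup>2) ^ (d (fst z) - 1) * X (fst z) (snd z)) = fps_to_fls g"
      unfolding \<Lambda>_def by (rule common_bound) (simp_all add: fps_multiple_of_fls[OF \<pi>])
    then obtain c0 where c0: "\<And>c. c \<ge> c0 \<Longrightarrow> \<forall>z\<in>{..<r} \<times> {..<N}. \<exists>g. \<Lambda> ^ c * (inverse (s\<^sup>2) ^ (d (fst z) - 1) * X (fst z) (snd z)) = fps_to_fls g"
      by blast
    have "\<exists>x. \<forall>i<r. dev N fps_cpoly (H i) f (cvec x) = [:\<pi> ^ c * R i:]" if c: "c \<ge> c0" for c R
    proof -
      obtain Z where Z: "\<And>l j. l < r \<Longrightarrow> j < N \<Longrightarrow> \<Lambda> ^ c * (inverse (s\<^sup>2) ^ (d l - 1) * X l j) = fps_to_fls (Z (l, j))"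
        using c0[OF c] unfolding bchoice_iff by auto
      define x where "x j = (\<Sum>l<r. Z (l, j) * R l)" for j
      have x: "[:fps_to_fls (x j):] = (\<Sum>l<r. [:\<Lambda> ^ c * inverse (s\<^sup>2) ^ (d l - 1) * fps_to_fls (R l):] * [:X l j:])" if j: "j < N" for j
      proof -
        have "fps_to_fls (x j) = (\<Sum>l<r. \<Lambda> ^ c * inverse (s\<^sup>2) ^ (d l - 1) * fps_to_fls (R l) * X l j)"
          unfolding x_def ring_map_sum[OF ring_map_fps_to_fls] fls_times_fps_to_fls
          using Z[OF _ j, symmetric] by (intro sum.cong) (auto simp: mult_ac)
        then show ?thesis by (simp add: ring_map_sum[OF ring_map_const_poly[OF ring_map_id]] mult.commute)
      qed
      have "dev N fps_cpoly (H i) f (cvec x) = [:\<pi> ^ c * R i:]" if i: "i < r" for i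
      proof (rule map_poly_fps_to_fls_inject)
        have "map_poly fps_to_fls (dev N fps_cpoly (H i) f (cvec x)) =
            dev N fls_cpoly (H i) (\<lambda>j. map_poly fps_to_fls (f j)) (\<lambda>j. [:fps_to_fls (x j):])"
          by (simp add: dev_hom[OF hom] mpc)
        also have "\<dots> = dev N fls_cpoly (H i) F (\<lambda>j. [:fps_to_fls (x j):])"
          using f vars[OF i] by (intro dev_cong_point) auto
        also have "\<dots> = dev N fls_cpoly (H i) F (\<lambda>j. \<Sum>l<r. [:\<Lambda> ^ c * inverse (s\<^sup>2) ^ (d l - 1) * fps_to_fls (R l):] * [:X l j:])"
          by (rule dev_cong) (rule x)
        also have "\<dots> = (\<Sum>l<r. if l = i then [:\<Lambda> ^ c * fps_to_fls (R i):] else 0)"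
          unfolding dev_sum dev_scale using dF[OF i] s by (intro sum.cong) (auto simp: power_inverse)
        also have "\<dots> = map_poly fps_to_fls [:\<pi> ^ c * R i:]"
          using i by (simp add: mpc fls_times_fps_to_fls fps_to_fls_power \<Lambda>_def)
        finally show "map_poly fps_to_fls (dev N fps_cpoly (H i) f (cvec x)) = map_poly fps_to_fls [:\<pi> ^ c * R i:]" .
      qed
      then show ?thesis by blast
    qed
    then show ?thesis using Hf unfolding f_def[abs_def] by (intro exI[of _ b]) blast
  qed
  then show ?thesis by blast
qed

end

section \<open>Base expansions and jets\<close>

text \<open>Repeated division by \<open>\<psi>\<close>: the polynomials form a free module over
  those in \<open>\<psi>\<close>, with basis the powers of the variable below \<open>B\<close>. The
  terms have distinct degrees, so none exceeds that of \<open>R\<close>.\<close>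

lemma base_expansion:
  fixes \<psi> :: "complex poly"
  assumes B: "degree \<psi> = B" "B > 0"
  shows "\<exists>Q. R = (\<Sum>t<B. monom 1 t * pcompose (Q t) \<psi>) \<and> (\<forall>t<B. Q t \<noteq> 0 \<longrightarrow> t + B * degree (Q t) \<le> degree R)"
proof (induction "degree R" arbitrary: R rule: less_induct)
  case less
  have \<psi>: "\<psi> \<noteq> 0" using B by auto
  define R0 R1 where "R0 = R mod \<psi>" and "R1 = R div \<psi>"
  have R: "R = \<psi> * R1 + R0" by (simp add: R0_def R1_def)
  have dR0: "R0 = 0 \<or> degree R0 < B" using degree_mod_less[OF \<psi>] B by (auto simp: R0_def)
  have R0: "R0 = (\<Sum>t<B. monom 1 t * [:poly.coeff R0 t:])"
    using dR0 by (intro poly_eqI) (auto simp: coeff_sum smult_monom coeff_eq_0 mult.commute[of "monom 1 _"])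
  have dR: "degree R = B + degree R1" if "R1 \<noteq> 0"
  proof -
    have "degree (\<psi> * R1) = B + degree R1" using \<psi> that B by (simp add: degree_mult_eq)
    then show ?thesis unfolding R using dR0 B by (auto simp: degree_add_eq_left)
  qed
  have "\<exists>Q. R1 = (\<Sum>t<B. monom 1 t * pcompose (Q t) \<psi>) \<and> (\<forall>t<B. Q t \<noteq> 0 \<longrightarrow> R1 \<noteq> 0 \<and> t + B * degree (Q t) \<le> degree R1)"
  proof (cases "R1 = 0")
    case True
    then show ?thesis by (intro exI[of _ "\<lambda>_. 0"]) simp
  next
    case False
    then show ?thesis using less.hyps[of R1] dR B by simp
  qed
  then obtain Q where Q: "R1 = (\<Sum>t<B. monom 1 t * pcompose (Q t) \<psi>)" "\<And>t. t < B \<Longrightarrow> Q t \<noteq> 0 \<Longrightarrow> R1 \<noteq> 0 \<and> t + B * degree (Q t) \<le> degree R1"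
    by blast
  define Q' where "Q' t = pCons (poly.coeff R0 t) (Q t)" for t
  have "R = (\<Sum>t<B. monom 1 t * pcompose (Q' t) \<psi>)"
  proof -
    have "R = \<psi> * (\<Sum>t<B. monom 1 t * pcompose (Q t) \<psi>) + (\<Sum>t<B. monom 1 t * [:poly.coeff R0 t:])"
      using R Q(1) R0 by metis
    also have "\<dots> = (\<Sum>t<B. monom 1 t * pcompose (Q' t) \<psi>)"
      by (simp add: Q'_def pcompose_pCons sum_distrib_left sum.distrib[symmetric] distrib_left mult_ac add.commute)
    finally show ?thesis .
  qed
  moreover have "t + B * degree (Q' t) \<le> degree R" if t: "t < B" "Q' t \<noteq> 0" for t
  proof (cases "Q t = 0")
    case True
    then have "poly.coeff R0 t \<noteq> 0" using t(2) by (simp add: Q'_def)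
    then have t0: "t \<le> degree R0" by (rule le_degree)
    have "degree R0 \<le> degree R"
    proof (cases "R1 = 0")
      case False
      then show ?thesis using dR dR0 by auto
    qed (simp add: R)
    then show ?thesis using True t0 by (simp add: Q'_def)
  next
    case False
    then show ?thesis using Q(2)[OF t(1) False] dR False by (simp add: Q'_def)
  qed
  ultimately show ?case by blast
qed

context smooth_system
begin

text \<open>The pullback of the conic under a polynomial of degree \<open>B\<close> is positive enough to solve the
  linearized equations with the degrees reduced by up to \<open>B + 1\<close>.\<close>

lemma pullback_onto:
  fixes C :: "nat \<Rightarrow> complex poly"
  assumes onto: "\<And>R. \<forall>i<r. degree (R i) \<le> 2 * d i - 2 \<Longrightarrow> \<exists>x. \<forall>i<r. devp N (H i) C (cvec x) = R i"
    and \<psi>: "degree \<psi> = B" "B > 0" and \<rho>: "1 \<le> \<rho>" "\<rho> \<le> B + 1"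
    and R: "\<And>i. i < r \<Longrightarrow> R i \<noteq> 0 \<Longrightarrow> degree (R i) + \<rho> \<le> 2 * d i * B"
  shows "\<exists>x. (\<forall>j. degree (x j) + \<rho> \<le> 2 * B) \<and>
    (\<forall>i<r. devp N (H i) (\<lambda>j. pcompose (C j) \<psi>) x = R i)"
proof -
  have "\<forall>i. \<exists>Q. R i = (\<Sum>t<B. monom 1 t * pcompose (Q t) \<psi>) \<and> (\<forall>t<B. Q t \<noteq> 0 \<longrightarrow> t + B * degree (Q t) \<le> degree (R i))"
    using base_expansion[OF \<psi>] by blast
  then obtain Q where Q: "\<And>i. R i = (\<Sum>t<B. monom 1 t * pcompose (Q i t) \<psi>)"
    "\<And>i t. t < B \<Longrightarrow> Q i t \<noteq> 0 \<Longrightarrow> t + B * degree (Q i t) \<le> degree (R i)"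
    unfolding choice_iff by blast
  have QR: "t + B * degree (Q i t) + \<rho> \<le> 2 * d i * B" if "i < r" "t < B" "Q i t \<noteq> 0" for i t
  proof -
    have "R i \<noteq> 0 \<or> R i = 0" by blast
    then show ?thesis
    proof
      assume "R i \<noteq> 0"
      then show ?thesis using R[OF that(1)] Q(2)[OF that(2,3)] by simp
    next
      assume "R i = 0"
      then have "t = 0" "degree (Q i t) = 0" using Q(2)[OF that(2,3)] \<psi>(2) by auto
      moreover have "2 * B \<le> 2 * d i * B" using degree_pos[OF that(1)] by (intro mult_le_mono1) simp
      moreover have "\<rho> \<le> 2 * B" using \<rho> \<psi>(2) by simp
      ultimately show ?thesis by (metis add_0 mult_zero_right order_trans)
    qed
  qed
  \<comment> \<open>For small \<open>t\<close> the preimage may be linear in \<open>\<psi>\<close>,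
    which reaches one degree more of the target. For larger \<open>t\<close> it must be constant,
    but then the bound on \<open>R\<close> lowers the degree of \<open>Q i t\<close> to what
    constants reach.\<close>
  have one: "\<exists>x. (\<forall>j. t + B * degree (x j) + \<rho> \<le> 2 * B) \<and> (\<forall>i<r. devp N (H i) C x = Q i t)" if t: "t < B" for t
  proof (cases "\<rho> + t \<le> B")
    case True
    have dQ: "degree (Q i t) \<le> 2 * d i - 1" if i: "i < r" for i
    proof (cases "Q i t = 0")
      case False
      have "2 * d i * B = B * (2 * d i)" by (rule mult.commute)
      then have "B * degree (Q i t) < B * (2 * d i)" using QR[OF i t False] \<rho>(1) by linarith
      then have "degree (Q i t) < 2 * d i" by (simp add: mult_less_cancel1)
      then show ?thesis by simp
    qed simp
    define h Q' where "h i = poly.coeff (Q i t) 0" and "Q' i = poly_shift 1 (Q i t)" for i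
    have split: "Q i t = [:h i:] + [:0, 1:] * Q' i" for i
      by (intro poly_eqI) (simp add: h_def Q'_def coeff_poly_shift coeff_pCons split: nat.split)
    obtain x0 where x0: "\<And>i. i < r \<Longrightarrow> devp N (H i) C (cvec x0) = [:h i:]"
      using onto[of "\<lambda>i. [:h i:]"] by auto
    have "degree (Q' i) \<le> 2 * d i - 2" if i: "i < r" for i
      using dQ[OF i] by (intro degree_le) (auto simp: Q'_def coeff_poly_shift intro!: coeff_eq_0)
    then obtain x1 where x1: "\<And>i. i < r \<Longrightarrow> devp N (H i) C (cvec x1) = Q' i"
      using onto[of Q'] by auto
    have a: "devp N (H i) C (\<lambda>j. [:x0 j:] + [:0, 1:] * [:x1 j:]) = Q i t" if i: "i < r" for i
      unfolding dev_add dev_scale x0[OF i] x1[OF i] split[of i] ..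
    have b: "t + B * degree ([:x0 j:] + [:0, 1:] * [:x1 j:]) + \<rho> \<le> 2 * B" for j
    proof -
      have "B * degree ([:x0 j:] + [:0, 1:] * [:x1 j:]) \<le> B * 1" by (rule mult_le_mono2) simp
      then show ?thesis using True by linarith
    qed
    show ?thesis by (intro exI[of _ "\<lambda>j. [:x0 j:] + [:0, 1:] * [:x1 j:]"] conjI allI impI a b)
  next
    case False
    have "degree (Q i t) \<le> 2 * d i - 2" if i: "i < r" for i
    proof (cases "Q i t = 0")
      case nz: False
      have "2 * d i * B = B * (2 * d i)" by (rule mult.commute)
      then have "B * degree (Q i t) + B < B * (2 * d i)" using QR[OF i t nz] False by linarith
      then have "B * (degree (Q i t) + 1) < B * (2 * d i)" by (simp only: distrib_left mult_1_right)
      then have "degree (Q i t) + 1 < 2 * d i" unfolding mult_less_cancel1 by simp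
      then show ?thesis by simp
    qed simp
    then obtain x where x: "\<And>i. i < r \<Longrightarrow> devp N (H i) C (cvec x) = Q i t"
      using onto[of "\<lambda>i. Q i t"] by auto
    then show ?thesis using t \<rho> by (intro exI[of _ "\<lambda>j. [:x j:]"]) simp
  qed
  then have "\<forall>t\<in>{..<B}. \<exists>x. (\<forall>j. t + B * degree (x j) + \<rho> \<le> 2 * B) \<and> (\<forall>i<r. devp N (H i) C x = Q i t)" by blast
  then obtain x where x: "\<And>t j. t < B \<Longrightarrow> t + B * degree (x t j) + \<rho> \<le> 2 * B"
    "\<And>t i. t < B \<Longrightarrow> i < r \<Longrightarrow> devp N (H i) C (x t) = Q i t"
    unfolding bchoice_iff by blast
  define y where "y j = (\<Sum>t<B. monom 1 t * pcompose (x t j) \<psi>)" for j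
  have "degree (y j) + \<rho> \<le> 2 * B" for j
  proof -
    have "degree (y j) \<le> 2 * B - \<rho>" unfolding y_def
    proof (rule degree_sum_le)
      fix t assume t: "t \<in> {..<B}"
      have "degree (monom 1 t * pcompose (x t j) \<psi>) \<le> degree (monom (1::complex) t) + degree (pcompose (x t j) \<psi>)" by (rule degree_mult_le)
      also have "\<dots> \<le> t + B * degree (x t j)" by (simp add: degree_monom_eq degree_pcompose \<psi>(1) mult.commute)
      also have "\<dots> \<le> 2 * B - \<rho>" using x(1)[of t j] t by simp
      finally show "degree (monom 1 t * pcompose (x t j) \<psi>) \<le> 2 * B - \<rho>" .
    qed simp
    then show ?thesis using \<rho> \<psi>(2) by simp
  qed
  moreover have "devp N (H i) (\<lambda>j. pcompose (C j) \<psi>) y = R i" if i: "i < r" for i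
  proof -
    have "devp N (H i) (\<lambda>j. pcompose (C j) \<psi>) y =
        (\<Sum>t<B. monom 1 t * devp N (H i) (\<lambda>j. pcompose (C j) \<psi>) (\<lambda>j. pcompose (x t j) \<psi>))"
      unfolding y_def[abs_def] dev_sum dev_scale ..
    also have "\<dots> = (\<Sum>t<B. monom 1 t * pcompose (devp N (H i) C (x t)) \<psi>)"
      by (simp add: dev_hom[OF ring_map_pcompose])
    also have "\<dots> = R i" unfolding Q(1)[of i] using x(2)[OF _ i] by (intro sum.cong) auto
    finally show ?thesis .
  qed
  ultimately show ?thesis by blast
qed

end

section \<open>Taylor expansions and jets at finitely many points\<close>

definition tay :: "complex \<Rightarrow> complex poly \<Rightarrow> complex fps" where
  "tay t p = fps_of_poly (pcompose p [:t, 1:])"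

lemma ring_map_tay: "ring_map (tay t)"
  by (simp add: ring_map_def tay_def pcompose_add pcompose_mult pcompose_1 fps_of_poly_add fps_of_poly_mult)

lemma tay_nth_0: "fps_nth (tay t p) 0 = poly p t"
  by (simp add: tay_def flip: poly_0_coeff_0) (simp add: poly_pcompose)

lemma tay_const: "tay t [:c:] = fps_const c"
  by (simp add: tay_def fps_of_poly_const)

lemma tay_linear: "tay t [:- t, 1:] = fps_X"
  by (simp add: tay_def pcompose_pCons)

lemma tay_eq_0_iff: "tay t p = 0 \<longleftrightarrow> p = 0"
  by (simp add: tay_def pcompose_eq_0_iff fps_of_poly_eq_iff[of _ 0, simplified])

lemma tay_dvd_iff: "fps_X ^ A dvd tay t p \<longleftrightarrow> [:- t, 1:] ^ A dvd p"
proof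
  assume "[:- t, 1:] ^ A dvd p"
  then obtain q where "p = [:- t, 1:] ^ A * q" by (rule dvdE)
  then have "tay t p = fps_X ^ A * tay t q"
    by (simp add: ring_mapD[OF ring_map_tay] ring_map_power[OF ring_map_tay] tay_linear)
  then show "fps_X ^ A dvd tay t p" by simp
next
  assume "fps_X ^ A dvd tay t p"
  then have "poly.coeff (pcompose p [:t, 1:]) i = 0" if "i < A" for i
    using that by (simp add: fps_X_power_dvd_iff tay_def)
  then have "monom 1 A dvd pcompose p [:t, 1:]" by (simp add: monom_1_dvd_iff')
  then obtain q where q: "pcompose p [:t, 1:] = monom 1 A * q" by (rule dvdE)
  have "p = pcompose (pcompose p [:t, 1:]) [:- t, 1:]" by (simp add: pcompose_assoc[symmetric] pcompose_pCons)
  also have "\<dots> = [:- t, 1:] ^ A * pcompose q [:- t, 1:]"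
    unfolding q by (simp add: monom_altdef ring_mapD[OF ring_map_pcompose] ring_map_power[OF ring_map_pcompose] pcompose_pCons)
  finally show "[:- t, 1:] ^ A dvd p" by (metis dvd_triv_left)
qed

text \<open>The Chinese remainder theorem for the powers \<open>[:- t, 1:] ^ A\<close>, adding one
  point at a time: the correction is a multiple of the product \<open>L\<close> for the earlier
  points.\<close>

lemma jets_interpolate:
  assumes "finite S"
  shows "\<exists>p. \<forall>t\<in>S. fps_X ^ A dvd tay t p - g t"
  using assms
proof (induction S rule: finite_induct)
  case (insert s S)
  then obtain p where p: "\<And>t. t \<in> S \<Longrightarrow> fps_X ^ A dvd tay t p - g t" by blast
  define L where "L = (\<Prod>t\<in>S. [:- t, 1:] ^ A)"
  have tL: "fps_X ^ A dvd tay t L" if "t \<in> S" for t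
    unfolding tay_dvd_iff L_def using insert.hyps(1) that by (rule dvd_prodI)
  have "poly [:- s, 1:] z = 0 \<Longrightarrow> poly L z \<noteq> 0" for z
    using insert.hyps by (auto simp: L_def poly_prod poly_power)
  then have "poly ([:- s, 1:] ^ A) z = 0 \<Longrightarrow> poly L z \<noteq> 0" for z by (auto simp: poly_power)
  then obtain a b where ab: "a * [:- s, 1:] ^ A + b * L = 1" using bezout_no_common_root by blast
  obtain w where w: "fps_X ^ A dvd tay s w - (g s - tay s p)"
  proof
    define f where "f = g s - tay s p"
    have "tay s (pcompose (truncate_fps A f) [:- s, 1:]) = fps_cutoff A f"
      by (simp add: tay_def pcompose_assoc[symmetric] pcompose_pCons)
    then show "fps_X ^ A dvd tay s (pcompose (truncate_fps A f) [:- s, 1:]) - (g s - tay s p)"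
      unfolding f_def[symmetric] by (simp add: fps_X_power_dvd_iff)
  qed
  define p' where "p' = p + b * L * w"
  have "fps_X ^ A dvd tay t p' - g t" if "t \<in> S" for t
  proof -
    have "tay t p' - g t = (tay t p - g t) + tay t L * (tay t b * tay t w)"
      by (simp add: p'_def ring_mapD[OF ring_map_tay] algebra_simps)
    show ?thesis unfolding \<open>tay t p' - g t = _\<close> by (intro dvd_add p[OF that] dvd_mult2 tL[OF that])
  qed
  moreover have "fps_X ^ A dvd tay s p' - g s"
  proof -
    have "b * L = 1 - a * [:- s, 1:] ^ A" using ab by (simp add: algebra_simps)
    then have "p' = p + (1 - a * [:- s, 1:] ^ A) * w" by (simp add: p'_def)
    then have "p' = p + w - a * w * [:- s, 1:] ^ A" by (simp add: algebra_simps)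
    then have "tay s p' = tay s p + tay s w - tay s a * tay s w * fps_X ^ A"
      by (simp only: ring_mapD[OF ring_map_tay] ring_map_diff[OF ring_map_tay]
          ring_map_power[OF ring_map_tay] tay_linear)
    then have "tay s p' - g s = (tay s w - (g s - tay s p)) - fps_X ^ A * (tay s a * tay s w)" by (simp add: algebra_simps)
    show ?thesis unfolding \<open>tay s p' - g s = _\<close> by (intro dvd_diff w dvd_triv_left)
  qed
  ultimately show ?case by blast
qed simp

lemma prod_linear_power_dvd:
  assumes "finite S" "\<And>t. t \<in> S \<Longrightarrow> [:- t, 1:] ^ A dvd p"
  shows "(\<Prod>t\<in>S. [:- t, 1:]) ^ A dvd (p :: complex poly)"
  using assms
proof (induction S rule: finite_induct)
  case (insert s S)
  define L where "L = (\<Prod>t\<in>S. [:- t, 1:])"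
  obtain q where q: "p = [:- s, 1:] ^ A * q" using insert.prems[of s] by (auto elim: dvdE)
  obtain q' where q': "p = L ^ A * q'" using insert by (auto simp: L_def elim: dvdE)
  have "poly ([:- s, 1:] ^ A) z = 0 \<Longrightarrow> poly (L ^ A) z \<noteq> 0" for z
    using insert.hyps by (auto simp: L_def poly_prod poly_power)
  then obtain a b where ab: "a * [:- s, 1:] ^ A + b * L ^ A = 1" using bezout_no_common_root by blast
  have "p = (a * [:- s, 1:] ^ A + b * L ^ A) * p" by (simp add: ab)
  also have "\<dots> = a * [:- s, 1:] ^ A * (L ^ A * q') + b * L ^ A * ([:- s, 1:] ^ A * q)"
    using q q' by (simp only: distrib_right)
  also have "\<dots> = ([:- s, 1:] ^ A * L ^ A) * (a * q' + b * q)" by (simp add: algebra_simps)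
  also have "[:- s, 1:] ^ A * L ^ A = (\<Prod>t\<in>insert s S. [:- t, 1:]) ^ A"
    unfolding prod.insert[OF insert.hyps] L_def by (rule power_mult_distrib[symmetric])
  finally show ?case by (metis dvd_triv_left)
qed simp

lemma const_poly_dvd_pCons:
  "c dvd a \<Longrightarrow> [:c:] dvd p \<Longrightarrow> [:c:] dvd pCons a (p :: 'a::idom poly)"
  by (auto simp: const_poly_dvd_iff coeff_pCons split: nat.split)

lemma const_poly_dvd_tay:
  assumes "finite S" "\<And>t. t \<in> S \<Longrightarrow> [:fps_X ^ A:] dvd map_poly (tay t) F"
  shows "[:(\<Prod>t\<in>S. [:- t, 1:]) ^ A:] dvd F"
proof -
  have "(\<Prod>t\<in>S. [:- t, 1:]) ^ A dvd poly.coeff F n" for n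
  proof (rule prod_linear_power_dvd[OF assms(1)])
    fix t assume "t \<in> S"
    then have "fps_X ^ A dvd poly.coeff (map_poly (tay t) F) n" using assms(2) unfolding const_poly_dvd_iff by blast
    then show "[:- t, 1:] ^ A dvd poly.coeff F n"
      by (simp add: coeff_map_poly ring_mapD[OF ring_map_tay] tay_dvd_iff)
  qed
  then show ?thesis unfolding const_poly_dvd_iff by blast
qed

context smooth_system
begin

abbreviation jet_conic ::
    "complex poly \<Rightarrow> nat \<Rightarrow> nat \<Rightarrow> nat \<Rightarrow> (nat \<Rightarrow> complex poly) \<Rightarrow> (nat \<Rightarrow> complex poly) \<Rightarrow> (nat \<Rightarrow> complex poly) \<Rightarrow> bool" where
  "jet_conic P M c A u W G \<equiv>
    (\<forall>i<r. [:P ^ A:] dvd ev cpoly2 (H i) (\<lambda>j. [:P ^ (2 * M) * u j, P * W j, G j:]) - monom [:\<kappa> i:] (2 * d i)) \<and>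
      (\<forall>R. \<exists>x. \<forall>i<r. [:P ^ A:] dvd dev N cpoly2 (H i) (\<lambda>j. [:P ^ (2 * M) * u j, P * W j, G j:]) (cvec x) -
        [:P ^ c * R i:])"

text \<open>The order of the quantifiers matters. \<open>M\<close> and \<open>c\<close> come from
  the poles of the conics and serve all points of \<open>S\<close>; only afterwards is the order
  \<open>A\<close> of the jets chosen, in terms of them. \<open>u\<close> is left open, since the
  degree of the curve at \<lambda> = 0 has to be chosen after those of \<open>G\<close> and
  \<open>W\<close>.\<close>

theorem global_jets:
  fixes \<gamma> :: "complex \<Rightarrow> nat \<Rightarrow> complex fps"
  assumes S: "finite S"
    and conic: "\<And>t i. t \<in> S \<Longrightarrow> i < r \<Longrightarrow> ev fls_cpoly (H i) (\<lambda>j. [:fls_const (q j), a t j, fps_to_fls (\<gamma> t j):]) =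
       monom (fls_const (\<kappa> i)) (2 * d i)"
    and X: "\<And>t l i. t \<in> S \<Longrightarrow> l < r \<Longrightarrow> i < r \<Longrightarrow> dev N fls_cpoly (H i) (\<lambda>j. [:fls_const (q j), a t j, fps_to_fls (\<gamma> t j):])
       (cvec (X t l)) = (if i = l then 1 else 0)"
  defines "P \<equiv> \<Prod>t\<in>S. [:- t, 1:]"
  shows "\<exists>M c. 1 \<le> M \<and> (\<forall>A. \<exists>G W. (\<forall>t\<in>S. \<forall>j. fps_X ^ A dvd tay t (G j) - \<gamma> t j) \<and>
    (\<forall>u. (\<forall>j. P ^ A dvd u j - [:q j:]) \<longrightarrow>
      jet_conic P M c A u W G))"
proof -
  have P: "P \<noteq> 0" using S by (simp add: P_def)
  define \<pi> where "\<pi> t = tay t P" for t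
  have \<pi>: "fps_nth (\<pi> t) 0 = 0" "\<pi> t \<noteq> 0" if "t \<in> S" for t
    using that S P by (auto simp: \<pi>_def tay_nth_0 tay_eq_0_iff P_def poly_prod)
  define good where "good t M b \<longleftrightarrow> arc_conic q (\<pi> t) M (b :: nat \<Rightarrow> complex fps) (\<gamma> t)" for t M b
  have "\<exists>M0. \<forall>M\<ge>M0. \<forall>t\<in>S. \<exists>b. good t M b"
  proof (rule common_bound[OF S])
    fix t assume t: "t \<in> S"
    show "\<exists>M0. \<forall>M\<ge>M0. \<exists>b. good t M b"
      unfolding good_def using t by (intro clear_denominators[of "\<pi> t" q "a t" "\<gamma> t" "X t"] \<pi> conic X)
  qed
  then obtain M0 where M0: "\<And>M. M \<ge> M0 \<Longrightarrow> \<forall>t\<in>S. \<exists>b. good t M b" by blast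
  define M where "M = M0 + 1"
  obtain b where b: "\<And>t. t \<in> S \<Longrightarrow> good t M (b t)"
    using M0[of M] unfolding bchoice_iff by (auto simp: M_def)
  define F where "F t j = [:\<pi> t ^ (2 * M) * fps_const (q j), \<pi> t * b t j, \<gamma> t j:]" for t j
  have F: "ev fps_cpoly (H i) (F t) = monom (fps_const (\<kappa> i)) (2 * d i)" if "t \<in> S" "i < r" for t i
    using b[OF that(1)] that(2) by (simp add: good_def F_def[abs_def])
  have "\<exists>c0. \<forall>c\<ge>c0. \<forall>t\<in>S. \<forall>R. \<exists>x. \<forall>i<r. dev N fps_cpoly (H i) (F t) (cvec x) = [:\<pi> t ^ c * R i:]"
    by (rule common_bound[OF S]) (use b in \<open>simp add: good_def F_def[abs_def]\<close>)
  then obtain c where c: "\<And>t R. t \<in> S \<Longrightarrow> \<exists>x. \<forall>i<r. dev N fps_cpoly (H i) (F t) (cvec x) = [:\<pi> t ^ c * R i:]"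
    by blast
  have main: "\<exists>G W. (\<forall>t\<in>S. \<forall>j. fps_X ^ A dvd tay t (G j) - \<gamma> t j) \<and>
    (\<forall>u. (\<forall>j. P ^ A dvd u j - [:q j:]) \<longrightarrow>
      jet_conic P M c A u W G)" for A
  proof -
    have "\<forall>j. \<exists>p. \<forall>t\<in>S. fps_X ^ A dvd tay t p - \<gamma> t j" by (intro allI jets_interpolate[OF S])
    then obtain G where G: "\<And>t j. t \<in> S \<Longrightarrow> fps_X ^ A dvd tay t (G j) - \<gamma> t j" unfolding choice_iff by blast
    have "\<forall>j. \<exists>p. \<forall>t\<in>S. fps_X ^ A dvd tay t p - b t j" by (intro allI jets_interpolate[OF S])
    then obtain W where W: "\<And>t j. t \<in> S \<Longrightarrow> fps_X ^ A dvd tay t (W j) - b t j" unfolding choice_iff by blast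
    have "jet_conic P M c A u W G" if u: "\<And>j. P ^ A dvd u j - [:q j:]" for u
    proof -
      define f where "f j = [:P ^ (2 * M) * u j, P * W j, G j:]" for j
      note ht = ring_mapD[OF ring_map_tay] ring_map_diff[OF ring_map_tay] ring_map_power[OF ring_map_tay]
      note hom = ring_map_map_poly[OF ring_map_tay]
      have mpc: "map_poly (tay t) [:x:] = [:tay t x:]" for t x by (simp add: map_poly_pCons ht)
      have close: "[:fps_X ^ A:] dvd map_poly (tay t) (f j) - F t j" if t: "t \<in> S" for t j
      proof -
        have "[:- t, 1:] dvd P" unfolding P_def using S t by (rule dvd_prodI)
        then have "[:- t, 1:] ^ A dvd u j - [:q j:]" using dvd_power_same dvd_trans u by blast
        then have 1: "fps_X ^ A dvd tay t (u j) - fps_const (q j)"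
          unfolding tay_dvd_iff[symmetric] by (simp add: ht tay_const)
        have "map_poly (tay t) (f j) - F t j =
            [:\<pi> t ^ (2 * M) * (tay t (u j) - fps_const (q j)), \<pi> t * (tay t (W j) - b t j), tay t (G j) - \<gamma> t j:]"
          by (simp add: f_def F_def map_poly_pCons ht \<pi>_def right_diff_distrib)
        then show ?thesis using 1 G[OF t, of j] W[OF t, of j]
          by (simp only:) (intro const_poly_dvd_pCons dvd_mult dvd_0_right)
      qed
      have "[:P ^ A:] dvd ev cpoly2 (H i) f - monom [:\<kappa> i:] (2 * d i)" if i: "i < r" for i
        unfolding P_def
      proof (rule const_poly_dvd_tay[OF S])
        fix t assume t: "t \<in> S"
        have "map_poly (tay t) (ev cpoly2 (H i) f - monom [:\<kappa> i:] (2 * d i)) =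
            ev fps_cpoly (H i) (\<lambda>j. map_poly (tay t) (f j)) - ev fps_cpoly (H i) (F t)"
          unfolding F[OF t i] ring_map_diff[OF hom] ev_hom[OF hom] mpc tay_const
          by (simp add: map_poly_monom ht tay_const)
        then show "[:fps_X ^ A:] dvd map_poly (tay t) (ev cpoly2 (H i) f - monom [:\<kappa> i:] (2 * d i))"
          using ev_dvd_diff[OF close[OF t]] by simp
      qed
      moreover have "\<exists>x. \<forall>i<r. [:P ^ A:] dvd dev N cpoly2 (H i) f (cvec x) - [:P ^ c * R i:]" for R
      proof -
        have "\<forall>t\<in>S. \<exists>x. \<forall>i<r. dev N fps_cpoly (H i) (F t) (cvec x) = [:\<pi> t ^ c * tay t (R i):]"
          by (intro ballI c)
        then obtain x where x: "\<And>t i. t \<in> S \<Longrightarrow> i < r \<Longrightarrow>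
            dev N fps_cpoly (H i) (F t) (cvec (x t)) = [:\<pi> t ^ c * tay t (R i):]"
          unfolding bchoice_iff by blast
        have "\<forall>j. \<exists>p. \<forall>t\<in>S. fps_X ^ A dvd tay t p - x t j" by (intro allI jets_interpolate[OF S])
        then obtain y where y: "\<And>t j. t \<in> S \<Longrightarrow> fps_X ^ A dvd tay t (y j) - x t j" unfolding choice_iff by blast
        have "[:P ^ A:] dvd dev N cpoly2 (H i) f (cvec y) - [:P ^ c * R i:]" if i: "i < r" for i
          unfolding P_def
        proof (rule const_poly_dvd_tay[OF S], fold P_def)
          fix t assume t: "t \<in> S"
          let ?d = "dev N fps_cpoly (H i)"
          have "map_poly (tay t) (dev N cpoly2 (H i) f (cvec y) - [:P ^ c * R i:]) =
              ?d (\<lambda>j. map_poly (tay t) (f j)) (\<lambda>j. [:tay t (y j):]) - ?d (F t) (cvec (x t))"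
            unfolding x[OF t i] ring_map_diff[OF hom] dev_hom[OF hom] mpc tay_const
            by (simp add: ht \<pi>_def)
          also have "\<dots> = (?d (\<lambda>j. map_poly (tay t) (f j)) (\<lambda>j. [:tay t (y j):]) - ?d (F t) (\<lambda>j. [:tay t (y j):])) +
              ?d (F t) (\<lambda>j. [:tay t (y j):] - [:x t j:])"
            unfolding dev_diff by simp
          also have "[:fps_X ^ A:] dvd \<dots>"
          proof (rule dvd_add)
            show "[:fps_X ^ A:] dvd ?d (\<lambda>j. map_poly (tay t) (f j)) (\<lambda>j. [:tay t (y j):]) - ?d (F t) (\<lambda>j. [:tay t (y j):])"
              by (rule dev_dvd_diff) (rule close[OF t])
            have "[:fps_X ^ A:] dvd [:tay t (y j):] - [:x t j:]" for j
              using y[OF t, of j] by (simp add: const_poly_dvd_pCons)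
            then show "[:fps_X ^ A:] dvd ?d (F t) (\<lambda>j. [:tay t (y j):] - [:x t j:])"
              unfolding dev_def by (intro dvd_sum dvd_mult)
          qed
          finally show "[:fps_X ^ A:] dvd map_poly (tay t) (dev N cpoly2 (H i) f (cvec y) - [:P ^ c * R i:])" .
        qed
        then show ?thesis by blast
      qed
      ultimately show ?thesis unfolding f_def[abs_def] by blast
    qed
    then show ?thesis using G by - (rule exI[of _ G], rule exI[of _ W], blast)
  qed
  have "1 \<le> M" by (simp add: M_def)
  then show ?thesis using main by - (rule exI[of _ M], rule exI[of _ c], intro conjI allI)
qed

end

section \<open>Gluing\<close>

lemma fps_const_dvd_iff: "fps_const c dvd (f :: 'a::comm_ring_1 fps) \<longleftrightarrow> (\<forall>n. c dvd fps_nth f n)"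
proof
  assume "\<forall>n. c dvd fps_nth f n"
  then obtain g where "\<And>n. fps_nth f n = c * g n" unfolding dvd_def by metis
  then have "f = fps_const c * Abs_fps g" by (intro fps_ext) simp
  then show "fps_const c dvd f" by simp
qed (auto elim!: dvdE)

abbreviation cst :: "complex \<Rightarrow> complex poly fps" where
  "cst \<equiv> \<lambda>c. fps_const [:c:]"

lemma ring_map_cst: "ring_map cst"
  by (rule ring_map_comp[OF ring_map_fps_const ring_map_pCons])

lemma degree_ev_fps:
  fixes f :: "nat \<Rightarrow> complex poly fps"
  assumes "phom n e" and f: "\<And>j t. degree (fps_nth (f j) t) \<le> \<Delta>"
  shows "degree (fps_nth (ev cst e f) t) \<le> n * \<Delta>"
  using assms(1)
proof (induction arbitrary: t rule: phom.induct)
  case (phom_zero e n)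
  then show ?case by (simp add: pzero_ev[OF _ ring_map_cst])
next
  case (phom_add n e e')
  then show ?case by (simp add: degree_add_le)
next
  case (phom_mul n e n' e')
  have "degree (fps_nth (ev cst e f) i * fps_nth (ev cst e' f) (t - i)) \<le> (n + n') * \<Delta>" for i
    using degree_mult_le[of "fps_nth (ev cst e f) i" "fps_nth (ev cst e' f) (t - i)"] phom_mul.IH[of i] phom_mul.IH(2)[of "t - i"]
    by (simp add: distrib_right)
  then show ?case by (simp add: fps_mult_nth degree_sum_le)
qed (use f in \<open>auto\<close>)

text \<open>\<open>f0\<close> solves the equations modulo \<open>P ^ A\<close>, and its linearization is solvable up to a factor
  \<open>P ^ c\<close> there; at \<open>\<lambda> = 0\<close> it is \<open>P ^ E\<close> times a solution \<open>u\<close> whose linearization is solvable with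
  small degrees. The exponents make the corrections in the Newton iteration divisible by
  \<open>P ^ (A2 - c)\<close>, and so their squares by \<open>P ^ A2\<close>.\<close>

locale gluing = smooth_system +
  fixes P :: "complex poly" and u :: "nat \<Rightarrow> complex poly" and f0 :: "nat \<Rightarrow> complex poly fps"
    and E c D A2 A B \<rho> :: nat
  assumes P: "P \<noteq> 0" and E: "1 \<le> E" "E \<le> A2"
    and D: "i < r \<Longrightarrow> E * (d i - 1) + 1 \<le> D"
    and A: "A2 = 2 * c + D" "A = A2 + D"
    and B: "degree P * A + \<rho> \<le> 2 * B" and \<rho>: "\<rho> + degree P * (E - 1) = degree P * A2"
    and f0_nth: "fps_nth (f0 j) 0 = P ^ E * u j" "degree (fps_nth (f0 j) t) \<le> degree P * E + 2 * B"
    and u: "degree (u j) \<le> 2 * B" "i < r \<Longrightarrow> evp (H i) u = 0"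
    and jet: "i < r \<Longrightarrow> fps_const (P ^ A) dvd ev cst (H i) f0 - fps_const [:\<kappa> i:] * fps_X ^ (2 * d i)"
    and jet_onto: "\<And>R. \<exists>x. \<forall>i<r. fps_const (P ^ A) dvd dev N cst (H i) f0 (fvec x) - fps_const (P ^ c * R i)"
    and positive: "\<And>R. \<forall>i<r. R i \<noteq> 0 \<longrightarrow> degree (R i) + \<rho> \<le> 2 * d i * B \<Longrightarrow>
      \<exists>x. (\<forall>j. degree (x j) + \<rho> \<le> 2 * B) \<and> (\<forall>i<r. devp N (H i) u x = R i)"
begin

definition err :: "nat \<Rightarrow> (nat \<Rightarrow> complex poly fps) \<Rightarrow> complex poly fps" where
  "err i f = ev cst (H i) f - fps_const [:\<kappa> i:] * fps_X ^ (2 * d i)"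

definition approx :: "nat \<Rightarrow> (nat \<Rightarrow> complex poly fps) \<Rightarrow> bool" where
  "approx k f \<longleftrightarrow> (\<forall>j. fps_nth (f j) 0 = P ^ E * u j) \<and> (\<forall>j t. degree (fps_nth (f j) t) \<le> degree P * E + 2 * B) \<and>
     (\<forall>j. fps_const (P ^ (A2 - c)) dvd f j - f0 j) \<and>
     (\<forall>i<r. fps_const (P ^ A2) dvd err i f \<and> fps_X ^ (k + 1) dvd err i f)"

lemma P_E_mult:
  "i < r \<Longrightarrow> fps_nth (dev N cst (H i) f (fvec w)) 0 = (P ^ E) ^ (d i - 1) * devp N (H i) u w"
  if "\<And>j. fps_nth (f j) 0 = P ^ E * u j"
  using that phom_dev[OF form ring_map_pCons, of i N "P ^ E" u w]
  by (simp add: dev_hom[OF ring_map_fps_nth_0])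

lemma approx_0: "approx 0 f0"
proof -
  have "fps_X dvd err i f0" if i: "i < r" for i
  proof -
    have "fps_nth (ev cst (H i) f0) 0 = evp (H i) (\<lambda>j. P ^ E * u j)"
      by (simp add: ev_hom[OF ring_map_fps_nth_0] f0_nth)
    also have "\<dots> = (P ^ E) ^ d i * evp (H i) u" by (rule phom_ev[OF form[OF i] ring_map_pCons])
    finally show ?thesis using u(2)[OF i] degree_pos[OF i]
      by (simp add: fps_X_dvd_iff err_def fps_X_power_nth)
  qed
  moreover have "fps_const (P ^ A2) dvd err i f0" if i: "i < r" for i
    using jet[OF i] A(2) unfolding err_def fps_const_dvd_iff by (metis dvd_trans le_add1 le_imp_power_dvd)
  ultimately show ?thesis using f0_nth by (simp add: approx_def)
qed

text \<open>The correction has the form \<open>P * w\<close> and must cancel \<open>e i\<close>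
  through the linearization at \<lambda> = 0. First the jets provide \<open>v\<close>, with degree
  bounded by reduction modulo \<open>P ^ A\<close>, which achieves the required value
  \<open>Q i\<close> up to a multiple of \<open>P ^ A2\<close>. Then \<open>positive\<close> removes
  the rest by \<open>P ^ A2 * z\<close>, whose additional degree \<open>\<rho>\<close> compensates
  up to the growth that is allowed.\<close>

lemma exists_correction:
  assumes e: "\<And>i. i < r \<Longrightarrow> degree (e i) \<le> d i * (degree P * E + 2 * B)" "\<And>i. i < r \<Longrightarrow> P ^ A2 dvd e i"
  shows "\<exists>w w0 z. (\<forall>j. w j = P ^ (A2 - c - 1) * w0 j + P ^ A2 * z j) \<and>
    (\<forall>j. degree (P * w j) \<le> degree P * E + 2 * B) \<and>
    (\<forall>i<r. P ^ (E * (d i - 1) + 1) * devp N (H i) u w = - e i) \<and>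
    (\<forall>i<r. fps_const (P ^ A2) dvd fps_const P * dev N cst (H i) f0 (\<lambda>j. fps_const (P ^ (A2 - c - 1) * w0 j)))"
proof -
  have "\<forall>i\<in>{..<r}. \<exists>e'. e i = P ^ A2 * e'" using e(2) by (auto elim: dvdE)
  then obtain e' where e': "\<And>i. i < r \<Longrightarrow> e i = P ^ A2 * e' i" unfolding bchoice_iff by auto
  \<comment> \<open>The value required of the linearization at \<open>w\<close>: the factor
    \<open>P ^ (E * (d i - 1))\<close> comes from inserting \<open>P ^ E * u\<close> into
    derivatives of degree \<open>d i - 1\<close>, one more \<open>P\<close> from the correction
    \<open>P * w\<close>.\<close>
  define Q where "Q i = - (P ^ (A2 - (E * (d i - 1) + 1)) * e' i)" for i
  have DA2: "E * (d i - 1) + 1 \<le> A2" if "i < r" for i using D[OF that] A(1) by simp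
  have QP: "P ^ (E * (d i - 1) + 1) * Q i = - e i" if i: "i < r" for i
    using DA2[OF i] unfolding Q_def e'[OF i] by (simp add: mult.assoc[symmetric] power_add[symmetric] del: power_Suc)
  have A1: "A2 - c - 1 + 1 + c = A2"
  proof -
    obtain i where "i < r" using nonlinear by blast
    then have "1 \<le> D" using D[of i] by linarith
    then show ?thesis using A(1) by simp
  qed
  obtain x where x: "\<And>i. i < r \<Longrightarrow> fps_const (P ^ A) dvd dev N cst (H i) f0 (fvec x) - fps_const (P ^ c * - e' i)"
    using jet_onto[of "\<lambda>i. - e' i"] by blast
  let ?n = "A2 - c - 1"
  \<comment> \<open>Reduction modulo \<open>P ^ A\<close> bounds the degree. It preserves
    divisibility by \<open>P ^ ?n\<close>, because \<open>?n \<le> A\<close>.\<close>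
  define v where "v j = (P ^ ?n * x j) mod P ^ A" for j
  have nA: "?n \<le> A" using A(2) by simp
  have v: "\<exists>y. v j = P ^ ?n * y" for j
  proof -
    have "P ^ ?n dvd P ^ A" using nA by (rule le_imp_power_dvd)
    then have "P ^ ?n dvd v j" unfolding v_def by (simp add: dvd_mod)
    then show ?thesis by (auto elim: dvdE)
  qed
  then obtain w0 where w0: "\<And>j. v j = P ^ ?n * w0 j" by metis
  have dv: "degree (v j) \<le> degree P * A" for j
    using degree_mod_less[of "P ^ A" "P ^ ?n * x j"] P by (auto simp: v_def degree_power_eq mult.commute)
  have dev_v: "fps_const (P ^ A) dvd dev N cst (H i) f0 (fvec v) + fps_const (P ^ (A2 - 1) * e' i)" if i: "i < r" for i
  proof -
    have "P ^ A dvd v j - P ^ ?n * x j" for j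
      by (simp add: v_def mod_eq_dvd_iff[symmetric])
    then have 1: "fps_const (P ^ A) dvd dev N cst (H i) f0 (\<lambda>j. fps_const (v j) - fps_const (P ^ ?n * x j))"
      unfolding dev_def by (intro dvd_sum dvd_mult) (simp add: fps_const_dvd_iff)
    have 2: "fps_const (P ^ A) dvd fps_const (P ^ ?n) * (dev N cst (H i) f0 (fvec x) - fps_const (P ^ c * - e' i))"
      by (rule dvd_mult[OF x[OF i]])
    have "?n + c = A2 - 1" using A1 by simp
    then have "P ^ (A2 - 1) = P ^ ?n * P ^ c" by (simp only: power_add[symmetric])
    then have b: "fps_const (P ^ (A2 - 1) * e' i) = - (fps_const (P ^ ?n) * fps_const (P ^ c * - e' i))"
      by (simp add: mult.assoc)
    have a: "fps_const (P ^ ?n * x j) = fps_const (P ^ ?n) * fps_const (x j)" for j by simp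
    have "dev N cst (H i) f0 (fvec v) + fps_const (P ^ (A2 - 1) * e' i) =
        dev N cst (H i) f0 (\<lambda>j. fps_const (v j) - fps_const (P ^ ?n * x j)) +
        fps_const (P ^ ?n) * (dev N cst (H i) f0 (fvec x) - fps_const (P ^ c * - e' i))"
      unfolding a b dev_diff dev_scale by (simp del: fps_const_mult add: right_diff_distrib)
    then show ?thesis using 1 2 by (simp only: dvd_add)
  qed
  have "\<exists>V. Q i - devp N (H i) u v = P ^ A2 * V" if i: "i < r" for i
  proof -
    have "P ^ A dvd fps_nth (dev N cst (H i) f0 (fvec v) + fps_const (P ^ (A2 - 1) * e' i)) 0"
      using dev_v[OF i] unfolding fps_const_dvd_iff by blast
    then have 1: "P ^ A dvd (P ^ E) ^ (d i - 1) * devp N (H i) u v + P ^ (A2 - 1) * e' i"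
      using P_E_mult[of f0 i v, OF f0_nth(1) i] by simp
    have "E * (d i - 1) + (A2 - (E * (d i - 1) + 1)) = A2 - 1" using DA2[OF i] by simp
    then have "P ^ (A2 - 1) * e' i = - ((P ^ E) ^ (d i - 1) * Q i)"
      unfolding Q_def by (simp only: power_mult[symmetric] mult_minus_right minus_minus mult.assoc[symmetric] power_add[symmetric])
    then have "P ^ A dvd P ^ (E * (d i - 1)) * (devp N (H i) u v - Q i)"
      using 1 by (simp add: right_diff_distrib power_mult)
    \<comment> \<open>\<open>A\<close> exceeds \<open>A2\<close> by \<open>D\<close> in order to
      survive this division by \<open>P ^ (E * (d i - 1))\<close>.\<close>
    moreover have "A = E * (d i - 1) + (A2 + (D - E * (d i - 1)))" using D[OF i] A(2) by simp
    then have "P ^ A = P ^ (E * (d i - 1)) * (P ^ A2 * P ^ (D - E * (d i - 1)))" by (simp only: power_add[symmetric])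
    ultimately have "P ^ A2 * P ^ (D - E * (d i - 1)) dvd devp N (H i) u v - Q i"
      using P by simp
    then have "P ^ A2 dvd Q i - devp N (H i) u v" by (metis dvd_diff_commute dvd_mult_left)
    then show ?thesis by (auto elim: dvdE)
  qed
  then have "\<forall>i\<in>{..<r}. \<exists>V. Q i - devp N (H i) u v = P ^ A2 * V" by simp
  then obtain V where V: "\<And>i. i < r \<Longrightarrow> Q i - devp N (H i) u v = P ^ A2 * V i" unfolding bchoice_iff by auto
  \<comment> \<open>Division by \<open>P ^ A2\<close> gains \<open>degree P * A2\<close>; of this,
    \<open>degree P * (E - 1)\<close> pays for the degree of \<open>Q i\<close>, and the rest is
    \<open>\<rho>\<close>.\<close>
  have "degree (V i) + \<rho> \<le> 2 * d i * B" if i: "i < r" and Vi: "V i \<noteq> 0" for i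
  proof -
    have "degree (P ^ A2 * V i) = degree P * A2 + degree (V i)"
      using P Vi by (simp add: degree_mult_eq degree_power_eq mult.commute)
    then have "degree P * A2 + degree (V i) \<le> max (degree (Q i)) (degree (devp N (H i) u v))"
      using degree_diff_le_max[of "Q i" "devp N (H i) u v"] unfolding V[OF i] by simp
    moreover have "degree (Q i) \<le> 2 * d i * B + degree P * (E - 1)"
    proof (cases "Q i = 0")
      case False
      have "degree (P ^ (E * (d i - 1) + 1) * Q i) = degree P * (E * (d i - 1) + 1) + degree (Q i)"
        using P False by (simp add: degree_mult_eq degree_power_eq mult.commute del: power_Suc)
      then have 1: "degree P * (E * (d i - 1) + 1) + degree (Q i) \<le> d i * (degree P * E + 2 * B)"
        using e(1)[OF i] unfolding QP[OF i] by simp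
      obtain d' where d': "d i = Suc d'" using degree_pos[OF i] by (cases "d i") auto
      obtain E' where E': "E = Suc E'" using E by (cases E) auto
      show ?thesis using 1 unfolding d' E' by (simp add: algebra_simps)
    qed simp
    moreover have "degree (devp N (H i) u v) \<le> (d i - 1) * (2 * B) + degree P * A"
      unfolding dev_def
    proof (rule degree_sum_le)
      fix j
      have "degree (evp (pd j (H i)) u * v j) \<le> degree (evp (pd j (H i)) u) + degree (v j)"
        by (rule degree_mult_le)
      also have "\<dots> \<le> (d i - 1) * (2 * B) + degree P * A"
        by (intro add_mono degree_ev_le[OF phom_pd[OF form[OF i]]] u dv) auto
      finally show "degree (evp (pd j (H i)) u * v j) \<le> (d i - 1) * (2 * B) + degree P * A" .
    qed simp
    moreover have "(d i - 1) * (2 * B) + 2 * B = 2 * d i * B"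
      using degree_pos[OF i] by (cases "d i") (simp_all add: algebra_simps)
    ultimately show ?thesis using B \<rho> by linarith
  qed
  then obtain z where z: "\<And>j. degree (z j) + \<rho> \<le> 2 * B" "\<And>i. i < r \<Longrightarrow> devp N (H i) u z = V i"
    using positive[of V] by blast
  define w where "w j = v j + P ^ A2 * z j" for j
  have "devp N (H i) u w = Q i" if i: "i < r" for i
    unfolding w_def[abs_def] dev_add dev_scale z(2)[OF i] V[OF i, symmetric] by simp
  then have f1: "P ^ (E * (d i - 1) + 1) * devp N (H i) u w = - e i" if "i < r" for i
    using QP that by simp
  have f2: "degree (P * w j) \<le> degree P * E + 2 * B" for j
  proof -
    have EE: "degree P * E = degree P + degree P * (E - 1)" using E by (cases E) auto
    have "degree (P ^ A2 * z j) \<le> degree P * A2 + degree (z j)"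
      using degree_mult_le[of "P ^ A2" "z j"] P by (simp add: degree_power_eq mult.commute)
    then have "degree (P ^ A2 * z j) \<le> degree P * (E - 1) + 2 * B" using z(1)[of j] \<rho> by linarith
    moreover have "degree (v j) \<le> degree P * (E - 1) + 2 * B" using dv[of j] B by linarith
    ultimately have "degree (w j) \<le> degree P * (E - 1) + 2 * B" unfolding w_def by (intro degree_add_le)
    then show ?thesis using degree_mult_le[of P "w j"] EE by linarith
  qed
  have f3: "fps_const (P ^ A2) dvd fps_const P * dev N cst (H i) f0 (\<lambda>j. fps_const (P ^ ?n * w0 j))" if i: "i < r" for i
  proof -
    have "fps_const (P ^ A2) dvd fps_const (P ^ A)" using A(2) by (auto simp: fps_const_dvd_iff le_imp_power_dvd)
    then have "fps_const (P ^ A2) dvd fps_const P * (dev N cst (H i) f0 (fvec v) + fps_const (P ^ (A2 - 1) * e' i))"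
      using dev_v[OF i] by (metis dvd_mult dvd_trans)
    moreover have "fps_const P * fps_const (P ^ (A2 - 1) * e' i) = fps_const (P ^ A2) * fps_const (e' i)"
    proof -
      have "P * P ^ (A2 - 1) = P ^ A2" using A1 by (metis Suc_eq_plus1 add.commute add_Suc_right diff_Suc_1 power_Suc)
      then show ?thesis by (simp add: mult.assoc[symmetric])
    qed
    ultimately have "fps_const (P ^ A2) dvd fps_const P * dev N cst (H i) f0 (fvec v) + fps_const (P ^ A2) * fps_const (e' i)"
      by (simp only: distrib_left)
    then show ?thesis unfolding w0 by (metis dvd_add_left_iff dvd_triv_left)
  qed
  have f4: "w j = P ^ ?n * w0 j + P ^ A2 * z j" for j unfolding w_def w0 ..
  show ?thesis
    by (rule exI[of _ w], rule exI[of _ w0], rule exI[of _ z], intro conjI allI impI f1 f2 f3 f4)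
qed

text \<open>Besides gaining one power of \<lambda>, the step has to keep the error divisible by
  \<open>P ^ A2\<close>, since the next correction divides by it.\<close>

lemma approx_step:
  assumes f: "approx k f"
  shows "\<exists>g. approx (Suc k) g \<and> (\<forall>j. fps_X ^ (k + 1) dvd g j - f j)"
proof -
  define n where "n = k + 1"
  define e where "e i = fps_nth (err i f) n" for i
  have f_nth: "fps_nth (f j) 0 = P ^ E * u j" "degree (fps_nth (f j) t) \<le> degree P * E + 2 * B" for j t
    using f by (auto simp: approx_def)
  have ff0: "fps_const (P ^ (A2 - c)) dvd f j - f0 j" for j using f by (simp add: approx_def)
  have errP: "fps_const (P ^ A2) dvd err i f" and errX: "fps_X ^ n dvd err i f" if "i < r" for i
    using f that by (auto simp: approx_def n_def simp del: power_Suc)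
  have "degree (e i) \<le> d i * (degree P * E + 2 * B)" if i: "i < r" for i
  proof -
    have "degree (fps_nth (fps_const [:\<kappa> i:] * fps_X ^ (2 * d i)) n) \<le> d i * (degree P * E + 2 * B)"
      by (simp add: fps_X_power_nth)
    then show ?thesis unfolding e_def err_def fps_sub_nth
      using degree_ev_fps[OF form[OF i] f_nth(2)] by (intro degree_diff_le)
  qed
  moreover have "P ^ A2 dvd e i" if "i < r" for i
    using errP[OF that] unfolding e_def fps_const_dvd_iff by blast
  ultimately obtain w w0 z where w: "\<And>j. w j = P ^ (A2 - c - 1) * w0 j + P ^ A2 * z j"
    and deg: "\<And>j. degree (P * w j) \<le> degree P * E + 2 * B"
    and lin: "\<And>i. i < r \<Longrightarrow> P ^ (E * (d i - 1) + 1) * devp N (H i) u w = - e i"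
    and jet0: "\<And>i. i < r \<Longrightarrow> fps_const (P ^ A2) dvd fps_const P * dev N cst (H i) f0 (\<lambda>j. fps_const (P ^ (A2 - c - 1) * w0 j))"
    using exists_correction[of e] by blast
  have cA2: "c + 1 \<le> A2"
  proof -
    obtain i where "i < r" using nonlinear by blast
    then show ?thesis using D[of i] A(1) by simp
  qed
  define y where "y j = w0 j + P ^ (c + 1) * z j" for j
  have Pw: "P * w j = P ^ (A2 - c) * y j" for j
  proof -
    have 1: "P ^ (A2 - c) = P * P ^ (A2 - c - 1)" using cA2 by (metis Suc_diff_Suc Suc_eq_plus1 Suc_le_lessD diff_diff_left power_Suc)
    have 2: "P ^ (A2 - c) * P ^ (c + 1) = P * P ^ A2" using cA2 by (simp add: power_add[symmetric] del: power_Suc) (simp add: Suc_diff_le[symmetric] flip: power_Suc)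
    show ?thesis unfolding w y_def distrib_left mult.assoc[symmetric] 1[symmetric] 2 ..
  qed
  define \<tau> where "\<tau> = fps_X ^ n * fps_const (P ^ (A2 - c))"
  define g where "g j = f j + \<tau> * fps_const (y j)" for j
  have g: "g j = f j + fps_X ^ n * fps_const (P * w j)" for j
    unfolding g_def \<tau>_def Pw by (simp add: mult.assoc)
  have n: "n \<noteq> 0" by (simp add: n_def)
  have "approx (Suc k) g" unfolding approx_def
  proof (intro conjI allI impI)
    show "fps_nth (g j) 0 = P ^ E * u j" for j using n by (simp add: g f_nth fps_X_power_mult_nth)
    show "degree (fps_nth (g j) t) \<le> degree P * E + 2 * B" for j t
      unfolding g using f_nth(2)[of j t] deg[of j] by (auto simp: fps_X_power_mult_nth intro: degree_add_le)
    show "fps_const (P ^ (A2 - c)) dvd g j - f0 j" for j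
    proof -
      have "g j - f0 j = (f j - f0 j) + fps_const (P ^ (A2 - c)) * (fps_X ^ n * fps_const (y j))"
        by (simp add: g_def \<tau>_def mult_ac)
      then show ?thesis using ff0[of j] by (simp only: dvd_add dvd_triv_left)
    qed
    fix i assume i: "i < r"
    obtain v where v: "ev cst (H i) g = ev cst (H i) f + \<tau> * dev N cst (H i) f (fvec y) + \<tau>\<^sup>2 * v"
      using taylor[OF ring_map_cst vars[OF i], of f \<tau> "\<lambda>j. fps_const (y j)"] unfolding g_def[abs_def] by blast
    define L where "L = dev N cst (H i) f (fvec w)"
    have "\<tau> * dev N cst (H i) f (fvec y) = dev N cst (H i) f (\<lambda>j. \<tau> * fps_const (y j))" by (simp add: dev_scale)
    also have "(\<lambda>j. \<tau> * fps_const (y j)) = (\<lambda>j. (fps_X ^ n * fps_const P) * fps_const (w j))"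
      by (simp add: \<tau>_def mult.assoc Pw)
    also have "dev N cst (H i) f \<dots> = (fps_X ^ n * fps_const P) * L" unfolding L_def by (rule dev_scale)
    finally have err_g: "err i g = err i f + fps_X ^ n * (fps_const P * L) + \<tau>\<^sup>2 * v"
      unfolding err_def v by (simp add: algebra_simps)
    show "fps_const (P ^ A2) dvd err i g" unfolding err_g
    proof (intro dvd_add errP[OF i])
      have "2 * (A2 - c) = A2 + (A2 - 2 * c)" using A(1) by simp
      then have p2: "P ^ (A2 - c) * P ^ (A2 - c) = P ^ A2 * P ^ (A2 - 2 * c)"
        by (simp only: power_add[symmetric] mult_2[symmetric])
      have "\<tau>\<^sup>2 = fps_X ^ n * fps_X ^ n * (fps_const (P ^ (A2 - c)) * fps_const (P ^ (A2 - c)))"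
        by (simp only: \<tau>_def power2_eq_square mult_ac)
      also have "fps_const (P ^ (A2 - c)) * fps_const (P ^ (A2 - c)) = fps_const (P ^ A2) * fps_const (P ^ (A2 - 2 * c))"
        unfolding fps_const_mult p2 ..
      finally have "\<tau>\<^sup>2 * v = fps_const (P ^ A2) * (fps_X ^ n * fps_X ^ n * fps_const (P ^ (A2 - 2 * c)) * v)"
        by (simp only: mult_ac)
      then show "fps_const (P ^ A2) dvd \<tau>\<^sup>2 * v" by (simp only: dvd_triv_left)
      let ?m = "A2 - c - 1"
      \<comment> \<open>Passing from \<open>f\<close> to \<open>f0\<close> in the differential costs
        a multiple of \<open>P ^ (A2 - c)\<close>; with the factors \<open>P\<close> and
        \<open>P ^ ?m\<close> this is again divisible by \<open>P ^ A2\<close>. At \<open>f0\<close>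
        itself \<open>jet0\<close> applies.\<close>
      have "fps_const (P ^ (A2 - c)) dvd dev N cst (H i) f (fvec w0) - dev N cst (H i) f0 (fvec w0)"
        by (rule dev_dvd_diff) (rule ff0)
      then obtain b where b: "dev N cst (H i) f (fvec w0) - dev N cst (H i) f0 (fvec w0) = fps_const (P ^ (A2 - c)) * b"
        by (rule dvdE)
      have w': "fps_const (w j) = fps_const (P ^ ?m) * fps_const (w0 j) + fps_const (P ^ A2) * fps_const (z j)" for j
        by (simp add: w)
      have w0': "fps_const (P ^ ?m * w0 j) = fps_const (P ^ ?m) * fps_const (w0 j)" for j by simp
      have "L = fps_const (P ^ ?m) * dev N cst (H i) f (fvec w0) + fps_const (P ^ A2) * dev N cst (H i) f (fvec z)"
        unfolding L_def w' dev_add dev_scale ..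
      also have "dev N cst (H i) f (fvec w0) = dev N cst (H i) f0 (fvec w0) + fps_const (P ^ (A2 - c)) * b"
        using b by (simp add: algebra_simps)
      finally have PL: "fps_const P * L = fps_const P * dev N cst (H i) f0 (\<lambda>j. fps_const (P ^ ?m * w0 j)) +
          fps_const P * fps_const (P ^ ?m) * fps_const (P ^ (A2 - c)) * b + fps_const (P ^ A2) * (fps_const P * dev N cst (H i) f (fvec z))"
        unfolding w0' dev_scale by (simp add: distrib_left mult_ac del: fps_const_mult)
      have PPP: "fps_const P * fps_const (P ^ ?m) * fps_const (P ^ (A2 - c)) = fps_const (P ^ A2) * fps_const (P ^ (A2 - 2 * c))"
      proof -
        have "1 + ?m + (A2 - c) = A2 + (A2 - 2 * c)" using A(1) cA2 by simp
        then have "P ^ 1 * P ^ ?m * P ^ (A2 - c) = P ^ A2 * P ^ (A2 - 2 * c)" by (simp only: power_add[symmetric])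
        then show ?thesis by simp
      qed
      have "fps_const P * L = fps_const P * dev N cst (H i) f0 (\<lambda>j. fps_const (P ^ ?m * w0 j)) +
          fps_const (P ^ A2) * (fps_const (P ^ (A2 - 2 * c)) * b) + fps_const (P ^ A2) * (fps_const P * dev N cst (H i) f (fvec z))"
        unfolding PL PPP by (simp only: mult.assoc)
      then have "fps_const (P ^ A2) dvd fps_const P * L" using jet0[OF i] by (simp only: dvd_add dvd_triv_left)
      then show "fps_const (P ^ A2) dvd fps_X ^ n * (fps_const P * L)" by (rule dvd_mult)
    qed
    have L0: "fps_nth (fps_const P * L) 0 = - e i"
      using lin[OF i] P_E_mult[of f i w, OF f_nth(1) i] by (simp add: L_def power_mult mult.assoc)
    have t2: "\<tau>\<^sup>2 * v = fps_X ^ (n + n) * (fps_const (P ^ (A2 - c)) * (fps_const (P ^ (A2 - c)) * v))"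
      unfolding \<tau>_def power_add power2_eq_square by (simp only: mult_ac)
    show "fps_X ^ (Suc k + 1) dvd err i g"
      unfolding fps_X_power_dvd_iff
    proof (intro allI impI)
      fix t assume t: "t < Suc k + 1"
      have "fps_nth (\<tau>\<^sup>2 * v) t = 0" using t n unfolding t2 by (simp only: fps_X_power_mult_nth) (simp add: n_def)
      moreover have "fps_nth (fps_X ^ n * (fps_const P * L)) t = (if t = n then - e i else 0)"
        using t L0 unfolding fps_X_power_mult_nth by (auto simp: n_def)
      moreover have "fps_nth (err i f) t = (if t = n then e i else 0)"
        using t errX[OF i] unfolding fps_X_power_dvd_iff by (auto simp: e_def n_def)
      ultimately show "fps_nth (err i g) t = 0" unfolding err_g by simp
    qed
  qed
  moreover have "fps_X ^ (k + 1) dvd g j - f j" for j unfolding g n_def by simp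
  ultimately show ?thesis by blast
qed

text \<open>All corrections are divisible by \<open>P ^ (A2 - c)\<close>, whose exponent is
  positive, so the limit keeps the values of \<open>f0\<close> at the roots of
  \<open>P\<close>.\<close>

theorem glued:
  "\<exists>f. (\<forall>i<r. ev cst (H i) f = fps_const [:\<kappa> i:] * fps_X ^ (2 * d i)) \<and>
    (\<forall>j t. degree (fps_nth (f j) t) \<le> degree P * E + 2 * B) \<and> (\<forall>j. fps_const P dvd f j - f0 j)"
proof -
  have "\<exists>F. \<forall>k. approx k (F k) \<and> (\<forall>j. fps_X ^ (k + 1) dvd F (Suc k) j - F k j)"
    using approx_0 approx_step by (intro dependent_nat_choice) auto
  then obtain F where F: "\<And>k. approx k (F k)" "\<And>k j. fps_X ^ (k + 1) dvd F (Suc k) j - F k j" by blast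
  obtain f where f: "\<And>k j. fps_nth (f j) k = fps_nth (F k j) k" and close: "\<And>k j. fps_X ^ (k + 1) dvd f j - F k j"
    using fps_sequence_limit[of F, OF F(2)] by blast
  have "err i f = 0" if i: "i < r" for i
  proof -
    have "fps_nth (err i f) k = 0" for k
    proof -
      have "fps_X ^ (k + 1) dvd ev cst (H i) f - ev cst (H i) (F k)" by (rule ev_dvd_diff) (rule close)
      moreover have "fps_X ^ (k + 1) dvd err i (F k)" using F(1)[of k] i by (simp add: approx_def)
      ultimately have "fps_X ^ (k + 1) dvd (ev cst (H i) f - ev cst (H i) (F k)) + err i (F k)" by (rule dvd_add)
      then have "fps_X ^ (k + 1) dvd err i f" by (simp add: err_def)
      then show ?thesis unfolding fps_X_power_dvd_iff by auto
    qed
    then show ?thesis by (intro fps_ext) simp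
  qed
  then have "\<forall>i<r. ev cst (H i) f = fps_const [:\<kappa> i:] * fps_X ^ (2 * d i)" by (simp add: err_def)
  moreover have "\<forall>j t. degree (fps_nth (f j) t) \<le> degree P * E + 2 * B"
    using F(1) by (simp add: f approx_def)
  moreover have "fps_const P dvd f j - f0 j" for j
    unfolding fps_const_dvd_iff
  proof
    fix k
    have "1 \<le> A2 - c"
    proof -
      obtain i where "i < r" using nonlinear by blast
      then show ?thesis using D[of i] A(1) by simp
    qed
    then have "P dvd P ^ (A2 - c)" using le_imp_power_dvd[of 1 "A2 - c" P] by simp
    moreover have "P ^ (A2 - c) dvd fps_nth (F k j - f0 j) k"
      using F(1)[of k] unfolding approx_def fps_const_dvd_iff by blast
    ultimately show "P dvd fps_nth (f j - f0 j) k" by (simp add: f dvd_trans)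
  qed
  ultimately show ?thesis by blast
qed

end

section \<open>From power series in \<lambda> to numbers\<close>

definition fps_eval :: "complex \<Rightarrow> complex poly fps \<Rightarrow> complex fps" where
  "fps_eval t f = Abs_fps (\<lambda>n. poly (fps_nth f n) t)"

lemma ring_map_fps_eval: "ring_map (fps_eval t)"
  by (simp add: ring_map_def fps_eval_def fps_eq_iff fps_mult_nth poly_sum)

lemma fps_eval_const: "fps_eval t (fps_const p) = fps_const (poly p t)"
  by (simp add: fps_eval_def fps_eq_iff)

lemma fps_eval_X: "fps_eval t fps_X = fps_X"
  by (simp add: fps_eval_def fps_eq_iff fps_X_def)

context smooth_system
begin

text \<open>A solution over the power series in \<open>\<lambda>\<close> becomes one over the complex numbers when the
  countable ring of its coefficients is embedded into the complex numbers.\<close>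

lemma specialize:
  fixes f :: "nat \<Rightarrow> complex poly fps"
  assumes S: "finite S"
    and f: "\<And>i. i < r \<Longrightarrow> ev cst (H i) f = fps_const [:\<kappa> i:] * fps_X ^ (2 * d i)"
    and deg: "\<And>j t. degree (fps_nth (f j) t) \<le> \<Delta>"
    and y: "\<And>t j. t \<in> S \<Longrightarrow> j < N \<Longrightarrow> fps_eval t (f j) = fps_const (y t j) * fps_X\<^sup>2"
  shows "\<exists>F. (\<forall>i<r. evp (H i) F = [:\<kappa> i:]) \<and> (\<forall>t\<in>S. \<forall>j<N. poly (F j) t = y t j)"
proof -
  \<comment> \<open>The uniform degree bound lets \<open>f j\<close>, a power series in \<lambda>
    with polynomial coefficients, be read as a polynomial \<open>V j\<close> whose coefficients are
    series in \<lambda>; only finitely many of these have to be embedded.\<close>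
  define \<phi> where "\<phi> j l = fps_to_fls (Abs_fps (\<lambda>n. poly.coeff (fps_nth (f j) n) l))" for j l
  define V where "V j = (\<Sum>l\<le>\<Delta>. monom (\<phi> j l) l)" for j
  have V: "poly (V j) (fls_const t) = fps_to_fls (fps_eval t (f j))" for j t
  proof -
    have "fps_eval t (f j) = (\<Sum>l\<le>\<Delta>. Abs_fps (\<lambda>n. poly.coeff (fps_nth (f j) n) l) * fps_const (t ^ l))"
      by (rule fps_ext) (simp add: fps_eval_def fps_sum_nth poly_sum_atMost[OF deg])
    then have "fps_to_fls (fps_eval t (f j)) = (\<Sum>l\<le>\<Delta>. \<phi> j l * fls_const (t ^ l))"
      by (simp add: ring_map_sum[OF ring_map_fps_to_fls] fls_times_fps_to_fls \<phi>_def)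
    then show ?thesis
      by (simp add: V_def poly_sum poly_monom ring_map_power[OF ring_map_fls_const])
  qed
  have HV: "ev fls_cpoly (H i) V = [:fls_const (\<kappa> i) * fls_X ^ (2 * d i):]" if i: "i < r" for i
  proof -
    have "ev fls_cpoly (H i) V - [:fls_const (\<kappa> i) * fls_X ^ (2 * d i):] = 0"
    proof (rule poly_zero_if_nat_zeros)
      fix n
      have n: "(of_nat n :: complex fls) = fls_const (of_nat n)" by (simp add: fls_of_nat)
      have "poly (ev fls_cpoly (H i) V) (of_nat n) = ev fls_const (H i) (\<lambda>j. fps_to_fls (fps_eval (of_nat n) (f j)))"
        unfolding ev_hom[OF ring_map_poly] n V by simp
      also have "\<dots> = fps_to_fls (fps_eval (of_nat n) (ev cst (H i) f))"
        by (simp add: ev_hom[OF ring_map_fps_to_fls] ev_hom[OF ring_map_fps_eval] fps_eval_const)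
      also have "\<dots> = fls_const (\<kappa> i) * fls_X ^ (2 * d i)"
        unfolding f[OF i] by (simp add: ring_mapD[OF ring_map_fps_eval] ring_map_power[OF ring_map_fps_eval]
            fps_eval_const fps_eval_X fls_times_fps_to_fls fps_to_fls_power)
      finally show "poly (ev fls_cpoly (H i) V - [:fls_const (\<kappa> i) * fls_X ^ (2 * d i):]) (of_nat n) = 0"
        by simp
    qed
    then show ?thesis by simp
  qed
  have "finite (S \<union> (\<Union>t\<in>S. y t ` {..<N}) \<union> \<kappa> ` {..<r} \<union> (\<Union>i<r. pconsts (H i)))" using S by (simp add: finite_pconsts)
  from exists_countable_subring[OF this] obtain k
    where k: "subring k" "countable k" "S \<union> (\<Union>t\<in>S. y t ` {..<N}) \<union> \<kappa> ` {..<r} \<union> (\<Union>i<r. pconsts (H i)) \<subseteq> k" by blast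
  define K where "K = fls_const ` k"
  have K: "subring K" "countable K" unfolding K_def using k by (auto intro: subring_image[OF emb_fls_const])
  define Ls where "Ls = [fls_X] @ concat (map (\<lambda>j. map (\<phi> j) [0..<Suc \<Delta>]) [0..<N])"
  define R where "R = adjoin_list K Ls"
  have R: "subring R" unfolding R_def by (rule subring_adjoin_list[OF K(1)])
  have gen: "z \<in> R" if "z \<in> set Ls" for z unfolding R_def by (rule adjoin_list_generators[OF K(1) that])
  have XR: "fls_X \<in> R" by (rule gen) (simp add: Ls_def)
  have \<phi>R: "\<phi> j l \<in> R" if "j < N" "l \<le> \<Delta>" for j l
  proof (rule gen)
    have "\<phi> j l \<in> set (concat (map (\<lambda>j. map (\<phi> j) [0..<Suc \<Delta>]) [0..<N]))"
      unfolding set_concat set_map image_image using that by (intro UN_I[of j] imageI) auto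
    then show "\<phi> j l \<in> set Ls" unfolding Ls_def by simp
  qed
  have cR: "fls_const a \<in> R" if "a \<in> k" for a
    unfolding R_def by (rule adjoin_list_superset[OF K(1)]) (simp add: K_def that)
  have "emb K (\<lambda>a. fls_nth a 0)" using K(1) by (auto simp: emb_def K_def)
  then obtain \<sigma> where \<sigma>: "emb R \<sigma>" "\<And>a. a \<in> K \<Longrightarrow> \<sigma> a = fls_nth a 0"
    using emb_extend_complex_list[OF _ K(2)] unfolding R_def by blast
  have \<sigma>c: "\<sigma> (fls_const a) = a" if "a \<in> k" for a using \<sigma>(2) that by (simp add: K_def)
  define l where "l = \<sigma> fls_X"
  have l: "l \<noteq> 0" using embD(6)[OF \<sigma>(1) XR] by (auto simp: l_def)
  have \<sigma>0: "\<sigma> 0 = 0" by (rule embD(2)[OF \<sigma>(1)])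
  note \<sigma>' = emb_map_poly[OF \<sigma>(1)]
  have VR: "V j \<in> over R" if "j < N" for j
    unfolding V_def using \<phi>R[OF that] by (intro subring_sum[OF subring_over[OF R]] over_intros(9)[OF R]) simp
  have pcR: "[:c:] \<in> over R" if "c \<in> R" for c using that subringD(1)[OF R] by (intro over_pCons over_0)
  have pc: "map_poly \<sigma> [:c:] = [:\<sigma> c:]" for c using \<sigma>0 by (simp add: map_poly_pCons)
  define F where "F j = [:inverse (l\<^sup>2):] * map_poly \<sigma> (V j)" for j
  have "evp (H i) F = [:\<kappa> i:]" if i: "i < r" for i
  proof -
    have con: "c \<in> k" if "c \<in> pconsts (H i)" for c using that k(3) i by blast
    have "map_poly \<sigma> (ev fls_cpoly (H i) V) = evp (H i) (\<lambda>j. map_poly \<sigma> (V j))"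
      using con cR vars[OF i] VR \<sigma>c by (intro emb_ev[OF \<sigma>'] pcR) (auto simp: pc)
    moreover have "map_poly \<sigma> (ev fls_cpoly (H i) V) = [:\<kappa> i * l ^ (2 * d i):]"
    proof -
      have \<kappa>k: "\<kappa> i \<in> k" using k(3) i by blast
      have "\<sigma> (fls_const (\<kappa> i) * fls_X ^ (2 * d i)) = \<kappa> i * l ^ (2 * d i)"
        using cR[OF \<kappa>k] \<sigma>c[OF \<kappa>k] XR
        by (simp add: embD(5)[OF \<sigma>(1)] subring_power[OF R] emb_power[OF \<sigma>(1)] l_def)
      then show ?thesis unfolding HV[OF i] pc by simp
    qed
    ultimately have "evp (H i) (\<lambda>j. map_poly \<sigma> (V j)) = [:\<kappa> i * l ^ (2 * d i):]" by simp
    moreover have "evp (H i) F = [:inverse (l\<^sup>2):] ^ d i * evp (H i) (\<lambda>j. map_poly \<sigma> (V j))"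
      unfolding F_def[abs_def] by (rule phom_ev[OF form[OF i] ring_map_pCons])
    ultimately show ?thesis using l by (simp add: poly_const_pow power_inverse power_mult[symmetric])
  qed
  moreover have "poly (F j) t = y t j" if t: "t \<in> S" and j: "j < N" for t j
  proof -
    have tk: "t \<in> k" "y t j \<in> k" using k(3) t j by blast+
    have "poly (map_poly \<sigma> (V j)) (\<sigma> (fls_const t)) = \<sigma> (poly (V j) (fls_const t))"
      by (rule emb_poly[OF \<sigma>(1) cR[OF tk(1)] VR[OF j], symmetric])
    also have "poly (V j) (fls_const t) = fls_const (y t j) * fls_X\<^sup>2"
      unfolding V y[OF t j] by (simp add: fls_times_fps_to_fls fps_to_fls_power)
    also have "\<sigma> \<dots> = y t j * l\<^sup>2"
      using cR[OF tk(2)] \<sigma>c[OF tk(2)] XR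
      by (simp add: embD(5)[OF \<sigma>(1)] subring_power[OF R] emb_power[OF \<sigma>(1)] l_def)
    finally show ?thesis using l \<sigma>c[OF tk(1)] by (simp add: F_def)
  qed
  ultimately show ?thesis by blast
qed

text \<open>\<open>r < N\<close> yields a nonzero solution \<open>y\<close>, and a generic point
  that specializes to a nonzero vector is itself nonzero.\<close>

lemma exists_generic_cone_point:
  assumes k: "subring k" "countable k" "\<And>i. i < r \<Longrightarrow> pconsts (H i) \<subseteq> k"
  shows "\<exists>q. (\<exists>j<N. q j \<noteq> 0) \<and> (\<forall>i<r. evc (H i) q = 0) \<and> generic k q"
proof -
  have "r \<le> (\<Sum>i<r. 2 * d i - 1)"
  proof -
    have "(\<Sum>i<r. 1) \<le> (\<Sum>i<r. 2 * d i - 1)" using degree_pos by (intro sum_mono) force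
    then show ?thesis by simp
  qed
  then have "r < N" using few_equations by simp
  then obtain y where y: "\<exists>j<N. y j \<noteq> 0" "\<forall>i<r. evc (H i) y = 0"
    using forms_common_zero[of r d H N] form degree_pos vars by auto
  have "\<exists>g \<tau> \<gamma>. (\<forall>i<r. evc (H i) g = 0 * \<kappa> i) \<and> generic k g \<and> emb (adjoin_list k (map g [0..<N])) \<tau> \<and>
    (\<forall>a\<in>k. \<tau> a = fls_const a) \<and> (\<forall>j<N. \<tau> (g j) = fps_to_fls (\<gamma> j) \<and> fps_nth (\<gamma> j) 0 = y j)"
    using y subringD(1)[OF k(1)] by (intro generic_point k) auto
  then obtain g \<tau> \<gamma> where g: "\<forall>i<r. evc (H i) g = 0 * \<kappa> i" "generic k g"
    and \<tau>: "emb (adjoin_list k (map g [0..<N])) \<tau>" "\<And>j. j < N \<Longrightarrow> \<tau> (g j) = fps_to_fls (\<gamma> j)"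
      "\<And>j. j < N \<Longrightarrow> fps_nth (\<gamma> j) 0 = y j" by blast
  obtain j where j: "j < N" "y j \<noteq> 0" using y by blast
  have "g j \<noteq> 0"
  proof
    assume "g j = 0"
    then have "\<gamma> j = 0" using \<tau>(2)[OF j(1)] embD(2)[OF \<tau>(1)] by (simp add: fps_to_fls_eq_0_iff)
    then show False using \<tau>(3)[OF j(1)] j(2) by simp
  qed
  then show ?thesis using g j(1) by (intro exI[of _ g]) auto
qed

end

lemma ring_map_fps_of_poly: "ring_map fps_of_poly"
  by (simp add: ring_map_def fps_of_poly_add fps_of_poly_mult)

lemma dvd_fps_of_poly: "[:p:] dvd X \<Longrightarrow> fps_const p dvd fps_of_poly (X :: 'a::comm_ring_1 poly)"
  by (auto elim!: dvdE simp: fps_of_poly_smult)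

context smooth_system
begin

theorem interpolation:
  assumes S: "finite S" "S \<noteq> {}"
    and y: "\<And>t i. t \<in> S \<Longrightarrow> i < r \<Longrightarrow> evc (H i) (y t) = \<kappa> i"
  shows "\<exists>F. (\<forall>i<r. evp (H i) F = [:\<kappa> i:]) \<and> (\<forall>t\<in>S. \<forall>j<N. poly (F j) t = y t j)"
proof -
  have "finite (\<kappa> ` {..<r} \<union> (\<Union>i<r. pconsts (H i)))" by (simp add: finite_pconsts)
  from exists_countable_subring[OF this] obtain k
    where k: "subring k" "countable k" "\<kappa> ` {..<r} \<union> (\<Union>i<r. pconsts (H i)) \<subseteq> k" by blast
  have con: "pconsts (H i) \<subseteq> k" and \<kappa>k: "\<kappa> i \<in> k" if "i < r" for i using k(3) that by blast+
  obtain q where q: "\<exists>j<N. q j \<noteq> 0" "\<forall>i<r. evc (H i) q = 0" "generic k q"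
    using exists_generic_cone_point[OF k(1,2) con] by blast
  define K where "K = adjoin_list k (map q [0..<N])"
  have K: "subring K" "countable K"
    unfolding K_def by (rule subring_adjoin_list[OF k(1)], rule countable_adjoin_list[OF k(2)])
  have conK: "pconsts (H i) \<subseteq> K" if "i < r" for i
    using con[OF that] adjoin_list_superset[OF k(1)] unfolding K_def by blast
  have qK: "q j \<in> K" if "j < N" for j unfolding K_def using that by (intro adjoin_list_generators[OF k(1)]) simp
  \<comment> \<open>A second cone point, generic over the first, gives with \<open>s = 0\<close> a
    conic inside the cone, with the same starting point \<open>q\<close> as the conics along the
    arcs.\<close>
  obtain p where p: "\<exists>j<N. p j \<noteq> 0" "\<forall>i<r. evc (H i) p = 0" "generic K p"
    using exists_generic_cone_point[OF K conK] by blast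
  have "\<exists>a. (\<forall>i<r. evp (H i) (conic q a p) = monom (0 * \<kappa> i) (2 * d i)) \<and>
    (\<forall>R. (\<forall>i<r. degree (R i) \<le> 2 * d i - 2) \<longrightarrow>
      (\<exists>x. \<forall>i<r. devp N (H i) (conic q a p) (cvec x) = R i))"
  proof -
    interpret two_points N r H d \<kappa> k 0 p q
      using k(1) con q p subringD(1)[OF k(1)] generic_not_multiple[OF K(1) qK q(1) p(3)]
      by unfold_locales (auto simp: K_def)
    show ?thesis by (rule conic)
  qed
  then obtain a where "\<forall>i<r. evp (H i) (conic q a p) = monom (0 * \<kappa> i) (2 * d i)"
    and onto: "\<And>R. \<forall>i<r. degree (R i) \<le> 2 * d i - 2 \<Longrightarrow>
      \<exists>x. \<forall>i<r. devp N (H i) (conic q a p) (cvec x) = R i"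
    by blast
  then have conic0: "evp (H i) (conic q a p) = 0" if "i < r" for i using that by simp
  have "\<forall>t\<in>S. \<exists>\<gamma> b X. (\<forall>j<N. fps_nth (\<gamma> j) 0 = y t j) \<and>
    (\<forall>i<r. ev fls_cpoly (H i) (\<lambda>j. [:fls_const (q j), b j, fps_to_fls (\<gamma> j):]) =
       monom (fls_const (\<kappa> i)) (2 * d i)) \<and>
    (\<forall>l<r. \<forall>i<r. dev N fls_cpoly (H i) (\<lambda>j. [:fls_const (q j), b j, fps_to_fls (\<gamma> j):])
       (cvec (X l)) = (if i = l then 1 else 0))"
  proof
    fix t assume t: "t \<in> S"
    show "\<exists>\<gamma> b X. (\<forall>j<N. fps_nth (\<gamma> j) 0 = y t j) \<and>
    (\<forall>i<r. ev fls_cpoly (H i) (\<lambda>j. [:fls_const (q j), b j, fps_to_fls (\<gamma> j):]) =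
       monom (fls_const (\<kappa> i)) (2 * d i)) \<and>
    (\<forall>l<r. \<forall>i<r. dev N fls_cpoly (H i) (\<lambda>j. [:fls_const (q j), b j, fps_to_fls (\<gamma> j):])
       (cvec (X l)) = (if i = l then 1 else 0))"
      using q(2) by (intro conic_along_arc[OF k(1,2) con \<kappa>k q(1) _ q(3) y[OF t]]) auto
  qed
  then obtain \<gamma> b X where \<gamma>: "\<And>t j. t \<in> S \<Longrightarrow> j < N \<Longrightarrow> fps_nth (\<gamma> t j) 0 = y t j"
    and arc: "\<And>t i. t \<in> S \<Longrightarrow> i < r \<Longrightarrow> ev fls_cpoly (H i) (\<lambda>j. [:fls_const (q j), b t j, fps_to_fls (\<gamma> t j):]) =
       monom (fls_const (\<kappa> i)) (2 * d i)"
    and arc_onto: "\<And>t l i. t \<in> S \<Longrightarrow> l < r \<Longrightarrow> i < r \<Longrightarrow> dev N fls_cpoly (H i) (\<lambda>j. [:fls_const (q j), b t j, fps_to_fls (\<gamma> t j):])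
       (cvec (X t l)) = (if i = l then 1 else 0)"
    unfolding bchoice_iff by blast
  define P where "P = (\<Prod>t\<in>S. [:- t, 1:])"
  have P: "P \<noteq> 0" using S by (simp add: P_def)
  have degP: "degree P = card S" unfolding P_def by (subst degree_prod_eq_sum_degree) auto
  have m: "1 \<le> degree P" using S unfolding degP by (simp add: Suc_le_eq card_gt_0_iff)
  obtain M c where M: "1 \<le> M" and jets: "\<And>A. \<exists>G W. (\<forall>t\<in>S. \<forall>j. fps_X ^ A dvd tay t (G j) - \<gamma> t j) \<and>
    (\<forall>u. (\<forall>j. P ^ A dvd u j - [:q j:]) \<longrightarrow>
      jet_conic P M c A u W G)"
    using global_jets[of S q b \<gamma> X, OF S(1) arc arc_onto] unfolding P_def by blast
  \<comment> \<open>\<open>E\<close> is the exponent of \<open>P\<close> that clearing denominators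
    puts in front of \<open>q\<close>, and \<open>D\<close> bounds the powers of \<open>P\<close>
    that the corrections lose. \<open>A2\<close> leaves room for squaring after a loss of
    \<open>c\<close>, and \<open>A\<close> is the order to which the jets are taken.\<close>
  define E where "E = 2 * M"
  define D where "D = (\<Sum>i<r. E * (d i - 1) + 1)"
  define A2 where "A2 = 2 * c + D"
  define A where "A = A2 + D"
  have E: "1 \<le> E" using M by (simp add: E_def)
  have D: "E * (d i - 1) + 1 \<le> D" if "i < r" for i
    unfolding D_def using that by (intro member_le_sum[of i "{..<r}" "\<lambda>i. E * (d i - 1) + 1"]) auto
  have EA2: "E \<le> A2"
  proof -
    obtain i where i: "i < r" "2 \<le> d i" using nonlinear by blast
    have "E * 1 \<le> E * (d i - 1)" using i(2) by (intro mult_le_mono2) simp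
    then show ?thesis using D[OF i(1)] unfolding A2_def mult_1_right by linarith
  qed
  have A_pos: "1 \<le> A" using E EA2 by (simp add: A_def)
  define \<rho> where "\<rho> = degree P * (A2 + 1 - E)"
  have \<rho>: "\<rho> + degree P * (E - 1) = degree P * A2"
    using E EA2 by (simp add: \<rho>_def distrib_left[symmetric])
  have \<rho>1: "1 \<le> \<rho>" using m EA2 by (simp add: \<rho>_def Suc_le_eq)
  obtain G0 W0 where G0: "\<And>t j. t \<in> S \<Longrightarrow> fps_X ^ A dvd tay t (G0 j) - \<gamma> t j"
    and jet0: "\<And>u. \<forall>j. P ^ A dvd u j - [:q j:] \<Longrightarrow>
      (\<forall>i<r. [:P ^ A:] dvd ev cpoly2 (H i) (\<lambda>j. [:P ^ E * u j, P * W0 j, G0 j:]) - monom [:\<kappa> i:] (2 * d i)) \<and>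
      (\<forall>R. \<exists>x. \<forall>i<r. [:P ^ A:] dvd dev N cpoly2 (H i) (\<lambda>j. [:P ^ E * u j, P * W0 j, G0 j:]) (cvec x) -
        [:P ^ c * R i:])"
    using jets[of A] unfolding E_def by blast
  \<comment> \<open>\<open>B\<close> dominates the degrees of the interpolated jets, so that these
    respect the degree bounds. As \<open>\<psi>\<close> is divisible by \<open>P ^ A\<close>, the
    pullback \<open>u\<close> of the conic is congruent to \<open>q\<close> to the order of the
    jets; the monomial factor raises its degree to \<open>B\<close>.\<close>
  define B where "B = degree P * A + \<rho> + (\<Sum>j<N. degree (P * W0 j) + degree (G0 j))"
  define \<psi> where "\<psi> = P ^ A * monom 1 (B - degree P * A)"
  have "degree \<psi> = degree (P ^ A) + degree (monom (1::complex) (B - degree P * A))"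
    unfolding \<psi>_def using P by (intro degree_mult_eq) auto
  then have \<psi>: "degree \<psi> = B" using P by (simp add: degree_power_eq degree_monom_eq mult.commute B_def)
  have B: "0 < B" "\<rho> \<le> B + 1" "degree P * A + \<rho> \<le> 2 * B" using \<rho>1 by (auto simp: B_def)
  define u where "u j = pcompose [:q j, a j, p j:] \<psi>" for j
  \<comment> \<open>Coordinates beyond \<open>N\<close> do not occur in the equations, and
    \<open>B\<close> does not bound their jets; these are set to 0.\<close>
  define f0 where "f0 j = [:P ^ E * u j, if j < N then P * W0 j else 0, if j < N then G0 j else 0:]" for j
  have u_q: "P ^ A dvd u j - [:q j:]" for j
  proof -
    have "u j - [:q j:] = P ^ A * (monom 1 (B - degree P * A) * ([:a j:] + \<psi> * [:p j:]))"
      by (simp add: u_def pcompose_pCons \<psi>_def mult.assoc)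
    then show ?thesis by simp
  qed
  have degu: "degree (u j) \<le> 2 * B" for j
  proof -
    have "degree (u j) = degree [:q j, a j, p j:] * B" unfolding u_def by (simp only: degree_pcompose \<psi>)
    also have "\<dots> \<le> 2 * B" by (intro mult_le_mono1) (simp add: degree_pCons_eq_if)
    finally show ?thesis .
  qed
  have WG: "degree (P * W0 j) \<le> B" "degree (G0 j) \<le> B" if "j < N" for j
  proof -
    have "degree (P * W0 j) + degree (G0 j) \<le> (\<Sum>j<N. degree (P * W0 j) + degree (G0 j))"
      using that by (intro member_le_sum[of j "{..<N}" "\<lambda>j. degree (P * W0 j) + degree (G0 j)"]) auto
    then show "degree (P * W0 j) \<le> B" "degree (G0 j) \<le> B" by (simp_all add: B_def)
  qed
  have degf0: "degree (poly.coeff (f0 j) t) \<le> degree P * E + 2 * B" for j t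
  proof -
    have "degree (P ^ E * u j) \<le> degree P * E + 2 * B"
      using degree_mult_le[of "P ^ E" "u j"] degu[of j] P by (simp add: degree_power_eq mult.commute)
    then show ?thesis using WG[of j] by (auto simp: f0_def coeff_pCons split: nat.split)
  qed
  have f0_eq: "f0 j = [:P ^ E * u j, P * W0 j, G0 j:]" if "j < N" for j using that by (simp add: f0_def)
  note jet = jet0[of u, OF allI[OF u_q]]
  have cst: "fps_of_poly [:[:x:]:] = cst x" for x by (simp add: fps_of_poly_const)
  note hp = ring_map_fps_of_poly
  have "gluing N r H d \<kappa> P u (\<lambda>j. fps_of_poly (f0 j)) E c D A2 A B \<rho>"
  proof
    show "P \<noteq> 0" "1 \<le> E" "E \<le> A2" "A2 = 2 * c + D" "A = A2 + D" "degree P * A + \<rho> \<le> 2 * B"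
      "\<rho> + degree P * (E - 1) = degree P * A2" by (fact P E EA2 A2_def A_def B(3) \<rho>)+
    show "E * (d i - 1) + 1 \<le> D" if "i < r" for i by (rule D[OF that])
    show "fps_nth (fps_of_poly (f0 j)) 0 = P ^ E * u j" for j by (simp add: f0_def)
    show "degree (fps_nth (fps_of_poly (f0 j)) t) \<le> degree P * E + 2 * B" for j t using degf0 by simp
    show "degree (u j) \<le> 2 * B" for j by (rule degu)
    show "evp (H i) u = 0" if "i < r" for i
    proof -
      have "evp (H i) u = pcompose (evp (H i) (conic q a p)) \<psi>"
        unfolding u_def[abs_def] by (subst ev_hom[OF ring_map_pcompose]) simp
      then show ?thesis by (simp add: conic0[OF that])
    qed
    show "fps_const (P ^ A) dvd ev cst (H i) (\<lambda>j. fps_of_poly (f0 j)) - fps_const [:\<kappa> i:] * fps_X ^ (2 * d i)"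
      if i: "i < r" for i
    proof -
      have "[:P ^ A:] dvd ev cpoly2 (H i) (\<lambda>j. [:P ^ E * u j, P * W0 j, G0 j:]) - monom [:\<kappa> i:] (2 * d i)"
        using jet i by blast
      also have "ev cpoly2 (H i) (\<lambda>j. [:P ^ E * u j, P * W0 j, G0 j:]) = ev cpoly2 (H i) f0"
        using f0_eq vars[OF i] by (intro ev_cong) auto
      finally have "fps_const (P ^ A) dvd fps_of_poly (ev cpoly2 (H i) f0 - monom [:\<kappa> i:] (2 * d i))"
        by (rule dvd_fps_of_poly)
      then show ?thesis by (simp add: fps_of_poly_diff fps_of_poly_monom ev_hom[OF hp] cst del: fps_of_poly_const)
    qed
    show "\<exists>x. \<forall>i<r. fps_const (P ^ A) dvd dev N cst (H i) (\<lambda>j. fps_of_poly (f0 j)) (fvec x) - fps_const (P ^ c * R i)" for R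
    proof -
      obtain x where x: "\<And>i. i < r \<Longrightarrow> [:P ^ A:] dvd dev N cpoly2 (H i) (\<lambda>j. [:P ^ E * u j, P * W0 j, G0 j:]) (cvec x) - [:P ^ c * R i:]"
        using jet by blast
      have "fps_const (P ^ A) dvd dev N cst (H i) (\<lambda>j. fps_of_poly (f0 j)) (fvec x) - fps_const (P ^ c * R i)" if i: "i < r" for i
      proof -
        have "dev N cpoly2 (H i) (\<lambda>j. [:P ^ E * u j, P * W0 j, G0 j:]) (cvec x) =
            dev N cpoly2 (H i) f0 (cvec x)"
          using f0_eq vars[OF i] by (intro dev_cong_point) auto
        then have "fps_const (P ^ A) dvd fps_of_poly (dev N cpoly2 (H i) f0 (cvec x) - [:P ^ c * R i:])"
          using x[OF i] by (intro dvd_fps_of_poly) simp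
        then show ?thesis by (simp add: fps_of_poly_diff dev_hom[OF hp] fps_of_poly_const)
      qed
      then show ?thesis by blast
    qed
    show "\<exists>x. (\<forall>j. degree (x j) + \<rho> \<le> 2 * B) \<and> (\<forall>i<r. devp N (H i) u x = R i)"
      if "\<forall>i<r. R i \<noteq> 0 \<longrightarrow> degree (R i) + \<rho> \<le> 2 * d i * B" for R
      unfolding u_def[abs_def] using that by (intro pullback_onto[OF onto \<psi> B(1) \<rho>1 B(2)]) auto
  qed
  then interpret gluing N r H d \<kappa> P u "\<lambda>j. fps_of_poly (f0 j)" E c D A2 A B \<rho> .
  obtain f where f: "\<forall>i<r. ev cst (H i) f = fps_const [:\<kappa> i:] * fps_X ^ (2 * d i)"
    "\<forall>j t. degree (fps_nth (f j) t) \<le> degree P * E + 2 * B" "\<forall>j. fps_const P dvd f j - fps_of_poly (f0 j)"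
    using glued by blast
  \<comment> \<open>At \<open>t\<close> the factors \<open>P ^ E\<close> and \<open>P\<close> kill
    the coefficients of degree 0 and 1 in \<lambda>, and \<open>f0\<close> has been changed only by
    multiples of \<open>P\<close>.\<close>
  have val: "fps_eval t (f j) = fps_const (y t j) * fps_X\<^sup>2" if t: "t \<in> S" and j: "j < N" for t j
  proof (rule fps_ext)
    fix n
    have P0: "poly P t = 0" using t S by (auto simp: P_def poly_prod)
    have "P dvd fps_nth (f j - fps_of_poly (f0 j)) n" using f(3) unfolding fps_const_dvd_iff by blast
    then obtain g where "fps_nth (f j - fps_of_poly (f0 j)) n = P * g" by (rule dvdE)
    from arg_cong[OF this, of "\<lambda>p. poly p t"] have "poly (fps_nth (f j) n) t = poly (poly.coeff (f0 j) n) t"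
      using P0 by simp
    also have "\<dots> = (if n = 2 then y t j else 0)"
    proof -
      have "fps_X dvd tay t (G0 j) - \<gamma> t j"
        using dvd_trans[OF le_imp_power_dvd[OF A_pos, of fps_X] G0[OF t, of j]] by simp
      then have "poly (G0 j) t = y t j" using \<gamma>[OF t j] by (simp add: fps_X_dvd_iff tay_nth_0)
      then have "poly (poly.coeff [:P ^ E * u j, P * W0 j, G0 j:] 2) t = y t j" by (simp add: numeral_2_eq_2)
      moreover have "poly (poly.coeff [:P ^ E * u j, P * W0 j, G0 j:] 0) t = 0" using P0 E by (simp add: power_0_left)
      moreover have "poly (poly.coeff [:P ^ E * u j, P * W0 j, G0 j:] 1) t = 0" using P0 by simp
      moreover have "poly.coeff [:P ^ E * u j, P * W0 j, G0 j:] n = 0" if "n \<ge> 3"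
        using that by (intro coeff_eq_0) (auto simp: degree_pCons_eq_if)
      moreover have "n = 0 \<or> n = 1 \<or> n = 2 \<or> n \<ge> 3" by linarith
      ultimately show ?thesis unfolding f0_eq[OF j] by (elim disjE) (simp_all only:, simp_all)
    qed
    finally show "fps_nth (fps_eval t (f j)) n = fps_nth (fps_const (y t j) * fps_X\<^sup>2) n"
      by (simp add: fps_eval_def fps_X_power_nth)
  qed
  show ?thesis using f(1,2) val by (intro specialize[OF S(1), of f]) auto
qed

end

section \<open>Curves through prescribed points\<close>

text \<open>Induction on the rows: vectors dual to the earlier rows modify a coordinate vector into
  one, \<open>y\<close>, that is killed by them. It is not killed by the new row, which is no
  combination of the earlier ones.\<close>

lemma independent_rows_onto:
  fixes w :: "nat \<Rightarrow> nat \<Rightarrow> complex"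
  assumes "\<And>a. \<forall>j<N. (\<Sum>i<r. a i * w i j) = 0 \<Longrightarrow> \<forall>i<r. a i = 0"
  shows "\<exists>x. \<forall>i<r. (\<Sum>j<N. w i j * x j) = \<rho> i"
  using assms
proof (induction r arbitrary: \<rho>)
  case (Suc r)
  have onto: "\<exists>x. \<forall>i<r. (\<Sum>j<N. w i j * x j) = \<rho> i" for \<rho>
  proof (rule Suc.IH)
    fix a assume "\<forall>j<N. (\<Sum>i<r. a i * w i j) = 0"
    then have zero: "\<forall>i<Suc r. (if i < r then a i else 0) = 0" by (intro Suc.prems) simp
    show "\<forall>i<r. a i = 0"
    proof (intro allI impI)
      fix i assume "i < r"
      then show "a i = 0" using zero[rule_format, of i] by simp
    qed
  qed
  have "\<forall>l. \<exists>x. \<forall>i<r. (\<Sum>j<N. w i j * x j) = (if i = l then 1 else 0)" by (intro allI onto)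
  then obtain z where z: "\<And>l i. i < r \<Longrightarrow> (\<Sum>j<N. w i j * z l j) = (if i = l then 1 else 0)"
    unfolding choice_iff by blast
  define b where "b l = (\<Sum>j<N. w r j * z l j)" for l
  have "\<exists>j<N. w r j - (\<Sum>l<r. b l * w l j) \<noteq> 0"
  proof (rule ccontr)
    assume "\<not> ?thesis"
    then have "\<forall>j<N. (\<Sum>i<Suc r. (if i < r then - b i else 1) * w i j) = 0"
      by (simp add: sum_negf)
    from Suc.prems[OF this] show False by auto
  qed
  then obtain j0 where j0: "j0 < N" "w r j0 - (\<Sum>l<r. b l * w l j0) \<noteq> 0" by blast
  define y where "y j = (if j = j0 then 1 else 0) - (\<Sum>l<r. w l j0 * z l j)" for j
  have wy: "(\<Sum>j<N. w i j * y j) = w i j0 - (\<Sum>l<r. w l j0 * (\<Sum>j<N. w i j * z l j))" for i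
  proof -
    have "(\<Sum>j<N. w i j * y j) = (\<Sum>j<N. if j = j0 then w i j else 0) - (\<Sum>j<N. \<Sum>l<r. w l j0 * (w i j * z l j))"
      unfolding sum_subtractf[symmetric] by (intro sum.cong refl) (auto simp: y_def right_diff_distrib sum_distrib_left mult_ac)
    then show ?thesis using j0(1) by (subst (asm) sum.swap) (simp add: sum_distrib_left)
  qed
  have y0: "(\<Sum>j<N. w i j * y j) = 0" if "i < r" for i
  proof -
    have "(\<Sum>l<r. w l j0 * (\<Sum>j<N. w i j * z l j)) = (\<Sum>l<r. if i = l then w l j0 else 0)"
      using z[OF that] by (intro sum.cong) auto
    then show ?thesis using that by (simp add: wy)
  qed
  have yr: "(\<Sum>j<N. w r j * y j) \<noteq> 0" 
    using j0(2) unfolding wy b_def by (simp add: mult.commute[of "w _ j0"])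
  obtain x where x: "\<forall>i<r. (\<Sum>j<N. w i j * x j) = \<rho> i" using onto by blast
  define t where "t = (\<rho> r - (\<Sum>j<N. w r j * x j)) / (\<Sum>j<N. w r j * y j)"
  have "(\<Sum>j<N. w i j * (x j + t * y j)) = (\<Sum>j<N. w i j * x j) + t * (\<Sum>j<N. w i j * y j)" for i
    by (simp add: distrib_left sum.distrib sum_distrib_left mult_ac)
  then have "\<forall>i<Suc r. (\<Sum>j<N. w i j * (x j + t * y j)) = \<rho> i"
    using x y0 yr by (auto simp: less_Suc_eq t_def)
  then show ?case by (intro exI[of _ "\<lambda>j. x j + t * y j"])
qed simp

section \<open>Forms as expressions, and the linear case\<close>

lemma pexp_of_power: "\<exists>e. phom a e \<and> pvars e \<subseteq> {i} \<and> (\<forall>v. evc e v = v i ^ a)"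
proof (induction a)
  case 0
  then show ?case by (intro exI[of _ "PConst 1"]) (simp add: phom_const)
next
  case (Suc a)
  then obtain e where "phom a e" "pvars e \<subseteq> {i}" "\<forall>v. evc e v = v i ^ a" by blast
  then show ?case using phom_mul[OF phom_var] by (intro exI[of _ "PMul (PVar i) e"]) fastforce
qed

lemma pexp_of_monomial:
  assumes "finite I"
  shows "\<exists>e. phom (\<Sum>i\<in>I. a i) e \<and> pvars e \<subseteq> I \<and> (\<forall>v. evc e v = (\<Prod>i\<in>I. v i ^ a i))"
  using assms
proof (induction I rule: finite_induct)
  case empty
  then show ?case by (intro exI[of _ "PConst 1"]) (simp add: phom_const)
next
  case (insert i I)
  then obtain e where e: "phom (\<Sum>i\<in>I. a i) e" "pvars e \<subseteq> I" "\<forall>v. evc e v = (\<Prod>i\<in>I. v i ^ a i)" by blast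
  obtain f where f: "phom (a i) f" "pvars f \<subseteq> {i}" "\<forall>v. evc f v = v i ^ a i" using pexp_of_power by blast
  have "phom (\<Sum>i\<in>insert i I. a i) (PMul f e)" using insert.hyps phom_mul[OF f(1) e(1)] by simp
  then show ?case using e f insert.hyps by (intro exI[of _ "PMul f e"]) auto
qed

lemma pexp_of_form:
  assumes F: "homog n d F"
  shows "\<exists>e. phom d e \<and> pvars e \<subseteq> {..<Suc n} \<and> (\<forall>v. evc e v = peval F v)"
proof -
  have "\<exists>e. phom d e \<and> pvars e \<subseteq> {..<Suc n} \<and>
      (\<forall>v. evc e v = (\<Sum>m\<in>K. Poly_Mapping.lookup F m * (\<Prod>i\<in>Poly_Mapping.keys m. v i ^ Poly_Mapping.lookup m i)))"
    if "finite K" "K \<subseteq> Poly_Mapping.keys F" for K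
    using that
  proof (induction K rule: finite_induct)
    case empty
    then show ?case by (intro exI[of _ "PConst 0"]) (simp add: phom_zero pzero.intros)
  next
    case (insert m K)
    then obtain e where e: "phom d e" "pvars e \<subseteq> {..<Suc n}"
      "\<forall>v. evc e v = (\<Sum>m\<in>K. Poly_Mapping.lookup F m * (\<Prod>i\<in>Poly_Mapping.keys m. v i ^ Poly_Mapping.lookup m i))" by blast
    obtain f where f: "phom (\<Sum>i\<in>Poly_Mapping.keys m. Poly_Mapping.lookup m i) f" "pvars f \<subseteq> Poly_Mapping.keys m"
      "\<forall>v. evc f v = (\<Prod>i\<in>Poly_Mapping.keys m. v i ^ Poly_Mapping.lookup m i)"
      using pexp_of_monomial[OF finite_keys[of m], of "Poly_Mapping.lookup m"] by blast
    have m: "Poly_Mapping.keys m \<subseteq> {..n}" "(\<Sum>i\<in>Poly_Mapping.keys m. Poly_Mapping.lookup m i) = d"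
      using F insert.prems by (auto simp: homog_def)
    have "phom (0 + d) (PMul (PConst (Poly_Mapping.lookup F m)) f)" using phom_mul[OF phom_const f(1)] m(2) by simp
    then have "phom d (PAdd (PMul (PConst (Poly_Mapping.lookup F m)) f) e)" using e(1) by (simp add: phom_add)
    then show ?case using e f m(1) insert.hyps
      by (intro exI[of _ "PAdd (PMul (PConst (Poly_Mapping.lookup F m)) f) e"]) (auto simp: lessThan_Suc_atMost)
  qed
  from this[OF _ order_refl] show ?thesis by (simp add: peval_def)
qed

lemma partial_pd: "\<forall>v. evc e v = peval F v \<Longrightarrow> partial j F v = evc (pd j e) v"
  using DERIV_imp_deriv[OF ev_has_field_derivative[of e v j "v j"]] by (simp add: partial_def)

lemma phom_1_ev:
  assumes "phom 1 e" "pvars e \<subseteq> {..<N}" "ring_map h"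
  shows "ev h e v = (\<Sum>j<N. h (evc (pd j e) (\<lambda>_. 0)) * v j)"
proof -
  have const: "ev h (pd j e) v = h (evc (pd j e) (\<lambda>_. 0))" for j
  proof -
    have "phom 0 (pd j e)" using phom_pd[OF assms(1), of j] by simp
    from phom_ev[OF this assms(3), of 0 v] have "ev h (pd j e) v = ev h (pd j e) (\<lambda>_. 0)" by simp
    also have "\<dots> = h (evc (pd j e) (\<lambda>_. 0))" by (simp add: ev_hom[OF assms(3)] ring_mapD[OF assms(3)])
    finally show ?thesis .
  qed
  have "ev h e v = dev N h e v v" using phom_euler[OF assms(1,3,2), of v] by simp
  then show ?thesis by (simp add: dev_def const)
qed

text \<open>In an affine hyperplane Lagrange interpolation relative to one of the points suffices.
  This case lies outside \<open>smooth_system\<close>, where some degree is at least 2.\<close>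

lemma linear_interpolation:
  fixes y :: "complex \<Rightarrow> nat \<Rightarrow> complex"
  assumes e: "phom 1 e" "pvars e \<subseteq> {..<N}" and S: "finite S" "S \<noteq> {}"
    and y: "\<And>t. t \<in> S \<Longrightarrow> evc e (y t) = b"
  shows "\<exists>F. evp e F = [:b:] \<and> (\<forall>t\<in>S. \<forall>j<N. poly (F j) t = y t j)"
proof -
  obtain t0 where t0: "t0 \<in> S" using S by blast
  have "\<exists>p. \<forall>t'\<in>S. poly p t' = (if t' = t then 1 else 0)" for t
  proof -
    obtain p where "\<forall>t'\<in>S. fps_X ^ 1 dvd tay t' p - (if t' = t then 1 else 0)"
      using jets_interpolate[OF S(1), of 1 "\<lambda>t'. if t' = t then 1 else 0"] by blast
    then have "\<forall>t'\<in>S. poly p t' = (if t' = t then 1 else 0)"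
      by (auto simp: fps_X_dvd_iff tay_nth_0 split: if_splits)
    then show ?thesis by blast
  qed
  then obtain L where L: "\<And>t t'. t' \<in> S \<Longrightarrow> poly (L t) t' = (if t' = t then 1 else 0)" by metis
  define F where "F j = [:y t0 j:] + (\<Sum>t\<in>S. L t * [:y t j - y t0 j:])" for j
  define c where "c j = evc (pd j e) (\<lambda>_. 0)" for j
  have c: "(\<Sum>j<N. c j * y t j) = b" if "t \<in> S" for t
    using y[OF that] phom_1_ev[OF e ring_map_id, of "y t"] by (simp add: c_def)
  have "evp e F = (\<Sum>j<N. [:c j:] * F j)"
    using phom_1_ev[OF e ring_map_pCons] by (simp add: c_def)
  also have "\<dots> = (\<Sum>j<N. [:c j * y t0 j:]) + (\<Sum>j<N. \<Sum>t\<in>S. L t * [:c j * y t j - c j * y t0 j:])"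
  proof -
    have "[:c j:] * F j = [:c j * y t0 j:] + (\<Sum>t\<in>S. L t * [:c j * y t j - c j * y t0 j:])" for j
    proof -
      have "[:c j:] * [:b:] = [:c j * b:]" for b by simp
      then have "[:c j:] * (L t * [:b:]) = L t * [:c j * b:]" for t b by (metis mult.left_commute)
      then show ?thesis unfolding F_def distrib_left sum_distrib_left by (simp add: right_diff_distrib)
    qed
    then show ?thesis by (simp add: sum.distrib)
  qed
  also have "(\<Sum>j<N. [:c j * y t0 j:]) = [:b:]"
    using c[OF t0] by (simp flip: ring_map_sum[OF ring_map_pCons])
  also have "(\<Sum>j<N. \<Sum>t\<in>S. L t * [:c j * y t j - c j * y t0 j:]) = (\<Sum>t\<in>S. L t * [:\<Sum>j<N. c j * y t j - c j * y t0 j:])"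
    by (subst sum.swap) (simp add: ring_map_sum[OF ring_map_pCons] sum_distrib_left)
  also have "\<dots> = 0" using c t0 by (intro sum.neutral) (simp add: sum_subtractf)
  finally have "evp e F = [:b:]" by simp
  moreover have "poly (F j) t = y t j" if "t \<in> S" for t j
  proof -
    have "poly (F j) t = y t0 j + (\<Sum>t'\<in>S. if t' = t then y t' j - y t0 j else 0)"
      using L[OF that] by (simp add: F_def poly_sum) (intro sum.cong, auto)
    then show ?thesis using that S(1) by simp
  qed
  ultimately show ?thesis by blast
qed

text \<open>A point generic over a ring that contains the coordinates of \<open>y\<close> differs
  from \<open>y\<close>, since some derivation trivial on that ring moves it. The second point will
  keep the curve from being constant.\<close>

lemma (in smooth_system) another_point:
  assumes y: "\<And>i. i < r \<Longrightarrow> evc (H i) y = \<kappa> i"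
  shows "\<exists>g. (\<forall>i<r. evc (H i) g = \<kappa> i) \<and> (\<exists>j<N. g j \<noteq> y j)"
proof -
  have "finite (\<kappa> ` {..<r} \<union> y ` {..<N} \<union> (\<Union>i<r. pconsts (H i)))" by (simp add: finite_pconsts)
  from exists_countable_subring[OF this] obtain k
    where k: "subring k" "countable k" "\<kappa> ` {..<r} \<union> y ` {..<N} \<union> (\<Union>i<r. pconsts (H i)) \<subseteq> k" by blast
  have con: "pconsts (H i) \<subseteq> k" and \<kappa>k: "1 * \<kappa> i \<in> k" if "i < r" for i using k(3) that by auto
  obtain g where g: "\<forall>i<r. evc (H i) g = 1 * \<kappa> i" "generic k g"
    using generic_point[OF k(1,2) con \<kappa>k level_1_nonzero[OF y]] y by auto
  have "r \<le> (\<Sum>i<r. 2 * d i - 1)"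
  proof -
    have "(\<Sum>i<r. 1) \<le> (\<Sum>i<r. 2 * d i - 1)" using degree_pos by (intro sum_mono) force
    then show ?thesis by simp
  qed
  then have "r < N" using few_equations by simp
  then obtain \<xi> where \<xi>: "\<exists>j\<in>{..<N}. \<xi> j \<noteq> 0" "\<forall>i<r. (\<Sum>j<N. evc (pd j (H i)) g * \<xi> j) = 0"
    using more_unknowns_than_equations[of "{..<N}" r "\<lambda>i j. evc (pd j (H i)) g"] by auto
  then obtain D where D: "\<forall>a\<in>k. D a = 0" "\<forall>j<N. D (g j) = \<xi> j"
    using g(2) unfolding generic_def dev_def by blast
  have "\<exists>j<N. g j \<noteq> y j"
  proof (rule ccontr)
    assume "\<not> ?thesis"
    then have "\<xi> j = 0" if "j < N" for j using D k(3) that by (metis UnCI image_eqI lessThan_iff subsetD)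
    then show False using \<xi>(1) by auto
  qed
  then show ?thesis using g(1) by auto
qed

section \<open>Complete intersection pairs as smooth systems\<close>

lemma ci_pair_equations:
  assumes X: "smooth_ci_equations n ds Fs X" and D: "smooth_ci_equations n (ds @ [k]) (Fs @ [G]) D"
  shows "length Fs = length ds" "X = zeros n (set Fs)" "D = zeros n (set (Fs @ [G]))"
    and "i < Suc (length ds) \<Longrightarrow> homog n ((ds @ [k]) ! i) ((Fs @ [G]) ! i)" "homog n k G"
    and "F \<in> set (Fs @ [G]) \<Longrightarrow> \<exists>d. homog n d F"
proof -
  show lF: "length Fs = length ds" and "X = zeros n (set Fs)" "D = zeros n (set (Fs @ [G]))"
    using X D by (simp_all add: smooth_ci_equations_def)
  have hom: "homog n ((ds @ [k]) ! i) ((Fs @ [G]) ! i)" if "i < Suc (length ds)" for i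
    using D that by (simp add: smooth_ci_equations_def)
  show "homog n ((ds @ [k]) ! i) ((Fs @ [G]) ! i)" if "i < Suc (length ds)" using hom[OF that] .
  show "homog n k G" using hom[of "length ds"] lF by (simp add: nth_append)
  show "\<exists>d. homog n d F" if "F \<in> set (Fs @ [G])" using that hom lF unfolding in_set_conv_nth by auto
qed

text \<open>For \<open>s = 0\<close> the point lies on \<open>D\<close>, whose Jacobian has
  independent rows. For other \<open>s\<close> it lies on \<open>X\<close>, which takes care of the
  first equations, and the last one is corrected by moving along \<open>v\<close> itself: by Euler's
  identity this changes \<open>G\<close> at the rate \<open>k * s\<close> and leaves the others
  fixed.\<close>

lemma ci_regular:
  assumes X: "smooth_ci_equations n ds Fs X" and D: "smooth_ci_equations n (ds @ [k]) (Fs @ [G]) D" and "0 < k"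
    and H: "\<And>i. i < Suc (length ds) \<Longrightarrow> phom ((ds @ [k]) ! i) (H i) \<and> pvars (H i) \<subseteq> {..<Suc n} \<and>
      (\<forall>v. evc (H i) v = peval ((Fs @ [G]) ! i) v)"
    and v: "\<exists>j<Suc n. v j \<noteq> 0" "\<forall>i<Suc (length ds). evc (H i) v = s * (if i = length ds then 1 else 0)"
  shows "\<exists>x. \<forall>i<Suc (length ds). devc (Suc n) (H i) v x = \<rho> i"
proof -
  define w where "w j = (if j \<le> n then v j else 0)" for j
  define W where "W i j = partial j ((Fs @ [G]) ! i) w" for i j
  have w: "w \<in> vectors n" using v(1) by (auto simp: vectors_def w_def less_Suc_eq_le)
  have ev_w: "peval ((Fs @ [G]) ! i) w = s * (if i = length ds then 1 else 0)" if i: "i < Suc (length ds)" for i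
  proof -
    have "evc (H i) w = evc (H i) v" using H[OF i] by (intro ev_cong) (auto simp: w_def)
    then show ?thesis using H[OF i] v(2) i by metis
  qed
  have dev_w: "devc (Suc n) (H i) v x = (\<Sum>j<Suc n. W i j * x j)" if i: "i < Suc (length ds)" for i x
  proof -
    have "devc (Suc n) (H i) v x = devc (Suc n) (H i) w x"
      using H[OF i] by (intro dev_cong_point) (auto simp: w_def)
    then show ?thesis using partial_pd[of "H i"] H[OF i] unfolding dev_def W_def by simp
  qed
  note eqs = ci_pair_equations[OF X D]
  note lF = eqs(1) and XD = eqs(2,3) and hom = eqs(4) and G = eqs(5) and hom' = eqs(6)
  show ?thesis
  proof (cases "s = 0")
    case True
    have "peval F w = 0" if F: "F \<in> set (Fs @ [G])" for F
    proof -
      obtain i where "i < length (Fs @ [G])" "F = (Fs @ [G]) ! i" using F unfolding in_set_conv_nth by blast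
      then show ?thesis using ev_w[of i] True lF by simp
    qed
    then have "point_of w \<in> zeros n (set (Fs @ [G]))" by (intro iffD2[OF zeros_iff[OF w hom']] ballI)
    then have "point_of w \<in> D" using D by (simp add: smooth_ci_equations_def)
    then have "\<forall>a. (\<forall>j\<le>n. (\<Sum>i<length (ds @ [k]). a i * W i j) = 0) \<longrightarrow> (\<forall>i<length (ds @ [k]). a i = 0)"
      using D mem_point_of[of w] unfolding smooth_ci_equations_def W_def by blast
    then have "\<exists>x. \<forall>i<Suc (length ds). (\<Sum>j<Suc n. W i j * x j) = \<rho> i"
      by (intro independent_rows_onto) (simp add: less_Suc_eq_le)
    then show ?thesis using dev_w by auto
  next
    case False
    have "\<forall>F\<in>set Fs. peval F w = 0"
    proof
      fix F assume "F \<in> set Fs"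
      then obtain i where "i < length ds" "F = Fs ! i" using lF by (auto simp: in_set_conv_nth)
      then show "peval F w = 0" using ev_w[of i] lF by (simp add: nth_append)
    qed
    then have "point_of w \<in> X" using zeros_iff[OF w, of "set Fs"] hom' X by (simp add: smooth_ci_equations_def)
    then have "\<forall>a. (\<forall>j\<le>n. (\<Sum>i<length ds. a i * partial j (Fs ! i) w) = 0) \<longrightarrow> (\<forall>i<length ds. a i = 0)"
      using X mem_point_of[of w] unfolding smooth_ci_equations_def by blast
    then have "\<exists>x. \<forall>i<length ds. (\<Sum>j<Suc n. partial j (Fs ! i) w * x j) = \<rho> i"
      by (intro independent_rows_onto) (simp add: less_Suc_eq_le)
    then obtain x where "\<forall>i<length ds. (\<Sum>j<Suc n. partial j (Fs ! i) w * x j) = \<rho> i" by blast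
    then have x: "devc (Suc n) (H i) v x = \<rho> i" if "i < length ds" for i
      using that dev_w[of i x] lF by (simp add: W_def nth_append)
    have euler: "devc (Suc n) (H i) v v = of_nat ((ds @ [k]) ! i) * (s * (if i = length ds then 1 else 0))"
      if i: "i < Suc (length ds)" for i
    proof -
      have "devc (Suc n) (H i) v v = of_nat ((ds @ [k]) ! i) * evc (H i) v"
        using H[OF i] by (intro phom_euler) auto
      then show ?thesis using v(2) i by simp
    qed
    define t where "t = (\<rho> (length ds) - devc (Suc n) (H (length ds)) v x) / (of_nat k * s)"
    have "devc (Suc n) (H i) v (\<lambda>j. x j + t * v j) = \<rho> i" if i: "i < Suc (length ds)" for i
    proof (cases "i = length ds")
      case True
      then show ?thesis using euler[of i] False \<open>0 < k\<close> unfolding dev_add dev_scale by (simp add: t_def)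
    next
      case False
      then show ?thesis using euler[of i] x[of i] i by (simp add: dev_add dev_scale)
    qed
    then show ?thesis by blast
  qed
qed

text \<open>Termwise this is \<open>(d - 1)\<^sup>2 \<ge> 0\<close>, with strict inequality for
  \<open>d \<ge> 2\<close>. It converts the hypothesis on squares into the count of conditions for a
  chain of two lines.\<close>

lemma sum_degrees_less:
  fixes es :: "nat list"
  assumes "\<And>d. d \<in> set es \<Longrightarrow> 1 \<le> d" and "2 \<le> e" "e \<in> set es"
  shows "(\<Sum>i<length es. 2 * es ! i - 1) < (\<Sum>d\<leftarrow>es. d\<^sup>2)"
proof -
  have le: "2 * d - 1 \<le> d\<^sup>2" if d: "1 \<le> d" for d :: nat
  proof -
    obtain a where "d = Suc a" using d by (cases d) auto
    then show ?thesis by (simp add: power2_eq_square)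
  qed
  have lt: "2 * e - 1 < e\<^sup>2"
  proof -
    obtain a where "e = Suc (Suc a)" using assms(2) by (metis le_add_diff_inverse add_2_eq_Suc)
    then show ?thesis by (simp add: power2_eq_square)
  qed
  have "(\<Sum>i<length es. 2 * es ! i - 1) < (\<Sum>i<length es. (es ! i)\<^sup>2)"
  proof (rule sum_strict_mono_ex1)
    show "\<forall>i\<in>{..<length es}. 2 * es ! i - 1 \<le> (es ! i)\<^sup>2" using assms(1) le by simp
    show "\<exists>i\<in>{..<length es}. 2 * es ! i - 1 < (es ! i)\<^sup>2"
      using assms(3) lt unfolding in_set_conv_nth by auto
  qed simp
  then show ?thesis by (simp add: sum_list_sum_nth atLeast0LessThan)
qed

lemma linear_another_point:
  assumes e: "phom 1 e" "pvars e \<subseteq> {..<N}" "1 < N"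
  shows "\<exists>g. evc e g = evc e y \<and> (\<exists>j<N. g j \<noteq> y j)"
proof -
  obtain \<xi> where \<xi>: "\<exists>j\<in>{..<N}. \<xi> j \<noteq> 0" "\<forall>i<1::nat. (\<Sum>j<N. evc (pd j e) (\<lambda>_. 0) * \<xi> j) = 0"
    using more_unknowns_than_equations[of "{..<N}" 1 "\<lambda>i j. evc (pd j e) (\<lambda>_. 0)"] e(3) by auto
  have "evc e (\<lambda>j. y j + \<xi> j) = evc e y"
    using \<xi>(2) phom_1_ev[OF e(1,2) ring_map_id] by (simp add: distrib_left sum.distrib)
  then show ?thesis using \<xi>(1) by (intro exI[of _ "\<lambda>j. y j + \<xi> j"]) auto
qed

lemma ci_interpolation:
  assumes X: "smooth_ci_equations n ds Fs X" and D: "smooth_ci_equations n (ds @ [k]) (Fs @ [G]) D"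
    and pos: "0 < k" "\<And>d. d \<in> set ds \<Longrightarrow> 2 \<le> d" "2 \<le> n" and le: "(\<Sum>d\<leftarrow>ds. d\<^sup>2) + k\<^sup>2 \<le> n + 1"
    and H: "\<And>i. i < Suc (length ds) \<Longrightarrow> phom ((ds @ [k]) ! i) (H i) \<and> pvars (H i) \<subseteq> {..<Suc n} \<and>
      (\<forall>v. evc (H i) v = peval ((Fs @ [G]) ! i) v)"
    and \<kappa>_def: "\<kappa> = (\<lambda>i. if i = length ds then 1 else 0)"
  shows "\<lbrakk>finite S; S \<noteq> {}; \<forall>t\<in>S. \<forall>i<Suc (length ds). evc (H i) (y t) = \<kappa> i\<rbrakk> \<Longrightarrow>
      \<exists>F. (\<forall>i<Suc (length ds). evp (H i) F = [:\<kappa> i:]) \<and> (\<forall>t\<in>S. \<forall>j<Suc n. poly (F j) t = y t j)"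
    and "\<forall>i<Suc (length ds). evc (H i) z = \<kappa> i \<Longrightarrow>
      \<exists>g. (\<forall>i<Suc (length ds). evc (H i) g = \<kappa> i) \<and> (\<exists>j<Suc n. g j \<noteq> z j)"
proof -
  have ge1: "1 \<le> d" if "d \<in> set (ds @ [k])" for d using that pos(1) pos(2)[of d] by force
  have system: "smooth_system (Suc n) (Suc (length ds)) H ((!) (ds @ [k])) \<kappa>"
    if e: "2 \<le> e" "e \<in> set (ds @ [k])" for e
  proof
    fix i assume i: "i < Suc (length ds)"
    show "phom ((ds @ [k]) ! i) (H i)" "pvars (H i) \<subseteq> {..<Suc n}" using H[OF i] by auto
    show "0 < (ds @ [k]) ! i" using ge1[OF nth_mem, of i] i by simp
  next
    fix v s \<rho>
    assume "\<exists>j<Suc n. v j \<noteq> 0" "\<forall>i<Suc (length ds). evc (H i) v = s * \<kappa> i"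
    then show "\<exists>x. \<forall>i<Suc (length ds). devc (Suc n) (H i) v x = \<rho> i"
      unfolding \<kappa>_def using ci_regular[OF X D pos(1) H] by blast
  next
    show "(\<Sum>i<Suc (length ds). 2 * (ds @ [k]) ! i - 1) < Suc n"
      using sum_degrees_less[OF ge1 e] le by simp
    show "\<exists>i<Suc (length ds). 2 \<le> (ds @ [k]) ! i" using e unfolding in_set_conv_nth by auto
    show "\<exists>i<Suc (length ds). \<kappa> i \<noteq> 0" by (auto simp: \<kappa>_def)
  qed
  \<comment> \<open>Without a degree of at least 2 the only equation is \<open>G\<close>, and it is
    linear.\<close>
  have linear: "ds = [] \<and> phom 1 (H 0) \<and> pvars (H 0) \<subseteq> {..<Suc n}" if "\<not> (\<exists>e\<in>set (ds @ [k]). 2 \<le> e)"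
  proof -
    have "ds = []" "k = 1" using that pos(1) pos(2)[of "hd ds"] by (cases ds, auto)
    then show ?thesis using H[of 0] by auto
  qed
  show "\<exists>F. (\<forall>i<Suc (length ds). evp (H i) F = [:\<kappa> i:]) \<and> (\<forall>t\<in>S. \<forall>j<Suc n. poly (F j) t = y t j)"
    if "finite S" "S \<noteq> {}" "\<forall>t\<in>S. \<forall>i<Suc (length ds). evc (H i) (y t) = \<kappa> i"
  proof (cases "\<exists>e\<in>set (ds @ [k]). 2 \<le> e")
    case True
    then obtain e where e: "2 \<le> e" "e \<in> set (ds @ [k])" by blast
    show ?thesis using smooth_system.interpolation[OF system[OF e] that(1,2), of y] that(3) by blast
  next
    case False
    then show ?thesis using linear_interpolation[of "H 0" "Suc n" S y "\<kappa> 0"] linear that by auto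
  qed
  show "\<exists>g. (\<forall>i<Suc (length ds). evc (H i) g = \<kappa> i) \<and> (\<exists>j<Suc n. g j \<noteq> z j)"
    if "\<forall>i<Suc (length ds). evc (H i) z = \<kappa> i"
  proof (cases "\<exists>e\<in>set (ds @ [k]). 2 \<le> e")
    case True
    then obtain e where e: "2 \<le> e" "e \<in> set (ds @ [k])" by blast
    show ?thesis using smooth_system.another_point[OF system[OF e], of z] that by blast
  next
    case False
    then show ?thesis using linear_another_point[of "H 0" "Suc n" z] linear that pos(3) by auto
  qed
qed

text \<open>\<open>G\<close> is nonzero at the point and has degree \<open>k\<close>, so rescaling a
  coordinate vector by a suitable \<open>k\<close>-th root makes the value 1.\<close>

lemma lift_point:
  assumes D: "smooth_ci_equations n (ds @ [k]) (Fs @ [G]) D" and X: "smooth_ci_equations n ds Fs X" and "0 < k"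
    and p: "p \<in> X - D"
  shows "\<exists>y. point_of y = p \<and> (\<forall>F\<in>set Fs. peval F y = 0) \<and> peval G y = 1"
proof -
  note eqs = ci_pair_equations[OF X D]
  note lF = eqs(1) and XD = eqs(2,3) and hom = eqs(4) and G = eqs(5) and hom' = eqs(6)
  have "p \<in> proj n" using p XD(1) by (simp add: zeros_def)
  then obtain v where v: "v \<in> vectors n" "p = point_of v" using proj_nonempty proj_memD by metis
  have F0: "\<forall>F\<in>set Fs. peval F v = 0" using p zeros_iff[OF v(1), of "set Fs"] hom' by (simp add: v(2) XD(1))
  have "p \<in> D \<longleftrightarrow> (\<forall>F\<in>set (Fs @ [G]). peval F v = 0)" unfolding v(2) XD(2) by (rule zeros_iff[OF v(1) hom'])
  then have G0: "peval G v \<noteq> 0" using p F0 by auto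
  obtain a where a: "a ^ k = inverse (peval G v)" using nth_root_exists[OF \<open>0 < k\<close>] by blast
  have "a \<noteq> 0" using a G0 \<open>0 < k\<close> by (auto simp: zero_power)
  then have "point_of (\<lambda>i. a * v i) = p" by (simp add: v(2) point_of_scale)
  moreover have "peval F (\<lambda>i. a * v i) = 0" if "F \<in> set Fs" for F
    using hom'[of F] that F0 by (auto simp: peval_scale)
  moreover have "peval G (\<lambda>i. a * v i) = 1" using peval_scale[OF G] a G0 by simp
  ultimately show ?thesis by blast
qed

theorem corollary1p6:
  fixes n k m :: nat and ds :: "nat list" and X D :: "ppoint set" and x :: "nat \<Rightarrow> ppoint"
  assumes "smooth_ci_pair n ds k X D"
    and "(\<Sum>d\<leftarrow>ds. d\<^sup>2) + k\<^sup>2 \<le> n + 1"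
    and "m > 0"
    and "\<And>i. i < m \<Longrightarrow> x i \<in> X - D"
  shows "\<exists>Q ps f fl. A1_curve n X D Q ps f fl \<and> (\<forall>i<m. x i \<in> f ` proj 1)"
proof -
  obtain Fs G where X: "smooth_ci_equations n ds Fs X" and D: "smooth_ci_equations n (ds @ [k]) (Fs @ [G]) D"
    and n: "2 \<le> n" and ds: "\<And>d. d \<in> set ds \<Longrightarrow> 2 \<le> d" and k: "0 < k"
    using assms(1) unfolding smooth_ci_pair_def by force
  note eqs = ci_pair_equations[OF X D]
  note lF = eqs(1) and XD = eqs(2,3) and hom = eqs(4) and G = eqs(5) and hom' = eqs(6)
  have "\<forall>i. \<exists>e. i < Suc (length ds) \<longrightarrow> phom ((ds @ [k]) ! i) e \<and> pvars e \<subseteq> {..<Suc n} \<and>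
      (\<forall>v. evc e v = peval ((Fs @ [G]) ! i) v)"
    using pexp_of_form[OF hom] by (intro allI) simp
  then obtain H where H: "\<And>i. i < Suc (length ds) \<Longrightarrow> phom ((ds @ [k]) ! i) (H i) \<and> pvars (H i) \<subseteq> {..<Suc n} \<and>
      (\<forall>v. evc (H i) v = peval ((Fs @ [G]) ! i) v)"
    unfolding choice_iff by blast
  define \<kappa> :: "nat \<Rightarrow> complex" where "\<kappa> = (\<lambda>i. if i = length ds then 1 else 0)"
  note interpolate = ci_interpolation[OF X D k ds n assms(2) H \<kappa>_def]
  have level: "(\<forall>i<Suc (length ds). evc (H i) v = \<kappa> i) \<longleftrightarrow> (\<forall>F\<in>set Fs. peval F v = 0) \<and> peval G v = 1" for v
    using H lF by (auto simp: \<kappa>_def nth_append all_set_conv_all_nth All_less_Suc)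
  have "\<forall>i. \<exists>y. i < m \<longrightarrow> point_of y = x i \<and> (\<forall>l<Suc (length ds). evc (H l) y = \<kappa> l)"
    using lift_point[OF D X k assms(4)] level by (intro allI) (metis (full_types))
  then obtain y where y: "\<And>i. i < m \<Longrightarrow> point_of (y i) = x i" "\<And>i l. i < m \<Longrightarrow> l < Suc (length ds) \<Longrightarrow> evc (H l) (y i) = \<kappa> l"
    unfolding choice_iff by blast
  obtain g where g: "\<forall>i<Suc (length ds). evc (H i) g = \<kappa> i" "\<exists>j<Suc n. g j \<noteq> y 0 j"
    using interpolate(2)[of "y 0"] y(2)[OF assms(3)] by blast
  \<comment> \<open>The extra parameter \<open>m\<close> takes a value different from the one at 0,
    which makes the polynomials nonconstant even if all points \<open>x i\<close> coincide.\<close>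
  define y' where "y' t = (if t = of_nat m then g else y (inv of_nat t))" for t :: complex
  have y': "y' (of_nat i) = (if i = m then g else y i)" for i
    by (simp add: y'_def inv_f_f[OF inj_of_nat])
  obtain F where F: "\<forall>i<Suc (length ds). evp (H i) F = [:\<kappa> i:]"
    "\<forall>t\<in>of_nat ` {..m}. \<forall>j<Suc n. poly (F j) t = y' t j"
    using interpolate(1)[of "of_nat ` {..m}" y'] g(1) y(2) y' by fastforce
  \<comment> \<open>\<open>F\<close> is not controlled at indices beyond \<open>n\<close>, where a
    coordinate vector has to vanish.\<close>
  define c where "c j = (if j \<le> n then F j else 0)" for j
  have on_curve: "(\<forall>F\<in>set Fs. peval F (\<lambda>i. poly (c i) t) = 0) \<and> peval G (\<lambda>i. poly (c i) t) = 1" for t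
  proof -
    have "evc (H i) (\<lambda>j. poly (c j) t) = \<kappa> i" if i: "i < Suc (length ds)" for i
    proof -
      have "ring_map (\<lambda>p. poly p t)" by (simp add: ring_map_def)
      from ev_hom[OF this, of "\<lambda>c. [:c:]" "H i" F] have "evc (H i) (\<lambda>j. poly (F j) t) = \<kappa> i" using F(1) i by simp
      moreover have "evc (H i) (\<lambda>j. poly (c j) t) = evc (H i) (\<lambda>j. poly (F j) t)"
        using H[OF i] by (intro ev_cong) (auto simp: c_def)
      ultimately show ?thesis by simp
    qed
    then show ?thesis using level by blast
  qed
  have c_at: "poly (c j) (of_nat i) = (if i = m then g j else y i j)" if "i \<le> m" "j \<le> n" for i j
  proof -
    have "poly (F j) (of_nat i) = y' (of_nat i) j" using F(2) that by (simp add: less_Suc_eq_le)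
    then show ?thesis using that by (simp add: c_def y')
  qed
  obtain j where j: "j \<le> n" "g j \<noteq> y 0 j" using g(2) by (auto simp: less_Suc_eq_le)
  have "degree (c j) > 0"
  proof (rule ccontr)
    assume "\<not> ?thesis"
    then obtain b where "c j = [:b:]" by (auto elim: degree_eq_zeroE)
    then show False using c_at[of m j] c_at[of 0 j] j assms(3) by simp
  qed
  then have "\<exists>Q ps f fl. A1_curve n X D Q ps f fl \<and> (\<forall>t. point_of (\<lambda>i. poly (c i) t) \<in> f ` proj 1)"
    using X D on_curve by (intro A1_curve_of_polynomials[OF hom' G k]) (auto simp: c_def smooth_ci_equations_def)
  then obtain Q ps f fl where
    A1: "A1_curve n X D Q ps f fl" "\<forall>t. point_of (\<lambda>i. poly (c i) t) \<in> f ` proj 1" by blast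
  have "x i \<in> f ` proj 1" if i: "i < m" for i
  proof -
    have "x i \<in> proj n" using assms(4)[OF i] X by (auto simp: smooth_ci_equations_def zeros_def)
    then have "y i \<in> vectors n" using y(1)[OF i] mem_point_of proj_memD(1) by metis
    then have "(\<lambda>j. poly (c j) (of_nat i)) = y i"
      using c_at[of i] i by (auto simp: c_def vectors_def fun_eq_iff)
    then show ?thesis using A1(2) y(1)[OF i] by metis
  qed
  then show ?thesis using A1(1) by blast
qed

end
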